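(* For real $X,Y\ge 1$ let $$S(X,Y)=\sum_{\substack{1\le m\le X\\ m\text{ odd}}}\ \sum_{\substack{1\le n\le Y\\ n\text{ odd}}}\left(\frac{m}{n}\right),$$ where $\left(\frac{m}{n}\right)$ is the Jacobi symbol. For $\alpha\ge 0$ define $$C(\alpha)=\sqrt{\alpha}+\frac{1}{2\pi}\sum_{k=1}^{\infty}\frac{1}{k^2}\int_0^{\alpha}\sqrt{y}\left(1-\cos\left(\frac{2\pi k^2}{y}\right)+\sin\left(\frac{2\pi k^2}{y}\right)\right)dy.$$ Then, uniformly for all sufficiently large $X$ and $Y$, $$S(X,Y)=\frac{2}{\pi^2}\,C\!\left(\frac{Y}{X}\right)X^{3/2}+O\!\left(\left(XY^{7/16}+YX^{7/16}\right)\log(XY)\right).$$ Moreover, for $\alpha>0$ one has the alternate expression $$C(\alpha)=\alpha+\alpha^{3/2}\,\frac{2}{\pi}\sum_{k=1}^{\infty}\frac{1}{k^2}\int_0^{1/\alpha}\sqrt{y}\,\sin\left(\frac{\pi k^2}{2y}\right)dy.$$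
   Context: $m,n$ range over positive odd integers. The implied constant in the $O$-term is absolute. *)

theory Defs
  imports "HOL-Analysis.Analysis" "HOL-Number_Theory.Number_Theory"
begin

text \<open>The second argument is meant to be odd and positive; for \<open>n = 1\<close> the product is empty.\<close>

definition Jacobi :: "int \<Rightarrow> nat \<Rightarrow> int" where
  "Jacobi a n = (\<Prod>p\<in>#prime_factorization n. Legendre a (int p))"

definition odd_upto :: "real \<Rightarrow> nat set" where
  "odd_upto X = {m. odd m \<and> 1 \<le> m \<and> real m \<le> X}"

definition jacobi_sum :: "real \<Rightarrow> real \<Rightarrow> real" where
  "jacobi_sum X Y = (\<Sum>m\<in>odd_upto X. \<Sum>n\<in>odd_upto Y. real_of_int (Jacobi (int m) n))"

text \<open>
  The series over \<open>k \<ge> 1\<close> is indexed from \<open>0\<close>, hence \<open>Suc k\<close>. At \<open>y = 0\<close> the quotient inside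
  cosine and sine is \<open>0\<close> by convention; this does not affect the integral.
\<close>

definition C_fun :: "real \<Rightarrow> real" where
  "C_fun \<alpha> = sqrt \<alpha> + 1 / (2 * pi) *
     (\<Sum>k. 1 / real (Suc k) ^ 2 *
        integral {0..\<alpha>} (\<lambda>y. sqrt y *
          (1 - cos (2 * pi * real (Suc k) ^ 2 / y) + sin (2 * pi * real (Suc k) ^ 2 / y))))"

end

theory Submission
  imports Defs "HOL-Complex_Analysis.Complex_Analysis" "HOL-Probability.Probability"
    "HOL-Computational_Algebra.Nth_Powers" "HOL-Real_Asymp.Real_Asymp"
begin

text \<open>
  Call \<open>a m n = \<Sum> d * (m/d\<^sup>2 | n/d\<^sup>2)\<close>, summed over all \<open>d\<close> with \<open>d\<^sup>2 | m\<close> and \<open>d\<^sup>2 | n\<close>, the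
  kernel. Unlike the Jacobi symbol it is, for every odd \<open>n\<close>, an eigenfunction of the Fourier transform
  modulo \<open>n\<close>: \<open>\<Sum>m a m n e(mk/n) = \<epsilon> \<surd>n a k n\<close>. This follows from reciprocity and the Gauss sum
  for prime \<open>n\<close>, whose sign comes from Estermann's elementary estimate. The truncated Fourier series of the
  sawtooth function therefore yields a finite Polya expansion of \<open>\<Sum>m a m n\<close>, \<open>m \<le> X\<close>, in terms of
  \<open>a k n / k\<close>. Summing over \<open>n \<in> (Y/2, Y]\<close>, the columns \<open>k = l\<^sup>2\<close> produce a dyadic piece of the main term,
  and all other columns are small by the Polya-Vinogradov inequality and partial summation. Adding the
  dyadic pieces gives the asymptotics of \<open>P X Y = \<Sum>m \<Sum>n a m n = \<Sum>d d S(X/d\<^sup>2, Y/d\<^sup>2)\<close>, with \<open>d\<close> odd.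
  Since \<open>\<Sum> d powr (-15/8) \<le> \<Sum> d powr (-3/2) \<le> 3/4\<close> over odd \<open>d \<ge> 3\<close>, the deviation of \<open>S\<close> from its main
  term is recovered from that of \<open>P\<close> by induction, without Moebius inversion.
  
  For the second formula, integrate the functional equation of the theta function along a ray in the right
  half plane and let the ray tend to the positive imaginary axis. Real plus imaginary part of the limit
  is an identity that shows that both expressions for \<open>C\<close> have the same derivative; both vanish at \<open>0\<close>.
\<close>

section \<open>The Jacobi symbol\<close>

text \<open>Modulo an \<open>n\<close> that is not squarefree the Jacobi symbol is an imprimitive
  character, so it is not an eigenfunction of the Fourier transform and has no clean Polya
  expansion. The weight \<open>d\<close> attached to \<open>d^2\<close> is exactly what restores
  self-duality.

  The dyadic blocks are forced by the exchange of sums: the truncation point has to follow the size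
  of \<open>n\<close>, and the derivative of \<open>sqrt y * trig e (u / y)\<close> is controlled by
  \<open>u / Y\<close> only while \<open>y\<close> is comparable to \<open>Y\<close>.

  The two summands of \<open>C\<close> have different sources. The term \<open>sqrt \<alpha>\<close>
  comes from square \<open>n\<close>, whose rows have a nonzero mean. The integrals come from square
  columns, where the classes 1 and 3 of \<open>n\<close> modulo 4 supply the sine and one minus the
  cosine. The constant \<open>2 / pi^2\<close> is \<open>1/4\<close>, the constant of the kernel
  sum, divided by \<open>pi^2 / 8\<close>, the sum of \<open>1 / d^2\<close> over odd
  \<open>d\<close>.

  Removing the kernel works by contraction: in the relation between the two sums, the terms with
  \<open>d \<ge> 3\<close> reproduce at most \<open>3/4\<close> of the bound that is being
  proved.\<close>

lemma Legendre_values: "Legendre a p \<in> {-1, 0, 1}"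
  by (auto simp: Legendre_def)

text \<open>Two such values differ by at most 2, which is less than \<open>p\<close>. This lifts
  Euler's criterion from a congruence to an equality.\<close>

lemma cong_imp_eq_sign:
  fixes x y :: int
  assumes "x \<in> {-1, 0, 1}" "y \<in> {-1, 0, 1}" "[x = y] (mod int p)" "2 < p"
  shows "x = y"
proof (rule ccontr)
  assume "x \<noteq> y"
  have "int p dvd x - y" using assms(3) by (simp add: cong_iff_dvd_diff)
  with \<open>x \<noteq> y\<close> have "\<bar>int p\<bar> \<le> \<bar>x - y\<bar>" by (intro dvd_imp_le_int) auto
  with assms show False by auto
qed

lemma Legendre_mult:
  assumes "prime p" "2 < p"
  shows "Legendre (a * b) (int p) = Legendre a (int p) * Legendre b (int p)"
proof (rule cong_imp_eq_sign[where p = p])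
  have "[Legendre a (int p) * Legendre b (int p) = a ^ ((p - 1) div 2) * b ^ ((p - 1) div 2)] (mod int p)"
    by (intro cong_mult euler_criterion assms)
  moreover have "[Legendre (a * b) (int p) = (a * b) ^ ((p - 1) div 2)] (mod int p)"
    by (intro euler_criterion assms)
  ultimately show "[Legendre (a * b) (int p) = Legendre a (int p) * Legendre b (int p)] (mod int p)"
    by (metis cong_sym cong_trans power_mult_distrib)
qed (use assms Legendre_values[of a "int p"] Legendre_values[of b "int p"] Legendre_values[of "a * b" "int p"] in auto)

lemma Legendre_cong:
  assumes "[a = b] (mod p)"
  shows "Legendre a p = Legendre b p"
proof -
  have "[a = 0] (mod p) \<longleftrightarrow> [b = 0] (mod p)" using assms cong_trans cong_sym by blast
  moreover have "QuadRes p a \<longleftrightarrow> QuadRes p b"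
    unfolding QuadRes_def using assms cong_trans cong_sym by blast
  ultimately show ?thesis by (simp add: Legendre_def)
qed

text \<open>The symbol is a product over prime factors, so each of its laws follows by adjoining one
  odd prime at a time.\<close>

lemma odd_prime_induct [consumes 1, case_names 1 prime]:
  assumes "odd (n :: nat)"
    and "P 1"
    and "\<And>p n. prime p \<Longrightarrow> odd p \<Longrightarrow> odd n \<Longrightarrow> P n \<Longrightarrow> P (p * n)"
  shows "P n"
proof -
  have "odd n \<longrightarrow> P n"
    by (induction n rule: prime_divisors_induct) (use assms in auto)
  with assms(1) show ?thesis by simp
qed

lemma odd_prime_gt_2: "prime (p :: nat) \<Longrightarrow> odd p \<Longrightarrow> 2 < p"
  using prime_ge_2_nat[of p] by (cases "p = 2") auto

lemma Jacobi_1_right [simp]: "Jacobi a (Suc 0) = 1"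
  by (simp add: Jacobi_def)

lemma Jacobi_mult_right:
  assumes "m > 0" "n > 0"
  shows "Jacobi a (m * n) = Jacobi a m * Jacobi a n"
  using assms by (simp add: Jacobi_def prime_factorization_mult)

lemma Jacobi_prime: "prime p \<Longrightarrow> Jacobi a p = Legendre a (int p)"
  by (simp add: Jacobi_def prime_factorization_prime)

lemma Jacobi_prime_mult:
  "prime p \<Longrightarrow> n > 0 \<Longrightarrow> Jacobi a (p * n) = Legendre a (int p) * Jacobi a n"
  by (simp add: Jacobi_mult_right Jacobi_prime prime_gt_0_nat)

lemma Jacobi_mult_left:
  assumes "odd n"
  shows "Jacobi (a * b) n = Jacobi a n * Jacobi b n"
  using assms
  by (induction n rule: odd_prime_induct)
     (auto simp: Jacobi_prime_mult odd_pos Legendre_mult odd_prime_gt_2)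

lemma Jacobi_cong:
  assumes "odd n" "[a = b] (mod int n)"
  shows "Jacobi a n = Jacobi b n"
  using assms
proof (induction n rule: odd_prime_induct)
  case (prime p n)
  have "[a = b] (mod int p)" "[a = b] (mod int n)"
    using prime.prems by (simp_all add: cong_modulus_mult) (metis cong_modulus_mult mult.commute)
  with prime show ?case by (simp add: Jacobi_prime_mult odd_pos Legendre_cong)
qed auto

lemma Jacobi_values: "odd n \<Longrightarrow> Jacobi a n \<in> {-1, 0, 1}"
proof (induction n rule: odd_prime_induct)
  case (prime p n)
  with Legendre_values[of a "int p"] show ?case by (auto simp: Jacobi_prime_mult odd_pos)
qed auto

lemma Jacobi_eq_0_iff:
  assumes "odd n"
  shows "Jacobi a n = 0 \<longleftrightarrow> \<not> coprime a (int n)"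
  using assms
proof (induction n rule: odd_prime_induct)
  case (prime p n)
  have "Legendre a (int p) = 0 \<longleftrightarrow> int p dvd a"
    by (auto simp: Legendre_def cong_0_iff)
  also have "\<dots> \<longleftrightarrow> \<not> coprime a (int p)"
    using prime(1) by (metis coprime_commute coprime_absorb_left not_prime_unit prime_imp_coprime prime_nat_int_transfer)
  finally show ?case using prime by (auto simp: Jacobi_prime_mult odd_pos)
qed auto

lemma Jacobi_square_eq_1:
  assumes "odd n" "coprime a (int n)"
  shows "Jacobi a n * Jacobi a n = 1"
  using Jacobi_values[OF assms(1), of a] Jacobi_eq_0_iff[OF assms(1), of a] assms(2) by auto

lemma Jacobi_1_left [simp]: "odd n \<Longrightarrow> Jacobi 1 n = 1"
  using Jacobi_square_eq_1[of n 1] Jacobi_mult_left[of n 1 1] by auto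

text \<open>For odd arguments this is the sign \<open>(-1)^((m-1)/2 * (n-1)/2)\<close> of
  reciprocity, in a form that visibly depends on residues modulo 4 only.\<close>

definition recip_sign :: "nat \<Rightarrow> nat \<Rightarrow> int" where
  "recip_sign m n = (if m mod 4 = 3 \<and> n mod 4 = 3 then - 1 else 1)"

lemma mod_4_mult_odd:
  assumes "odd (m :: nat)" "odd n"
  shows "(m * n) mod 4 = 3 \<longleftrightarrow> (m mod 4 = 3) \<noteq> (n mod 4 = 3)"
proof -
  have "m mod 4 = 1 \<or> m mod 4 = 3" "n mod 4 = 1 \<or> n mod 4 = 3" using assms by presburger+
  moreover have "(m * n) mod 4 = (m mod 4) * (n mod 4) mod 4" by (simp add: mod_mult_eq)
  ultimately show ?thesis by auto
qed

lemma recip_sign_mult_left: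
  "odd m \<Longrightarrow> odd m' \<Longrightarrow> recip_sign (m * m') n = recip_sign m n * recip_sign m' n"
  by (auto simp: recip_sign_def mod_4_mult_odd)

lemma recip_sign_commute: "recip_sign m n = recip_sign n m"
  by (auto simp: recip_sign_def)

lemma Jacobi_reciprocity_prime:
  assumes "prime p" "odd p" "prime q" "odd q"
  shows "Jacobi (int p) q = recip_sign p q * Jacobi (int q) p"
proof (cases "p = q")
  case True
  have "\<not> coprime (int p) (int p)" using prime_gt_1_nat[OF assms(1)] by auto
  then show ?thesis using True assms(2) Jacobi_eq_0_iff[of p "int p"] by simp
next
  case False
  define s where "s = Legendre (int q) (int p)"
  have eq: "Legendre (int p) (int q) * s = (-1) ^ ((p - 1) div 2 * ((q - 1) div 2))"
    unfolding s_def using Quadratic_Reciprocity[of p q] assms False odd_prime_gt_2 by auto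
  have "s * s = 1" unfolding s_def
    using Jacobi_square_eq_1[of p "int q"] assms False
    by (simp add: Jacobi_prime primes_coprime)
  moreover have "(-1) ^ ((p - 1) div 2 * ((q - 1) div 2)) = recip_sign p q"
  proof -
    have "even ((p - 1) div 2) \<longleftrightarrow> p mod 4 \<noteq> 3" "even ((q - 1) div 2) \<longleftrightarrow> q mod 4 \<noteq> 3"
      using assms by presburger+
    then show ?thesis by (auto simp: recip_sign_def minus_one_power_iff)
  qed
  ultimately have "Legendre (int p) (int q) = recip_sign p q * s"
    using eq by (metis mult.assoc mult.right_neutral)
  then show ?thesis using assms by (simp add: Jacobi_prime s_def)
qed

text \<open>At a common factor both sides vanish, so the law holds for all odd pairs. This keeps the
  two inductions, over the primes of \<open>n\<close> and then over those of \<open>m\<close>, free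
  of side conditions.\<close>

theorem Jacobi_reciprocity:
  assumes "odd m" "odd n"
  shows "Jacobi (int m) n = recip_sign m n * Jacobi (int n) m"
proof -
  have step: "Jacobi (int p) n = recip_sign p n * Jacobi (int n) p"
    if "prime p" "odd p" "odd n" for p n
    using that(3)
  proof (induction n rule: odd_prime_induct)
    case 1
    show ?case using that by (simp add: recip_sign_def)
  next
    case (prime q n)
    then show ?case using that Jacobi_reciprocity_prime[of p q]
      by (simp add: Jacobi_mult_right[of q] Jacobi_mult_left odd_pos prime_gt_0_nat
          recip_sign_commute[of p] recip_sign_mult_left)
  qed
  show ?thesis using assms(1)
  proof (induction m rule: odd_prime_induct)
    case 1
    show ?case using assms by (simp add: recip_sign_def)
  next
    case (prime p m)
    then show ?case using assms(2) step[of p n]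
      by (simp add: Jacobi_mult_left Jacobi_mult_right[of p] odd_pos prime_gt_0_nat recip_sign_mult_left)
  qed
qed

lemma Jacobi_minus_1:
  assumes "odd n"
  shows "Jacobi (-1) n = (if n mod 4 = 3 then -1 else 1)"
  using assms
proof (induction n rule: odd_prime_induct)
  case (prime p n)
  have "Legendre (-1) (int p) = (-1) ^ ((p - 1) div 2)"
  proof (rule cong_imp_eq_sign[where p = p])
    show "[Legendre (-1) (int p) = (-1) ^ ((p - 1) div 2)] (mod int p)"
      using euler_criterion[of p "-1"] prime odd_prime_gt_2 by blast
  qed (use Legendre_values[of "-1" "int p"] odd_prime_gt_2 prime in \<open>auto simp: minus_one_power_iff\<close>)
  moreover have "even ((p - 1) div 2) \<longleftrightarrow> p mod 4 \<noteq> 3"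
    using \<open>odd p\<close> by presburger
  ultimately have "Legendre (-1) (int p) = (if p mod 4 = 3 then -1 else 1)"
    by (auto simp: minus_one_power_iff)
  then show ?case using prime mod_4_mult_odd[of p n] by (auto simp: Jacobi_prime_mult odd_pos)
qed auto

text \<open>Induction in steps of two. Since \<open>-2\<close> is congruent to \<open>n\<close>
  modulo \<open>n + 2\<close>, the symbol \<open>(2 | n+2)\<close> equals
  \<open>(-1 | n+2) * (n | n+2)\<close>, and reciprocity turns the last factor into
  \<open>(n+2 | n) = (2 | n)\<close>. Its sign is trivial because one of \<open>n\<close>,
  \<open>n + 2\<close> is 1 modulo 4.\<close>

lemma Jacobi_2:
  assumes "odd n"
  shows "Jacobi 2 n = (if n mod 8 = 1 \<or> n mod 8 = 7 then 1 else -1)"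
proof -
  have "Jacobi 2 (2 * j + 1) = (if (2 * j + 1) mod 8 = 1 \<or> (2 * j + 1) mod 8 = 7 then 1 else -1)" for j
  proof (induction j)
    case (Suc j)
    define n where "n = 2 * j + 1"
    have n: "odd n" "2 * Suc j + 1 = n + 2" by (simp_all add: n_def)
    have "Jacobi 2 (n + 2) = Jacobi (-1) (n + 2) * Jacobi (-2) (n + 2)"
      using Jacobi_mult_left[of "n + 2" "-1" "-2"] n by simp
    also have "Jacobi (-2) (n + 2) = Jacobi (int n) (n + 2)"
    proof (rule Jacobi_cong)
      have eq: "-2 - int n = - int (n + 2)" by linarith
      show "[-2 = int n] (mod int (n + 2))"
        unfolding cong_iff_dvd_diff eq by (rule dvd_minus_iff[THEN iffD2, OF dvd_refl])
    qed (use n in auto)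
    also have "\<dots> = recip_sign n (n + 2) * Jacobi (int (n + 2)) n"
      by (rule Jacobi_reciprocity) (use n in auto)
    also have "recip_sign n (n + 2) = 1"
      using n unfolding recip_sign_def by presburger
    also have "Jacobi (int (n + 2)) n = Jacobi 2 n"
      by (rule Jacobi_cong) (use n in \<open>auto simp: cong_iff_dvd_diff\<close>)
    finally have eq: "Jacobi 2 (n + 2) = Jacobi (-1) (n + 2) * Jacobi 2 n" by simp
    have "n mod 8 = 1 \<and> (n + 2) mod 8 = 3 \<and> (n + 2) mod 4 = 3 \<or> n mod 8 = 3 \<and> (n + 2) mod 8 = 5 \<and> (n + 2) mod 4 = 1
        \<or> n mod 8 = 5 \<and> (n + 2) mod 8 = 7 \<and> (n + 2) mod 4 = 3 \<or> n mod 8 = 7 \<and> (n + 2) mod 8 = 1 \<and> (n + 2) mod 4 = 1"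
      using n(1) by presburger
    then show ?case using eq Suc.IH Jacobi_minus_1[of "n + 2"] n(1)
      unfolding n(2) n_def[symmetric] by (elim disjE conjE) (simp_all del: add_2_eq_Suc')
  qed auto
  with assms show ?thesis by (metis oddE)
qed

section \<open>The sign of the quadratic Gauss sum\<close>

lemma cis_2pi_cong:
  assumes "[a = b] (mod int n)" "n > 0" "x \<in> \<int>"
  shows "cis (2 * pi * (real_of_int a * x / real n)) = cis (2 * pi * (real_of_int b * x / real n))"
proof -
  obtain k where k: "a - b = int n * k"
    using assms(1) by (auto simp: cong_iff_dvd_diff)
  obtain z where z: "x = of_int z" using assms(3) by (elim Ints_cases)
  have "real_of_int a = real_of_int b + real n * real_of_int k"
    using k by (metis add.commute add_diff_cancel_left' diff_add_cancel of_int_add of_int_mult of_int_of_nat_eq)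
  then have "2 * pi * (real_of_int a * x / real n) = 2 * pi * (real_of_int b * x / real n) + 2 * pi * of_int (k * z)"
    using assms(2) z by (simp add: field_simps)
  then show ?thesis
    by (simp add: cis_mult[symmetric] cis_multiple_2pi)
qed

text \<open>One tool for every change of variables modulo \<open>n\<close>: multiplication by a
  unit, translation with reflection, the Chinese remainder map and the splitting
  \<open>a + p * b\<close> are all injections of an index set of size \<open>n\<close> into the
  residues.\<close>

lemma sum_over_residues:
  fixes f :: "int \<Rightarrow> 'a :: comm_monoid_add"
  assumes per: "\<And>x y. [x = y] (mod int n) \<Longrightarrow> f x = f y"
    and inj: "\<And>i j. i \<in> I \<Longrightarrow> j \<in> I \<Longrightarrow> [h i = h j] (mod int n) \<Longrightarrow> i = j"
    and card: "card I = n" and n: "n > 0"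
  shows "(\<Sum>i\<in>I. f (h i)) = (\<Sum>m<n. f (int m))"
proof -
  define r where "r i = nat (h i mod int n)" for i
  have inj': "inj_on r I"
    unfolding inj_on_def r_def using n inj by (auto simp: cong_def nat_eq_iff pos_mod_sign)
  have "r ` I \<subseteq> {..<n}" using n by (auto simp: r_def nat_less_iff)
  moreover have "card (r ` I) = card {..<n}" using inj' card by (simp add: card_image)
  ultimately have "r ` I = {..<n}" by (intro card_subset_eq) auto
  then have "(\<Sum>m<n. f (int m)) = (\<Sum>i\<in>I. f (int (r i)))"
    using inj' by (metis (no_types, lifting) sum.reindex_cong)
  also have "\<dots> = (\<Sum>i\<in>I. f (h i))"
    by (intro sum.cong refl per) (use n in \<open>auto simp: r_def cong_def\<close>)
  finally show ?thesis by simp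
qed

lemma sum_cis_residues:
  assumes "n > 0"
  shows "(\<Sum>m<n. cis (2 * pi * (real m * real_of_int k / real n))) = (if int n dvd k then of_nat n else 0)"
proof -
  define w where "w = cis (2 * pi * (real_of_int k / real n))"
  have pow: "cis (2 * pi * (real m * real_of_int k / real n)) = w ^ m" for m
    unfolding w_def Complex.DeMoivre by (simp add: field_simps)
  have wn: "w ^ n = 1"
    unfolding pow[symmetric] using assms cis_multiple_2pi[of "of_int k"] by (simp add: mult.commute)
  show ?thesis
  proof (cases "int n dvd k")
    case True
    then obtain z where "k = int n * z" by auto
    then have "w = 1" unfolding w_def using assms by (simp add: cis_multiple_2pi)
    then show ?thesis using True pow by simp
  next
    case False
    have "w \<noteq> 1"
    proof
      assume "w = 1"
      then have "cos (2 * pi * (real_of_int k / real n)) = 1" unfolding w_def by (metis cis.sel(1) one_complex.sel(1))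
      then obtain z where "2 * pi * (real_of_int k / real n) = of_int z * 2 * pi"
        using cos_one_2pi_int by auto
      then have "real_of_int k = real_of_int (z * int n)" using assms by (simp add: field_simps)
      then have "k = z * int n" by linarith
      with False show False by simp
    qed
    then have "(\<Sum>m<n. w ^ m) = 0" using wn geometric_sum[of w n] by simp
    then show ?thesis using False pow by simp
  qed
qed

text \<open>\<open>1 + (a | p)\<close> is the number of square roots of \<open>a\<close> modulo
  \<open>p\<close>. With an exponential for \<open>f\<close> this relates quadratic sums to the
  Gauss sum of the character; with \<open>f = 1\<close> it shows that the character has sum
  0.\<close>

lemma sum_squares_mod_prime:
  fixes f :: "int \<Rightarrow> complex"
  assumes "prime p" "odd p" and per: "\<And>x y. [x = y] (mod int p) \<Longrightarrow> f x = f y"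
  shows "(\<Sum>r<p. f (int r ^ 2)) = (\<Sum>a<p. (1 + of_int (Jacobi (int a) p)) * f (int a))"
proof -
  have p0: "p > 0" using assms by (simp add: prime_gt_0_nat)
  define S where "S a = {r. r < p \<and> [int r ^ 2 = int a] (mod int p)}" for a
  have card_S: "of_nat (card (S a)) = (1 + of_int (Jacobi (int a) p) :: complex)" if a: "a < p" for a
  proof (cases "\<exists>y. [y ^ 2 = int a] (mod int p)")
    case False
    then have "S a = {}" by (auto simp: S_def)
    moreover have "Jacobi (int a) p = -1"
    proof -
      have "\<not> [int a = 0] (mod int p)"
      proof
        assume "[int a = 0] (mod int p)"
        then have "[0 ^ 2 = int a] (mod int p)" by (simp add: cong_sym)
        with False show False by blast
      qed
      moreover have "\<not> QuadRes (int p) (int a)" using False by (simp add: QuadRes_def)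
      ultimately show ?thesis using assms by (simp add: Jacobi_prime Legendre_def)
    qed
    ultimately show ?thesis by simp
  next
    case True
    then obtain y where y: "[y ^ 2 = int a] (mod int p)" by blast
    define r1 where "r1 = nat (y mod int p)"
    define r2 where "r2 = nat ((- y) mod int p)"
    have mb: "0 \<le> z mod int p" "z mod int p < int p" for z :: int using p0 by simp_all
    have r: "[int (nat (z mod int p)) = z] (mod int p)" "nat (z mod int p) < p" for z :: int
      by (simp only: cong_def nat_0_le[OF mb(1)] mod_mod_trivial)
         (simp only: nat_less_iff[OF mb(1)] mb(2))
    note r1 = r[of y, folded r1_def] and r2 = r[of "- y", folded r2_def]
    have pp: "prime (int p)" using assms by simp
    \<comment> \<open>There are no other roots, because \<open>p\<close> divides
      \<open>(r - y) * (r + y)\<close>. The two coincide exactly when \<open>p\<close> divides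
      \<open>y\<close>; then the symbol is 0 and the count is 1.\<close>
    have "S a = {r1, r2}"
    proof (intro subset_antisym subsetI)
      fix r assume "r \<in> S a"
      then have r: "r < p" "[int r ^ 2 = y ^ 2] (mod int p)"
        using y by (auto simp: S_def intro: cong_trans cong_sym)
      have "int p dvd (int r - y) * (int r + y)"
        using r(2) by (simp add: cong_iff_dvd_diff power2_eq_square algebra_simps)
      then have "int p dvd int r - y \<or> int p dvd int r + y" using pp by (simp add: prime_dvd_mult_iff)
      then have "[int r = y] (mod int p) \<or> [int r = - y] (mod int p)" by (simp add: cong_iff_dvd_diff)
      then have "[int r = int r1] (mod int p) \<or> [int r = int r2] (mod int p)"
        using r1 r2 cong_trans cong_sym by meson
      then show "r \<in> {r1, r2}"
        using r(1) r1 r2 by (auto simp: cong_int_iff cong_less_modulus_unique_nat)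
    next
      fix r assume "r \<in> {r1, r2}"
      then have "[int r = y] (mod int p) \<or> [int r = - y] (mod int p)" "r < p" using r1 r2 by auto
      then have "[int r ^ 2 = y ^ 2] (mod int p)" "r < p"
        by (auto dest: cong_pow[of _ _ _ 2])
      then show "r \<in> S a" using y by (auto simp: S_def intro: cong_trans)
    qed
    moreover have "r1 = r2 \<longleftrightarrow> int p dvd y"
    proof -
      have "r1 = r2 \<longleftrightarrow> [y = - y] (mod int p)"
        using r1 r2 by (metis cong_less_modulus_unique_nat cong_int_iff cong_sym cong_trans cong_refl)
      also have "\<dots> \<longleftrightarrow> int p dvd 2 * y" by (simp add: cong_iff_dvd_diff)
      also have "\<dots> \<longleftrightarrow> int p dvd y"
      proof -
        have "\<not> int p dvd 2"
          using odd_prime_gt_2[of p] assms zdvd_not_zless[of 2 "int p"] by simp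
        then show ?thesis using prime_dvd_mult_iff[OF pp, of 2 y] by simp
      qed
      finally show ?thesis .
    qed
    moreover have "Jacobi (int a) p = (if int p dvd y then 0 else 1)"
    proof -
      have "[int a = 0] (mod int p) \<longleftrightarrow> int p dvd y ^ 2"
        using y by (metis cong_0_iff cong_sym cong_trans)
      also have "\<dots> \<longleftrightarrow> int p dvd y" using pp by (simp add: prime_dvd_power_iff)
      finally show ?thesis using y assms by (auto simp: Jacobi_prime Legendre_def QuadRes_def)
    qed
    ultimately show ?thesis by (auto simp: card_insert_if)
  qed
  have "(\<Sum>r<p. f (int r ^ 2)) = (\<Sum>a<p. \<Sum>r\<in>{r\<in>{..<p}. nat (int r ^ 2 mod int p) = a}. f (int r ^ 2))"
    using p0 by (intro sum.group[symmetric]) (auto simp: nat_less_iff)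
  also have "\<dots> = (\<Sum>a<p. \<Sum>r\<in>S a. f (int a))"
  proof (intro sum.cong refl)
    fix a assume a: "a \<in> {..<p}"
    have "nat (int r ^ 2 mod int p) = a \<longleftrightarrow> [int r ^ 2 = int a] (mod int p)" for r
      using a p0 by (auto simp: cong_def nat_eq_iff)
    then show "{r \<in> {..<p}. nat (int r ^ 2 mod int p) = a} = S a" by (auto simp: S_def)
  next
    fix a r assume "r \<in> S a"
    then show "f (int r ^ 2) = f (int a)" using per by (simp add: S_def)
  qed
  also have "\<dots> = (\<Sum>a<p. (1 + of_int (Jacobi (int a) p)) * f (int a))"
    by (intro sum.cong refl) (simp add: card_S)
  finally show ?thesis .
qed

definition gauss_tau :: "nat \<Rightarrow> complex" where
  "gauss_tau p = (\<Sum>m<p. of_int (Jacobi (int m) p) * cis (2 * pi * (real m / real p)))"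

text \<open>For \<open>k\<close> prime to \<open>p\<close>, the map from \<open>m\<close> to
  \<open>m * k\<close> permutes the residues and \<open>(k | p)\<close> is its own inverse. For
  \<open>p | k\<close> both sides are 0, the left one because the character has sum 0.\<close>

lemma gauss_sum_prime:
  assumes "prime p" "odd p"
  shows "(\<Sum>m<p. of_int (Jacobi (int m) p) * cis (2 * pi * (real m * real_of_int k / real p)))
           = of_int (Jacobi k p) * gauss_tau p"
proof (cases "int p dvd k")
  case True
  have p0: "p > 0" using assms by (simp add: prime_gt_0_nat)
  obtain z where z: "k = int p * z" using True by auto
  have c1: "cis (2 * pi * (real m * real_of_int k / real p)) = 1" for m
    using p0 cis_multiple_2pi[of "of_int (int m * z)"] by (simp add: z mult_ac)
  have "(\<Sum>m<p. of_int (Jacobi (int m) p) * cis (2 * pi * (real m * real_of_int k / real p)))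
          = (\<Sum>m<p. of_int (Jacobi (int m) p))"
    by (simp only: c1 mult_1_right)
  moreover have "(\<Sum>r<p. 1 :: complex) = (\<Sum>a<p. (1 + of_int (Jacobi (int a) p)) * 1)"
    using sum_squares_mod_prime[OF assms, of "\<lambda>_. 1"] by simp
  then have "(\<Sum>m<p. of_int (Jacobi (int m) p)) = (0 :: complex)"
    by (simp add: sum.distrib)
  ultimately have "(\<Sum>m<p. of_int (Jacobi (int m) p) * cis (2 * pi * (real m * real_of_int k / real p))) = 0"
    by (simp only:)
  moreover have "Jacobi k p = 0"
    using True assms by (simp add: Jacobi_prime Legendre_def cong_0_iff)
  ultimately show ?thesis by simp
next
  case False
  have p0: "p > 0" using assms by (simp add: prime_gt_0_nat)
  have cop: "coprime k (int p)"
    using False assms by (metis coprime_commute prime_imp_coprime prime_nat_int_transfer)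
  define f where "f x = of_int (Jacobi x p) * cis (2 * pi * (real_of_int x * 1 / real p))" for x
  have per: "f x = f y" if "[x = y] (mod int p)" for x y
    unfolding f_def using that Jacobi_cong[OF assms(2) that] cis_2pi_cong[OF that p0, of 1] by simp
  have "(\<Sum>m<p. f (int m * k)) = (\<Sum>m<p. f (int m))"
  proof (rule sum_over_residues[OF per])
    fix i j assume "i \<in> {..<p}" "j \<in> {..<p}" "[int i * k = int j * k] (mod int p)"
    then show "i = j"
      using cop by (metis cong_mult_rcancel cong_int_iff cong_less_modulus_unique_nat lessThan_iff)
  qed (use p0 in auto)
  then have "gauss_tau p = (\<Sum>m<p. f (int m * k))"
    by (simp add: gauss_tau_def f_def)
  then have "of_int (Jacobi k p) * gauss_tau p = (\<Sum>m<p. of_int (Jacobi k p) * f (int m * k))"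
    by (simp add: sum_distrib_left)
  also have "\<dots> = (\<Sum>m<p. of_int (Jacobi (int m) p) * cis (2 * pi * (real m * real_of_int k / real p)))"
  proof (intro sum.cong refl)
    fix m
    have "(of_int (Jacobi k p) * of_int (Jacobi k p) :: complex) = 1"
      using Jacobi_square_eq_1[OF assms(2) cop] by (metis of_int_1 of_int_mult)
    moreover have "of_int (Jacobi k p) * f (int m * k) = of_int (Jacobi k p) * of_int (Jacobi k p) *
        (of_int (Jacobi (int m) p) * cis (2 * pi * (real m * real_of_int k / real p)))"
      by (simp add: f_def Jacobi_mult_left[OF assms(2)])
    ultimately show "of_int (Jacobi k p) * f (int m * k)
        = of_int (Jacobi (int m) p) * cis (2 * pi * (real m * real_of_int k / real p))"
      by (simp only: mult_1)
  qed
  finally show ?thesis by simp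
qed

text \<open>The Fourier transform is applied twice and evaluated at \<open>-1\<close>. By
  \<open>gauss_sum_prime\<close> this gives the square of the Gauss sum up to
  \<open>(-1 | p)\<close>; by orthogonality only \<open>m = 1\<close> survives and gives
  \<open>p\<close>.\<close>

lemma gauss_tau_square:
  assumes "prime p" "odd p"
  shows "gauss_tau p * gauss_tau p = of_int (Jacobi (-1) p) * of_nat p"
proof -
  have p0: "p > 0" using assms by (simp add: prime_gt_0_nat)
  define E where "E m k = cis (2 * pi * (real m * real_of_int k / real p))" for m k
  have "(\<Sum>k<p. (\<Sum>m<p. of_int (Jacobi (int m) p) * E m (int k)) * E k (-1))
      = (\<Sum>k<p. (of_int (Jacobi (int k) p) * gauss_tau p) * E k (-1))"
    unfolding E_def by (intro sum.cong refl arg_cong2[where f = times] gauss_sum_prime assms)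
  also have "\<dots> = gauss_tau p * (\<Sum>k<p. of_int (Jacobi (int k) p) * E k (-1))"
    by (simp add: sum_distrib_left mult_ac)
  also have "\<dots> = gauss_tau p * (of_int (Jacobi (-1) p) * gauss_tau p)"
    unfolding E_def by (subst gauss_sum_prime[OF assms]) simp
  finally have 1: "(\<Sum>k<p. (\<Sum>m<p. of_int (Jacobi (int m) p) * E m (int k)) * E k (-1))
      = gauss_tau p * (of_int (Jacobi (-1) p) * gauss_tau p)" .
  have "(\<Sum>k<p. (\<Sum>m<p. of_int (Jacobi (int m) p) * E m (int k)) * E k (-1))
      = (\<Sum>m<p. of_int (Jacobi (int m) p) * (\<Sum>k<p. E k (int m - 1)))"
    unfolding sum_distrib_right sum_distrib_left
    by (subst sum.swap) (intro sum.cong refl, simp add: E_def mult.assoc cis_mult, simp add: field_simps)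
  also have "\<dots> = (\<Sum>m<p. of_int (Jacobi (int m) p) * (if m = 1 then of_nat p else 0))"
  proof (intro sum.cong refl arg_cong2[where f = times])
    fix m assume m: "m \<in> {..<p}"
    have "int p dvd int m - 1 \<longleftrightarrow> m = 1"
    proof
      assume "int p dvd int m - 1"
      then have "[int m = int 1] (mod int p)" by (simp add: cong_iff_dvd_diff)
      then have "[m = 1] (mod p)" by (simp only: cong_int_iff)
      then show "m = 1" using m prime_gt_1_nat[OF assms(1)] by (simp add: cong_less_modulus_unique_nat)
    qed auto
    then show "(\<Sum>k<p. E k (int m - 1)) = (if m = 1 then of_nat p else 0)"
      unfolding E_def using sum_cis_residues[OF p0, of "int m - 1"] by simp
  qed
  also have "\<dots> = of_nat p"
    using prime_gt_1_nat[OF assms(1)] assms(2) by (simp add: sum.delta if_distrib[of "times _"] cong: if_cong)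
  finally have "gauss_tau p * (of_int (Jacobi (-1) p) * gauss_tau p) = of_nat p" using 1 by simp
  then have "of_int (Jacobi (-1) p * Jacobi (-1) p) * (gauss_tau p * gauss_tau p)
       = of_int (Jacobi (-1) p) * (of_nat p :: complex)"
    by (simp add: mult_ac)
  moreover have "Jacobi (-1) p * Jacobi (-1) p = 1"
    by (rule Jacobi_square_eq_1) (use assms in auto)
  ultimately show ?thesis by simp
qed

section \<open>Estermann's estimate and the sign of the Gauss sum\<close>

lemma abel_telescoping_bound:
  fixes V s :: "nat \<Rightarrow> real"
  assumes V: "\<And>i. \<bar>V i\<bar> \<le> 1" and "\<And>i. a \<le> i \<Longrightarrow> i < b \<Longrightarrow> s (Suc i) \<le> s i"
    and "\<And>i. a \<le> i \<Longrightarrow> i \<le> b \<Longrightarrow> s i \<ge> 0" and "a \<le> b"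
  shows "\<bar>(\<Sum>i=a..b. (V (Suc i) - V i) * s i) - V (Suc b) * s b\<bar> \<le> 2 * s a - s b"
  using assms(4,2,3)
proof (induction b rule: dec_induct)
  case base
  have "\<bar>V a * s a\<bar> \<le> 1 * s a"
    unfolding abs_mult using base V[of a] by (intro mult_mono) auto
  then show ?case by (simp add: algebra_simps)
next
  case (step b)
  have IH: "\<bar>(\<Sum>i=a..b. (V (Suc i) - V i) * s i) - V (Suc b) * s b\<bar> \<le> 2 * s a - s b"
    using step by simp
  have le: "s (Suc b) \<le> s b" using step by simp
  have "\<bar>V (Suc b) * (s b - s (Suc b))\<bar> \<le> 1 * (s b - s (Suc b))"
    unfolding abs_mult using le V[of "Suc b"] by (intro mult_mono) auto
  \<comment> \<open>Including the boundary term keeps the estimate inductive: one step adds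
    \<open>V (Suc b)\<close> times the decrease of \<open>s\<close>, which is exactly the amount by
    which the right-hand side grows.\<close>
  moreover have "(\<Sum>i=a..Suc b. (V (Suc i) - V i) * s i) - V (Suc (Suc b)) * s (Suc b)
     = ((\<Sum>i=a..b. (V (Suc i) - V i) * s i) - V (Suc b) * s b) + V (Suc b) * (s b - s (Suc b))"
    using step by (simp add: algebra_simps)
  ultimately show ?case
    using IH abs_triangle_ineq[of "(\<Sum>i=a..b. (V (Suc i) - V i) * s i) - V (Suc b) * s b" "V (Suc b) * (s b - s (Suc b))"]
    by simp
qed

text \<open>Jordan's inequality: the concave sine lies above its chord over
  \<open>[0, pi/2]\<close>.\<close>

lemma sin_ge_two_over_pi:
  assumes "0 \<le> x" "x \<le> 1"
  shows "x \<le> sin (pi / 2 * x)"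
proof -
  have conc: "concave_on {0..pi / 2} sin"
    unfolding concave_on_def
  proof (rule convex_on_realI[where f' = "\<lambda>x. - cos x"])
    fix x y :: real assume "x \<in> {0..pi/2}" "y \<in> {0..pi/2}" "x \<le> y"
    then show "- cos x \<le> - cos y" using cos_mono_le_eq[of y x] by simp
  qed (auto intro!: derivative_eq_intros)
  have "sin ((1 - x) * 0 + x * (pi / 2)) \<ge> (1 - x) * sin 0 + x * sin (pi / 2)"
    using concave_onD[OF conc, of x 0 "pi/2"] assms by simp
  then show ?thesis by (simp add: mult.commute)
qed

text \<open>
  The cosines are the real parts of the terms of the Gauss sum, turned by \<open>- \<pi>/4\<close>. As that sum is
  \<open>\<plusminus> \<surd>N\<close>, the bound decides the sign. The terms with \<open>(2i + 1)\<^sup>2 \<le> 2N\<close> are at least \<open>1/\<surd>2\<close>, the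
  others cancel by partial summation.
\<close>

lemma estermann_bound:
  assumes N: "N = 2 * M + 1" "M \<ge> 1"
  defines "u \<equiv> \<lambda>i :: nat. cos (pi * (2 * real i + 1) ^ 2 / (4 * real N) - pi / 4)"
  shows "(\<Sum>i<M. u i) + (\<Sum>i\<le>M. u i) > - sqrt (real N)"
proof -
  have N3: "N \<ge> 3" and N0: "real N \<noteq> 0" using N by simp_all
  define B where "B i = pi * (2 * real i + 1) / (2 * real N)" for i :: nat
  \<comment> \<open>The squares of \<open>2i\<close> and \<open>2i + 2\<close> lie around that of
    \<open>2i + 1\<close>; the shift by \<open>pi / (4N)\<close> centres them, so that
    \<open>V i\<close> and \<open>V (Suc i)\<close> are the sines of \<open>A - B i\<close> and
    \<open>A + B i\<close>, where \<open>u i = cos A\<close>. Hence \<open>u i\<close> is a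
    difference of \<open>V\<close> divided by \<open>2 * sin (B i)\<close>.\<close>
  define V where "V i = sin (pi * (2 * real i) ^ 2 / (4 * real N) - pi / 4 - pi / (4 * real N))" for i :: nat
  define s where "s i = 1 / (2 * sin (B i))" for i
  have B: "0 < B i" "B i \<le> pi / 2" if "i \<le> M" for i
  proof -
    show "0 < B i" unfolding B_def using N by (intro divide_pos_pos mult_pos_pos) auto
    have "(2 * real i + 1) / real N \<le> 1" using that N by simp
    then have "pi / 2 * ((2 * real i + 1) / real N) \<le> pi / 2 * 1" by (intro mult_left_mono) auto
    then show "B i \<le> pi / 2" by (simp add: B_def)
  qed
  have sinB: "sin (B i) \<ge> (2 * real i + 1) / real N" if "i \<le> M" for i
    using sin_ge_two_over_pi[of "(2 * real i + 1) / real N"] that N by (simp add: B_def mult_ac)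
  have sinB0: "sin (B i) > 0" if "i \<le> M" for i
    by (rule less_le_trans[OF _ sinB[OF that]]) (use N in auto)
  have u_eq: "u i = (V (Suc i) - V i) * s i" if "i \<le> M" for i
  proof -
    define A where "A = pi * (2 * real i + 1) ^ 2 / (4 * real N) - pi / 4"
    have 1: "pi * (2 * real (Suc i)) ^ 2 / (4 * real N) - pi / 4 - pi / (4 * real N) = A + B i"
      using N0 by (simp add: A_def B_def field_simps power2_eq_square)
    have 2: "pi * (2 * real i) ^ 2 / (4 * real N) - pi / 4 - pi / (4 * real N) = A - B i"
      using N0 by (simp add: A_def B_def field_simps power2_eq_square)
    have "V (Suc i) - V i = 2 * cos A * sin (B i)"
      unfolding V_def 1 2 by (simp add: sin_add sin_diff)
    then show ?thesis using sinB0[OF that] by (simp add: s_def u_def A_def)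
  qed
  have tail: "\<bar>\<Sum>i=a..b. u i\<bar> \<le> real N / (2 * real a + 1)" if "a \<le> b" "b \<le> M" for a b
  proof -
    have "\<bar>(\<Sum>i=a..b. (V (Suc i) - V i) * s i) - V (Suc b) * s b\<bar> \<le> 2 * s a - s b"
    proof (rule abel_telescoping_bound)
      fix i show "\<bar>V i\<bar> \<le> 1" by (simp add: V_def)
    next
      fix i assume i: "a \<le> i" "i < b"
      have "sin (B i) \<le> sin (B (Suc i))"
        using B[of i] B[of "Suc i"] i that N by (intro sin_monotone_2pi_le) (auto simp: B_def field_simps)
      then show "s (Suc i) \<le> s i" using sinB0[of i] i that by (simp add: s_def frac_le)
    next
      fix i assume "a \<le> i" "i \<le> b"
      then show "s i \<ge> 0" using sinB0[of i] that by (simp add: s_def)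
    qed (use that in auto)
    moreover have "\<bar>V (Suc b) * s b\<bar> \<le> 1 * s b"
      unfolding abs_mult using sinB0[of b] that by (intro mult_mono) (auto simp: s_def V_def)
    moreover have "(\<Sum>i=a..b. u i) = (\<Sum>i=a..b. (V (Suc i) - V i) * s i)"
      by (intro sum.cong refl u_eq) (use that in auto)
    ultimately have "\<bar>\<Sum>i=a..b. u i\<bar> \<le> 2 * s a" by linarith
    also have "\<dots> = 1 / sin (B a)" by (simp add: s_def)
    also have "\<dots> \<le> 1 / ((2 * real a + 1) / real N)"
      using sinB[of a] that N by (intro frac_le) auto
    finally show ?thesis by simp
  qed
  \<comment> \<open>Marks the indices at which the argument of the cosine has left the interval from
    \<open>-pi/4\<close> to \<open>pi/4\<close>.\<close>
  define P where "P a \<longleftrightarrow> (2 * real a + 1) ^ 2 > 2 * real N" for a :: nat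
  have PM: "P M"
  proof -
    have "real N * real N > 2 * real N" using N3 by simp
    then show ?thesis using N by (simp add: P_def power2_eq_square add.commute)
  qed
  define a where "a = (LEAST a. P a)"
  have Pa: "P a" unfolding a_def using PM by (rule LeastI)
  have aM: "a \<le> M" unfolding a_def using PM by (rule Least_le)
  have head: "u i \<ge> sqrt 2 / 2" if "i < a" for i
  proof -
    have "\<not> P i" using that not_less_Least unfolding a_def by blast
    then have "(2 * real i + 1) ^ 2 \<le> 2 * real N" by (simp add: P_def)
    then have le: "(2 * real i + 1) ^ 2 / (4 * real N) \<le> 1 / 2" using N by (simp add: field_simps)
    define z where "z = pi * (2 * real i + 1) ^ 2 / (4 * real N)"
    have "pi * ((2 * real i + 1) ^ 2 / (4 * real N)) \<le> pi * (1 / 2)"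
      using le by (intro mult_left_mono) auto
    then have "z \<le> pi / 2" "z \<ge> 0" by (simp_all add: z_def)
    then have "\<bar>z - pi / 4\<bar> \<le> pi / 4" by linarith
    then have "\<bar>pi * (2 * real i + 1) ^ 2 / (4 * real N) - pi / 4\<bar> \<le> pi / 4"
      by (simp only: z_def)
    then have "cos (pi / 4) \<le> cos \<bar>pi * (2 * real i + 1) ^ 2 / (4 * real N) - pi / 4\<bar>"
      by (intro cos_monotone_0_pi_le) auto
    then show ?thesis by (simp add: u_def cos_45)
  qed
  \<comment> \<open>A head of \<open>a\<close> terms that are at least \<open>sqrt 2 / 2\<close>,
    and a tail bounded by partial summation. The condition allows \<open>a = Suc b\<close>, where
    the tail is empty.\<close>
  have part: "(\<Sum>i=0..b. u i) \<ge> real a * (sqrt 2 / 2) - real N / (2 * real a + 1)" if "b \<le> M" "a \<le> Suc b" for b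
  proof -
    have "(\<Sum>i=0..b. u i) = (\<Sum>i\<in>{0..<a} \<union> {a..b}. u i)"
      using that by (intro sum.cong) auto
    also have "\<dots> = (\<Sum>i\<in>{0..<a}. u i) + (\<Sum>i=a..b. u i)"
      by (rule sum.union_disjoint) auto
    finally have eq: "(\<Sum>i=0..b. u i) = (\<Sum>i\<in>{0..<a}. u i) + (\<Sum>i=a..b. u i)" .
    have "(\<Sum>i\<in>{0..<a}. u i) \<ge> (\<Sum>i\<in>{0..<a}. sqrt 2 / 2)" by (intro sum_mono head) auto
    moreover have "\<bar>\<Sum>i=a..b. u i\<bar> \<le> real N / (2 * real a + 1)"
    proof (cases "a \<le> b")
      case False
      then show ?thesis by simp
    qed (use tail that in auto)
    ultimately show ?thesis unfolding eq by simp
  qed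
  have e1: "{..<M} = {0..M - 1}" "{..M} = {0..M}" using N by auto
  have "(\<Sum>i<M. u i) + (\<Sum>i\<le>M. u i) \<ge> 2 * (real a * (sqrt 2 / 2) - real N / (2 * real a + 1))"
  proof -
    have "(\<Sum>i=0..M - 1. u i) \<ge> real a * (sqrt 2 / 2) - real N / (2 * real a + 1)"
      by (rule part) (use aM N(2) in auto)
    moreover have "(\<Sum>i=0..M. u i) \<ge> real a * (sqrt 2 / 2) - real N / (2 * real a + 1)"
      by (rule part) (use aM in auto)
    ultimately show ?thesis unfolding e1 mult_2 by (rule add_mono)
  qed
  \<comment> \<open>With \<open>t = sqrt 2\<close>, \<open>x = sqrt N\<close> and
    \<open>2a + 1 > t * x\<close>, the head contributes at least \<open>x - t/2\<close> and the tail
    costs at most \<open>t * x\<close>. What remains is \<open>x * (2 - t) > t / 2\<close>, which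
    holds already for \<open>x \<ge> 17/10\<close>, hence for \<open>N \<ge> 3\<close>.\<close>
  moreover have "2 * (real a * (sqrt 2 / 2) - real N / (2 * real a + 1)) > - sqrt (real N)"
  proof -
    define x where "x = sqrt (real N)"
    have x: "x > 0" "x * x = real N" using N by (simp_all add: x_def)
    have x17: "x \<ge> 17 / 10" unfolding x_def using N3 by (intro real_le_rsqrt) (simp add: power2_eq_square)
    define t where "t = sqrt (2 :: real)"
    have t: "t > 0" "t * t = 2" by (simp_all add: t_def)
    have t15: "t < 1415 / 1000" unfolding t_def by (rule real_less_lsqrt) (simp_all add: power2_eq_square)
    define y where "y = 2 * real a + 1"
    have "(t * x) ^ 2 = (t * t) * (x * x)" by (simp add: power2_eq_square)
    then have "(t * x) ^ 2 < y ^ 2" using Pa x t by (simp add: P_def y_def)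
    then have y: "t * x < y" by (rule power_less_imp_less_base) (simp add: y_def)
    have ypos: "y > 0" by (simp add: y_def)
    have "2 * real N / y \<le> 2 * real N / (t * x)"
      using y x t ypos by (intro divide_left_mono) auto
    also have "\<dots> = t * x"
      using x t by (simp add: field_simps)
    finally have b1: "2 * real N / y \<le> t * x" .
    have "real a * t = (y - 1) * t / 2" by (simp add: y_def)
    also have "\<dots> \<ge> (t * x - 1) * t / 2" using y t by simp
    also have "(t * x - 1) * t / 2 = (t * t) * x / 2 - t / 2" by (simp add: algebra_simps diff_divide_distrib)
    also have "\<dots> = x - t / 2" using t by simp
    finally have b2: "real a * t \<ge> x - t / 2" .
    have "x * (2 - t) \<ge> (17 / 10) * (585 / 1000)" using x17 t15 by (intro mult_mono) auto
    then have "x - t / 2 - t * x > - x" using t15 by (simp add: algebra_simps)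
    then show ?thesis using b1 b2 unfolding y_def[symmetric] x_def[symmetric] t_def[symmetric] by (simp add: algebra_simps)
  qed
  ultimately show ?thesis by linarith
qed

definition gauss_eps :: "nat \<Rightarrow> complex" where
  "gauss_eps n = (if n mod 4 = 3 then \<i> else 1)"

text \<open>The square leaves only the sign open. The quadratic sum \<open>W\<close> is rotated into
  the sum of cosines of \<open>estermann_bound\<close>, and that bound excludes the value
  \<open>- sqrt p\<close> belonging to the wrong sign.\<close>

theorem gauss_tau_prime:
  assumes "prime p" "odd p"
  shows "gauss_tau p = gauss_eps p * of_real (sqrt (real p))"
proof -
  have p2: "p > 2" using assms odd_prime_gt_2 by blast
  then have p0: "p > 0" by simp
  define M where "M = p div 2"
  have pM: "p = 2 * M + 1" "M \<ge> 1" using assms(2) p2 by (auto simp: M_def elim: oddE)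
  \<comment> \<open>An inverse of 2 modulo \<open>p\<close>. This frequency allows the square to be
    completed with odd numbers and changes the Gauss sum only by the known factor
    \<open>(2 | p)\<close>.\<close>
  define c where "c = int (M + 1)"
  have c2: "2 * c = int p + 1" using pM by (simp add: c_def)
  define f where "f x = cis (2 * pi * (real_of_int x * real_of_int c / real p))" for x
  have per: "f x = f y" if "[x = y] (mod int p)" for x y
    unfolding f_def by (rule cis_2pi_cong[OF that p0]) auto
  have "Jacobi (2 * c) p = 1"
    using Jacobi_cong[OF assms(2), of "2 * c" 1] assms(2) by (simp add: c2 cong_iff_dvd_diff)
  then have "Jacobi 2 p * Jacobi c p = 1" by (simp add: Jacobi_mult_left assms)
  then have Jc: "Jacobi c p = Jacobi 2 p"
    using Jacobi_values[OF assms(2), of 2] Jacobi_values[OF assms(2), of c] by auto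
  define W where "W = (\<Sum>r<p. f (int r ^ 2))"
  have "W = (\<Sum>a<p. f (int a)) + (\<Sum>a<p. of_int (Jacobi (int a) p) * f (int a))"
    using sum_squares_mod_prime[of p f, OF assms per] unfolding W_def by (simp add: algebra_simps sum.distrib)
  also have "(\<Sum>a<p. f (int a)) = 0"
  proof -
    have "\<not> int p dvd c" using pM zdvd_not_zless[of c "int p"] by (simp add: c_def)
    then show ?thesis using sum_cis_residues[OF p0, of c] by (simp add: f_def)
  qed
  also have "(\<Sum>a<p. of_int (Jacobi (int a) p) * f (int a)) = of_int (Jacobi 2 p) * gauss_tau p"
    using gauss_sum_prime[OF assms, of c] by (simp add: f_def Jc)
  finally have W1: "W = of_int (Jacobi 2 p) * gauss_tau p" by simp
  define U where "U i = cis (2 * pi * ((2 * real i + 1) ^ 2 / (8 * real p)))" for i :: nat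
  \<comment> \<open>Completing the square: \<open>r^2 * (p + 1) / (2p)\<close> and
    \<open>(p - 2r)^2 / (8p) - p/8\<close> differ by \<open>r * (r + 1) / 2\<close>, which is an
    integer and disappears in the exponential.\<close>
  have fsq: "f (r ^ 2) = cis (- (2 * pi * (real p / 8))) * cis (2 * pi * (real_of_int j ^ 2 / (8 * real p)))"
    if j: "j = int p - 2 * r" for r j
  proof -
    have "even (r * (r + 1))" by simp
    then obtain z where z: "r * (r + 1) = 2 * z" by (rule evenE)
    have zr: "real_of_int z = real_of_int r * (real_of_int r + 1) / 2"
      using arg_cong[OF z, of real_of_int] by simp
    have cr: "real_of_int c = (real p + 1) / 2" using arg_cong[OF c2, of real_of_int] by simp
    have jr: "real_of_int j = real p - 2 * real_of_int r" using j by simp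
    have "real_of_int (r ^ 2) * real_of_int c / real p
        = - (real p / 8) + real_of_int j ^ 2 / (8 * real p) + real_of_int z"
      unfolding cr jr zr using p0 by (simp add: field_simps power2_eq_square)
    then have *: "2 * pi * (real_of_int (r ^ 2) * real_of_int c / real p)
        = - (2 * pi * (real p / 8)) + 2 * pi * (real_of_int j ^ 2 / (8 * real p)) + 2 * pi * real_of_int z"
      by (simp only:) (simp add: algebra_simps)
    show ?thesis
      unfolding f_def * by (simp only: cis_mult[symmetric] cis_multiple_2pi Ints_of_int mult_1_right)
  qed
  \<comment> \<open>Under \<open>j = p - 2r\<close> the residues up to \<open>M\<close> give the
    positive odd \<open>j\<close> and the others the negative ones. As only \<open>j^2\<close>
    matters, the same terms \<open>U i\<close> occur twice, except for \<open>i = M\<close>.\<close>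
  have "W = (\<Sum>r\<in>{..M} \<union> {M + 1..<p}. f (int r ^ 2))"
    unfolding W_def using pM by (intro sum.cong) auto
  also have "\<dots> = (\<Sum>r\<le>M. f (int r ^ 2)) + (\<Sum>r\<in>{M + 1..<p}. f (int r ^ 2))"
    by (rule sum.union_disjoint) auto
  also have "(\<Sum>r\<le>M. f (int r ^ 2)) = (\<Sum>i\<le>M. f (int (M - i) ^ 2))"
    by (rule sum.reindex_bij_witness[of _ "\<lambda>i. M - i" "\<lambda>i. M - i"]) auto
  also have "\<dots> = (\<Sum>i\<le>M. cis (- (2 * pi * (real p / 8))) * U i)"
  proof (intro sum.cong refl)
    fix i assume i: "i \<in> {..M}"
    have "2 * int i + 1 = int p - 2 * int (M - i)" using i pM by auto
    from fsq[OF this] show "f (int (M - i) ^ 2) = cis (- (2 * pi * (real p / 8))) * U i"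
      by (simp add: U_def)
  qed
  also have "(\<Sum>r\<in>{M + 1..<p}. f (int r ^ 2)) = (\<Sum>i<M. f (int (M + 1 + i) ^ 2))"
    by (rule sum.reindex_bij_witness[of _ "\<lambda>i. M + 1 + i" "\<lambda>r. r - (M + 1)"]) (use pM in auto)
  also have "\<dots> = (\<Sum>i<M. cis (- (2 * pi * (real p / 8))) * U i)"
  proof (intro sum.cong refl)
    fix i
    have "- (2 * int i + 1) = int p - 2 * int (M + 1 + i)" using pM by auto
    from fsq[OF this] show "f (int (M + 1 + i) ^ 2) = cis (- (2 * pi * (real p / 8))) * U i"
      by (simp add: U_def power2_eq_square algebra_simps)
  qed
  finally have W2: "W = cis (- (2 * pi * (real p / 8))) * ((\<Sum>i<M. U i) + (\<Sum>i\<le>M. U i))"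
    by (simp only: sum_distrib_left[symmetric] distrib_left add.commute)
  have "cis (2 * pi * (real p / 8)) * cis (- (2 * pi * (real p / 8))) = 1"
    by (simp add: cis_mult)
  then have W3: "cis (2 * pi * (real p / 8)) * W = (\<Sum>i<M. U i) + (\<Sum>i\<le>M. U i)"
    unfolding W2 by (simp only: mult.assoc[symmetric] mult_1)
  have "Re (cis (- (pi / 4)) * U i) = cos (pi * (2 * real i + 1) ^ 2 / (4 * real p) - pi / 4)" for i
  proof -
    have "- (pi / 4) + 2 * pi * ((2 * real i + 1) ^ 2 / (8 * real p)) = pi * (2 * real i + 1) ^ 2 / (4 * real p) - pi / 4"
      by simp
    then show ?thesis unfolding U_def cis_mult by (simp only: cis.sel)
  qed
  then have "Re (cis (- (pi / 4)) * (cis (2 * pi * (real p / 8)) * W)) > - sqrt (real p)"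
    unfolding W3 using estermann_bound[OF pM]
    by (simp only: distrib_left sum_distrib_left plus_complex.sel Re_sum)
  moreover have "- (pi / 4) + 2 * pi * (real p / 8) = pi * (real p - 1) / 4"
    by (simp add: field_simps)
  then have "cis (- (pi / 4)) * (cis (2 * pi * (real p / 8)) * W) = cis (pi * (real p - 1) / 4) * W"
    by (simp only: mult.assoc[symmetric] cis_mult)
  ultimately have pos: "Re (cis (pi * (real p - 1) / 4) * (of_int (Jacobi 2 p) * gauss_tau p)) > - sqrt (real p)"
    by (simp only: W1)
  define q r where "q = p div 8" and "r = p mod 8"
  have pq: "real p = 8 * real q + real r" unfolding q_def r_def by (metis mult_div_mod_eq of_nat_add of_nat_mult of_nat_numeral)
  have "cis (pi * (real p - 1) / 4) = cis (2 * pi * real q) * cis (pi * (real r - 1) / 4)"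
    unfolding cis_mult pq by (simp add: field_simps)
  also have "cis (2 * pi * real q) = 1" by (simp add: cis_multiple_2pi)
  finally have cisr: "cis (pi * (real p - 1) / 4) = cis (pi * (real r - 1) / 4)" by simp
  define w where "w = of_real (sqrt (real p)) * gauss_eps p"
  have "of_real (sqrt (real p)) * of_real (sqrt (real p)) = (of_nat p :: complex)"
    by (simp flip: of_real_mult)
  then have ww: "w * w = gauss_eps p * gauss_eps p * of_nat p"
    by (simp add: w_def mult_ac)
  have "gauss_eps p * gauss_eps p = of_int (Jacobi (-1) p)"
    by (simp add: gauss_eps_def Jacobi_minus_1[OF assms(2)])
  then have "gauss_tau p * gauss_tau p = w * w"
    using gauss_tau_square[OF assms] ww by simp
  then have "(gauss_tau p - w) * (gauss_tau p + w) = 0" by (simp add: algebra_simps)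
  then have tau: "gauss_tau p = w \<or> gauss_tau p = - w" by (auto simp: add_eq_0_iff)
  have r: "r = 1 \<or> r = 3 \<or> r = 5 \<or> r = 7" using assms(2) unfolding r_def by presburger
  have p4: "p mod 4 = r mod 4" unfolding r_def by (simp add: mod_mod_cancel)
  \<comment> \<open>In each of the four classes modulo 8 the rotation, the factor
    \<open>(2 | p)\<close> and \<open>gauss_eps p\<close> combine to 1, so the expected Gauss sum is
    rotated to \<open>+ sqrt p\<close>.\<close>
  have key: "cis (pi * (real p - 1) / 4) * (of_int (Jacobi 2 p) * w) = of_real (sqrt (real p))"
    unfolding cisr Jacobi_2[OF assms(2)] r_def[symmetric] w_def gauss_eps_def p4
  proof -
    have a: "cis (pi * 2 / 4) = \<i>" "cis (pi * 4 / 4) = -1" "cis (pi * 6 / 4) = -\<i>" "cis (3 * pi / 2) = -\<i>"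
    proof -
      show "cis (pi * 2 / 4) = \<i>" by simp
      show "cis (pi * 4 / 4) = -1" by simp
      have "pi * 6 / 4 = pi + pi / 2" by simp
      then show "cis (pi * 6 / 4) = -\<i>" by (simp only: cis_mult[symmetric] cis_pi cis_pi_half) simp
      then show "cis (3 * pi / 2) = -\<i>" by (simp add: mult.commute)
    qed
    from r show "cis (pi * (real r - 1) / 4) * (complex_of_int (if r = 1 \<or> r = 7 then 1 else - 1) *
          (complex_of_real (sqrt (real p)) * (if r mod 4 = 3 then \<i> else 1))) = of_real (sqrt (real p))"
      by (elim disjE) (simp_all add: a complex_eq_iff)
  qed
  have "gauss_tau p \<noteq> - w"
  proof
    assume "gauss_tau p = - w"
    with pos key show False by simp
  qed
  with tau show ?thesis by (simp add: w_def mult.commute)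
qed

section \<open>The self-dual kernel\<close>

text \<open>
  At most one term is nonzero: the one with \<open>d\<^sup>2 = gcd m n\<close>.
\<close>

definition jkernel :: "int \<Rightarrow> nat \<Rightarrow> int" where
  "jkernel m n = (\<Sum>d | d ^ 2 dvd n \<and> int d ^ 2 dvd m. int d * Jacobi (m div int d ^ 2) (n div d ^ 2))"

lemma finite_square_divisors: "n > 0 \<Longrightarrow> finite {d :: nat. d ^ 2 dvd n}"
proof (rule finite_subset[of _ "{..n}"])
  assume "n > 0"
  show "{d. d ^ 2 dvd n} \<subseteq> {..n}"
  proof
    fix d assume "d \<in> {d. d ^ 2 dvd n}"
    then have "d ^ 2 \<le> n" using \<open>n > 0\<close> by (auto intro: dvd_imp_le)
    then show "d \<in> {..n}" using self_le_power[of d 2] by (cases "d = 0") auto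
  qed
qed auto

lemma square_dvd_quotient:
  assumes "d ^ 2 dvd (n :: nat)" "odd n"
  shows "odd (n div d ^ 2)" "odd d" "d > 0"
  using assms by (auto elim!: dvdE simp: odd_pos)

lemma gcd_div_square:
  assumes "d ^ 2 dvd n" "int d ^ 2 dvd m" "d > 0"
  shows "gcd m (int n) = int d ^ 2 * gcd (m div int d ^ 2) (int (n div d ^ 2))"
proof -
  obtain n' m' where n': "n = d ^ 2 * n'" and m': "m = int d ^ 2 * m'" using assms by (auto elim!: dvdE)
  have "gcd (int d ^ 2 * m') (int d ^ 2 * int n') = int d ^ 2 * gcd m' (int n')"
    by (simp add: gcd_mult_distrib_int[symmetric] abs_mult)
  then show ?thesis using assms(3) by (simp add: n' m')
qed

lemma jkernel_term_eq_0:
  assumes "odd n" "d ^ 2 dvd n" "int d ^ 2 dvd m" "gcd m (int n) \<noteq> int d ^ 2"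
  shows "Jacobi (m div int d ^ 2) (n div d ^ 2) = 0"
  using assms gcd_div_square[of d n m] square_dvd_quotient[of d n]
  by (auto simp: Jacobi_eq_0_iff coprime_iff_gcd_eq_1)

lemma jkernel_square:
  assumes "odd n" "gcd m (int n) = int s ^ 2"
  shows "jkernel m n = int s * Jacobi (m div int s ^ 2) (n div s ^ 2)"
proof -
  have dv: "int s ^ 2 dvd m" "int s ^ 2 dvd int n" using assms(2) by (metis gcd_dvd1, metis gcd_dvd2)
  then have dv': "s ^ 2 dvd n" by (metis int_dvd_int_iff of_nat_power)
  have fin: "finite {d. d ^ 2 dvd n \<and> int d ^ 2 dvd m}"
    by (rule finite_subset[OF _ finite_square_divisors[of n]]) (use assms odd_pos in auto)
  have "jkernel m n = (\<Sum>d\<in>{s}. int d * Jacobi (m div int d ^ 2) (n div d ^ 2))"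
    unfolding jkernel_def
  proof (rule sum.mono_neutral_right[OF fin])
    show "\<forall>d\<in>{d. d\<^sup>2 dvd n \<and> (int d)\<^sup>2 dvd m} - {s}. int d * Jacobi (m div (int d)\<^sup>2) (n div d\<^sup>2) = 0"
    proof
      fix d assume d: "d \<in> {d. d\<^sup>2 dvd n \<and> (int d)\<^sup>2 dvd m} - {s}"
      then have "int d ^ 2 \<noteq> int s ^ 2" by (simp add: power2_eq_iff_nonneg)
      then show "int d * Jacobi (m div (int d)\<^sup>2) (n div d\<^sup>2) = 0"
        using d assms jkernel_term_eq_0[of n d m] by simp
    qed
  qed (use dv dv' in auto)
  then show ?thesis by simp
qed

lemma jkernel_nonsquare:
  assumes "odd n" "\<And>s. gcd m (int n) \<noteq> int s ^ 2"
  shows "jkernel m n = 0"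
  unfolding jkernel_def using assms by (auto intro!: sum.neutral simp: jkernel_term_eq_0)

lemma jkernel_cases:
  assumes "odd n"
  obtains (square) s where "gcd m (int n) = int s ^ 2" "odd s" "s > 0" "s ^ 2 dvd n" "int s ^ 2 dvd m"
      "coprime (m div int s ^ 2) (int (n div s ^ 2))" "odd (n div s ^ 2)"
      "jkernel m n = int s * Jacobi (m div int s ^ 2) (n div s ^ 2)"
  | (nonsquare) "\<And>s. gcd m (int n) \<noteq> int s ^ 2" "jkernel m n = 0"
proof (cases "\<exists>s. gcd m (int n) = int s ^ 2")
  case True
  then obtain s where s: "gcd m (int n) = int s ^ 2" by blast
  then have dv: "int s ^ 2 dvd m" "int s ^ 2 dvd int n" by (metis gcd_dvd1, metis gcd_dvd2)
  then have dv': "s ^ 2 dvd n" by (metis int_dvd_int_iff of_nat_power)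
  note o = square_dvd_quotient[OF dv' assms]
  have "coprime (m div int s ^ 2) (int (n div s ^ 2))"
    using gcd_div_square[OF dv' dv(1) o(3)] s o(3) by (simp add: coprime_iff_gcd_eq_1)
  then show ?thesis using square s dv dv' o jkernel_square[OF assms s] by blast
next
  case False
  then show ?thesis using nonsquare jkernel_nonsquare[OF assms] by blast
qed

lemma Jacobi_square_right:
  assumes "odd s" "coprime a (int s)"
  shows "Jacobi a (s ^ 2) = 1"
  using Jacobi_square_eq_1[OF assms] assms(1) by (simp add: power2_eq_square Jacobi_mult_right odd_pos)

lemma Jacobi_square_left:
  assumes "odd n" "coprime a (int n)"
  shows "Jacobi (a ^ 2) n = 1"
  using Jacobi_square_eq_1[OF assms] assms(1) by (simp add: power2_eq_square Jacobi_mult_left)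

lemma jkernel_cong:
  assumes "odd n" "[m = m'] (mod int n)"
  shows "jkernel m n = jkernel m' n"
proof -
  have g: "gcd m (int n) = gcd m' (int n)" using assms(2) by (metis cong_gcd_eq)
  show ?thesis
  proof (cases rule: jkernel_cases[OF assms(1), of m, case_names square nonsquare])
    case (square s)
    have dv: "int s ^ 2 dvd m'" using square(1) g by (metis gcd_dvd1)
    obtain a b where ab: "m = int s ^ 2 * a" "m' = int s ^ 2 * b" using square(5) dv by (auto elim!: dvdE)
    obtain c where c: "n = s ^ 2 * c" using square(4) by auto
    have "int s ^ 2 * int c dvd int s ^ 2 * (a - b)"
      using assms(2) by (simp add: cong_iff_dvd_diff ab c algebra_simps)
    then have "[a = b] (mod int c)" using square(3) by (simp add: cong_iff_dvd_diff)
    then have "Jacobi a c = Jacobi b c" using square(7) square(3) c by (intro Jacobi_cong) auto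
    moreover have "jkernel m' n = int s * Jacobi (m' div int s ^ 2) (n div s ^ 2)"
      using g square(1) by (intro jkernel_square assms(1)) simp
    ultimately show ?thesis using square(3,8) by (simp add: ab c)
  next
    case nonsquare
    then show ?thesis using g jkernel_nonsquare[OF assms(1), of m'] by auto
  qed
qed

text \<open>A unit does not change the gcd, and \<open>(c | s^2) = 1\<close> lets
  \<open>(c | n / s^2)\<close> be written as \<open>(c | n)\<close>.\<close>

lemma jkernel_mult_coprime_left:
  assumes "odd n" "coprime c (int n)"
  shows "jkernel (c * m) n = Jacobi c n * jkernel m n"
proof -
  have g: "gcd (c * m) (int n) = gcd m (int n)"
    using assms(2) by (simp add: gcd_mult_left_left_cancel coprime_commute)
  show ?thesis
  proof (cases rule: jkernel_cases[OF assms(1), of m, case_names square nonsquare])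
    case (square s)
    obtain a where a: "m = int s ^ 2 * a" using square(5) by auto
    obtain b where b: "n = s ^ 2 * b" using square(4) by auto
    have ob: "odd b" using b assms(1) by simp
    have cops: "coprime c (int s)" "coprime c (int b)" using assms(2) b by simp_all
    have "jkernel (c * m) n = int s * Jacobi (c * m div int s ^ 2) (n div s ^ 2)"
      using g square(1) by (intro jkernel_square assms(1)) simp
    also have "\<dots> = int s * Jacobi (c * a) b"
      using square(3) by (simp add: a b)
    also have "\<dots> = Jacobi c (s ^ 2 * b) * (int s * Jacobi a b)"
      using cops square(2,3) ob by (simp add: Jacobi_mult_left Jacobi_mult_right Jacobi_square_right odd_pos)
    finally show ?thesis using square(3,8) by (simp add: a b)
  next
    case nonsquare
    then show ?thesis using g jkernel_nonsquare[OF assms(1), of "c * m"] by auto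
  qed
qed

lemma gcd_mult_coprime_int:
  fixes a b m :: int
  assumes "coprime a b"
  shows "gcd m (a * b) = gcd m a * gcd m b"
proof (rule zdvd_antisym_nonneg)
  show "gcd m (a * b) dvd gcd m a * gcd m b"
  proof -
    obtain x y where xy: "gcd m (a * b) = x * y" "x dvd a" "y dvd b"
      using division_decomp[OF gcd_dvd2[of m "a * b"]] by blast
    moreover have "x dvd m" "y dvd m" using xy(1) gcd_dvd1[of m "a * b"] by (metis dvd_mult_left, metis dvd_mult_right)
    ultimately show ?thesis by (simp add: mult_dvd_mono)
  qed
  show "gcd m a * gcd m b dvd gcd m (a * b)"
    using assms by (intro gcd_greatest divides_mult) (auto intro: mult_dvd_mono coprime_divisors)
qed auto

lemma jkernel_mult_right:
  assumes "odd n" "odd n'" "coprime n n'"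
  shows "jkernel m (n * n') = jkernel m n * jkernel m n'"
proof -
  have on: "odd (n * n')" using assms by simp
  have g: "gcd m (int (n * n')) = gcd m (int n) * gcd m (int n')"
    using gcd_mult_coprime_int[of "int n" "int n'" m] assms(3) by simp
  have copg: "coprime (gcd m (int n)) (gcd m (int n'))"
    using assms(3) by (intro coprime_divisors[OF gcd_dvd2 gcd_dvd2]) simp
  show ?thesis
  proof (cases rule: jkernel_cases[OF assms(1), of m, case_names square nonsquare])
    case s: (square s)
    show ?thesis
    proof (cases rule: jkernel_cases[OF assms(2), of m, case_names square nonsquare])
      case t: (square t)
      have gst: "gcd m (int (n * n')) = int (s * t) ^ 2" using g s t by (simp add: power_mult_distrib)
      have "(int (s * t)) ^ 2 dvd m" by (metis gst gcd_dvd1)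
      then obtain a where a: "m = int s ^ 2 * int t ^ 2 * a" by (auto simp: power_mult_distrib)
      obtain b where b: "n = s ^ 2 * b" using s(4) by auto
      obtain c where c: "n' = t ^ 2 * c" using t(4) by auto
      have obc: "odd b" "odd c" using assms b c by auto
      have cops: "coprime (int t) (int b)" "coprime (int s) (int c)" using assms(3) b c
        by (auto simp: coprime_commute)
      have "jkernel m (n * n') = int (s * t) * Jacobi (m div int (s * t) ^ 2) (n * n' div (s * t) ^ 2)"
        by (rule jkernel_square[OF on gst])
      also have "m div int (s * t) ^ 2 = a" using s(3) t(3) by (simp add: a power_mult_distrib)
      also have "n * n' div (s * t) ^ 2 = b * c" using s(3) t(3)
        by (simp add: b c power_mult_distrib mult_ac flip: mult.assoc[of "s^2" "t^2"])
      also have "Jacobi a (b * c) = Jacobi a b * Jacobi a c" using obc by (simp add: Jacobi_mult_right odd_pos)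
      also have "Jacobi a b = Jacobi (m div int s ^ 2) (n div s ^ 2)"
        using s(3) obc cops by (simp add: a b Jacobi_mult_left Jacobi_square_left mult.assoc)
      also have "Jacobi a c = Jacobi (m div int t ^ 2) (n' div t ^ 2)"
        using t(3) obc cops by (simp add: a c Jacobi_mult_left Jacobi_square_left mult_ac)
      finally show ?thesis using s(8) t(8) by simp
    next
      case nonsquare
      have "gcd m (int (n * n')) \<noteq> int u ^ 2" for u
      proof
        assume "gcd m (int (n * n')) = int u ^ 2"
        then have "nat (gcd m (int n)) * nat (gcd m (int n')) = u ^ 2"
          using g by (metis nat_int nat_mult_distrib gcd_ge_0_int of_nat_power)
        moreover have "coprime (nat (gcd m (int n))) (nat (gcd m (int n')))"
          using copg by (simp flip: coprime_int_iff)
        ultimately have "is_nth_power 2 (nat (gcd m (int n')))"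
          using is_nth_power_mult_coprime_nat_iff[of "nat (gcd m (int n))" "nat (gcd m (int n'))" 2]
          by (metis is_nth_power_nth_power)
        then show False using nonsquare by (metis is_nth_power_def int_nat_eq of_nat_power gcd_ge_0_int)
      qed
      then have "jkernel m (n * n') = 0" by (rule jkernel_nonsquare[OF on])
      then show ?thesis using nonsquare by simp
    qed
  next
    case nonsquare
    have "gcd m (int (n * n')) \<noteq> int u ^ 2" for u
    proof
      assume "gcd m (int (n * n')) = int u ^ 2"
      then have "nat (gcd m (int n)) * nat (gcd m (int n')) = u ^ 2"
        using g by (metis nat_int nat_mult_distrib gcd_ge_0_int of_nat_power)
      moreover have "coprime (nat (gcd m (int n))) (nat (gcd m (int n')))"
        using copg by (simp flip: coprime_int_iff)
      ultimately have "is_nth_power 2 (nat (gcd m (int n)))"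
        using is_nth_power_mult_coprime_nat_iff[of "nat (gcd m (int n))" "nat (gcd m (int n'))" 2]
        by (metis is_nth_power_nth_power)
      then show False using nonsquare by (metis is_nth_power_def int_nat_eq of_nat_power gcd_ge_0_int)
    qed
    then have "jkernel m (n * n') = 0" by (rule jkernel_nonsquare[OF on])
    then show ?thesis using nonsquare by simp
  qed
qed

text \<open>Removing the common square \<open>s^2\<close> reduces this to Jacobi symbols. The sign
  survives the reduction because an odd square is 1 modulo 4.\<close>

lemma jkernel_reciprocity:
  assumes "odd m" "odd n"
  shows "jkernel (int m) n = recip_sign m n * jkernel (int n) m"
proof (cases rule: jkernel_cases[OF assms(2), of "int m", case_names square nonsquare])
  case (square s)
  obtain a where a: "m = s ^ 2 * a" using square(5) by (metis int_dvd_int_iff of_nat_power dvdE)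
  obtain b where b: "n = s ^ 2 * b" using square(4) by auto
  have ob: "odd a" "odd b" using a b assms by simp_all
  have "s mod 4 = 1 \<or> s mod 4 = 3" using square(2) by presburger
  then have s2: "recip_sign (s ^ 2) k = 1" for k
    using mod_4_mult_odd[OF square(2) square(2)] by (auto simp: recip_sign_def power2_eq_square)
  have "recip_sign m n = recip_sign (s ^ 2) n * recip_sign a n"
    unfolding a using square(2) ob by (intro recip_sign_mult_left) auto
  also have "recip_sign a n = recip_sign (s ^ 2) a * recip_sign b a"
    unfolding b recip_sign_commute[of a] using square(2) ob by (intro recip_sign_mult_left) auto
  finally have "recip_sign m n = recip_sign a b" by (simp only: s2 mult_1 recip_sign_commute[of b a])
  moreover have "gcd (int n) (int m) = int s ^ 2" using square(1) by (simp add: gcd.commute)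
  then have "jkernel (int n) m = int s * Jacobi (int n div int s ^ 2) (m div s ^ 2)"
    by (rule jkernel_square[OF assms(1)])
  moreover have "int n div int s ^ 2 = int b" "int m div int s ^ 2 = int a" "m div s ^ 2 = a" "n div s ^ 2 = b"
    using square(3) by (simp_all add: a b)
  ultimately show ?thesis using Jacobi_reciprocity[OF ob] square(8) by simp
next
  case nonsquare
  then show ?thesis using jkernel_nonsquare[OF assms(1), of "int n"] by (simp add: gcd.commute)
qed

lemma jkernel_1 [simp]: "jkernel m (Suc 0) = 1"
  using jkernel_square[of 1 m 1] by simp

text \<open>Crude for a single \<open>m\<close>, but the divisibility conditions remain visible: a
  later sum over \<open>m\<close> gains \<open>1 / d^2\<close> from \<open>d^2 | m\<close>, which
  outweighs the factor \<open>d\<close>.\<close>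

lemma abs_jkernel_le:
  assumes "odd n"
  shows "\<bar>jkernel m n\<bar> \<le> (\<Sum>d | d ^ 2 dvd n \<and> int d ^ 2 dvd m. int d)"
proof -
  have "\<bar>jkernel m n\<bar> \<le> (\<Sum>d | d ^ 2 dvd n \<and> int d ^ 2 dvd m. \<bar>int d * Jacobi (m div int d ^ 2) (n div d ^ 2)\<bar>)"
    unfolding jkernel_def by (rule sum_abs)
  also have "\<dots> \<le> (\<Sum>d | d ^ 2 dvd n \<and> int d ^ 2 dvd m. int d)"
  proof (rule sum_mono)
    fix d assume "d \<in> {d. d\<^sup>2 dvd n \<and> (int d)\<^sup>2 dvd m}"
    then have "odd (n div d ^ 2)" using square_dvd_quotient assms by blast
    then show "\<bar>int d * Jacobi (m div int d ^ 2) (n div d ^ 2)\<bar> \<le> int d"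
      using Jacobi_values[of "n div d ^ 2" "m div int d ^ 2"] by (auto simp: abs_mult)
  qed
  finally show ?thesis .
qed

section \<open>Self-duality of the kernel under the Fourier transform\<close>

definition fourier_jkernel :: "nat \<Rightarrow> int \<Rightarrow> complex" where
  "fourier_jkernel n k = (\<Sum>m<n. of_int (jkernel (int m) n) * cis (2 * pi * (real m * real_of_int k / real n)))"

definition self_dual :: "nat \<Rightarrow> bool" where
  "self_dual n \<longleftrightarrow> (\<forall>k. fourier_jkernel n k = gauss_eps n * of_real (sqrt (real n)) * of_int (jkernel k n))"

lemma gauss_eps_mult:
  assumes "odd m" "odd n"
  shows "gauss_eps (m * n) = gauss_eps m * gauss_eps n * of_int (recip_sign m n)"
  using mod_4_mult_odd[OF assms] by (auto simp: gauss_eps_def recip_sign_def)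

text \<open>Chinese remainder theorem in the form \<open>m = i * n' + j * n\<close>. The twists
  \<open>(n' | n)\<close> and \<open>(n | n')\<close> multiply to the sign of reciprocity, which is
  precisely the factor by which \<open>gauss_eps\<close> fails to be multiplicative.\<close>

lemma self_dual_mult:
  assumes o: "odd n" "odd n'" and cop: "coprime n n'" and sd: "self_dual n" "self_dual n'"
  shows "self_dual (n * n')"
  unfolding self_dual_def
proof
  fix k
  define N where "N = n * n'"
  have pos: "n > 0" "n' > 0" "N > 0" and oN: "odd N" using o by (auto simp: odd_pos N_def)
  define f where "f x = of_int (jkernel x N) * cis (2 * pi * (real_of_int x * real_of_int k / real N))" for x
  define E where "E n m = of_int (jkernel (int m) n) * cis (2 * pi * (real m * real_of_int k / real n))" for n m
  have per: "f x = f y" if "[x = y] (mod int N)" for x y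
    unfolding f_def using jkernel_cong[OF oN that] cis_2pi_cong[OF that pos(3), of "real_of_int k"] by simp
  define h where "h = (\<lambda>(i, j). int i * int n' + int j * int n)"
  have inj: "a = b" if "a \<in> {..<n} \<times> {..<n'}" "b \<in> {..<n} \<times> {..<n'}" "[h a = h b] (mod int N)" for a b
  proof -
    obtain i j i' j' where ab: "a = (i, j)" "b = (i', j')" by (cases a, cases b) auto
    have dv: "int n * int n' dvd (int i - int i') * int n' + (int j - int j') * int n"
      using that(3) by (simp add: h_def ab cong_iff_dvd_diff N_def algebra_simps)
    have "int n dvd (int i - int i') * int n'"
      using dvd_mult_left[OF dv] by (simp add: dvd_add_left_iff)
    then have "int n dvd int i - int i'" using cop by (simp add: coprime_dvd_mult_left_iff)
    then have "[i = i'] (mod n)" by (simp add: cong_iff_dvd_diff flip: cong_int_iff)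
    moreover have "int n' dvd (int j - int j') * int n"
      using dvd_mult_right[OF dv] by (simp add: dvd_add_right_iff)
    then have "int n' dvd int j - int j'" using cop by (simp add: coprime_dvd_mult_left_iff coprime_commute)
    then have "[j = j'] (mod n')" by (simp add: cong_iff_dvd_diff flip: cong_int_iff)
    ultimately show ?thesis using that ab by (auto simp: cong_less_modulus_unique_nat)
  qed
  have fh: "f (h (i, j)) = of_int (Jacobi (int n') n) * of_int (Jacobi (int n) n') * (E n i * E n' j)" for i j
  proof -
    define x where "x = h (i, j)"
    have "jkernel x n = jkernel (int n' * int i) n"
      by (rule jkernel_cong) (use o in \<open>auto simp: x_def h_def cong_iff_dvd_diff\<close>)
    also have "\<dots> = Jacobi (int n') n * jkernel (int i) n"
      using o cop by (intro jkernel_mult_coprime_left) (auto simp: coprime_commute)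
    finally have 1: "jkernel x n = Jacobi (int n') n * jkernel (int i) n" .
    have "jkernel x n' = jkernel (int n * int j) n'"
      by (rule jkernel_cong) (use o in \<open>auto simp: x_def h_def cong_iff_dvd_diff\<close>)
    also have "\<dots> = Jacobi (int n) n' * jkernel (int j) n'"
      using o cop by (intro jkernel_mult_coprime_left) auto
    finally have 2: "jkernel x n' = Jacobi (int n) n' * jkernel (int j) n'" .
    have "2 * pi * (real_of_int x * real_of_int k / real N)
       = 2 * pi * (real i * real_of_int k / real n) + 2 * pi * (real j * real_of_int k / real n')"
      using pos by (simp add: x_def h_def N_def field_simps)
    then show ?thesis
      unfolding x_def[symmetric] f_def E_def
      by (simp add: N_def jkernel_mult_right[OF o cop] 1 2 cis_mult[symmetric])
  qed
  have "fourier_jkernel N k = (\<Sum>m<N. f (int m))"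
    by (simp add: fourier_jkernel_def f_def)
  also have "\<dots> = (\<Sum>a\<in>{..<n} \<times> {..<n'}. f (h a))"
    by (rule sum_over_residues[OF per inj, symmetric]) (use pos in \<open>auto simp: N_def\<close>)
  also have "\<dots> = (\<Sum>i<n. \<Sum>j<n'. f (h (i, j)))"
    by (simp add: sum.cartesian_product)
  also have "\<dots> = of_int (Jacobi (int n') n) * of_int (Jacobi (int n) n') * (fourier_jkernel n k * fourier_jkernel n' k)"
    unfolding fh fourier_jkernel_def E_def[symmetric] sum_product by (simp add: sum_distrib_left)
  also have "(of_int (Jacobi (int n') n) * of_int (Jacobi (int n) n') :: complex) = of_int (recip_sign n n')"
  proof -
    have "Jacobi (int n) n' * Jacobi (int n) n' = 1" using o cop by (intro Jacobi_square_eq_1) auto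
    then have "Jacobi (int n') n * Jacobi (int n) n' = recip_sign n n'"
      using Jacobi_reciprocity[OF o(2,1)] by (simp add: recip_sign_commute mult.assoc)
    then show ?thesis by (metis of_int_mult)
  qed
  also have "fourier_jkernel n k = gauss_eps n * of_real (sqrt (real n)) * of_int (jkernel k n)"
    using sd by (simp add: self_dual_def)
  also have "fourier_jkernel n' k = gauss_eps n' * of_real (sqrt (real n')) * of_int (jkernel k n')"
    using sd by (simp add: self_dual_def)
  finally show "fourier_jkernel (n * n') k = gauss_eps (n * n') * of_real (sqrt (real (n * n'))) * of_int (jkernel k (n * n'))"
    by (simp add: N_def gauss_eps_mult[OF o] jkernel_mult_right[OF o cop] real_sqrt_mult)
qed

text \<open>Both gcd and cofactors scale so that the Jacobi symbol stays the same; only the weight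
  changes.\<close>

lemma jkernel_scale_square:
  assumes "odd n" "odd s"
  shows "jkernel (int s ^ 2 * m) (s ^ 2 * n) = int s * jkernel m n"
proof -
  have o: "odd (s ^ 2 * n)" and s0: "s > 0" using assms by (auto simp: odd_pos)
  have g: "gcd (int s ^ 2 * m) (int (s ^ 2 * n)) = int s ^ 2 * gcd m (int n)"
    by (simp add: gcd_mult_distrib_int[symmetric] abs_mult)
  show ?thesis
  proof (cases rule: jkernel_cases[OF assms(1), of m, case_names square nonsquare])
    case (square t)
    have "gcd (int s ^ 2 * m) (int (s ^ 2 * n)) = int (s * t) ^ 2"
      using g square(1) by (simp add: power_mult_distrib)
    from jkernel_square[OF o this]
    have "jkernel (int s ^ 2 * m) (s ^ 2 * n)
       = int (s * t) * Jacobi (int s ^ 2 * m div int (s * t) ^ 2) (s ^ 2 * n div (s * t) ^ 2)" .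
    also have "int s ^ 2 * m div int (s * t) ^ 2 = m div int t ^ 2" using s0 by (simp add: power_mult_distrib)
    also have "s ^ 2 * n div (s * t) ^ 2 = n div t ^ 2" using s0 by (simp add: power_mult_distrib)
    finally show ?thesis using square(8) by simp
  next
    case nonsquare
    have "gcd (int s ^ 2 * m) (int (s ^ 2 * n)) \<noteq> int u ^ 2" for u
    proof
      assume u: "gcd (int s ^ 2 * m) (int (s ^ 2 * n)) = int u ^ 2"
      then have "int s ^ 2 dvd int u ^ 2" using g by (metis dvd_triv_left)
      then have "int s dvd int u" by simp
      then obtain v where v: "u = s * v" by auto
      have "gcd m (int n) = int v ^ 2" using u g s0 by (simp add: v power_mult_distrib)
      then show False using nonsquare(1) by blast
    qed
    then show ?thesis using jkernel_nonsquare[OF o] nonsquare(2) by simp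
  qed
qed

lemma prime_neq_square: "prime p \<Longrightarrow> int p \<noteq> int s ^ 2"
proof
  assume "prime p" "int p = int s ^ 2"
  then have "p = s * s" by (metis of_nat_eq_iff of_nat_power power2_eq_square)
  then show False using \<open>prime p\<close> by (metis prime_product mult_1 not_prime_1)
qed

lemma jkernel_coprime:
  assumes "odd n" "coprime m (int n)"
  shows "jkernel m n = Jacobi m n"
  using jkernel_square[OF assms(1), of m 1] assms(2) by simp

lemma jkernel_prime:
  assumes "prime p" "odd p"
  shows "jkernel m p = Jacobi m p"
proof (cases "coprime m (int p)")
  case False
  then have "int p dvd m" using assms(1) by (metis coprime_commute prime_imp_coprime prime_nat_int_transfer)
  then have "gcd m (int p) = int p" by (simp add: gcd_proj2_iff)
  then have "jkernel m p = 0" using prime_neq_square[OF assms(1)] by (intro jkernel_nonsquare assms) auto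
  then show ?thesis using False assms by (simp add: Jacobi_eq_0_iff)
qed (use assms jkernel_coprime in auto)

text \<open>As the modulus is divisible by \<open>p^2\<close> and the first argument by
  \<open>p\<close> exactly once, the gcd is \<open>p\<close>, which is not a square.\<close>

lemma jkernel_prime_exact:
  assumes "prime p" "odd p" "\<not> int p dvd x"
  shows "jkernel (int p * x) (p ^ (a + 2)) = 0"
proof (rule jkernel_nonsquare)
  have "coprime x (int p)" using assms by (metis coprime_commute prime_imp_coprime prime_nat_int_transfer)
  then have "coprime x (int p ^ (a + 1))" by simp
  then have "gcd x (int p ^ (a + 1)) = 1" by (simp only: coprime_iff_gcd_eq_1)
  moreover have "gcd (int p * x) (int p * int p ^ (a + 1)) = int p * gcd x (int p ^ (a + 1))"
    by (simp only: gcd_mult_distrib_int[symmetric] abs_of_nat)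
  moreover have "int (p ^ (a + 2)) = int p * int p ^ (a + 1)" by simp
  ultimately show "gcd (int p * x) (int (p ^ (a + 2))) \<noteq> int s ^ 2" for s
    using prime_neq_square[OF assms(1)] by (simp only: mult_1_right not_False_eq_True)
qed (use assms in auto)

text \<open>After \<open>m = a + p * b\<close> the sum over \<open>b\<close> is a complete
  exponential sum modulo \<open>M\<close>, so only frequencies divisible by \<open>M\<close>
  survive.\<close>

lemma sum_periodic_cis:
  fixes h :: "int \<Rightarrow> complex"
  assumes per: "\<And>x y. [x = y] (mod int p) \<Longrightarrow> h x = h y" and p: "p > 0" and M: "M > 0"
  shows "(\<Sum>m<p * M. h (int m) * cis (2 * pi * (real m * real_of_int k / real (p * M))))
    = (if int M dvd k then of_nat M * (\<Sum>a<p. h (int a) * cis (2 * pi * (real a * real_of_int (k div int M) / real p))) else 0)"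
proof -
  define f where "f x = h x * cis (2 * pi * (real_of_int x * real_of_int k / real (p * M)))" for x
  have perf: "f x = f y" if "[x = y] (mod int (p * M))" for x y
  proof -
    have "[x = y] (mod int p)" using that by (simp add: cong_modulus_mult)
    then show ?thesis unfolding f_def using per cis_2pi_cong[OF that, of "real_of_int k"] p M by simp
  qed
  define g where "g = (\<lambda>(a, b). int a + int p * int b)"
  have inj: "x = y" if "x \<in> {..<p} \<times> {..<M}" "y \<in> {..<p} \<times> {..<M}" "[g x = g y] (mod int (p * M))" for x y
  proof -
    obtain a b a' b' where xy: "x = (a, b)" "y = (a', b')" by (cases x, cases y) auto
    have ineq: "a + p * b < p * M" if "a < p" "b < M" for a b
    proof -
      have "a + p * b < p * Suc b" using that by simp
      also have "\<dots> \<le> p * M" using that by (intro mult_left_mono) auto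
      finally show ?thesis .
    qed
    have "[a + p * b = a' + p * b'] (mod p * M)"
      using that(3) by (simp add: g_def xy flip: cong_int_iff)
    then have eq: "a + p * b = a' + p * b'"
      using that xy ineq by (auto intro: cong_less_modulus_unique_nat)
    have "(a + p * b) mod p = (a' + p * b') mod p" "(a + p * b) div p = (a' + p * b') div p" using eq by simp_all
    then show ?thesis using that xy p by auto
  qed
  have "(\<Sum>m<p * M. h (int m) * cis (2 * pi * (real m * real_of_int k / real (p * M)))) = (\<Sum>m<p * M. f (int m))"
    by (simp add: f_def)
  also have "\<dots> = (\<Sum>x\<in>{..<p} \<times> {..<M}. f (g x))"
    by (rule sum_over_residues[OF perf inj, symmetric]) (use p M in auto)
  also have "\<dots> = (\<Sum>a<p. \<Sum>b<M. f (g (a, b)))" by (simp add: sum.cartesian_product)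
  also have "\<dots> = (\<Sum>a<p. h (int a) * cis (2 * pi * (real a * real_of_int k / real (p * M))) *
        (\<Sum>b<M. cis (2 * pi * (real b * real_of_int k / real M))))"
  proof (intro sum.cong refl)
    fix a
    have "f (g (a, b)) = h (int a) * cis (2 * pi * (real a * real_of_int k / real (p * M))) *
        cis (2 * pi * (real b * real_of_int k / real M))" for b
    proof -
      have "h (g (a, b)) = h (int a)" by (rule per) (simp add: g_def cong_iff_dvd_diff)
      moreover have "2 * pi * (real_of_int (g (a, b)) * real_of_int k / real (p * M))
        = 2 * pi * (real a * real_of_int k / real (p * M)) + 2 * pi * (real b * real_of_int k / real M)"
        using p M by (simp add: g_def field_simps)
      ultimately show ?thesis by (simp only: f_def cis_mult[symmetric] mult.assoc)
    qed
    then show "(\<Sum>b<M. f (g (a, b))) = h (int a) * cis (2 * pi * (real a * real_of_int k / real (p * M))) *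
        (\<Sum>b<M. cis (2 * pi * (real b * real_of_int k / real M)))" by (simp add: sum_distrib_left)
  qed
  also have "\<dots> = (if int M dvd k then of_nat M * (\<Sum>a<p. h (int a) * cis (2 * pi * (real a * real_of_int (k div int M) / real p))) else 0)"
  proof (cases "int M dvd k")
    case True
    then obtain z where z: "k = int M * z" by auto
    have "real a * real_of_int k / real (p * M) = real a * real_of_int (k div int M) / real p" for a
      using M by (simp add: z)
    then show ?thesis using True sum_cis_residues[OF M, of k]
      by (simp add: sum_distrib_left mult_ac del: of_nat_mult)
  qed (use sum_cis_residues[OF M, of k] in simp)
  finally show ?thesis .
qed

lemma Jacobi_power_right:
  assumes "odd p"
  shows "Jacobi a (p ^ i) = Jacobi a p ^ i"
  using assms by (induction i) (simp_all add: Jacobi_mult_right odd_pos)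

text \<open>
  Split off the residues divisible by \<open>p\<^sup>2\<close>: they contribute \<open>p\<close> times the transform modulo \<open>p^a\<close>, and
  the remaining part of the kernel has period \<open>p\<close>.
\<close>

lemma self_dual_prime_power_step:
  assumes p: "prime p" "odd p" and sd: "self_dual (p ^ a)"
  shows "self_dual (p ^ (a + 2))"
  unfolding self_dual_def
proof
  fix k
  define n N M where "n = p ^ a" and "N = p ^ (a + 2)" and "M = p ^ (a + 1)"
  have p0: "p > 0" using p by (simp add: prime_gt_0_nat)
  have pp: "prime (int p)" using p by simp
  have NM: "N = p * M" "N = p ^ 2 * n" and pos: "n > 0" "N > 0" "M > 0" and o: "odd n" "odd N" "odd M"
    using p0 p by (auto simp: n_def N_def M_def power2_eq_square)
  define e where "e m = cis (2 * pi * (real m * real_of_int k / real N))" for m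
  \<comment> \<open>The part of the kernel on residues prime to \<open>p\<close>, where
    \<open>(x | p)^(a+2) = (x | p)^a\<close>. The explicit 0 for \<open>p | x\<close> matters when
    \<open>a = 0\<close>, since the zeroth power of 0 is 1.\<close>
  define h where "h x = (if int p dvd x then 0 else of_int (Jacobi x p) ^ a :: complex)" for x
  have perh: "h x = h y" if "[x = y] (mod int p)" for x y
    using Jacobi_cong[OF p(2) that] that by (simp add: h_def cong_dvd_iff)
  have split: "of_int (jkernel (int m) N) = h (int m) + (if p ^ 2 dvd m then of_int (int p * jkernel (int (m div p ^ 2)) n) else 0 :: complex)" for m
  proof (cases "p dvd m")
    case False
    then have cop: "coprime (int m) (int p)" using pp by (metis coprime_commute int_dvd_int_iff prime_imp_coprime)
    then have "coprime (int m) (int N)" by (simp add: N_def)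
    then have "jkernel (int m) N = Jacobi (int m) N" by (rule jkernel_coprime[OF o(2)])
    also have "\<dots> = Jacobi (int m) p ^ (a + 2)" unfolding N_def by (rule Jacobi_power_right[OF p(2)])
    also have "\<dots> = Jacobi (int m) p ^ a"
      using Jacobi_square_eq_1[OF p(2) cop] by (simp add: power_add power2_eq_square)
    finally show ?thesis using False by (auto simp: h_def power2_eq_square dest: dvd_mult_left)
  next
    case True
    then obtain x where x: "m = p * x" by auto
    show ?thesis
    proof (cases "p dvd x")
      case True
      then obtain y where y: "x = p * y" by auto
      have m: "m = p ^ 2 * y" by (simp add: x y power2_eq_square)
      have "jkernel (int m) N = int p * jkernel (int y) n"
        using jkernel_scale_square[OF o(1) p(2), of "int y"] by (simp add: NM(2) m)
      then show ?thesis using p0 by (simp add: h_def m)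
    next
      case False
      then have "\<not> p ^ 2 dvd m" using p0 by (simp add: x power2_eq_square)
      moreover have "jkernel (int m) N = 0"
        using jkernel_prime_exact[OF p, of "int x" a] False by (simp add: N_def x)
      ultimately show ?thesis using True by (simp add: h_def)
    qed
  qed
  have "fourier_jkernel N k = (\<Sum>m<N. h (int m) * e m) + (\<Sum>m<N. if p ^ 2 dvd m then of_int (int p * jkernel (int (m div p ^ 2)) n) * e m else 0)"
    unfolding fourier_jkernel_def e_def[symmetric] split distrib_right sum.distrib
    by (intro arg_cong2[where f = "(+)"] refl sum.cong) auto
  also have "(\<Sum>m<N. if p ^ 2 dvd m then of_int (int p * jkernel (int (m div p ^ 2)) n) * e m else 0)
     = (\<Sum>m\<in>{m\<in>{..<N}. p ^ 2 dvd m}. of_int (int p * jkernel (int (m div p ^ 2)) n) * e m)"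
    by (rule sum.inter_filter[symmetric]) auto
  also have "\<dots> = (\<Sum>m<n. of_int (int p * jkernel (int m) n) * e (p ^ 2 * m))"
    by (rule sum.reindex_bij_witness[of _ "\<lambda>m. p ^ 2 * m" "\<lambda>m. m div p ^ 2"])
       (use p0 in \<open>auto simp: NM(2) elim!: dvdE\<close>)
  also have "\<dots> = of_nat p * fourier_jkernel n k"
    using p0 by (simp add: fourier_jkernel_def sum_distrib_left e_def NM(2) mult.assoc)
  also have "fourier_jkernel n k = gauss_eps n * of_real (sqrt (real n)) * of_int (jkernel k n)"
    using sd by (simp add: self_dual_def n_def)
  finally have T: "fourier_jkernel N k = (\<Sum>m<N. h (int m) * e m) + of_nat p * (gauss_eps n * of_real (sqrt (real n)) * of_int (jkernel k n))" .
  have epsN: "gauss_eps N = gauss_eps n"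
  proof -
    have "recip_sign (p ^ 2) n = 1" "gauss_eps (p ^ 2) = 1"
      using mod_4_mult_odd[OF p(2) p(2)] by (auto simp: recip_sign_def gauss_eps_def power2_eq_square)
    then show ?thesis using gauss_eps_mult[of "p ^ 2" n] p o by (simp add: NM(2))
  qed
  have sqrtN: "sqrt (real N) = real p * sqrt (real n)" by (simp add: NM(2) real_sqrt_mult)
  have sumh: "(\<Sum>m<N. h (int m) * e m) = (if int M dvd k then of_nat M *
      (\<Sum>b<p. h (int b) * cis (2 * pi * (real b * real_of_int (k div int M) / real p))) else 0)"
    unfolding e_def NM(1) by (rule sum_periodic_cis[OF perh p0 pos(3)])
  have "fourier_jkernel N k = gauss_eps N * of_real (sqrt (real N)) * of_int (jkernel k N)"
  proof (cases "int M dvd k")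
    case False
    \<comment> \<open>\<open>gcd k N\<close> is a power of \<open>p\<close> not divisible by
      \<open>p^(a+1)\<close>, so it divides \<open>p^a\<close> already. Hence the kernels modulo
      \<open>N\<close> and \<open>n\<close> agree at \<open>k\<close>, and the periodic part
      contributes nothing.\<close>
    have g: "gcd k (int N) = gcd k (int n)"
    proof (rule zdvd_antisym_nonneg)
      have "nat (gcd k (int N)) dvd p ^ (a + 2)"
        by (metis N_def gcd_dvd2 gcd_ge_0_int int_dvd_int_iff nat_0_le)
      then obtain i where i: "i \<le> a + 2" "nat (gcd k (int N)) = p ^ i"
        using p(1) divides_primepow_nat by blast
      then have gi: "gcd k (int N) = int (p ^ i)" by (metis gcd_ge_0_int int_nat_eq)
      have "i \<le> a"
      proof (rule ccontr)
        assume "\<not> i \<le> a"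
        then have "M dvd p ^ i" unfolding M_def by (intro le_imp_power_dvd) simp
        then have "int M dvd k" using gi by (metis dvd_trans gcd_dvd1 int_dvd_int_iff)
        with False show False by simp
      qed
      then have "p ^ i dvd n" by (simp add: n_def le_imp_power_dvd)
      then have "int (p ^ i) dvd int n" by (simp only: int_dvd_int_iff)
      then show "gcd k (int N) dvd gcd k (int n)" using gi by (metis gcd_dvd1 gcd_greatest)
      show "gcd k (int n) dvd gcd k (int N)"
        by (intro gcd_mono) (auto simp: NM(2))
    qed auto
    have "jkernel k N = jkernel k n"
    proof (cases rule: jkernel_cases[OF o(2), of k, case_names square nonsquare])
      case (square s)
      have "int s ^ 2 dvd int n" using square(1) g by (metis gcd_dvd2)
      then have "s ^ 2 dvd n" by (metis int_dvd_int_iff of_nat_power)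
      then obtain b where b: "n = s ^ 2 * b" by auto
      have Nb: "N div s ^ 2 = p ^ 2 * b" using square(3) by (simp add: NM(2) b)
      have cop: "coprime (k div int s ^ 2) (int p)" using square(6) by (simp add: Nb)
      have "Jacobi (k div int s ^ 2) (p ^ 2 * b) = Jacobi (k div int s ^ 2) b"
        using o b p0 Jacobi_square_right[OF p(2) cop] by (simp add: Jacobi_mult_right odd_pos)
      moreover have "jkernel k n = int s * Jacobi (k div int s ^ 2) (n div s ^ 2)"
        using g square(1) by (intro jkernel_square o) simp
      ultimately show ?thesis using square(3,8) by (simp add: Nb) (simp add: b)
    next
      case nonsquare
      then show ?thesis using g jkernel_nonsquare[OF o(1), of k] by simp
    qed
    then show ?thesis using False T sumh by (simp add: epsN sqrtN)
  next
    case True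
    then obtain z where z: "k = int M * z" by auto
    have kM: "k div int M = z" using pos by (simp add: z)
    \<comment> \<open>For even \<open>a\<close> the function \<open>h\<close> is the trivial
      character modulo \<open>p\<close>, with transform \<open>p - 1\<close> or \<open>-1\<close>;
      the contribution of the multiples of \<open>p^2\<close> cancels the \<open>-1\<close>. For odd
      \<open>a\<close> that contribution vanishes and a genuine Gauss sum modulo \<open>p\<close>
      remains.\<close>
    show ?thesis
    proof (cases "even a")
      case True
      then obtain t where t: "a = 2 * t" by auto
      have n2: "n = (p ^ t) ^ 2 * 1" and M2: "M = (p ^ t) ^ 2 * p" and N2: "N = (p ^ t) ^ 2 * p ^ 2"
        by (simp_all add: n_def M_def N_def t power_mult power2_eq_square[of p] power_mult_distrib mult_ac)
      have j1: "jkernel k n = int p ^ t"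
        using jkernel_scale_square[of 1 "p ^ t" "int p * z"] p
        by (simp add: n2 z M2 mult.assoc)
      have "jkernel (int p * z) (p ^ 2) = (if int p dvd z then int p else 0)"
      proof (cases "int p dvd z")
        case True
        then obtain y where "z = int p * y" by auto
        then show ?thesis using jkernel_scale_square[of 1 p y] p by (simp add: power2_eq_square mult.assoc)
      qed (use jkernel_prime_exact[OF p, of z 0] in \<open>simp add: power2_eq_square\<close>)
      then have j2: "jkernel k N = (if int p dvd z then int p ^ (t + 1) else 0)"
        using jkernel_scale_square[of "p ^ 2" "p ^ t" "int p * z"] p
        by (simp add: N2 z M2 mult.assoc)
      have h1: "h (int b) = (if b = 0 then 0 else 1)" if "b < p" for b
      proof (cases "b = 0")
        case False
        then have "\<not> p dvd b" using that by (auto dest: dvd_imp_le)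
        moreover from this have "coprime (int b) (int p)" using pp by (metis coprime_commute int_dvd_int_iff prime_imp_coprime)
        then have "of_int (Jacobi (int b) p) * of_int (Jacobi (int b) p) = (1 :: complex)"
          using Jacobi_square_eq_1[OF p(2)] by (metis of_int_1 of_int_mult)
        ultimately show ?thesis using False by (simp add: h_def t power_mult power2_eq_square)
      qed (simp add: h_def)
      have "(\<Sum>b<p. h (int b) * cis (2 * pi * (real b * real_of_int z / real p)))
          = (\<Sum>b<p. cis (2 * pi * (real b * real_of_int z / real p)) - (if b = 0 then 1 else 0))"
        by (intro sum.cong refl) (auto simp: h1)
      also have "\<dots> = (if int p dvd z then of_nat p else 0) - 1"
        using p0 sum_cis_residues[OF p0, of z] by (simp add: sum_subtractf split: if_splits)
      finally have hs: "(\<Sum>b<p. h (int b) * cis (2 * pi * (real b * real_of_int z / real p)))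
          = (if int p dvd z then of_nat p else 0) - 1" .
      have sq: "sqrt (real n) = real p ^ t" by (simp add: n2)
      have "odd (p ^ t)" using p by simp
      then have "n mod 4 \<noteq> 3" using mod_4_mult_odd[of "p ^ t" "p ^ t"] by (simp add: n2 power2_eq_square)
      then have eps1: "gauss_eps n = 1" by (simp add: gauss_eps_def)
      show ?thesis unfolding T sumh kM hs j1 j2 epsN sqrtN sq eps1
        using True z by (simp add: M2 power2_eq_square algebra_simps)
    next
      case False
      then obtain t where t: "a = 2 * t + 1" by (auto elim: oddE)
      have n2: "n = (p ^ t) ^ 2 * p" and M2: "M = (p ^ (t + 1)) ^ 2" and N2: "N = (p ^ (t + 1)) ^ 2 * p"
        by (simp_all add: n_def M_def N_def t power_mult power2_eq_square[of p] power_mult_distrib mult_ac)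
      have "jkernel k n = int (p ^ t) * jkernel (int p * (int p * z)) p"
        using jkernel_scale_square[of p "p ^ t" "int p * (int p * z)"] p
        by (simp add: n2 z M2 power2_eq_square mult_ac)
      also have "jkernel (int p * (int p * z)) p = 0"
        using p prime_gt_1_nat[OF p(1)] by (simp add: jkernel_prime Jacobi_eq_0_iff)
      finally have j1: "jkernel k n = 0" by simp
      have j2: "jkernel k N = int (p ^ (t + 1)) * Jacobi z p"
        using jkernel_scale_square[of p "p ^ (t + 1)" z] p by (simp add: N2 z M2 jkernel_prime)
      have h1: "h x = of_int (Jacobi x p)" for x
      proof (cases "int p dvd x")
        case True
        then have "\<not> coprime x (int p)" using pp by (metis coprime_common_divisor dvd_refl not_prime_unit)
        then show ?thesis using True p by (simp add: h_def Jacobi_eq_0_iff)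
      next
        case False
        then have "coprime x (int p)" using pp by (metis coprime_commute prime_imp_coprime)
        then have "of_int (Jacobi x p) * of_int (Jacobi x p) = (1 :: complex)"
          using Jacobi_square_eq_1[OF p(2)] by (metis of_int_1 of_int_mult)
        then show ?thesis using False by (simp add: h_def t power_mult power2_eq_square)
      qed
      have hs: "(\<Sum>b<p. h (int b) * cis (2 * pi * (real b * real_of_int z / real p)))
          = of_int (Jacobi z p) * (gauss_eps p * of_real (sqrt (real p)))"
        unfolding h1 using gauss_sum_prime[OF p, of z] by (simp add: gauss_tau_prime[OF p])
      have sq: "sqrt (real n) = real p ^ t * sqrt (real p)" by (simp add: n2 real_sqrt_mult)
      have eps1: "gauss_eps n = gauss_eps p"
      proof -
        have "odd (p ^ t)" using p by simp
        then have "n mod 4 = 3 \<longleftrightarrow> p mod 4 = 3"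
          using mod_4_mult_odd[of "p ^ t" "p ^ t"] mod_4_mult_odd[of "(p ^ t) ^ 2" p] p by (simp add: n2 power2_eq_square)
        then show ?thesis by (simp add: gauss_eps_def)
      qed
      show ?thesis unfolding T sumh kM hs j1 j2 epsN sqrtN sq eps1
        using True z by (simp add: M2 power2_eq_square algebra_simps)
    qed
  qed
  then show "fourier_jkernel (p ^ (a + 2)) k = gauss_eps (p ^ (a + 2)) * of_real (sqrt (real (p ^ (a + 2)))) * of_int (jkernel k (p ^ (a + 2)))"
    by (simp only: N_def)
qed

lemma self_dual_prime_power:
  assumes p: "prime p" "odd p"
  shows "self_dual (p ^ a)"
proof (induction a rule: less_induct)
  case (less a)
  consider "a = 0" | "a = 1" | b where "a = b + 2" by (metis add_2_eq_Suc' not0_implies_Suc One_nat_def)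
  then show ?case
  proof cases
    case 1
    then show ?thesis by (simp add: self_dual_def fourier_jkernel_def gauss_eps_def)
  next
    case 2
    then show ?thesis using gauss_sum_prime[OF p]
      by (simp add: self_dual_def fourier_jkernel_def jkernel_prime[OF p] gauss_tau_prime[OF p] mult_ac)
  next
    case 3
    then show ?thesis using self_dual_prime_power_step[OF p] less by simp
  qed
qed

theorem jkernel_self_dual: "odd n \<Longrightarrow> self_dual n"
proof (induction n rule: less_induct)
  case (less n)
  show ?case
  proof (cases "n = 1")
    case True
    then show ?thesis by (simp add: self_dual_def fourier_jkernel_def gauss_eps_def)
  next
    case False
    then obtain p where p: "prime p" "p dvd n" using prime_factor_nat by blast
    have op: "odd p" using p less.prems by auto
    have n0: "n \<noteq> 0" using less.prems by (cases n) auto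
    obtain m where m: "n = p ^ multiplicity p n * m" "\<not> p dvd m"
      using multiplicity_decompose'[OF n0, of p] p(1) not_prime_unit[of p] by blast
    have "multiplicity p n > 0" using m p(2) by (cases "multiplicity p n") auto
    then have gt: "p ^ multiplicity p n > 1" using p prime_gt_1_nat by (metis one_less_power)
    have om: "odd m" using m less.prems by (metis even_mult_iff)
    have m0: "m > 0" using om by (simp add: odd_pos)
    have "1 * m < p ^ multiplicity p n * m" using gt m0 by (intro mult_strict_right_mono) auto
    then have lt: "m < n" using m(1) by linarith
    have cop: "coprime (p ^ multiplicity p n) m"
      using m p by (simp add: prime_imp_coprime)
    have "self_dual (p ^ multiplicity p n * m)"
      by (rule self_dual_mult) (use op om cop self_dual_prime_power[OF p(1) op] less.IH[OF lt om] in auto)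
    then show ?thesis using m(1) by simp
  qed
qed

section \<open>The sawtooth function and the Polya expansion\<close>

text \<open>The Dirichlet kernel, cleared of its denominator.\<close>

lemma sin_kernel_telescope:
  "2 * sin (u / 2) * (1 / 2 + (\<Sum>k=1..K. cos (real k * u))) = sin ((real K + 1 / 2) * u)"
proof (induction K)
  case (Suc K)
  have "2 * sin (u / 2) * cos (real (Suc K) * u) = sin ((real (Suc K) + 1 / 2) * u) - sin ((real K + 1 / 2) * u)"
  proof -
    have 1: "(real (Suc K) + 1 / 2) * u = real (Suc K) * u + u / 2" "(real K + 1 / 2) * u = real (Suc K) * u - u / 2"
      by (simp_all add: field_simps)
    show ?thesis unfolding 1 sin_add sin_diff by simp
  qed
  then show ?case using Suc by (simp add: algebra_simps)
qed simp

text \<open>Remainder of the Fourier series of \<open>(pi - t) / 2\<close> on the interval from 0 to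
  \<open>2 * pi\<close>. Its derivative is a negative Dirichlet kernel, which is where the bounds
  come from.\<close>

definition saw_rem :: "nat \<Rightarrow> real \<Rightarrow> real" where
  "saw_rem K t = (pi - t) / 2 - (\<Sum>k=1..K. sin (real k * t) / real k)"

lemma saw_rem_deriv:
  assumes "0 < t" "t < 2 * pi"
  shows "(saw_rem K has_real_derivative - (sin ((real K + 1 / 2) * t) / (2 * sin (t / 2)))) (at t)"
proof -
  have s: "sin (t / 2) > 0" using assms by (intro sin_gt_zero) auto
  have "(saw_rem K has_real_derivative - (1 / 2) - (\<Sum>k=1..K. cos (real k * t))) (at t)"
    unfolding saw_rem_def
    by (auto intro!: derivative_eq_intros sum.cong simp: field_simps)
  also have "- (1 / 2) - (\<Sum>k=1..K. cos (real k * t)) = - (sin ((real K + 1 / 2) * t) / (2 * sin (t / 2)))"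
    unfolding sin_kernel_telescope[symmetric] using s by simp
  finally show ?thesis .
qed

lemma saw_rem_pi: "saw_rem K pi = 0"
  by (simp add: saw_rem_def)

text \<open>Integration by parts in differential form. Subtracting
  \<open>cos (c u) / c * h u\<close> leaves a function \<open>q\<close> whose derivative is at most
  \<open>- h' u / c\<close> in absolute value, because \<open>h\<close> decreases; so
  \<open>q + h / c\<close> and \<open>q - h / c\<close> are monotone. The choice
  \<open>c = K + 1/2\<close> makes everything vanish at \<open>pi\<close>.\<close>

lemma saw_rem_decay:
  assumes t: "0 < t" "t \<le> pi" and K: "K > 0"
  shows "\<bar>saw_rem K t\<bar> \<le> pi / (real K * t)"
proof -
  define c where "c = real K + 1 / 2"
  have c: "c > 0" "c \<ge> real K" by (simp_all add: c_def)
  define h where "h u = 1 / (2 * sin (u / 2))" for u :: real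
  define h' where "h' u = - cos (u / 2) / (4 * sin (u / 2) ^ 2)" for u :: real
  have sp: "sin (u / 2) > 0" if "0 < u" "u \<le> pi" for u using that by (intro sin_gt_zero) auto
  have cp: "cos (u / 2) \<ge> 0" if "0 < u" "u \<le> pi" for u using that by (intro cos_ge_zero) auto
  have dh: "(h has_real_derivative h' u) (at u)" if "0 < u" "u \<le> pi" for u
    unfolding h_def h'_def using sp[OF that]
    by (auto intro!: derivative_eq_intros simp: field_simps power2_eq_square)
  define q where "q u = saw_rem K u - cos (c * u) / c * h u" for u
  have dq: "(q has_real_derivative - (cos (c * u) / c * h' u)) (at u)" if "0 < u" "u \<le> pi" for u
  proof -
    have "((\<lambda>u. cos (c * u) / c) has_real_derivative - sin (c * u)) (at u)"
      using c by (auto intro!: derivative_eq_intros)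
    from DERIV_mult[OF this dh[OF that]]
    have "((\<lambda>u. cos (c * u) / c * h u) has_real_derivative (- sin (c * u)) * h u + h' u * (cos (c * u) / c)) (at u)" .
    moreover have "(saw_rem K has_real_derivative - (sin (c * u) / (2 * sin (u / 2)))) (at u)"
      unfolding c_def by (rule saw_rem_deriv) (use that pi_gt_zero in linarith)+
    ultimately have "(q has_real_derivative - (sin (c * u) / (2 * sin (u / 2))) - ((- sin (c * u)) * h u + h' u * (cos (c * u) / c))) (at u)"
      unfolding q_def by (intro DERIV_diff)
    then show ?thesis by (simp add: h_def mult.commute)
  qed
  have h'bound: "\<bar>cos (c * u) / c * h' u\<bar> \<le> - (h' u / c)" if "0 < u" "u \<le> pi" for u
  proof -
    have "\<bar>cos (c * u)\<bar> * (- h' u) \<le> 1 * (- h' u)"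
      using sp[OF that] cp[OF that] by (intro mult_right_mono) (auto simp: h'_def)
    moreover have "\<bar>h' u\<bar> = - h' u" using sp[OF that] cp[OF that] by (auto simp: h'_def)
    ultimately show ?thesis using c by (simp add: abs_mult divide_simps)
  qed
  have qpi: "q pi = 0"
  proof -
    have "cos (c * pi) = 0"
    proof -
      have "c * pi = real K * pi + pi / 2" by (simp add: c_def algebra_simps)
      then show ?thesis by (simp add: cos_add)
    qed
    then show ?thesis by (simp add: q_def saw_rem_pi)
  qed
  have "q t + h t / c \<ge> q pi + h pi / c"
  proof (rule DERIV_nonpos_imp_nonincreasing[OF t(2)])
    fix u assume u: "t \<le> u" "u \<le> pi"
    have "((\<lambda>u. q u + h u / c) has_real_derivative - (cos (c * u) / c * h' u) + h' u / c) (at u)"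
      using u t by (intro DERIV_add dq DERIV_cdivide dh) auto
    moreover have "- (cos (c * u) / c * h' u) + h' u / c \<le> 0" using h'bound[of u] u t by linarith
    ultimately show "\<exists>y. ((\<lambda>u. q u + h u / c) has_real_derivative y) (at u) \<and> y \<le> 0" by blast
  qed
  moreover have "q t - h t / c \<le> q pi - h pi / c"
  proof (rule DERIV_nonneg_imp_nondecreasing[OF t(2)])
    fix u assume u: "t \<le> u" "u \<le> pi"
    have "((\<lambda>u. q u - h u / c) has_real_derivative - (cos (c * u) / c * h' u) - h' u / c) (at u)"
      using u t by (intro DERIV_diff dq DERIV_cdivide dh) auto
    moreover have "- (cos (c * u) / c * h' u) - h' u / c \<ge> 0" using h'bound[of u] u t by linarith
    ultimately show "\<exists>y. ((\<lambda>u. q u - h u / c) has_real_derivative y) (at u) \<and> 0 \<le> y" by blast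
  qed
  moreover have "h pi / c \<ge> 0" using c by (simp add: h_def)
  ultimately have "\<bar>q t\<bar> \<le> h t / c" using qpi by linarith
  moreover have "\<bar>cos (c * t) / c * h t\<bar> \<le> h t / c"
  proof -
    have "h t \<ge> 0" using sp[OF t] by (simp add: h_def)
    then have "\<bar>cos (c * t)\<bar> * h t \<le> 1 * h t" by (intro mult_right_mono) auto
    then show ?thesis using c \<open>h t \<ge> 0\<close> by (simp add: abs_mult divide_simps)
  qed
  ultimately have "\<bar>saw_rem K t\<bar> \<le> 2 * h t / c" unfolding q_def by linarith
  also have "\<dots> \<le> pi / (real K * t)"
  proof -
    have s: "sin (t / 2) \<ge> t / pi"
      using sin_ge_two_over_pi[of "t / pi"] t by simp
    have "2 * h t / c = 1 / (c * sin (t / 2))" by (simp add: h_def mult.commute)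
    also have "\<dots> \<le> 1 / (real K * (t / pi))"
      using s c t K sp[OF t] by (intro divide_left_mono mult_mono mult_pos_pos) auto
    finally show ?thesis by simp
  qed
  finally show ?thesis .
qed

text \<open>Up to \<open>t = 1 / K\<close> each term is at most \<open>t\<close>, so the partial sum
  is at most 1; beyond that point the decay bound is at most \<open>pi\<close>.\<close>

lemma saw_rem_bounded:
  assumes t: "0 < t" "t \<le> pi"
  shows "\<bar>saw_rem K t\<bar> \<le> 4"
proof (cases "real K * t \<le> 1")
  case True
  have "\<bar>\<Sum>k=1..K. sin (real k * t) / real k\<bar> \<le> (\<Sum>k=1..K. \<bar>sin (real k * t) / real k\<bar>)" by (rule sum_abs)
  also have "\<dots> \<le> (\<Sum>k=1..K. t)"
  proof (rule sum_mono)
    fix k assume k: "k \<in> {1..K}"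
    have "\<bar>sin (real k * t)\<bar> \<le> \<bar>real k * t\<bar>" by (rule abs_sin_x_le_abs_x)
    then show "\<bar>sin (real k * t) / real k\<bar> \<le> t" using k t by (simp add: divide_simps mult.commute)
  qed
  also have "\<dots> \<le> 1" using True by simp
  finally have 1: "\<bar>\<Sum>k=1..K. sin (real k * t) / real k\<bar> \<le> 1" .
  have "\<bar>(pi - t) / 2\<bar> \<le> 2" using t pi_less_4 by simp
  then show ?thesis using 1 unfolding saw_rem_def by linarith
next
  case False
  then have K: "K > 0" by (cases K) auto
  have "\<bar>saw_rem K t\<bar> \<le> pi / (real K * t)" by (rule saw_rem_decay[OF t K])
  also have "\<dots> \<le> pi / 1" using False by (intro divide_left_mono) auto
  also have "\<dots> \<le> 4" using pi_less_4 by simp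
  finally show ?thesis .
qed

lemma saw_rem_reflect: "saw_rem K (2 * pi - t) = - saw_rem K t"
proof -
  have "sin (real k * (2 * pi - t)) = - sin (real k * t)" for k
  proof -
    have "real k * (2 * pi - t) = 2 * pi * of_int (int k) - real k * t" by (simp add: algebra_simps)
    then show ?thesis by (simp only: sin_diff cos_int_2pin sin_int_2pin mult_zero_left mult_1_left diff_0)
  qed
  then show ?thesis by (simp add: saw_rem_def sum_negf field_simps)
qed

definition saw_err :: "nat \<Rightarrow> real \<Rightarrow> real" where
  "saw_err K x = frac x - 1 / 2 + (\<Sum>k=1..K. sin (2 * pi * (real k * x)) / (pi * real k))"

lemma saw_err_eq_rem:
  "saw_err K x = - saw_rem K (2 * pi * frac x) / pi"
proof -
  have "sin (2 * pi * (real k * x)) = sin (real k * (2 * pi * frac x))" for k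
  proof -
    have "2 * pi * (real k * x) = real k * (2 * pi * frac x) + 2 * pi * of_int (int k * \<lfloor>x\<rfloor>)"
      by (simp add: frac_def algebra_simps)
    then show ?thesis by (simp only: sin_add cos_int_2pin sin_int_2pin mult_zero_right mult_1_right add_0_right)
  qed
  then show ?thesis
    by (simp add: saw_err_def saw_rem_def field_simps sum_divide_distrib sum_distrib_left)
qed

lemma saw_err_bounded: "\<bar>saw_err K x\<bar> \<le> 2"
proof (cases "frac x = 0")
  \<comment> \<open>At integers the sines vanish while \<open>frac\<close> takes its right-hand
    limit 0, so an error of absolute value \<open>1/2\<close> remains for every
    \<open>K\<close>.\<close>
  case True
  have "saw_rem K 0 = pi / 2" by (simp add: saw_rem_def)
  then have "\<bar>- saw_rem K 0 / pi\<bar> = 1 / 2" by (simp only:) simp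
  then show ?thesis unfolding saw_err_eq_rem True mult_zero_right by linarith
next
  case False
  define t where "t = 2 * pi * frac x"
  have t: "0 < t" "t < 2 * pi" using False frac_ge_0[of x] frac_lt_1[of x] by (auto simp: t_def less_le)
  have "\<bar>saw_rem K t\<bar> \<le> 4"
  proof (cases "t \<le> pi")
    case True
    then show ?thesis using saw_rem_bounded t by blast
  next
    case False
    then show ?thesis using saw_rem_bounded[of "2 * pi - t" K] saw_rem_reflect[of K t] t by simp
  qed
  then have "\<bar>saw_err K x\<bar> \<le> 4 / pi"
    unfolding saw_err_eq_rem t_def[symmetric] by (simp add: divide_right_mono)
  also have "\<dots> \<le> 2" using pi_ge_two by (simp add: field_simps)
  finally show ?thesis .
qed

lemma saw_err_decay:
  assumes K: "K > 0" and x: "0 < frac x"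
  shows "\<bar>saw_err K x\<bar> \<le> 1 / (2 * real K * frac x) + 1 / (2 * real K * (1 - frac x))"
proof -
  define t where "t = 2 * pi * frac x"
  have f: "frac x > 0" "frac x < 1" using x frac_lt_1 by auto
  have t: "0 < t" "t < 2 * pi" using f by (auto simp: t_def)
  have "\<bar>saw_rem K t\<bar> \<le> pi / (real K * t) + pi / (real K * (2 * pi - t))"
  proof (cases "t \<le> pi")
    case True
    have "pi / (real K * (2 * pi - t)) \<ge> 0" using t by simp
    then show ?thesis using saw_rem_decay[OF t(1) True K] by linarith
  next
    case False
    have "pi / (real K * t) \<ge> 0" using t by simp
    moreover have "\<bar>saw_rem K (2 * pi - t)\<bar> \<le> pi / (real K * (2 * pi - t))"
      by (rule saw_rem_decay) (use False t K in auto)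
    ultimately show ?thesis using saw_rem_reflect[of K t] by linarith
  qed
  then have "\<bar>saw_err K x\<bar> \<le> (pi / (real K * t) + pi / (real K * (2 * pi - t))) / pi"
    unfolding saw_err_eq_rem t_def[symmetric] by (simp add: divide_right_mono)
  also have "\<dots> = 1 / (real K * t) + 1 / (real K * (2 * pi - t))" by (simp add: add_divide_distrib)
  also have "\<dots> = (1 / (2 * real K * frac x) + 1 / (2 * real K * (1 - frac x))) / pi"
  proof -
    have "2 * pi - t = pi * (2 * (1 - frac x))" "t = pi * (2 * frac x)" by (simp_all add: t_def algebra_simps)
    then show ?thesis by (simp add: add_divide_distrib mult_ac)
  qed
  also have "\<dots> \<le> (1 / (2 * real K * frac x) + 1 / (2 * real K * (1 - frac x))) / 1"
    using f pi_ge_two by (intro divide_left_mono add_nonneg_nonneg) auto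
  finally show ?thesis by simp
qed

text \<open>The difference of the two floors counts the numbers from 1 to \<open>N\<close> in the
  class of \<open>r\<close>. In this form each count can be expanded by the sawtooth
  function.\<close>

lemma sum_periodic_residue_counts:
  fixes f :: "int \<Rightarrow> real"
  assumes per: "\<And>x y. [x = y] (mod int n) \<Longrightarrow> f x = f y" and n: "n > 0"
  shows "(\<Sum>m=1..N. f (int m)) = (\<Sum>r<n. f (int r) * of_int ((int N - int r) div int n - (- int r) div int n))"
proof (induction N)
  case (Suc N)
  have step: "(int (Suc N) - int r) div int n = (int N - int r) div int n + (if r = Suc N mod n then 1 else 0)"
    if r: "r < n" for r
  proof -
    define x where "x = int N - int r"
    have "r = Suc N mod n \<longleftrightarrow> [Suc N = r] (mod n)"
      using r by (auto simp: cong_def)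
    also have "\<dots> \<longleftrightarrow> [int (Suc N) = int r] (mod int n)" by (simp only: cong_int_iff)
    also have "\<dots> \<longleftrightarrow> int n dvd x + 1" by (simp add: cong_iff_dvd_diff x_def algebra_simps)
    finally have iff: "r = Suc N mod n \<longleftrightarrow> int n dvd x + 1" .
    have "(x + 1) div int n = x div int n + (if int n dvd x + 1 then 1 else 0)"
    proof (cases "int n dvd x + 1")
      case True
      then obtain z where "x + 1 = int n * z" by auto
      then have "x = int n * (z - 1) + (int n - 1)" by (simp add: algebra_simps)
      then have "x div int n = z - 1" using n by (simp add: div_add1_eq)
      then show ?thesis using True \<open>x + 1 = int n * z\<close> n by simp
    next
      case False
      define q t where "q = x div int n" and "t = x mod int n"
      have x: "x = int n * q + t" by (simp add: q_def t_def)
      have t: "0 \<le> t" "t < int n" using n by (simp_all add: t_def)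
      have "t + 1 \<noteq> int n"
      proof
        assume "t + 1 = int n"
        then have "x + 1 = int n * (q + 1)" by (simp add: x algebra_simps)
        with False show False by simp
      qed
      then have "(x + 1) div int n = q"
        using t by (intro int_div_pos_eq[of _ _ _ "t + 1"]) (auto simp: x)
      then show ?thesis using False by (simp add: q_def)
    qed
    moreover have "int (Suc N) - int r = x + 1" by (simp add: x_def)
    ultimately show ?thesis by (simp only: iff x_def[symmetric])
  qed
  have "(\<Sum>r<n. f (int r) * of_int ((int (Suc N) - int r) div int n - (- int r) div int n))
     = (\<Sum>r<n. f (int r) * of_int ((int N - int r) div int n - (- int r) div int n) + (if r = Suc N mod n then f (int r) else 0))"
    by (intro sum.cong refl) (auto simp: step algebra_simps simp del: of_nat_Suc)
  also have "\<dots> = (\<Sum>m=1..N. f (int m)) + f (int (Suc N mod n))"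
    using n unfolding sum.distrib Suc.IH[symmetric] by simp
  also have "f (int (Suc N mod n)) = f (int (Suc N))"
    by (rule per) (simp add: cong_def zmod_int)
  finally show ?case by simp
qed (use n in auto)

section \<open>The finite Polya expansion\<close>

definition square_ind :: "nat \<Rightarrow> real" where
  "square_ind n = (if \<exists>s. n = s ^ 2 then 1 else 0)"

text \<open>
  The character \<open>(- | n)\<close> is even for \<open>n mod 4 = 1\<close> and odd for \<open>n mod 4 = 3\<close>.
\<close>

definition trig :: "nat \<Rightarrow> real \<Rightarrow> real" where
  "trig n t = (if n mod 4 = 3 then 1 - cos (2 * pi * t) else sin (2 * pi * t))"

lemma odd_square_mod_8: "odd (s :: nat) \<Longrightarrow> s ^ 2 mod 8 = 1"
proof -
  assume "odd s"
  then have "s mod 8 = 1 \<or> s mod 8 = 3 \<or> s mod 8 = 5 \<or> s mod 8 = 7" by presburger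
  moreover have "s ^ 2 mod 8 = (s mod 8) ^ 2 mod 8" by (simp add: power_mod)
  ultimately show ?thesis by (elim disjE) simp_all
qed

lemma jkernel_0_left:
  assumes "odd n"
  shows "real_of_int (jkernel 0 n) = sqrt (real n) * square_ind n"
proof (cases "\<exists>s. n = s ^ 2")
  case True
  then obtain s where s: "n = s ^ 2" by blast
  have "jkernel 0 n = int s * Jacobi 0 1"
    using jkernel_square[OF assms, of 0 s] assms s by (simp add: odd_pos)
  then show ?thesis using True s by (simp add: square_ind_def)
next
  case False
  then have "jkernel 0 n = 0"
  proof (intro jkernel_nonsquare[OF assms] notI)
    fix s assume "gcd 0 (int n) = int s ^ 2"
    then have "int n = int (s ^ 2)" by simp
    then have "n = s ^ 2" by (simp only: of_nat_eq_iff)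
    with False show False by blast
  qed
  then show ?thesis using False by (simp add: square_ind_def)
qed

text \<open>The transform at frequency 0. It is nonzero only for square \<open>n\<close>, and an odd
  square has \<open>gauss_eps n = 1\<close>.\<close>

lemma sum_jkernel_residues:
  assumes "odd n"
  shows "(\<Sum>r<n. real_of_int (jkernel (int r) n)) = real n * square_ind n"
proof -
  have "complex_of_real (\<Sum>r<n. real_of_int (jkernel (int r) n)) = fourier_jkernel n 0"
    by (simp add: fourier_jkernel_def)
  also have "\<dots> = gauss_eps n * of_real (sqrt (real n)) * of_int (jkernel 0 n)"
    using jkernel_self_dual[OF assms] by (simp add: self_dual_def)
  also have "(of_int (jkernel 0 n) :: complex) = of_real (real_of_int (jkernel 0 n))" by simp
  also have "real_of_int (jkernel 0 n) = sqrt (real n) * square_ind n" by (rule jkernel_0_left[OF assms])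
  also have "gauss_eps n * of_real (sqrt (real n)) * of_real (sqrt (real n) * square_ind n)
      = gauss_eps n * of_real (square_ind n) * of_real (sqrt (real n) * sqrt (real n))"
    by (simp only: of_real_mult mult_ac)
  also have "gauss_eps n * of_real (square_ind n) = of_real (square_ind n)"
  proof (cases "\<exists>s. n = s ^ 2")
    case True
    then obtain s where "n = s ^ 2" "odd s" using assms by auto
    then have "n mod 8 = 1" using odd_square_mod_8 by simp
    then have "n mod 4 = 1" by presburger
    then show ?thesis by (simp add: gauss_eps_def)
  qed (simp add: square_ind_def)
  also have "sqrt (real n) * sqrt (real n) = real n" by simp
  finally have "complex_of_real (\<Sum>r<n. real_of_int (jkernel (int r) n)) = of_real (real n * square_ind n)"
    by (simp add: mult.commute)
  then show ?thesis by (simp only: of_real_eq_iff)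
qed

text \<open>Each sine sum is the imaginary part of an exponential times the conjugate of the
  transform. The factor \<open>gauss_eps n\<close> is 1 or \<open>i\<close>; conjugation and
  subtraction of the value at 0 turn these cases into a sine and into one minus a cosine.\<close>

lemma sum_jkernel_sin:
  assumes "odd n"
  shows "(\<Sum>r<n. real_of_int (jkernel (int r) n) * (sin (2 * pi * (real k * ((Z - real r) / real n))) - sin (2 * pi * (real k * (- real r / real n)))))
    = sqrt (real n) * real_of_int (jkernel (int k) n) * trig n (real k * Z / real n)"
proof -
  define G where "G = fourier_jkernel n (int k)"
  have G: "G = gauss_eps n * of_real (sqrt (real n)) * of_int (jkernel (int k) n)"
    using jkernel_self_dual[OF assms] by (simp add: self_dual_def G_def)
  have S: "(\<Sum>r<n. real_of_int (jkernel (int r) n) * sin (2 * pi * (real k * ((z - real r) / real n))))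
     = Im (cis (2 * pi * (real k * z / real n)) * cnj G)" for z
  proof -
    have "cis (2 * pi * (real k * z / real n)) * cnj G
       = (\<Sum>r<n. of_real (real_of_int (jkernel (int r) n)) * cis (2 * pi * (real k * ((z - real r) / real n))))"
      unfolding G_def fourier_jkernel_def cnj_sum sum_distrib_left
    proof (intro sum.cong refl)
      fix r
      have "2 * pi * (real k * ((z - real r) / real n)) = 2 * pi * (real k * z / real n) - 2 * pi * (real r * real k / real n)"
        by (simp add: diff_divide_distrib algebra_simps)
      then show "cis (2 * pi * (real k * z / real n)) * cnj (of_int (jkernel (int r) n) * cis (2 * pi * (real r * real_of_int (int k) / real n)))
         = of_real (real_of_int (jkernel (int r) n)) * cis (2 * pi * (real k * ((z - real r) / real n)))"
        by (simp add: cis_cnj cis_mult)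
    qed
    then show ?thesis by (simp add: Im_sum)
  qed
  have "(\<Sum>r<n. real_of_int (jkernel (int r) n) * (sin (2 * pi * (real k * ((Z - real r) / real n))) - sin (2 * pi * (real k * (- real r / real n)))))
    = Im (cis (2 * pi * (real k * Z / real n)) * cnj G) - Im (cis (2 * pi * (real k * 0 / real n)) * cnj G)"
    unfolding S[symmetric] by (simp only: right_diff_distrib sum_subtractf diff_0)
  also have "\<dots> = sqrt (real n) * real_of_int (jkernel (int k) n) * trig n (real k * Z / real n)"
    unfolding G by (simp add: gauss_eps_def trig_def algebra_simps)
  finally show ?thesis .
qed

definition jkernel_sum :: "nat \<Rightarrow> real \<Rightarrow> real" where
  "jkernel_sum n Z = (\<Sum>m=1..nat \<lfloor>Z\<rfloor>. real_of_int (jkernel (int m) n))"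

text \<open>An exact identity: every residue count is a difference of floors, every floor a linear
  term plus a truncated sawtooth series, and the truncation errors are kept as a sum.\<close>

lemma jkernel_sum_expansion:
  assumes o: "odd n" and Z: "Z \<ge> 0"
  shows "jkernel_sum n Z = Z * square_ind n
     + sqrt (real n) / pi * (\<Sum>k=1..K. real_of_int (jkernel (int k) n) / real k * trig n (real k * Z / real n))
     - (\<Sum>r<n. real_of_int (jkernel (int r) n) * (saw_err K ((Z - real r) / real n) - saw_err K (- real r / real n)))"
proof -
  have n: "n > 0" using o by (simp add: odd_pos)
  define F where "F r = real_of_int (jkernel (int r) n)" for r :: nat
  define sn where "sn k x = sin (2 * pi * (real k * x)) / (pi * real k)" for k :: nat and x
  define a b where "a r = (Z - real r) / real n" and "b r = - real r / real n" for r :: nat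
  have fl: "real_of_int ((int (nat \<lfloor>Z\<rfloor>) - int r) div int n - (- int r) div int n)
      = Z / real n + (\<Sum>k=1..K. sn k (a r) - sn k (b r)) - (saw_err K (a r) - saw_err K (b r))" for r
  proof -
    have "(int (nat \<lfloor>Z\<rfloor>) - int r) div int n = \<lfloor>a r\<rfloor>"
    proof -
      have "\<lfloor>a r\<rfloor> = \<lfloor>(Z - real r) / real_of_int (int n)\<rfloor>" by (simp add: a_def)
      also have "\<dots> = \<lfloor>Z - real r\<rfloor> div int n" by (rule floor_divide_real_eq_div) simp
      also have "\<lfloor>Z - real r\<rfloor> = \<lfloor>Z\<rfloor> - int r" by (metis floor_diff_of_int of_int_of_nat_eq)
      finally show ?thesis using Z by simp
    qed
    moreover have "(- int r) div int n = \<lfloor>b r\<rfloor>"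
      unfolding b_def by (metis floor_divide_of_int_eq of_int_minus of_int_of_nat_eq)
    moreover have "real_of_int \<lfloor>x\<rfloor> = x - 1 / 2 + (\<Sum>k=1..K. sn k x) - saw_err K x" for x
      by (simp add: saw_err_def sn_def frac_def)
    ultimately have "real_of_int ((int (nat \<lfloor>Z\<rfloor>) - int r) div int n - (- int r) div int n)
        = (a r - b r) + ((\<Sum>k=1..K. sn k (a r)) - (\<Sum>k=1..K. sn k (b r))) - (saw_err K (a r) - saw_err K (b r))"
      by simp
    moreover have "a r - b r = Z / real n" by (simp add: a_def b_def diff_divide_distrib)
    ultimately show ?thesis by (simp add: sum_subtractf)
  qed
  have "jkernel_sum n Z = (\<Sum>r<n. F r * real_of_int ((int (nat \<lfloor>Z\<rfloor>) - int r) div int n - (- int r) div int n))"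
    unfolding jkernel_sum_def F_def
    by (rule sum_periodic_residue_counts) (use n jkernel_cong[OF o] in auto)
  also have "\<dots> = (\<Sum>r<n. F r) * (Z / real n) + (\<Sum>r<n. \<Sum>k=1..K. F r * (sn k (a r) - sn k (b r)))
       - (\<Sum>r<n. F r * (saw_err K (a r) - saw_err K (b r)))"
  proof -
    have "F r * real_of_int ((int (nat \<lfloor>Z\<rfloor>) - int r) div int n - (- int r) div int n)
        = F r * (Z / real n) + (\<Sum>k=1..K. F r * (sn k (a r) - sn k (b r))) - F r * (saw_err K (a r) - saw_err K (b r))" for r
      unfolding fl right_diff_distrib[of "F r" "Z / real n + _"] distrib_left sum_distrib_left ..
    then show ?thesis by (simp only: sum.distrib sum_subtractf sum_distrib_right)
  qed
  also have "(\<Sum>r<n. F r) * (Z / real n) = Z * square_ind n"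
    using sum_jkernel_residues[OF o] n by (simp add: F_def)
  also have "(\<Sum>r<n. \<Sum>k=1..K. F r * (sn k (a r) - sn k (b r)))
      = (\<Sum>k=1..K. (\<Sum>r<n. F r * (sin (2 * pi * (real k * a r)) - sin (2 * pi * (real k * b r)))) / (pi * real k))"
    by (subst sum.swap) (intro sum.cong refl, simp add: sn_def sum_divide_distrib flip: diff_divide_distrib)
  also have "\<dots> = (\<Sum>k=1..K. sqrt (real n) * real_of_int (jkernel (int k) n) * trig n (real k * Z / real n) / (pi * real k))"
    unfolding F_def a_def b_def sum_jkernel_sin[OF o] ..
  also have "\<dots> = sqrt (real n) / pi * (\<Sum>k=1..K. real_of_int (jkernel (int k) n) / real k * trig n (real k * Z / real n))"
    by (simp add: sum_distrib_left mult_ac)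
  finally show ?thesis by (simp add: F_def a_def b_def)
qed

lemma sum_inverse_le_ln: "(\<Sum>j=1..n. 1 / real j) \<le> 1 + ln (real n)" if "n \<ge> 1"
  using that
proof (induction n rule: dec_induct)
  case (step n)
  have "ln (real n / real (Suc n)) \<le> real n / real (Suc n) - 1"
    using step by (intro ln_le_minus_one) auto
  also have "\<dots> = - (1 / real (Suc n))" by (simp add: field_simps)
  finally have "1 / real (Suc n) \<le> ln (real (Suc n)) - ln (real n)"
    using step by (simp add: ln_div)
  then show ?case using step by simp
qed simp

text \<open>Up to reindexing modulo \<open>n\<close> the points are
  \<open>(\<theta> + j) / n\<close> with \<open>0 \<le> j < n\<close>. The two that may be
  arbitrarily close to an integer, \<open>j = 0\<close> and \<open>j = n - 1\<close>, get the
  trivial bound 2 each; the others have distance at least \<open>j / n\<close> from 0 and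
  \<open>(n - 1 - j) / n\<close> from 1, which gives harmonic sums.\<close>

lemma sum_saw_err_le:
  assumes n: "n > 0" and K: "K > 0"
  shows "(\<Sum>r<n. \<bar>saw_err K ((z - real r) / real n)\<bar>) \<le> 4 + real n / real K * (1 + ln (real n))"
proof -
  define \<theta> where "\<theta> = frac z"
  have \<theta>: "0 \<le> \<theta>" "\<theta> < 1" by (simp_all add: \<theta>_def frac_lt_1)
  define g where "g x = \<bar>saw_err K ((\<theta> + real_of_int x) / real n)\<bar>" for x :: int
  have per: "g x = g y" if "[x = y] (mod int n)" for x y
  proof -
    have "int n dvd x - y" using that by (simp add: cong_iff_dvd_diff)
    then obtain q where "x - y = int n * q" by (rule dvdE)
    then have q: "x = y + int n * q" by simp
    have eq: "(\<theta> + real_of_int x) / real n = (\<theta> + real_of_int y) / real n + real_of_int q"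
      using n by (simp add: q field_simps)
    have "saw_err K (u + real_of_int q) = saw_err K u" for u
      by (simp add: saw_err_eq_rem)
    then show ?thesis unfolding g_def eq by simp
  qed
  have "(\<Sum>r<n. \<bar>saw_err K ((z - real r) / real n)\<bar>) = (\<Sum>r<n. g (\<lfloor>z\<rfloor> - int r))"
    by (simp add: g_def \<theta>_def frac_def)
  also have "\<dots> = (\<Sum>j<n. g (int j))"
  proof (rule sum_over_residues[OF per])
    fix i j assume "i \<in> {..<n}" "j \<in> {..<n}" "[\<lfloor>z\<rfloor> - int i = \<lfloor>z\<rfloor> - int j] (mod int n)"
    moreover from this have "int n dvd int j - int i" by (simp add: cong_iff_dvd_diff)
    then have "[j = i] (mod n)" by (simp add: cong_iff_dvd_diff flip: cong_int_iff)
    ultimately show "i = j" by (auto dest: cong_less_modulus_unique_nat)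
  qed (use n in auto)
  also have "\<dots> \<le> 4 + real n / real K * (1 + ln (real n))"
  proof (cases "n \<le> 2")
    case True
    have "(\<Sum>j<n. g (int j)) \<le> (\<Sum>j<n. 2)" by (intro sum_mono) (simp add: g_def saw_err_bounded)
    also have "\<dots> \<le> 4" using True by simp
    also have "\<dots> \<le> 4 + real n / real K * (1 + ln (real n))" using n by simp
    finally show ?thesis .
  next
    case False
    define N where "N = n - 2"
    have nN: "n = N + 2" "N \<ge> 1" using False by (simp_all add: N_def)
    have "{..<n} = insert 0 (insert (n - 1) {1..N})" using nN by auto
    then have "(\<Sum>j<n. g (int j)) = g 0 + (g (int (n - 1)) + (\<Sum>j=1..N. g (int j)))"
      using nN by simp
    also have "\<dots> \<le> 2 + (2 + (\<Sum>j=1..N. g (int j)))"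
      by (intro add_mono order_refl) (simp_all only: g_def saw_err_bounded)
    also have "(\<Sum>j=1..N. g (int j)) \<le> (\<Sum>j=1..N. real n / (2 * real K) * (1 / real j + 1 / real (Suc N - j)))"
    proof (rule sum_mono)
      fix j assume j: "j \<in> {1..N}"
      define x where "x = (\<theta> + real j) / real n"
      have x: "x \<ge> real j / real n" "1 - x \<ge> real (Suc N - j) / real n"
        using \<theta> j nN by (auto simp: x_def divide_simps of_nat_diff)
      have pos: "real j / real n > 0" "real (Suc N - j) / real n > 0" using j n by auto
      have x01: "0 < x" "x < 1" using x pos by linarith+
      then have fr: "frac x = x" by (simp add: frac_eq)
      have "g (int j) \<le> 1 / (2 * real K * x) + 1 / (2 * real K * (1 - x))"
        using saw_err_decay[OF K, of x] x01 by (simp add: g_def x_def[symmetric] fr)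
      also have "\<dots> \<le> 1 / (2 * real K * (real j / real n)) + 1 / (2 * real K * (real (Suc N - j) / real n))"
      proof -
        have "1 / (2 * real K * u) \<le> 1 / (2 * real K * v)" if "v \<le> u" "0 < v" for u v
          using that K by (intro divide_left_mono mult_left_mono mult_pos_pos) auto
        then show ?thesis using x pos by (intro add_mono) blast+
      qed
      also have "\<dots> = real n / (2 * real K) * (1 / real j + 1 / real (Suc N - j))"
        by (simp add: distrib_left)
      finally show "g (int j) \<le> real n / (2 * real K) * (1 / real j + 1 / real (Suc N - j))" .
    qed
    also have "\<dots> = real n / (2 * real K) * ((\<Sum>j=1..N. 1 / real j) + (\<Sum>j=1..N. 1 / real (Suc N - j)))"
      by (simp only: sum.distrib sum_distrib_left[symmetric])
    also have "(\<Sum>j=1..N. 1 / real (Suc N - j)) = (\<Sum>j=1..N. 1 / real j)"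
      by (rule sum.reindex_bij_witness[of _ "\<lambda>j. Suc N - j" "\<lambda>j. Suc N - j"]) auto
    also have "real n / (2 * real K) * ((\<Sum>j=1..N. 1 / real j) + (\<Sum>j=1..N. 1 / real j)) = real n / real K * (\<Sum>j=1..N. 1 / real j)"
      by simp
    also have "\<dots> \<le> real n / real K * (1 + ln (real n))"
    proof (intro mult_left_mono)
      have "(\<Sum>j=1..N. 1 / real j) \<le> 1 + ln (real N)" by (rule sum_inverse_le_ln[OF nN(2)])
      also have "\<dots> \<le> 1 + ln (real n)" using nN by simp
      finally show "(\<Sum>j=1..N. 1 / real j) \<le> 1 + ln (real n)" .
    qed auto
    finally show ?thesis by simp
  qed
  finally show ?thesis .
qed

definition polya_err :: "nat \<Rightarrow> nat \<Rightarrow> real" where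
  "polya_err K n = (\<Sum>d | d ^ 2 dvd n. real d * (4 + real n / real d ^ 2 / real K * (1 + ln (real n))))"

text \<open>For each weight \<open>d\<close> the residues divisible by \<open>d^2\<close> turn the
  grid of step \<open>1 / n\<close> into a grid of step \<open>1 / n'\<close> with
  \<open>n' = n / d^2\<close>, so the previous bound applies to the smaller modulus.\<close>

lemma sum_jkernel_saw_err_le:
  assumes o: "odd n" and K: "K > 0"
  shows "\<bar>\<Sum>r<n. real_of_int (jkernel (int r) n) * saw_err K ((z - real r) / real n)\<bar> \<le> polya_err K n"
proof -
  have n: "n > 0" using o by (simp add: odd_pos)
  define E where "E r = \<bar>saw_err K ((z - real r) / real n)\<bar>" for r :: nat
  define D where "D = {d :: nat. d ^ 2 dvd n}"
  have fin: "finite D" unfolding D_def by (rule finite_square_divisors[OF n])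
  have jk: "\<bar>real_of_int (jkernel (int r) n)\<bar> \<le> (\<Sum>d\<in>D. if d ^ 2 dvd r then real d else 0)" for r
  proof -
    have "\<bar>jkernel (int r) n\<bar> \<le> (\<Sum>d | d ^ 2 dvd n \<and> int d ^ 2 dvd int r. int d)" by (rule abs_jkernel_le[OF o])
    also have "{d. d ^ 2 dvd n \<and> int d ^ 2 dvd int r} = {d \<in> D. d ^ 2 dvd r}"
      by (auto simp: D_def simp flip: of_nat_power)
    finally have "real_of_int \<bar>jkernel (int r) n\<bar> \<le> real_of_int (\<Sum>d\<in>{d \<in> D. d ^ 2 dvd r}. int d)"
      by (simp only: of_int_le_iff)
    also have "\<dots> = (\<Sum>d\<in>{d \<in> D. d ^ 2 dvd r}. real d)" by simp
    also have "\<dots> = (\<Sum>d\<in>D. if d ^ 2 dvd r then real d else 0)" by (rule sum.inter_filter[OF fin])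
    finally show ?thesis by simp
  qed
  have "\<bar>\<Sum>r<n. real_of_int (jkernel (int r) n) * saw_err K ((z - real r) / real n)\<bar>
     \<le> (\<Sum>r<n. \<bar>real_of_int (jkernel (int r) n)\<bar> * E r)"
    by (rule order.trans[OF sum_abs]) (simp add: abs_mult E_def)
  also have "\<dots> \<le> (\<Sum>r<n. (\<Sum>d\<in>D. if d ^ 2 dvd r then real d else 0) * E r)"
    by (intro sum_mono mult_right_mono jk) (simp add: E_def)
  also have "\<dots> = (\<Sum>d\<in>D. \<Sum>r<n. if d ^ 2 dvd r then real d * E r else 0)"
    unfolding sum_distrib_right by (subst sum.swap) (intro sum.cong refl, auto)
  also have "\<dots> \<le> (\<Sum>d\<in>D. real d * (4 + real n / real d ^ 2 / real K * (1 + ln (real n))))"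
  proof (rule sum_mono)
    fix d assume "d \<in> D"
    then obtain n' where n': "n = d ^ 2 * n'" by (auto simp: D_def)
    have pos: "d > 0" "n' > 0" using n n' by (auto intro: Nat.gr0I)
    have "(\<Sum>r<n. if d ^ 2 dvd r then real d * E r else 0) = (\<Sum>r\<in>{r \<in> {..<n}. d ^ 2 dvd r}. real d * E r)"
      by (rule sum.inter_filter[symmetric]) auto
    also have "\<dots> = (\<Sum>r<n'. real d * E (d ^ 2 * r))"
      by (rule sum.reindex_bij_witness[of _ "\<lambda>m. d ^ 2 * m" "\<lambda>m. m div d ^ 2"])
         (use pos in \<open>auto simp: n' elim!: dvdE\<close>)
    also have "\<dots> = real d * (\<Sum>r<n'. \<bar>saw_err K ((z / real d ^ 2 - real r) / real n')\<bar>)"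
    proof -
      have "(z - real (d ^ 2 * r)) / real n = (z / real d ^ 2 - real r) / real n'" for r
        using pos by (simp add: n' field_simps)
      then show ?thesis by (simp add: E_def sum_distrib_left)
    qed
    also have "\<dots> \<le> real d * (4 + real n' / real K * (1 + ln (real n')))"
      by (intro mult_left_mono sum_saw_err_le pos K) auto
    also have "\<dots> \<le> real d * (4 + real n' / real K * (1 + ln (real n)))"
    proof (intro mult_left_mono add_left_mono)
      have "n' \<le> n" using pos by (simp add: n')
      then show "ln (real n') \<le> ln (real n)" using pos by simp
    qed auto
    also have "real n' = real n / real d ^ 2" using pos by (simp add: n')
    finally show "(\<Sum>r<n. if d ^ 2 dvd r then real d * E r else 0) \<le> real d * (4 + real n / real d ^ 2 / real K * (1 + ln (real n)))" .
  qed
  finally show ?thesis by (simp add: polya_err_def D_def)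
qed

theorem polya_expansion:
  assumes o: "odd n" and Z: "Z \<ge> 0" and K: "K > 0"
  shows "\<bar>jkernel_sum n Z - Z * square_ind n
     - sqrt (real n) / pi * (\<Sum>k=1..K. real_of_int (jkernel (int k) n) / real k * trig n (real k * Z / real n))\<bar>
     \<le> 2 * polya_err K n"
proof -
  have "(\<Sum>r<n. real_of_int (jkernel (int r) n) * (saw_err K ((Z - real r) / real n) - saw_err K (- real r / real n)))
     = (\<Sum>r<n. real_of_int (jkernel (int r) n) * saw_err K ((Z - real r) / real n))
      - (\<Sum>r<n. real_of_int (jkernel (int r) n) * saw_err K ((0 - real r) / real n))"
    by (simp add: sum_subtractf algebra_simps)
  then show ?thesis
    using jkernel_sum_expansion[OF o Z, of K] sum_jkernel_saw_err_le[OF o K, of Z] sum_jkernel_saw_err_le[OF o K, of 0]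
    by linarith
qed

section \<open>The Polya-Vinogradov inequality and sums along columns\<close>

definition div_weight :: "nat \<Rightarrow> real" where
  "div_weight k = (\<Sum>d | d ^ 2 dvd k. sqrt (real k) / real d + real d)"

lemma div_weight_ge_1: "k > 0 \<Longrightarrow> div_weight k \<ge> 1"
proof -
  assume k: "k > 0"
  have "(\<Sum>d\<in>{1}. sqrt (real k) / real d + real d) \<le> div_weight k"
    unfolding div_weight_def using k by (intro sum_mono2 finite_square_divisors) auto
  then have "sqrt (real k) + 1 \<le> div_weight k" by simp
  moreover have "sqrt (real k) \<ge> 0" by simp
  ultimately show ?thesis by linarith
qed

lemma div_weight_mono_dvd:
  assumes "k dvd l" "l > 0"
  shows "div_weight k \<le> div_weight l"
proof -
  have kl: "k \<le> l" using assms by (intro dvd_imp_le)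
  have "div_weight k \<le> (\<Sum>d | d ^ 2 dvd k. sqrt (real l) / real d + real d)"
    unfolding div_weight_def by (intro sum_mono add_right_mono divide_right_mono) (use kl in auto)
  also have "\<dots> \<le> div_weight l"
    unfolding div_weight_def using assms
    by (intro sum_mono2 finite_square_divisors) (auto intro: dvd_trans)
  finally show ?thesis .
qed

lemma trig_bounds: "\<bar>trig n t\<bar> \<le> 2"
proof -
  have "\<bar>sin (2 * pi * t)\<bar> \<le> 1" "\<bar>cos (2 * pi * t)\<bar> \<le> 1" by simp_all
  then show ?thesis unfolding trig_def by (smt (verit))
qed

lemma sum_multiples_inverse_le:
  assumes "d > 0" "k > 0"
  shows "(\<Sum>h\<in>{h\<in>{1..k}. d dvd h}. 1 / real h) \<le> (1 + ln (real k)) / real d"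
proof -
  have "(\<Sum>h\<in>{h\<in>{1..k}. d dvd h}. 1 / real h) = (\<Sum>i=1..k div d. 1 / real (d * i))"
    by (rule sum.reindex_bij_witness[of _ "\<lambda>i. d * i" "\<lambda>h. h div d"])
       (use assms in \<open>auto elim!: dvdE simp: div_le_mono Suc_le_eq less_eq_div_iff_mult_less_eq mult.commute\<close>)
  also have "\<dots> = (\<Sum>i=1..k div d. 1 / real i) / real d"
    by (simp add: sum_divide_distrib mult.commute)
  also have "\<dots> \<le> (1 + ln (real k)) / real d"
  proof (cases "k div d \<ge> 1")
    case True
    have "(\<Sum>i=1..k div d. 1 / real i) \<le> 1 + ln (real (k div d))" by (rule sum_inverse_le_ln[OF True])
    also have "\<dots> \<le> 1 + ln (real k)"
    proof (intro add_left_mono ln_mono)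
      show "0 < real (k div d)" using True by linarith
      show "real (k div d) \<le> real k" by (simp only: of_nat_le_iff div_le_dividend)
    qed
    finally show ?thesis by (intro divide_right_mono) auto
  next
    case False
    then have "k div d = 0" by simp
    then have "(\<Sum>i=1..k div d. 1 / real i) = 0" by simp
    moreover have "(1 + ln (real k)) / real d \<ge> 0" using assms by (intro divide_nonneg_nonneg add_nonneg_nonneg ln_ge_zero) auto
    ultimately show ?thesis by simp
  qed
  finally show ?thesis .
qed

text \<open>The expansion with as many terms as the modulus. For each \<open>d\<close>, the
  reciprocals of the multiples of \<open>d^2\<close> give \<open>sqrt k / d\<close> and the
  truncation error gives \<open>d\<close>, both up to a logarithm; together they form
  \<open>div_weight\<close>.\<close>

theorem polya_vinogradov:
  assumes o: "odd k" and Z: "Z \<ge> 0"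
  shows "\<bar>jkernel_sum k Z - Z * square_ind k\<bar> \<le> 10 * (1 + ln (real k)) * div_weight k"
proof -
  have k: "k > 0" using o by (simp add: odd_pos)
  define L where "L = 1 + ln (real k)"
  have L: "L \<ge> 1" using k by (simp add: L_def)
  define D where "D = {d :: nat. d ^ 2 dvd k}"
  have fin: "finite D" unfolding D_def by (rule finite_square_divisors[OF k])
  have dpos: "d > 0" if "d \<in> D" for d using that k by (auto simp: D_def intro!: Nat.gr0I)
  define S where "S = (\<Sum>h=1..k. real_of_int (jkernel (int h) k) / real h * trig k (real h * Z / real k))"
  have jk: "\<bar>real_of_int (jkernel (int r) k)\<bar> \<le> (\<Sum>d\<in>D. if d ^ 2 dvd r then real d else 0)" for r
  proof -
    have "\<bar>jkernel (int r) k\<bar> \<le> (\<Sum>d | d ^ 2 dvd k \<and> int d ^ 2 dvd int r. int d)" by (rule abs_jkernel_le[OF o])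
    also have "{d. d ^ 2 dvd k \<and> int d ^ 2 dvd int r} = {d \<in> D. d ^ 2 dvd r}"
      by (auto simp: D_def simp flip: of_nat_power)
    finally have "real_of_int \<bar>jkernel (int r) k\<bar> \<le> real_of_int (\<Sum>d\<in>{d \<in> D. d ^ 2 dvd r}. int d)"
      by (simp only: of_int_le_iff)
    also have "\<dots> = (\<Sum>d\<in>{d \<in> D. d ^ 2 dvd r}. real d)" by simp
    also have "\<dots> = (\<Sum>d\<in>D. if d ^ 2 dvd r then real d else 0)" by (rule sum.inter_filter[OF fin])
    finally show ?thesis by simp
  qed
  have "\<bar>S\<bar> \<le> (\<Sum>h=1..k. \<bar>real_of_int (jkernel (int h) k) / real h * trig k (real h * Z / real k)\<bar>)"
    unfolding S_def by (rule sum_abs)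
  also have "\<dots> \<le> (\<Sum>h=1..k. (\<Sum>d\<in>D. if d ^ 2 dvd h then real d else 0) * (1 / real h) * 2)"
  proof (rule sum_mono)
    fix h
    have "\<bar>real_of_int (jkernel (int h) k)\<bar> * (1 / real h) * \<bar>trig k (real h * Z / real k)\<bar>
        \<le> (\<Sum>d\<in>D. if d ^ 2 dvd h then real d else 0) * (1 / real h) * 2"
      using order.trans[OF abs_ge_zero jk[of h]]
      by (intro mult_mono jk trig_bounds) auto
    then show "\<bar>real_of_int (jkernel (int h) k) / real h * trig k (real h * Z / real k)\<bar>
        \<le> (\<Sum>d\<in>D. if d ^ 2 dvd h then real d else 0) * (1 / real h) * 2"
      by (simp add: abs_mult)
  qed
  also have "\<dots> = 2 * (\<Sum>h=1..k. \<Sum>d\<in>D. real d * (if d ^ 2 dvd h then 1 / real h else 0))"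
    by (simp add: sum_distrib_left sum_distrib_right mult_ac if_distrib cong: if_cong)
  also have "\<dots> = 2 * (\<Sum>d\<in>D. \<Sum>h=1..k. real d * (if d ^ 2 dvd h then 1 / real h else 0))"
    by (subst sum.swap) (rule refl)
  also have "\<dots> = 2 * (\<Sum>d\<in>D. real d * (\<Sum>h\<in>{h\<in>{1..k}. d ^ 2 dvd h}. 1 / real h))"
    unfolding sum_distrib_left[symmetric] by (subst sum.inter_filter) auto
  also have "\<dots> \<le> 2 * (\<Sum>d\<in>D. real d * (L / real (d ^ 2)))"
    unfolding L_def using dpos k
    by (intro mult_left_mono sum_mono sum_multiples_inverse_le) auto
  also have "\<dots> = 2 * (\<Sum>d\<in>D. L / real d)"
    using dpos by (intro arg_cong[where f = "times 2"] sum.cong) (auto simp: power2_eq_square)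
  finally have S: "\<bar>S\<bar> \<le> 2 * (\<Sum>d\<in>D. L / real d)" .
  have "\<bar>sqrt (real k) / pi * S\<bar> = sqrt (real k) * \<bar>S\<bar> / pi" by (simp add: abs_mult)
  also have "\<dots> \<le> sqrt (real k) * (2 * (\<Sum>d\<in>D. L / real d)) / pi"
    using S by (intro divide_right_mono mult_left_mono) auto
  also have "\<dots> \<le> sqrt (real k) * (2 * (\<Sum>d\<in>D. L / real d)) / 2"
    using pi_ge_two L by (intro divide_left_mono mult_nonneg_nonneg sum_nonneg) auto
  also have "\<dots> = (\<Sum>d\<in>D. L * (sqrt (real k) / real d))"
    by (simp add: sum_distrib_left mult_ac)
  finally have 1: "\<bar>sqrt (real k) / pi * S\<bar> \<le> (\<Sum>d\<in>D. L * (sqrt (real k) / real d))" .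
  have "2 * polya_err k k \<le> 2 * (\<Sum>d\<in>D. 5 * (L * real d))"
    unfolding polya_err_def D_def[symmetric]
  proof (intro mult_left_mono sum_mono)
    fix d assume d: "d \<in> D"
    have "1 \<le> real d ^ 2" using dpos[OF d] by simp
    then have "1 / real d ^ 2 \<le> 1 / 1" by (intro divide_left_mono) (use dpos[OF d] in auto)
    then have "1 / real d ^ 2 * L \<le> 1 * L"
      using L by (intro mult_right_mono) auto
    then have "4 + real k / real d ^ 2 / real k * L \<le> 5 * L" using k L by simp
    then have "real d * (4 + real k / real d ^ 2 / real k * L) \<le> real d * (5 * L)" by (intro mult_left_mono) auto
    then show "real d * (4 + real k / real d ^ 2 / real k * (1 + ln (real k))) \<le> 5 * (L * real d)"
      by (simp add: L_def mult_ac)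
  qed auto
  also have "\<dots> = (\<Sum>d\<in>D. 10 * (L * real d))" by (simp add: sum_distrib_left)
  finally have 2: "2 * polya_err k k \<le> (\<Sum>d\<in>D. 10 * (L * real d))" .
  have "\<bar>jkernel_sum k Z - Z * square_ind k - sqrt (real k) / pi * S\<bar> \<le> 2 * polya_err k k"
    unfolding S_def by (rule polya_expansion[OF o Z k])
  moreover have "\<bar>a\<bar> \<le> p + q" if "\<bar>a - x\<bar> \<le> r" "\<bar>x\<bar> \<le> p" "r \<le> q" for a x p q r :: real
    using that by linarith
  ultimately have "\<bar>jkernel_sum k Z - Z * square_ind k\<bar> \<le> (\<Sum>d\<in>D. L * (sqrt (real k) / real d)) + (\<Sum>d\<in>D. 10 * (L * real d))"
    using 1 2 by blast
  also have "\<dots> \<le> (\<Sum>d\<in>D. 10 * L * (sqrt (real k) / real d + real d))"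
    unfolding sum.distrib[symmetric]
  proof (rule sum_mono)
    fix d
    have "0 \<le> L * (sqrt (real k) / real d)" using L by simp
    moreover have "10 * L * (sqrt (real k) / real d + real d) = 10 * (L * (sqrt (real k) / real d)) + 10 * (L * real d)"
      by (simp only: distrib_left mult.assoc)
    ultimately show "L * (sqrt (real k) / real d) + 10 * (L * real d) \<le> 10 * L * (sqrt (real k) / real d + real d)"
      by linarith
  qed
  also have "\<dots> = 10 * L * div_weight k" by (simp add: div_weight_def D_def sum_distrib_left)
  finally show ?thesis by (simp add: L_def)
qed

lemma residue_class_8_sum:
  fixes f :: "nat \<Rightarrow> real"
  assumes "1 \<le> c" "c \<le> 7"
  shows "(\<Sum>n\<in>{n\<in>{1..N}. n mod 8 = c}. f n) = (\<Sum>i<(N + 8 - c) div 8. f (8 * i + c))"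
proof (rule sum.reindex_bij_witness[of _ "\<lambda>i. 8 * i + c" "\<lambda>n. n div 8"])
  fix n assume n: "n \<in> {n\<in>{1..N}. n mod 8 = c}"
  then have "n = 8 * (n div 8) + c" by (metis (mono_tags, lifting) mem_Collect_eq mult_div_mod_eq)
  then show "8 * (n div 8) + c = n" "f (8 * (n div 8) + c) = f n" by simp_all
  have "n \<le> N" using n by simp
  with \<open>n = 8 * (n div 8) + c\<close> show "n div 8 \<in> {..<(N + 8 - c) div 8}" using assms by auto
next
  fix i assume i: "i \<in> {..<(N + 8 - c) div 8}"
  show "(8 * i + c) div 8 = i" using assms by simp
  have "8 * i + c \<le> N" using i assms by auto
  then show "8 * i + c \<in> {n \<in> {1..N}. n mod 8 = c}" using assms by auto
qed

text \<open>
  Reciprocity needs odd arguments; writing \<open>8j + c \<equiv> 8 (j + t) (mod k)\<close> turns a progression modulo 8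
  into an interval.
\<close>

lemma jkernel_sum_class_8:
  assumes o: "odd k" and c: "c \<in> {1, 3, 5, 7}"
  shows "\<bar>(\<Sum>n\<in>{n\<in>{1..N}. n mod 8 = c}. real_of_int (jkernel (int n) k))
            - square_ind k * (real N / 8)\<bar> \<le> 20 * (1 + ln (real k)) * div_weight k + 1"
proof -
  have k: "k > 0" using o by (simp add: odd_pos)
  define M where "M = (N + 8 - c) div 8"
  have cop8: "coprime 8 (int k)"
  proof -
    have "coprime 2 (int k)" using o by simp
    then have "coprime (2 ^ 3) (int k)" by (intro coprime_power_left_iff[THEN iffD2] disjI1)
    then show ?thesis by simp
  qed
  obtain u where u: "[8 * u = 1] (mod int k)" using cop8 by (metis cong_solve_coprime_int)
  \<comment> \<open>A representative of \<open>c / 8\<close> modulo \<open>k\<close>; adding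
    \<open>k\<close> makes it positive, so that \<open>t - 1\<close> is a true difference.\<close>
  define t where "t = nat ((int c * u) mod int k) + k"
  have t1: "t \<ge> 1" using k by (simp add: t_def)
  have ct: "[int c = 8 * int t] (mod int k)"
  proof -
    have "[int t = int c * u] (mod int k)" using k by (simp add: t_def cong_def)
    then have "[8 * int t = int c * (8 * u)] (mod int k)"
      by (metis cong_scalar_left mult.left_commute)
    moreover have "[int c * (8 * u) = int c * 1] (mod int k)" using u by (rule cong_scalar_left)
    ultimately show ?thesis by (metis cong_sym cong_trans mult.right_neutral)
  qed
  have jk: "jkernel (int (8 * i + c)) k = Jacobi 8 k * jkernel (int (i + t)) k" for i
  proof -
    have "[int (8 * i + c) = 8 * int (i + t)] (mod int k)"
      using cong_add[OF cong_refl[of "8 * int i" "int k"] ct] by (simp add: algebra_simps)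
    then have "jkernel (int (8 * i + c)) k = jkernel (8 * int (i + t)) k" by (rule jkernel_cong[OF o])
    also have "\<dots> = Jacobi 8 k * jkernel (int (i + t)) k" by (rule jkernel_mult_coprime_left[OF o cop8])
    finally show ?thesis .
  qed
  define B where "B = 10 * (1 + ln (real k)) * div_weight k"
  have js: "jkernel_sum k (real (M + t - 1)) - jkernel_sum k (real (t - 1)) = (\<Sum>i<M. real_of_int (jkernel (int (i + t)) k))"
  proof -
    have "{1..M + t - 1} = {1..t - 1} \<union> {t..<M + t}" using t1 by auto
    then have "(\<Sum>m=1..M + t - 1. real_of_int (jkernel (int m) k))
        = (\<Sum>m=1..t - 1. real_of_int (jkernel (int m) k)) + (\<Sum>m\<in>{t..<M + t}. real_of_int (jkernel (int m) k))"
      using t1 by (simp only:) (rule sum.union_disjoint, auto)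
    moreover have "(\<Sum>m\<in>{t..<M + t}. real_of_int (jkernel (int m) k)) = (\<Sum>i<M. real_of_int (jkernel (int (i + t)) k))"
      by (rule sum.reindex_bij_witness[of _ "\<lambda>i. i + t" "\<lambda>m. m - t"]) auto
    ultimately show ?thesis by (simp add: jkernel_sum_def)
  qed
  have "\<bar>jkernel_sum k (real (M + t - 1)) - real (M + t - 1) * square_ind k\<bar> \<le> B"
    "\<bar>jkernel_sum k (real (t - 1)) - real (t - 1) * square_ind k\<bar> \<le> B"
    unfolding B_def by (rule polya_vinogradov[OF o]; simp)+
  moreover have "real (M + t - 1) * square_ind k - real (t - 1) * square_ind k = real M * square_ind k"
    using t1 by (simp add: of_nat_diff algebra_simps)
  ultimately have b: "\<bar>(\<Sum>i<M. real_of_int (jkernel (int (i + t)) k)) - real M * square_ind k\<bar> \<le> 2 * B"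
    unfolding js[symmetric] by linarith
  have "(\<Sum>n\<in>{n\<in>{1..N}. n mod 8 = c}. real_of_int (jkernel (int n) k))
     = real_of_int (Jacobi 8 k) * (\<Sum>i<M. real_of_int (jkernel (int (i + t)) k))"
  proof -
    have "1 \<le> c" "c \<le> 7" using c by auto
    from residue_class_8_sum[OF this, of "\<lambda>n. real_of_int (jkernel (int n) k)" N]
    show ?thesis by (simp only: M_def[symmetric] jk of_int_mult sum_distrib_left[symmetric])
  qed
  \<comment> \<open>The mean is present only for square \<open>k\<close>, and there
    \<open>(8 | k) = 1\<close>; so the twist does not alter it.\<close>
  moreover have "real_of_int (Jacobi 8 k) * (real M * square_ind k) = real M * square_ind k"
  proof (cases "\<exists>s. k = s ^ 2")
    case True
    then obtain s where s: "k = s ^ 2" "odd s" using o by auto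
    then have "coprime 8 (int s)" using cop8 by simp
    then have "Jacobi 8 k = 1" using s by (simp add: Jacobi_square_right)
    then show ?thesis by simp
  qed (simp add: square_ind_def)
  moreover have "\<bar>real_of_int (Jacobi 8 k)\<bar> \<le> 1" using Jacobi_values[OF o, of 8] by auto
  ultimately have "\<bar>(\<Sum>n\<in>{n\<in>{1..N}. n mod 8 = c}. real_of_int (jkernel (int n) k)) - real M * square_ind k\<bar> \<le> 1 * (2 * B)"
  proof -
    assume a: "(\<Sum>n\<in>{n\<in>{1..N}. n mod 8 = c}. real_of_int (jkernel (int n) k))
     = real_of_int (Jacobi 8 k) * (\<Sum>i<M. real_of_int (jkernel (int (i + t)) k))"
     and b': "real_of_int (Jacobi 8 k) * (real M * square_ind k) = real M * square_ind k"
     and c': "\<bar>real_of_int (Jacobi 8 k)\<bar> \<le> 1"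
    have "(\<Sum>n\<in>{n\<in>{1..N}. n mod 8 = c}. real_of_int (jkernel (int n) k)) - real M * square_ind k
       = real_of_int (Jacobi 8 k) * ((\<Sum>i<M. real_of_int (jkernel (int (i + t)) k)) - real M * square_ind k)"
      unfolding a using b' by (simp add: algebra_simps)
    then show ?thesis using b c' by (simp only: abs_mult) (intro mult_mono, auto)
  qed
  moreover have "\<bar>real M - real N / 8\<bar> \<le> 1"
  proof -
    have "8 * M \<le> N + 8" "N \<le> 8 * M + 8" using c unfolding M_def by auto
    then have "real (8 * M) \<le> real (N + 8)" "real N \<le> real (8 * M + 8)" by (simp_all only: of_nat_le_iff)
    then show ?thesis by (simp add: abs_le_iff)
  qed
  then have "\<bar>real M * square_ind k - square_ind k * (real N / 8)\<bar> \<le> 1" by (simp add: square_ind_def)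
  ultimately show ?thesis unfolding B_def by linarith
qed

lemma square_ind_mult_square: "s > 0 \<Longrightarrow> square_ind (s ^ 2 * n) = square_ind n"
proof -
  assume s: "s > 0"
  have "(\<exists>t. s ^ 2 * n = t ^ 2) \<longleftrightarrow> (\<exists>t. n = t ^ 2)"
  proof
    assume "\<exists>t. s ^ 2 * n = t ^ 2"
    then obtain t where t: "s ^ 2 * n = t ^ 2" by blast
    then have "s ^ 2 dvd t ^ 2" by (metis dvd_triv_left)
    then have "s dvd t" by simp
    then obtain v where "t = s * v" by auto
    then have "n = v ^ 2" using t s by (simp add: power_mult_distrib)
    then show "\<exists>t. n = t ^ 2" by blast
  qed (metis power_mult_distrib)
  then show ?thesis by (simp add: square_ind_def)
qed

lemma square_ind_2_mult_odd: "odd n \<Longrightarrow> square_ind (2 * n) = 0"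
proof -
  assume "odd n"
  have "2 * n \<noteq> t ^ 2" for t
  proof
    assume t: "2 * n = t ^ 2"
    then have "even (t ^ 2)" by (metis dvd_triv_left)
    then have "even t" by simp
    then have "4 dvd t ^ 2" by (auto elim!: evenE simp: power_mult_distrib)
    then have "2 dvd n" using t by presburger
    with \<open>odd n\<close> show False by simp
  qed
  then show ?thesis by (simp add: square_ind_def)
qed

text \<open>With \<open>k = 2^j * k'\<close> the symbol is, on each class modulo 8, a constant sign
  times the kernel with the two arguments exchanged. For even \<open>j\<close> the means of the
  classes \<open>e\<close> and \<open>e + 4\<close> add up. For odd \<open>j\<close> the symbol
  \<open>(2 | n)\<close> has opposite signs on them, so the means cancel, in accordance with
  \<open>k\<close> not being a square.\<close>

theorem jkernel_column_sum:
  assumes k: "k > 0" and e: "e \<in> {1, 3}"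
  shows "\<bar>(\<Sum>n\<in>{n\<in>{1..N}. n mod 4 = e}. real_of_int (jkernel (int k) n)) - square_ind k * (real N / 4)\<bar>
     \<le> 42 * (1 + ln (real k)) * div_weight k"
proof -
  have "k \<noteq> 0" using k by simp
  then obtain k' where k': "k = 2 ^ multiplicity 2 k * k'" "odd k'"
    using multiplicity_decompose'[of k 2] by auto
  define j where "j = multiplicity 2 k"
  have kj: "k = 2 ^ j * k'" using k'(1) by (simp add: j_def)
  have k'0: "k' > 0" using k' by (simp add: odd_pos)
  define s where "s c = (if c = 1 \<or> c = 7 then 1 else -1 :: int)" for c :: nat
  define S where "S c = (\<Sum>n\<in>{n\<in>{1..N}. n mod 8 = c}. real_of_int (jkernel (int k) n))" for c
  define B where "B = 20 * (1 + ln (real k')) * div_weight k' + 1"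
  have cls: "\<bar>S c - real_of_int (s c) ^ j * square_ind k' * (real N / 8)\<bar> \<le> B" if c: "c \<in> {1, 3, 5, 7}" for c
  proof -
    define \<rho> where "\<rho> = s c ^ j * recip_sign k' c"
    have jk: "jkernel (int k) n = \<rho> * jkernel (int n) k'" if n: "n mod 8 = c" for n
    proof -
      have on: "odd n" using n c by (auto; presburger)
      have "jkernel (int k) n = Jacobi (2 ^ j) n * jkernel (int k') n"
        using jkernel_mult_coprime_left[OF on, of "2 ^ j" "int k'"] on by (simp add: kj)
      also have "Jacobi (2 ^ j) n = Jacobi 2 n ^ j"
        using on by (induction j) (simp_all add: Jacobi_mult_left)
      also have "Jacobi 2 n = s c" using n c by (simp add: Jacobi_2[OF on] s_def)
      also have "jkernel (int k') n = recip_sign k' n * jkernel (int n) k'"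
        by (rule jkernel_reciprocity[OF k'(2) on])
      also have "recip_sign k' n = recip_sign k' c"
      proof -
        have "n mod 4 = c mod 4" using n by (metis mod_mod_cancel dvd_triv_left[of 4 2] numeral_times_numeral semiring_norm(13) semiring_norm(11) mod_double_nat[of n 4] even_numeral)
        then show ?thesis by (simp add: recip_sign_def)
      qed
      finally show ?thesis by (simp add: \<rho>_def)
    qed
    have abs\<rho>: "\<bar>real_of_int \<rho>\<bar> = 1" by (simp add: \<rho>_def s_def recip_sign_def abs_mult power_abs)
    have \<rho>sq: "real_of_int \<rho> * square_ind k' = real_of_int (s c) ^ j * square_ind k'"
    proof (cases "\<exists>s. k' = s ^ 2")
      case True
      then obtain s where "k' = s ^ 2" "odd s" using k' by auto
      then have "k' mod 8 = 1" using odd_square_mod_8 by simp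
      then have "k' mod 4 \<noteq> 3" by presburger
      then show ?thesis by (simp add: \<rho>_def recip_sign_def)
    qed (simp add: square_ind_def)
    have "S c = real_of_int \<rho> * (\<Sum>n\<in>{n\<in>{1..N}. n mod 8 = c}. real_of_int (jkernel (int n) k'))"
      unfolding S_def sum_distrib_left by (intro sum.cong refl) (simp add: jk)
    then have "S c - real_of_int (s c) ^ j * square_ind k' * (real N / 8)
       = real_of_int \<rho> * ((\<Sum>n\<in>{n\<in>{1..N}. n mod 8 = c}. real_of_int (jkernel (int n) k')) - square_ind k' * (real N / 8))"
      unfolding \<rho>sq[symmetric] by (simp add: algebra_simps)
    then show ?thesis using jkernel_sum_class_8[OF k'(2) c, of N] abs\<rho> by (simp add: abs_mult B_def)
  qed
  have e4: "e \<in> {1, 3, 5, 7}" "e + 4 \<in> {1, 3, 5, 7}" using e by auto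
  have "{n\<in>{1..N}. n mod 4 = e} = {n\<in>{1..N}. n mod 8 = e} \<union> {n\<in>{1..N}. n mod 8 = e + 4}"
    using e by (auto; presburger)
  then have "(\<Sum>n\<in>{n\<in>{1..N}. n mod 4 = e}. real_of_int (jkernel (int k) n)) = S e + S (e + 4)"
    unfolding S_def by (simp only:) (rule sum.union_disjoint, auto)
  moreover have "real_of_int (s e) ^ j * square_ind k' * (real N / 8) + real_of_int (s (e + 4)) ^ j * square_ind k' * (real N / 8)
      = square_ind k * (real N / 4)"
  proof (cases "even j")
    case True
    then obtain i where i: "j = 2 * i" by auto
    have "square_ind k = square_ind k'"
      using square_ind_mult_square[of "2 ^ i" k'] by (simp add: kj i power_mult mult.commute[of 2] flip: power_mult)
    moreover have "real_of_int (s c) ^ j = 1" for c using True by (simp add: s_def)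
    ultimately show ?thesis by simp
  next
    case False
    then obtain i where i: "j = 2 * i + 1" by (auto elim: oddE)
    have "k = (2 ^ i) ^ 2 * (2 * k')" by (simp add: kj i power_mult mult.commute[of 2 i] flip: power_mult)
    then have "square_ind k = 0"
      using square_ind_mult_square[of "2 ^ i" "2 * k'"] square_ind_2_mult_odd[OF k'(2)] by simp
    moreover have "s (e + 4) = - s e" using e by (auto simp: s_def)
    ultimately show ?thesis using False by simp
  qed
  ultimately have "\<bar>(\<Sum>n\<in>{n\<in>{1..N}. n mod 4 = e}. real_of_int (jkernel (int k) n)) - square_ind k * (real N / 4)\<bar> \<le> 2 * B"
    using cls[OF e4(1)] cls[OF e4(2)] by linarith
  also have "\<dots> \<le> 42 * (1 + ln (real k)) * div_weight k"
  proof -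
    have "k' dvd k" by (simp add: kj)
    then have "k' \<le> k" using k by (intro dvd_imp_le)
    then have ln: "1 + ln (real k') \<le> 1 + ln (real k)" "1 + ln (real k') \<ge> 1" using k'0 by simp_all
    have "(1 + ln (real k')) * div_weight k' \<le> (1 + ln (real k)) * div_weight k"
      using ln div_weight_mono_dvd[OF \<open>k' dvd k\<close> k] div_weight_ge_1[OF k'0] by (intro mult_mono) auto
    moreover have "1 * 1 \<le> (1 + ln (real k)) * div_weight k"
      using ln div_weight_ge_1[OF k] by (intro mult_mono) auto
    moreover have "2 * (20 * x + 1) \<le> 42 * y" if "x \<le> y" "1 * 1 \<le> y" for x y :: real
      using that by (simp add: algebra_simps)
    ultimately show ?thesis unfolding B_def mult.assoc by blast
  qed
  finally show ?thesis .
qed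

section \<open>Partial summation and the function C\<close>

text \<open>The summatory function is a finite sum of step functions, so its integral against
  \<open>\<phi>'\<close> is computed term by term. Subtracting the same formula for
  \<open>l * t\<close> leaves an integrand bounded by \<open>E * M\<close> and two boundary
  terms.\<close>

theorem abel_summation_bound:
  fixes c :: "nat \<Rightarrow> real" and \<phi> \<phi>' :: "real \<Rightarrow> real"
  assumes ab: "0 \<le> a" "a \<le> b"
    and d: "\<And>t. t \<in> {a..b} \<Longrightarrow> (\<phi> has_real_derivative \<phi>' t) (at t within {a..b})"
    and F: "\<And>t. t \<in> {a..b} \<Longrightarrow> \<bar>(\<Sum>n=1..nat \<lfloor>t\<rfloor>. c n) - l * t\<bar> \<le> E"
    and M: "\<And>t. t \<in> {a..b} \<Longrightarrow> \<bar>\<phi>' t\<bar> \<le> M"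
  shows "\<bar>(\<Sum>n\<in>{n. a < real n \<and> real n \<le> b}. c n * \<phi> (real n)) - l * integral {a..b} \<phi>\<bar>
           \<le> E * (\<bar>\<phi> a\<bar> + \<bar>\<phi> b\<bar> + (b - a) * M)"
proof -
  define N where "N = {n :: nat. a < real n \<and> real n \<le> b}"
  have finN: "finite N"
    by (rule finite_subset[of _ "{..nat \<lfloor>b\<rfloor>}"]) (auto simp: N_def le_nat_floor)
  define A where "A t = (\<Sum>n=1..nat \<lfloor>t\<rfloor>. c n)" for t :: real
  have A_eq: "A t = A a + (\<Sum>n\<in>N. if real n \<le> t then c n else 0)" if t: "t \<in> {a..b}" for t
  proof -
    have fl: "n \<le> nat \<lfloor>x\<rfloor> \<longleftrightarrow> real n \<le> x" if "x \<ge> 0" for n x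
      using that by (metis le_nat_floor le_nat_iff le_floor_iff of_int_of_nat_eq zero_le_floor)
    have "{1..nat \<lfloor>t\<rfloor>} = {1..nat \<lfloor>a\<rfloor>} \<union> {n \<in> N. real n \<le> t}"
      using t ab by (auto simp: N_def fl)
    then have "A t = (\<Sum>n\<in>{1..nat \<lfloor>a\<rfloor>} \<union> {n \<in> N. real n \<le> t}. c n)" by (simp only: A_def)
    also have "\<dots> = A a + (\<Sum>n\<in>{n \<in> N. real n \<le> t}. c n)"
      unfolding A_def using finN by (intro sum.union_disjoint) (use ab in \<open>auto simp: fl\<close>, auto simp: N_def)
    also have "(\<Sum>n\<in>{n \<in> N. real n \<le> t}. c n) = (\<Sum>n\<in>N. if real n \<le> t then c n else 0)"
      by (rule sum.inter_filter[OF finN])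
    finally show ?thesis .
  qed
  have ftc: "(\<phi>' has_integral (\<phi> y - \<phi> x)) {x..y}" if "a \<le> x" "x \<le> y" "y \<le> b" for x y
  proof (rule fundamental_theorem_of_calculus[OF that(2)])
    fix t assume t: "t \<in> {x..y}"
    have "(\<phi> has_real_derivative \<phi>' t) (at t within {x..y})"
      by (rule DERIV_subset[OF d]) (use that t in auto)
    then show "(\<phi> has_vector_derivative \<phi>' t) (at t within {x..y})"
      by (simp add: has_real_derivative_iff_has_vector_derivative)
  qed
  have phi_cont: "continuous_on {a..b} \<phi>"
    unfolding continuous_on_eq_continuous_within using d DERIV_continuous by blast
  have I1: "((\<lambda>t. if real n \<le> t then c n * \<phi>' t else 0) has_integral c n * (\<phi> b - \<phi> (real n))) {a..b}" if n: "n \<in> N" for n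
  proof -
    have "((\<lambda>t. c n * \<phi>' t) has_integral c n * (\<phi> b - \<phi> (real n))) {real n..b}"
      using n by (intro has_integral_mult_right ftc) (auto simp: N_def)
    then have "((\<lambda>t. if t \<in> {real n..b} then c n * \<phi>' t else 0) has_integral c n * (\<phi> b - \<phi> (real n))) {a..b}"
      using n by (subst has_integral_restrict) (auto simp: N_def)
    then show ?thesis
      by (rule has_integral_eq[rotated]) (use n in \<open>auto simp: N_def\<close>)
  qed
  have "((\<lambda>t. \<Sum>n\<in>N. if real n \<le> t then c n * \<phi>' t else 0) has_integral (\<Sum>n\<in>N. c n * (\<phi> b - \<phi> (real n)))) {a..b}"
    by (intro has_integral_sum finN I1)
  moreover have "((\<lambda>t. A a * \<phi>' t) has_integral A a * (\<phi> b - \<phi> a)) {a..b}"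
    using ab by (intro has_integral_mult_right ftc) auto
  ultimately have I2: "((\<lambda>t. A a * \<phi>' t + (\<Sum>n\<in>N. if real n \<le> t then c n * \<phi>' t else 0)) has_integral
      (A a * (\<phi> b - \<phi> a) + (\<Sum>n\<in>N. c n * (\<phi> b - \<phi> (real n))))) {a..b}"
    by (intro has_integral_add)
  have I3: "((\<lambda>t. A t * \<phi>' t) has_integral (A a * (\<phi> b - \<phi> a) + (\<Sum>n\<in>N. c n * (\<phi> b - \<phi> (real n))))) {a..b}"
  proof (rule has_integral_eq[OF _ I2])
    fix t assume t: "t \<in> {a..b}"
    show "A a * \<phi>' t + (\<Sum>n\<in>N. if real n \<le> t then c n * \<phi>' t else 0) = A t * \<phi>' t"
      unfolding A_eq[OF t] distrib_right sum_distrib_right by (intro arg_cong2[where f = "(+)"] sum.cong) auto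
  qed
  have "((\<lambda>t. t * \<phi>' t + 1 * \<phi> t) has_integral (b * \<phi> b - a * \<phi> a)) {a..b}"
  proof (rule fundamental_theorem_of_calculus[OF ab(2)])
    fix x assume x: "x \<in> {a..b}"
    show "((\<lambda>t. t * \<phi> t) has_vector_derivative x * \<phi>' x + 1 * \<phi> x) (at x within {a..b})"
      unfolding has_real_derivative_iff_has_vector_derivative[symmetric]
      using DERIV_mult[OF DERIV_ident d[OF x]] by (simp add: algebra_simps)
  qed
  moreover have "(\<phi> has_integral integral {a..b} \<phi>) {a..b}"
    using phi_cont by (intro integrable_integral integrable_continuous_interval)
  ultimately have "((\<lambda>t. (t * \<phi>' t + 1 * \<phi> t) - \<phi> t) has_integral (b * \<phi> b - a * \<phi> a - integral {a..b} \<phi>)) {a..b}"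
    by (intro has_integral_diff)
  then have I4: "((\<lambda>t. l * (t * \<phi>' t)) has_integral l * (b * \<phi> b - a * \<phi> a - integral {a..b} \<phi>)) {a..b}"
    by (intro has_integral_mult_right) simp
  define R where "R = (A a * (\<phi> b - \<phi> a) + (\<Sum>n\<in>N. c n * (\<phi> b - \<phi> (real n)))) - l * (b * \<phi> b - a * \<phi> a - integral {a..b} \<phi>)"
  have I5: "((\<lambda>t. A t * \<phi>' t - l * (t * \<phi>' t)) has_integral R) {a..b}"
    unfolding R_def by (intro has_integral_diff I3 I4)
  have E0: "E \<ge> 0" using F[of a] ab by auto
  have "norm R \<le> (E * M) * measure lborel (cbox a b)"
  proof (rule has_integral_bound)
    show "0 \<le> E * M" using E0 M[of a] ab by auto
    show "((\<lambda>t. A t * \<phi>' t - l * (t * \<phi>' t)) has_integral R) (cbox a b)" using I5 by simp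
    fix t assume t: "t \<in> cbox a b"
    have "\<bar>A t - l * t\<bar> * \<bar>\<phi>' t\<bar> \<le> E * M"
      using F[of t] M[of t] t E0 by (intro mult_mono) (auto simp: A_def)
    then show "norm (A t * \<phi>' t - l * (t * \<phi>' t)) \<le> E * M"
      by (simp add: abs_mult[symmetric] algebra_simps)
  qed
  then have R: "\<bar>R\<bar> \<le> E * ((b - a) * M)" using ab by (simp add: mult_ac)
  define S where "S = (\<Sum>n\<in>N. c n * \<phi> (real n))"
  have Ab: "A b = A a + (\<Sum>n\<in>N. c n)"
  proof -
    have "(\<Sum>n\<in>N. if real n \<le> b then c n else 0) = (\<Sum>n\<in>N. c n)"
      by (intro sum.cong) (auto simp: N_def)
    then show ?thesis using A_eq[of b] ab by simp
  qed
  have "(\<Sum>n\<in>N. c n * (\<phi> b - \<phi> (real n))) = (\<Sum>n\<in>N. c n) * \<phi> b - S"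
    by (simp add: S_def right_diff_distrib sum_subtractf sum_distrib_right)
  then have "S - l * integral {a..b} \<phi> = (A b - l * b) * \<phi> b - (A a - l * a) * \<phi> a - R"
    by (simp add: R_def Ab algebra_simps)
  moreover have "\<bar>(A b - l * b) * \<phi> b\<bar> \<le> E * \<bar>\<phi> b\<bar>" "\<bar>(A a - l * a) * \<phi> a\<bar> \<le> E * \<bar>\<phi> a\<bar>"
    unfolding abs_mult using F[of a] F[of b] ab by (auto simp: A_def intro!: mult_right_mono)
  ultimately have "\<bar>S - l * integral {a..b} \<phi>\<bar> \<le> E * \<bar>\<phi> b\<bar> + E * \<bar>\<phi> a\<bar> + E * ((b - a) * M)"
    using R by linarith
  then show ?thesis by (simp add: S_def N_def algebra_simps)
qed

section \<open>The oscillating series and the integrals in C\<close>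

lemma inverse_squares_summable: "summable (\<lambda>k. 1 / real (Suc k) ^ 2)"
  using inverse_squares_sums by (simp add: sums_iff add.commute)

lemma inverse_squares_suminf_le: "(\<Sum>k. 1 / real (Suc k) ^ 2) \<le> 2"
proof -
  have "(\<Sum>k. 1 / real (Suc k) ^ 2) = pi ^ 2 / 6"
    using inverse_squares_sums by (simp add: sums_iff add.commute)
  also have "\<dots> \<le> (32 / 10) ^ 2 / 6"
    using pi_approx by (intro divide_right_mono power_mono) auto
  also have "\<dots> \<le> 2" by (simp add: power2_eq_square)
  finally show ?thesis .
qed

lemma inverse_squares_tail:
  assumes "N > 0"
  shows "(\<Sum>k. 1 / real (Suc (k + N)) ^ 2) \<le> 1 / real N"
proof (rule suminf_le_const)
  show "summable (\<lambda>k. 1 / real (Suc (k + N)) ^ 2)"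
    using summable_ignore_initial_segment[OF inverse_squares_summable, of N] by simp
  fix M
  have "(\<Sum>k<M. 1 / real (Suc (k + N)) ^ 2) \<le> 1 / real N - 1 / real (M + N)"
  proof (induction M)
    case (Suc M)
    define x where "x = real (M + N)"
    have x: "x > 0" "real (Suc (M + N)) = x + 1" "real (Suc M + N) = x + 1" using assms by (auto simp: x_def)
    have "1 / (x + 1) ^ 2 \<le> 1 / (x * (x + 1))"
      unfolding power2_eq_square using x(1) by (intro divide_left_mono mult_right_mono mult_pos_pos) auto
    also have "\<dots> = 1 / x - 1 / (x + 1)" using x(1) by (simp add: field_simps)
    finally have "1 / real (Suc (M + N)) ^ 2 \<le> 1 / real (M + N) - 1 / real (Suc M + N)"
      unfolding x(2,3) x_def[symmetric] .
    then show ?case using Suc unfolding sum.lessThan_Suc by linarith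
  qed simp
  also have "\<dots> \<le> 1 / real N" by simp
  finally show "(\<Sum>k<M. 1 / real (Suc (k + N)) ^ 2) \<le> 1 / real N" .
qed

text \<open>The series over \<open>k\<close> taken inside the integrals that define
  \<open>C\<close>: with \<open>u = w / y\<close> it serves both expressions, for
  \<open>\<phi> = osc\<close> and for \<open>\<phi> = sin\<close>.\<close>

definition osc_series :: "(real \<Rightarrow> real) \<Rightarrow> real \<Rightarrow> real" where
  "osc_series \<phi> u = (\<Sum>k. 1 / real (Suc k) ^ 2 * \<phi> (u * real (Suc k) ^ 2))"

lemma osc_series_summable:
  assumes "\<And>x. \<bar>\<phi> x\<bar> \<le> B"
  shows "summable (\<lambda>k. 1 / real (Suc k) ^ 2 * \<phi> (a k))"
proof (rule summable_comparison_test'[of "\<lambda>k. B * (1 / real (Suc k) ^ 2)" 0])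
  show "summable (\<lambda>k. B * (1 / real (Suc k) ^ 2))" by (intro summable_mult inverse_squares_summable)
  fix k
  have "1 / real (Suc k) ^ 2 * \<bar>\<phi> (a k)\<bar> \<le> 1 / real (Suc k) ^ 2 * B"
    using assms by (intro mult_left_mono) auto
  then show "norm (1 / real (Suc k) ^ 2 * \<phi> (a k)) \<le> B * (1 / real (Suc k) ^ 2)"
    by (simp add: abs_mult mult.commute)
qed

text \<open>The series is split near \<open>k = 1 / sqrt u\<close>. Before that point the linear
  bound gives \<open>L * u\<close> per term, after it the tail of the inverse squares is about
  \<open>sqrt u\<close>. The resulting square root makes
  \<open>sqrt y * osc_series \<phi> (w / y)\<close> bounded in \<open>y\<close>.\<close>

lemma osc_series_bound:
  assumes B: "\<And>x. \<bar>\<phi> x\<bar> \<le> B" and L: "\<And>x. x \<ge> 0 \<Longrightarrow> \<bar>\<phi> x\<bar> \<le> L * x" and u: "u > 0"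
  shows "\<bar>osc_series \<phi> u\<bar> \<le> (2 * L + 2 * B) * sqrt u"
proof -
  have B0: "B \<ge> 0" using B[of 0] by linarith
  have L0: "L \<ge> 0" using L[of 1] by linarith
  have sa: "summable (\<lambda>k. 1 / real (Suc k) ^ 2 * \<bar>\<phi> (u * real (Suc k) ^ 2)\<bar>)"
    using osc_series_summable[of "\<lambda>x. \<bar>\<phi> x\<bar>" B] B by simp
  have s0: "sqrt u > 0" using u by simp
  have abs_le: "\<bar>osc_series \<phi> u\<bar> \<le> (\<Sum>k. 1 / real (Suc k) ^ 2 * \<bar>\<phi> (u * real (Suc k) ^ 2)\<bar>)"
    unfolding osc_series_def
    using summable_rabs[of "\<lambda>k. 1 / real (Suc k) ^ 2 * \<phi> (u * real (Suc k) ^ 2)"] sa by (simp add: abs_mult)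
  show ?thesis
  proof (cases "u \<le> 1")
    case False
    have "(\<Sum>k. 1 / real (Suc k) ^ 2 * \<bar>\<phi> (u * real (Suc k) ^ 2)\<bar>) \<le> (\<Sum>k. B * (1 / real (Suc k) ^ 2))"
    proof (rule suminf_le[OF _ sa])
      show "1 / real (Suc k) ^ 2 * \<bar>\<phi> (u * real (Suc k) ^ 2)\<bar> \<le> B * (1 / real (Suc k) ^ 2)" for k
        using B[of "u * real (Suc k) ^ 2"] by (simp add: divide_right_mono)
      show "summable (\<lambda>k. B * (1 / real (Suc k) ^ 2))" by (intro summable_mult inverse_squares_summable)
    qed
    also have "\<dots> = B * (\<Sum>k. 1 / real (Suc k) ^ 2)" by (intro suminf_mult inverse_squares_summable)
    also have "\<dots> \<le> B * 2" using B0 inverse_squares_suminf_le by (intro mult_left_mono)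
    also have "\<dots> \<le> (2 * L + 2 * B) * 1" using L0 by simp
    also have "\<dots> \<le> (2 * L + 2 * B) * sqrt u" using False L0 B0 by (intro mult_left_mono) auto
    finally show ?thesis using abs_le by linarith
  next
    case True
    define N where "N = nat \<lceil>1 / sqrt u\<rceil>"
    have N1: "real N \<ge> 1 / sqrt u" unfolding N_def by linarith
    have N2: "real N \<le> 1 / sqrt u + 1" unfolding N_def using s0 by (simp add: of_nat_nat)
    have N0: "N > 0" using N1 s0 by (cases N) auto
    have "(\<Sum>k. 1 / real (Suc k) ^ 2 * \<bar>\<phi> (u * real (Suc k) ^ 2)\<bar>)
       = (\<Sum>k. 1 / real (Suc (k + N)) ^ 2 * \<bar>\<phi> (u * real (Suc (k + N)) ^ 2)\<bar>) + (\<Sum>k<N. 1 / real (Suc k) ^ 2 * \<bar>\<phi> (u * real (Suc k) ^ 2)\<bar>)"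
      by (rule suminf_split_initial_segment[OF sa])
    also have "(\<Sum>k<N. 1 / real (Suc k) ^ 2 * \<bar>\<phi> (u * real (Suc k) ^ 2)\<bar>) \<le> (\<Sum>k<N. L * u)"
    proof (rule sum_mono)
      fix k
      have "1 / real (Suc k) ^ 2 * \<bar>\<phi> (u * real (Suc k) ^ 2)\<bar> \<le> 1 / real (Suc k) ^ 2 * (L * (u * real (Suc k) ^ 2))"
        using u by (intro mult_left_mono L) auto
      then show "1 / real (Suc k) ^ 2 * \<bar>\<phi> (u * real (Suc k) ^ 2)\<bar> \<le> L * u" by simp
    qed
    also have "(\<Sum>k<N. L * u) = real N * (L * u)" by simp
    also have "\<dots> \<le> (1 / sqrt u + 1) * (L * u)" using N2 L0 u by (intro mult_right_mono) auto
    also have "\<dots> = L * sqrt u + L * (sqrt u * sqrt u)"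
    proof -
      have "(1 / s + 1) * (L * (s * s)) = L * s + L * (s * s)" if "s > 0" for s
        using that by (simp add: field_simps)
      from this[OF s0] show ?thesis using u by simp
    qed
    also have "\<dots> \<le> L * sqrt u + L * (sqrt u * 1)"
      using True u L0 by (intro add_left_mono mult_left_mono) auto
    also have "(\<Sum>k. 1 / real (Suc (k + N)) ^ 2 * \<bar>\<phi> (u * real (Suc (k + N)) ^ 2)\<bar>) \<le> (\<Sum>k. B * (1 / real (Suc (k + N)) ^ 2))"
    proof (rule suminf_le)
      show "1 / real (Suc (k + N)) ^ 2 * \<bar>\<phi> (u * real (Suc (k + N)) ^ 2)\<bar> \<le> B * (1 / real (Suc (k + N)) ^ 2)" for k
        using B[of "u * real (Suc (k + N)) ^ 2"] by (simp add: divide_right_mono)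
      show "summable (\<lambda>k. B * (1 / real (Suc (k + N)) ^ 2))"
        using summable_ignore_initial_segment[OF inverse_squares_summable, of N] by (intro summable_mult) simp
      show "summable (\<lambda>k. 1 / real (Suc (k + N)) ^ 2 * \<bar>\<phi> (u * real (Suc (k + N)) ^ 2)\<bar>)"
        using summable_ignore_initial_segment[OF sa, of N] by simp
    qed
    also have "(\<Sum>k. B * (1 / real (Suc (k + N)) ^ 2)) = B * (\<Sum>k. 1 / real (Suc (k + N)) ^ 2)"
      using summable_ignore_initial_segment[OF inverse_squares_summable, of N] by (intro suminf_mult) simp
    also have "\<dots> \<le> B * (1 / real N)" using B0 N0 by (intro mult_left_mono inverse_squares_tail)
    also have "\<dots> \<le> B * sqrt u"
    proof (intro mult_left_mono[OF _ B0])
      have "1 / real N \<le> 1 / (1 / sqrt u)" using N1 s0 N0 by (intro divide_left_mono mult_pos_pos) auto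
      then show "1 / real N \<le> sqrt u" by simp
    qed
    finally have "\<bar>osc_series \<phi> u\<bar> \<le> B * sqrt u + (L * sqrt u + L * (sqrt u * 1))" using abs_le by linarith
    also have "\<dots> \<le> (2 * L + 2 * B) * sqrt u" using B0 s0 by (simp add: algebra_simps)
    finally show ?thesis .
  qed
qed

text \<open>At \<open>y = 0\<close> the second factor may oscillate without limit but stays bounded,
  and \<open>sqrt y\<close> forces the product to 0.\<close>

lemma osc_term_continuous:
  assumes c: "continuous_on UNIV \<phi>" and B: "\<And>x. \<bar>\<phi> x\<bar> \<le> B"
  shows "continuous_on {0..} (\<lambda>y. sqrt y * \<phi> (c / y))"
  unfolding continuous_on_eq_continuous_within
proof
  fix y :: real assume y: "y \<in> {0..}"
  show "continuous (at y within {0..}) (\<lambda>y. sqrt y * \<phi> (c / y))"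
  proof (cases "y = 0")
    case True
    have "((\<lambda>y. sqrt y * \<phi> (c / y)) \<longlongrightarrow> 0) (at 0 within {0..})"
    proof (rule Lim_null_comparison)
      have "\<bar>\<phi> x\<bar> \<le> \<bar>B\<bar>" for x using B[of x] by linarith
      then have "norm (sqrt y * \<phi> (c / y)) \<le> \<bar>sqrt y\<bar> * \<bar>B\<bar>" for y
        by (simp add: abs_mult mult_left_mono)
      then show "\<forall>\<^sub>F y in at 0 within {0..}. norm (sqrt y * \<phi> (c / y)) \<le> \<bar>sqrt y\<bar> * \<bar>B\<bar>" by simp
      show "((\<lambda>y. \<bar>sqrt y\<bar> * \<bar>B\<bar>) \<longlongrightarrow> 0) (at 0 within {0..})"
      proof -
        have "((\<lambda>y. \<bar>sqrt y\<bar> * \<bar>B\<bar>) \<longlongrightarrow> \<bar>sqrt 0\<bar> * \<bar>B\<bar>) (at 0 within {0..})" by (intro tendsto_intros)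
        then show ?thesis by simp
      qed
    qed
    then show ?thesis using True by (simp add: continuous_within)
  next
    case False
    have 1: "isCont \<phi> (c / y)" using c by (simp add: continuous_on_eq_continuous_at)
    have 2: "isCont (\<lambda>y. c / y) y" using False by (intro continuous_intros) auto
    have "isCont (\<lambda>y. sqrt y * \<phi> (c / y)) y"
      by (rule isCont_mult[OF isCont_real_sqrt isCont_o2[where f = "\<lambda>y. c / y" and g = \<phi>, OF 2 1]])
    then show ?thesis by (rule continuous_at_imp_continuous_at_within)
  qed
qed

text \<open>The weights \<open>1 / k^2\<close> give uniform convergence on bounded intervals, so the
  limit keeps continuity and commutes with the integral.\<close>

theorem osc_series_integral:
  fixes \<phi> :: "real \<Rightarrow> real"
  assumes c: "continuous_on UNIV \<phi>" and B: "\<And>x. \<bar>\<phi> x\<bar> \<le> B" and ab: "0 \<le> a" "a \<le> b"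
  shows "continuous_on {a..b} (\<lambda>y. sqrt y * osc_series \<phi> (w / y))"
    and "(\<lambda>k. 1 / real (Suc k) ^ 2 * integral {a..b} (\<lambda>y. sqrt y * \<phi> (w * real (Suc k) ^ 2 / y))) sums
           integral {a..b} (\<lambda>y. sqrt y * osc_series \<phi> (w / y))"
proof -
  define f where "f k y = 1 / real (Suc k) ^ 2 * (sqrt y * \<phi> (w * real (Suc k) ^ 2 / y))" for k y
  define g where "g y = sqrt y * osc_series \<phi> (w / y)" for y
  have fc: "continuous_on {a..b} (f k)" for k
  proof -
    have "continuous_on {a..b} (\<lambda>y. sqrt y * \<phi> (w * real (Suc k) ^ 2 / y))"
      by (rule continuous_on_subset[OF osc_term_continuous[OF c B]]) (use ab in auto)
    then show ?thesis unfolding f_def by (rule continuous_on_mult_left)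
  qed
  have ul: "uniform_limit {a..b} (\<lambda>n y. \<Sum>k<n. f k y) (\<lambda>y. \<Sum>k. f k y) sequentially"
  proof (rule Weierstrass_m_test)
    show "summable (\<lambda>k. (sqrt b * B) * (1 / real (Suc k) ^ 2))" by (intro summable_mult inverse_squares_summable)
    fix k y assume y: "y \<in> {a..b}"
    have "\<bar>sqrt y\<bar> * \<bar>\<phi> (w * real (Suc k) ^ 2 / y)\<bar> \<le> sqrt b * B"
      using y ab B by (intro mult_mono) auto
    then show "norm (f k y) \<le> (sqrt b * B) * (1 / real (Suc k) ^ 2)"
      by (simp add: f_def abs_mult divide_right_mono)
  qed
  have "(\<Sum>k. f k y) = g y" for y
  proof -
    have "f k y = sqrt y * (1 / real (Suc k) ^ 2 * \<phi> (w / y * real (Suc k) ^ 2))" for k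
      by (simp add: f_def)
    moreover have "summable (\<lambda>k. 1 / real (Suc k) ^ 2 * \<phi> (w / y * real (Suc k) ^ 2))"
      by (rule osc_series_summable[OF B])
    ultimately show ?thesis unfolding g_def osc_series_def by (simp only: suminf_mult)
  qed
  then have ul': "uniform_limit {a..b} (\<lambda>n y. \<Sum>k<n. f k y) g sequentially"
    using ul by simp
  have sc: "continuous_on {a..b} (\<lambda>y. \<Sum>k<n. f k y)" for n
    using fc by (intro continuous_on_sum) auto
  show "continuous_on {a..b} (\<lambda>y. sqrt y * osc_series \<phi> (w / y))"
    using uniform_limit_theorem[OF _ ul'] sc by (simp add: g_def)
  obtain I J where I: "\<And>n. ((\<lambda>y. \<Sum>k<n. f k y) has_integral I n) {a..b}" and J: "(g has_integral J) {a..b}"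
    and lim: "I \<longlonglongrightarrow> J"
    using uniform_limit_integral[OF ul' sc trivial_limit_sequentially] by blast
  have "I n = (\<Sum>k<n. integral {a..b} (f k))" for n
  proof -
    have "((\<lambda>y. \<Sum>k<n. f k y) has_integral (\<Sum>k<n. integral {a..b} (f k))) {a..b}"
      by (intro has_integral_sum integrable_integral integrable_continuous_interval fc) auto
    then show ?thesis using I[of n] by (simp add: has_integral_unique)
  qed
  moreover have "J = integral {a..b} g" using J by (simp add: integral_unique)
  ultimately have "(\<lambda>k. integral {a..b} (f k)) sums integral {a..b} g"
  proof -
    assume I_eq: "\<And>n. I n = (\<Sum>k<n. integral {a..b} (f k))" and J_eq: "J = integral {a..b} g"
    have "I = (\<lambda>n. \<Sum>k<n. integral {a..b} (f k))" using I_eq by (rule ext)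
    then show ?thesis using lim by (simp only: sums_def J_eq)
  qed
  moreover have "integral {a..b} (f k) = 1 / real (Suc k) ^ 2 * integral {a..b} (\<lambda>y. sqrt y * \<phi> (w * real (Suc k) ^ 2 / y))" for k
    unfolding f_def by (rule integral_mult_right)
  ultimately show "(\<lambda>k. 1 / real (Suc k) ^ 2 * integral {a..b} (\<lambda>y. sqrt y * \<phi> (w * real (Suc k) ^ 2 / y))) sums
           integral {a..b} (\<lambda>y. sqrt y * osc_series \<phi> (w / y))"
    by (simp only: g_def[abs_def])
qed

definition osc :: "real \<Rightarrow> real" where
  "osc x = 1 - cos x + sin x"

lemma osc_bounds: "\<bar>osc x\<bar> \<le> 3" "x \<ge> 0 \<Longrightarrow> \<bar>osc x\<bar> \<le> 2 * x" "continuous_on UNIV osc"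
proof -
  have "\<bar>sin x\<bar> \<le> 1" "\<bar>cos x\<bar> \<le> 1" by simp_all
  then show "\<bar>osc x\<bar> \<le> 3" unfolding osc_def by linarith
  show "continuous_on UNIV osc" unfolding osc_def by (intro continuous_intros)
  assume x: "x \<ge> 0"
  have "1 - cos x = 2 * sin (x / 2) ^ 2" using cos_double_sin[of "x / 2"] by simp
  also have "\<dots> = 2 * (\<bar>sin (x / 2)\<bar> * \<bar>sin (x / 2)\<bar>)" by (simp add: power2_eq_square)
  also have "\<dots> \<le> 2 * (\<bar>x / 2\<bar> * 1)"
    by (intro mult_left_mono mult_mono abs_sin_x_le_abs_x) auto
  finally have "1 - cos x \<le> x" using x by simp
  moreover have "\<bar>sin x\<bar> \<le> x" using abs_sin_x_le_abs_x[of x] x by simp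
  moreover have "1 - cos x \<ge> 0" by simp
  ultimately show "\<bar>osc x\<bar> \<le> 2 * x" unfolding osc_def by linarith
qed

lemma C_fun_eq_integral:
  assumes "\<alpha> \<ge> 0"
  shows "C_fun \<alpha> = sqrt \<alpha> + 1 / (2 * pi) * integral {0..\<alpha>} (\<lambda>y. sqrt y * osc_series osc (2 * pi / y))"
proof -
  have "(\<Sum>k. 1 / real (Suc k) ^ 2 * integral {0..\<alpha>} (\<lambda>y. sqrt y * osc (2 * pi * real (Suc k) ^ 2 / y)))
     = integral {0..\<alpha>} (\<lambda>y. sqrt y * osc_series osc (2 * pi / y))"
    by (rule sums_unique[symmetric, OF osc_series_integral(2)[where \<phi> = osc, OF osc_bounds(3) osc_bounds(1)]])
       (use assms in auto)
  then show ?thesis by (simp only: C_fun_def osc_def)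
qed

text \<open>Growth like \<open>sqrt \<alpha>\<close> near 0 and like \<open>\<alpha>\<close> at
  infinity. This controls the main term when one of the variables is below 1, and the limit at 0 in
  the alternate formula.\<close>

theorem C_fun_bound:
  assumes "\<alpha> \<ge> 0"
  shows "\<bar>C_fun \<alpha>\<bar> \<le> sqrt \<alpha> + 10 * \<alpha>"
proof -
  have bd: "\<bar>sqrt y * osc_series osc (2 * pi / y)\<bar> \<le> 10 * sqrt (2 * pi)" if y: "y \<ge> 0" for y
  proof (cases "y = 0")
    case False
    have "\<bar>osc_series osc (2 * pi / y)\<bar> \<le> (2 * 2 + 2 * 3) * sqrt (2 * pi / y)"
      by (rule osc_series_bound) (use osc_bounds y False in auto)
    then have "\<bar>sqrt y\<bar> * \<bar>osc_series osc (2 * pi / y)\<bar> \<le> \<bar>sqrt y\<bar> * ((2 * 2 + 2 * 3) * sqrt (2 * pi / y))"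
      by (intro mult_left_mono) auto
    also have "\<dots> = 10 * (sqrt y * sqrt (2 * pi / y))" using y by simp
    also have "sqrt y * sqrt (2 * pi / y) = sqrt (y * (2 * pi / y))" by (rule real_sqrt_mult[symmetric])
    also have "y * (2 * pi / y) = 2 * pi" using False by simp
    finally show ?thesis by (simp add: abs_mult)
  qed simp
  define v where "v = integral {0..\<alpha>} (\<lambda>y. sqrt y * osc_series osc (2 * pi / y))"
  have "norm v \<le> 10 * sqrt (2 * pi) * (\<alpha> - 0)"
    unfolding v_def
  proof (rule integral_bound[OF assms])
    show "continuous_on {0..\<alpha>} (\<lambda>y. sqrt y * osc_series osc (2 * pi / y))"
      by (rule osc_series_integral(1)[where \<phi> = osc, OF osc_bounds(3) osc_bounds(1)]) (use assms in auto)
  qed (use bd in auto)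
  then have "1 / (2 * pi) * \<bar>v\<bar> \<le> 1 / (2 * pi) * (10 * sqrt (2 * pi) * \<alpha>)"
    by (intro mult_left_mono) auto
  then have "\<bar>1 / (2 * pi) * v\<bar> \<le> 1 / (2 * pi) * (10 * sqrt (2 * pi) * \<alpha>)"
    by (simp only: abs_mult) simp
  also have "\<dots> \<le> 10 * \<alpha>"
  proof -
    have "sqrt (2 * pi) \<le> 2 * pi"
    proof -
      have "sqrt (2 * pi) * 1 \<le> sqrt (2 * pi) * sqrt (2 * pi)" using pi_ge_two by (intro mult_left_mono) auto
      then show ?thesis by simp
    qed
    then have "10 * \<alpha> * (sqrt (2 * pi) / (2 * pi)) \<le> 10 * \<alpha> * 1" using assms by (intro mult_left_mono) auto
    then show ?thesis by (simp add: field_simps)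
  qed
  finally have "\<bar>1 / (2 * pi) * v\<bar> \<le> 10 * \<alpha>" .
  moreover have "sqrt \<alpha> \<ge> 0" using assms by simp
  ultimately show ?thesis unfolding C_fun_eq_integral[OF assms] v_def[symmetric]
    using abs_triangle_ineq[of "sqrt \<alpha>" "1 / (2 * pi) * v"] by linarith
qed

section \<open>The dyadic blocks of the kernel sum\<close>

lemma le_nat_floor_iff: "x \<ge> 0 \<Longrightarrow> n \<le> nat \<lfloor>x\<rfloor> \<longleftrightarrow> real n \<le> x"
  by (metis le_nat_floor le_nat_iff le_floor_iff of_int_of_nat_eq zero_le_floor)

lemma odd_upto_eq: "X \<ge> 0 \<Longrightarrow> odd_upto X = {m \<in> {1..nat \<lfloor>X\<rfloor>}. odd m}"
  by (auto simp: odd_upto_def le_nat_floor_iff)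

lemma real_div_le: "real (m div n) \<le> real m / real n"
proof (cases "n = 0")
  case False
  have "real (m div n * n) \<le> real m" by (simp only: of_nat_le_iff div_times_less_eq_dividend)
  then show ?thesis using False by (simp add: field_simps)
qed simp

lemma finite_odd_upto [simp]: "finite (odd_upto X)"
  by (rule finite_subset[of _ "{..nat \<lfloor>X\<rfloor>}"]) (auto simp: odd_upto_def le_nat_floor)

lemma jkernel_2_mult: "odd n \<Longrightarrow> jkernel (2 * m) n = Jacobi 2 n * jkernel m n"
  by (rule jkernel_mult_coprime_left) auto

text \<open>An even \<open>m\<close> is twice a number up to \<open>X / 2\<close>, and the factor 2
  splits off as \<open>(2 | n)\<close>.\<close>

lemma odd_row_sum:
  assumes o: "odd n" and X: "X \<ge> 0"
  shows "(\<Sum>m\<in>odd_upto X. real_of_int (jkernel (int m) n))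
     = jkernel_sum n X - real_of_int (Jacobi 2 n) * jkernel_sum n (X / 2)"
proof -
  define f where "f m = real_of_int (jkernel (int m) n)" for m
  have "{1..nat \<lfloor>X\<rfloor>} = odd_upto X \<union> {m \<in> {1..nat \<lfloor>X\<rfloor>}. even m}"
    using X by (auto simp: odd_upto_eq)
  then have "jkernel_sum n X = (\<Sum>m\<in>odd_upto X \<union> {m \<in> {1..nat \<lfloor>X\<rfloor>}. even m}. f m)"
    by (simp only: jkernel_sum_def f_def)
  also have "\<dots> = (\<Sum>m\<in>odd_upto X. f m) + (\<Sum>m\<in>{m \<in> {1..nat \<lfloor>X\<rfloor>}. even m}. f m)"
    using X by (intro sum.union_disjoint) (auto simp: odd_upto_eq)
  also have "(\<Sum>m\<in>{m \<in> {1..nat \<lfloor>X\<rfloor>}. even m}. f m) = (\<Sum>m=1..nat \<lfloor>X / 2\<rfloor>. f (2 * m))"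
    by (rule sum.reindex_bij_witness[of _ "\<lambda>m. 2 * m" "\<lambda>m. m div 2"])
       (use X in \<open>auto simp: le_nat_floor_iff elim!: evenE\<close>)
  also have "\<dots> = real_of_int (Jacobi 2 n) * jkernel_sum n (X / 2)"
    using jkernel_2_mult[OF o] by (simp add: f_def jkernel_sum_def sum_distrib_left)
  finally show ?thesis by (simp add: f_def)
qed

lemma sum_inverse_sqrt_le: "(\<Sum>q=1..M. 1 / sqrt (real q)) \<le> 2 * sqrt (real M)"
proof (induction M)
  case (Suc M)
  define s t where "s = sqrt (real M)" and "t = sqrt (real (Suc M))"
  have t: "t > 0" "s \<ge> 0" "s \<le> t" by (simp_all add: s_def t_def)
  have "t * t - s * s = 1" by (simp add: s_def t_def)
  then have "1 = (t - s) * (t + s)" by (simp add: algebra_simps)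
  also have "\<dots> \<le> (t - s) * (2 * t)" using t by (intro mult_left_mono) auto
  finally have "1 / t \<le> 2 * t - 2 * s" using t by (simp add: field_simps)
  then show ?case using Suc unfolding sum.cl_ivl_Suc s_def[symmetric] t_def[symmetric] by auto
qed simp

lemma sum_square_divisors_swap:
  fixes g :: "nat \<Rightarrow> nat \<Rightarrow> real"
  shows "(\<Sum>q=1..Q. \<Sum>d | d ^ 2 dvd q. g d q) = (\<Sum>d=1..Q. \<Sum>q=1..Q div d ^ 2. g d (d ^ 2 * q))"
proof -
  have "(\<Sum>q=1..Q. \<Sum>d | d ^ 2 dvd q. g d q) = (\<Sum>q=1..Q. \<Sum>d\<in>{d \<in> {1..Q}. d ^ 2 dvd q}. g d q)"
  proof (rule sum.cong[OF refl], rule sum.cong[OF _ refl])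
    fix q assume q: "q \<in> {1..Q}"
    show "{d. d ^ 2 dvd q} = {d \<in> {1..Q}. d ^ 2 dvd q}"
    proof (intro subset_antisym subsetI)
      fix d assume d: "d \<in> {d. d ^ 2 dvd q}"
      then have "d > 0" using q by (auto intro: Nat.gr0I)
      moreover have "d ^ 2 \<le> q" using d q by (auto intro: dvd_imp_le)
      then have "d \<le> q" using self_le_power[of d 2] \<open>d > 0\<close> by simp
      ultimately show "d \<in> {d \<in> {1..Q}. d ^ 2 dvd q}" using d q by auto
    qed auto
  qed
  also have "\<dots> = (\<Sum>q=1..Q. \<Sum>d=1..Q. if d ^ 2 dvd q then g d q else 0)"
    by (intro sum.cong refl sum.inter_filter) auto
  also have "\<dots> = (\<Sum>d=1..Q. \<Sum>q=1..Q. if d ^ 2 dvd q then g d q else 0)" by (rule sum.swap)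
  also have "\<dots> = (\<Sum>d=1..Q. \<Sum>q\<in>{q \<in> {1..Q}. d ^ 2 dvd q}. g d q)"
    by (intro sum.cong refl sum.inter_filter[symmetric]) auto
  also have "\<dots> = (\<Sum>d=1..Q. \<Sum>q=1..Q div d ^ 2. g d (d ^ 2 * q))"
  proof (rule sum.cong[OF refl])
    fix d assume d: "d \<in> {1..Q}"
    show "(\<Sum>q\<in>{q \<in> {1..Q}. d ^ 2 dvd q}. g d q) = (\<Sum>q=1..Q div d ^ 2. g d (d ^ 2 * q))"
      by (rule sum.reindex_bij_witness[of _ "\<lambda>i. d ^ 2 * i" "\<lambda>h. h div d ^ 2"])
         (use d in \<open>auto elim!: dvdE simp: div_le_mono Suc_le_eq less_eq_div_iff_mult_less_eq mult.commute\<close>)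
  qed
  finally show ?thesis .
qed

lemma sum_inverse_squares_le: "(\<Sum>d=1..Q. 1 / real d ^ 2) \<le> 2"
proof -
  have "(\<Sum>d=1..Q. 1 / real d ^ 2) = (\<Sum>k<Q. 1 / real (Suc k) ^ 2)"
    by (rule sum.reindex_bij_witness[of _ Suc "\<lambda>d. d - 1"]) auto
  also have "\<dots> \<le> (\<Sum>k. 1 / real (Suc k) ^ 2)"
    by (rule sum_le_suminf[OF inverse_squares_summable]) auto
  finally show ?thesis using inverse_squares_suminf_le by linarith
qed

text \<open>For \<open>q\<close> replaced by \<open>d^2 * q\<close> both parts of the weight
  contribute at most \<open>1 / (d * sqrt q)\<close>. The sum over \<open>q \<le> Q / d^2\<close> is
  about \<open>sqrt Q / d\<close>, so a convergent series of \<open>1 / d^2\<close> remains: on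
  average the weight is of order \<open>sqrt q\<close>.\<close>

lemma sum_div_weight_le:
  "(\<Sum>q=1..Q. div_weight q / real q) \<le> 8 * sqrt (real Q)"
proof -
  have "(\<Sum>q=1..Q. div_weight q / real q) = (\<Sum>q=1..Q. \<Sum>d | d ^ 2 dvd q. (sqrt (real q) / real d + real d) / real q)"
    by (simp add: div_weight_def sum_divide_distrib)
  also have "\<dots> = (\<Sum>d=1..Q. \<Sum>q=1..Q div d ^ 2. (sqrt (real (d ^ 2 * q)) / real d + real d) / real (d ^ 2 * q))"
    by (rule sum_square_divisors_swap)
  also have "\<dots> \<le> (\<Sum>d=1..Q. \<Sum>q=1..Q div d ^ 2. 2 / real d * (1 / sqrt (real q)))"
  proof (intro sum_mono)
    fix d q assume d: "d \<in> {1..Q}" and q: "q \<in> {1..Q div d ^ 2}"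
    define s where "s = sqrt (real q)"
    have s: "s \<ge> 1" "real q = s * s" using q by (simp_all add: s_def)
    have d1: "real d \<ge> 1" using d by simp
    have eq: "sqrt (real (d ^ 2 * q)) = real d * s" by (simp add: s_def real_sqrt_mult)
    have "(sqrt (real (d ^ 2 * q)) / real d + real d) / real (d ^ 2 * q) = (s + real d) / (real d * real d * (s * s))"
      unfolding eq using d1 s by (simp add: power2_eq_square)
    also have "\<dots> \<le> (real d * s + real d * s) / (real d * real d * (s * s))"
      using d1 s by (intro divide_right_mono add_mono) auto
    also have "\<dots> = 2 / real d * (1 / s)" using d1 s by (simp add: field_simps)
    finally show "(sqrt (real (d ^ 2 * q)) / real d + real d) / real (d ^ 2 * q) \<le> 2 / real d * (1 / sqrt (real q))"
      by (simp add: s_def)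
  qed
  also have "\<dots> = (\<Sum>d=1..Q. 2 / real d * (\<Sum>q=1..Q div d ^ 2. 1 / sqrt (real q)))"
    by (simp only: sum_distrib_left)
  also have "\<dots> \<le> (\<Sum>d=1..Q. 4 * sqrt (real Q) * (1 / real d ^ 2))"
  proof (rule sum_mono)
    fix d assume d: "d \<in> {1..Q}"
    have "(\<Sum>q=1..Q div d ^ 2. 1 / sqrt (real q)) \<le> 2 * sqrt (real (Q div d ^ 2))" by (rule sum_inverse_sqrt_le)
    also have "\<dots> \<le> 2 * sqrt (real Q / real (d ^ 2))"
      using real_div_le[of Q "d ^ 2"] by simp
    also have "\<dots> = 2 * sqrt (real Q) / real d" by (simp add: real_sqrt_divide)
    finally have "2 / real d * (\<Sum>q=1..Q div d ^ 2. 1 / sqrt (real q)) \<le> 2 / real d * (2 * sqrt (real Q) / real d)"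
      by (intro mult_left_mono) auto
    then show "2 / real d * (\<Sum>q=1..Q div d ^ 2. 1 / sqrt (real q)) \<le> 4 * sqrt (real Q) * (1 / real d ^ 2)"
      by (simp add: power2_eq_square)
  qed
  also have "\<dots> = 4 * sqrt (real Q) * (\<Sum>d=1..Q. 1 / real d ^ 2)" by (simp only: sum_distrib_left)
  also have "\<dots> \<le> 4 * sqrt (real Q) * 2" by (intro mult_left_mono sum_inverse_squares_le) auto
  finally show ?thesis by simp
qed

text \<open>For a single square \<open>n\<close> the truncation error can reach the order
  \<open>sqrt n\<close>; only its average is small. The weights \<open>d\<close> occur for about
  \<open>N / d^2\<close> values of \<open>n\<close>, which leaves a harmonic sum and hence one more
  logarithm.\<close>

lemma sum_polya_err_le:
  assumes N: "N > 0" and K: "K > 0"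
  shows "(\<Sum>n=1..N. polya_err K n) \<le> 4 * real N * (1 + ln (real N)) + 2 * real N ^ 2 / real K * (1 + ln (real N))"
proof -
  define L where "L = 1 + ln (real N)"
  have L: "L \<ge> 1" using N by (simp add: L_def)
  have "(\<Sum>n=1..N. polya_err K n) \<le> (\<Sum>n=1..N. \<Sum>d | d ^ 2 dvd n. real d * (4 + real n / real d ^ 2 / real K * L))"
    unfolding polya_err_def L_def
    by (intro sum_mono mult_left_mono add_left_mono) (auto intro!: mult_left_mono divide_nonneg_nonneg)
  also have "\<dots> = (\<Sum>d=1..N. \<Sum>q=1..N div d ^ 2. real d * (4 + real (d ^ 2 * q) / real d ^ 2 / real K * L))"
    by (rule sum_square_divisors_swap)
  also have "\<dots> \<le> (\<Sum>d=1..N. 4 * real N * (1 / real d) + real N ^ 2 / real K * L * (1 / real d ^ 2))"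
  proof (rule sum_mono)
    fix d assume d: "d \<in> {1..N}"
    define M where "M = N div d ^ 2"
    have d1: "real d \<ge> 1" using d by simp
    have M: "real M \<le> real N / (real d * real d)"
      using real_div_le[of N "d ^ 2"] by (simp add: M_def power2_eq_square)
    have "(\<Sum>q=1..M. real d * (4 + real (d ^ 2 * q) / real d ^ 2 / real K * L)) \<le> (\<Sum>q=1..M. real d * (4 + real M / real K * L))"
    proof (intro sum_mono mult_left_mono add_left_mono mult_right_mono divide_right_mono)
      fix q assume "q \<in> {1..M}"
      then show "real (d ^ 2 * q) / real d ^ 2 \<le> real M" using d1 by simp
    qed (use L in auto)
    also have "\<dots> = 4 * (real M * real d) + (real M * real M * real d) * (L / real K)" by (simp add: algebra_simps)
    also have "\<dots> \<le> 4 * (real N / (real d * real d) * real d) + (real N / (real d * real d) * (real N / (real d * real d)) * (real d * real d)) * (L / real K)"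
      using M d1 L by (intro add_mono mult_mono mult_left_mono mult_right_mono) auto
    also have "\<dots> = 4 * real N * (1 / real d) + real N ^ 2 / real K * L * (1 / real d ^ 2)"
      using d1 by (simp add: field_simps power2_eq_square)
    finally show "(\<Sum>q=1..N div d ^ 2. real d * (4 + real (d ^ 2 * q) / real d ^ 2 / real K * L))
        \<le> 4 * real N * (1 / real d) + real N ^ 2 / real K * L * (1 / real d ^ 2)" by (simp only: M_def)
  qed
  also have "\<dots> = 4 * real N * (\<Sum>d=1..N. 1 / real d) + real N ^ 2 / real K * L * (\<Sum>d=1..N. 1 / real d ^ 2)"
    by (simp only: sum.distrib sum_distrib_left)
  also have "\<dots> \<le> 4 * real N * L + real N ^ 2 / real K * L * 2"
    unfolding L_def using N L
    by (intro add_mono mult_left_mono sum_inverse_le_ln sum_inverse_squares_le) (auto simp: L_def)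
  finally show ?thesis by (simp add: L_def mult_ac)
qed

section \<open>Column sums, one dyadic block, and the matching block of C\<close>

definition col_err :: "nat \<Rightarrow> real" where
  "col_err q = 43 * (1 + ln (real q)) * div_weight q"

text \<open>Abel summation with the mean \<open>square_ind q / 4\<close> of a column within one
  class modulo 4. On the block the weight varies by \<open>sqrt Y * (1 + u / Y)\<close> up to a
  constant; restricting to one class fixes the type of \<open>trig\<close>.\<close>

lemma column_abel:
  assumes q: "q > 0" and e: "e \<in> {1, 3}" and Y: "Y > 0" and u: "u \<ge> 0"
  shows "\<bar>(\<Sum>n\<in>{n. Y / 2 < real n \<and> real n \<le> Y \<and> n mod 4 = e}. real_of_int (jkernel (int q) n) * (sqrt (real n) * trig e (u / real n)))
     - square_ind q / 4 * integral {Y / 2..Y} (\<lambda>y. sqrt y * trig e (u / y))\<bar>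
     \<le> col_err q * (13 * sqrt Y * (1 + u / Y))"
proof -
  define c where "c n = (if n mod 4 = e then real_of_int (jkernel (int q) n) else 0)" for n
  define \<phi> where "\<phi> y = sqrt y * trig e (u / y)" for y
  define tr' where "tr' x = (if e = 3 then 2 * pi * sin (2 * pi * x) else 2 * pi * cos (2 * pi * x))" for x
  define \<phi>' where "\<phi>' y = inverse (sqrt y) / 2 * trig e (u / y) + sqrt y * (tr' (u / y) * (- u / (y * y)))" for y
  have e3: "e mod 4 = 3 \<longleftrightarrow> e = 3" using e by auto
  have dtrig: "(trig e has_real_derivative tr' x) (at x)" for x
    unfolding trig_def[abs_def] tr'_def e3 by (auto intro!: derivative_eq_intros)
  have dphi: "(\<phi> has_real_derivative \<phi>' t) (at t)" if "t > 0" for t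
  proof -
    have "((\<lambda>y. u / y) has_real_derivative - u / (t * t)) (at t)"
      using that by (auto intro!: derivative_eq_intros simp: power2_eq_square)
    then have "((\<lambda>y. trig e (u / y)) has_real_derivative tr' (u / t) * (- u / (t * t))) (at t)"
      by (rule DERIV_chain2[OF dtrig])
    from DERIV_mult[OF DERIV_real_sqrt[OF that] this] show ?thesis
      unfolding \<phi>_def \<phi>'_def by (simp add: algebra_simps)
  qed
  \<comment> \<open>On the block \<open>sqrt t \<ge> sqrt Y / 2\<close>. The first summand bounds
    the derivative of the square root, the second that of the phase, where
    \<open>8 * pi < 26\<close>.\<close>
  define M where "M = 2 / sqrt Y + 26 * u / (Y * sqrt Y)"
  have sY: "sqrt Y > 0" "sqrt Y * sqrt Y = Y" using Y by simp_all
  define E where "E = col_err q"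
  have E: "\<bar>(\<Sum>n=1..nat \<lfloor>t\<rfloor>. c n) - square_ind q / 4 * t\<bar> \<le> E" if t: "t \<ge> 0" for t
  proof -
    have "(\<Sum>n=1..nat \<lfloor>t\<rfloor>. c n) = (\<Sum>n\<in>{n\<in>{1..nat \<lfloor>t\<rfloor>}. n mod 4 = e}. real_of_int (jkernel (int q) n))"
      unfolding c_def by (rule sum.inter_filter[symmetric]) auto
    moreover have "\<bar>\<dots> - square_ind q * (real (nat \<lfloor>t\<rfloor>) / 4)\<bar> \<le> 42 * (1 + ln (real q)) * div_weight q"
      by (rule jkernel_column_sum[OF q e])
    \<comment> \<open>Replacing the floor of \<open>t\<close> by \<open>t\<close> costs at most 1,
      which raises the constant from 42 to the 43 of \<open>col_err\<close>.\<close>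
    moreover have "\<bar>square_ind q * (real (nat \<lfloor>t\<rfloor>) / 4) - square_ind q / 4 * t\<bar> \<le> 1"
    proof -
      have "\<bar>real (nat \<lfloor>t\<rfloor>) - t\<bar> \<le> 1" using t by linarith
      then show ?thesis by (auto simp: square_ind_def)
    qed
    moreover have "1 * 1 \<le> (1 + ln (real q)) * div_weight q"
      using q div_weight_ge_1[OF q] by (intro mult_mono) auto
    ultimately show ?thesis unfolding E_def col_err_def mult.assoc by linarith
  qed
  have tr'b: "\<bar>tr' x\<bar> \<le> 2 * pi" for x by (simp add: tr'_def abs_mult)
  have M: "\<bar>\<phi>' t\<bar> \<le> M" if t: "t \<in> {Y / 2..Y}" for t
  proof -
    have t0: "t > 0" "sqrt t > 0" using t Y by auto
    have "sqrt Y / 2 \<le> sqrt t"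
    proof -
      have "sqrt (Y / 4) \<le> sqrt t" using t Y by (intro real_sqrt_le_mono) auto
      then show ?thesis by (simp add: real_sqrt_divide)
    qed
    then have "inverse (sqrt t) \<le> inverse (sqrt Y / 2)" using sY by (intro le_imp_inverse_le) auto
    then have inv: "inverse (sqrt t) \<le> 2 / sqrt Y" by simp
    have "\<bar>inverse (sqrt t) / 2\<bar> * \<bar>trig e (u / t)\<bar> \<le> (2 / sqrt Y) / 2 * 2"
      using inv t0 Y by (intro mult_mono trig_bounds) auto
    then have "\<bar>inverse (sqrt t) / 2 * trig e (u / t)\<bar> \<le> 2 / sqrt Y"
      by (simp only: abs_mult) simp
    moreover have "\<bar>sqrt t * (tr' (u / t) * (- u / (t * t)))\<bar> \<le> 26 * u / (Y * sqrt Y)"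
    proof -
      have "\<bar>sqrt t * (tr' (u / t) * (- u / (t * t)))\<bar> = \<bar>tr' (u / t)\<bar> * (u * (inverse (sqrt t) * inverse t))"
      proof -
        have "v / ((v * v) * (v * v)) = inverse v * inverse (v * v)" if "v > 0" for v :: real
          using that by (simp add: field_simps)
        from this[OF t0(2)] have r: "sqrt t / (t * t) = inverse (sqrt t) * inverse t" using t0 by simp
        have "sqrt t * (tr' (u / t) * (- u / (t * t))) = - (tr' (u / t) * (u * (sqrt t / (t * t))))" by simp
        then have "sqrt t * (tr' (u / t) * (- u / (t * t))) = - (tr' (u / t) * (u * (inverse (sqrt t) * inverse t)))"
          by (simp only: r)
        then show ?thesis using u t0 by (simp add: abs_mult)
      qed
      also have "\<dots> \<le> 2 * pi * (u * ((2 / sqrt Y) * (2 / Y)))"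
        using inv t0 t u Y tr'b by (intro mult_mono mult_left_mono) (auto simp: field_simps)
      also have "\<dots> = 8 * pi * (u / (Y * sqrt Y))" by (simp add: mult_ac)
      also have "\<dots> \<le> 26 * (u / (Y * sqrt Y))" using pi_approx u Y by (intro mult_right_mono) auto
      finally show ?thesis by simp
    qed
    ultimately show ?thesis unfolding \<phi>'_def M_def by (intro order.trans[OF abs_triangle_ineq add_mono])
  qed
  have finite: "finite {n. Y / 2 < real n \<and> real n \<le> Y}"
    by (rule finite_subset[of _ "{..nat \<lfloor>Y\<rfloor>}"]) (auto simp: le_nat_floor)
  have "\<bar>(\<Sum>n\<in>{n. Y / 2 < real n \<and> real n \<le> Y}. c n * \<phi> (real n)) - square_ind q / 4 * integral {Y / 2..Y} \<phi>\<bar>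
           \<le> E * (\<bar>\<phi> (Y / 2)\<bar> + \<bar>\<phi> Y\<bar> + (Y - Y / 2) * M)"
    by (rule abel_summation_bound[where \<phi>' = \<phi>']) (use Y dphi E M in \<open>auto intro: has_field_derivative_at_within\<close>)
  also have "\<dots> \<le> E * (13 * sqrt Y * (1 + u / Y))"
  proof (intro mult_left_mono)
    have "\<bar>\<phi> t\<bar> \<le> sqrt Y * 2" if "0 < t" "t \<le> Y" for t
      unfolding \<phi>_def abs_mult using that by (intro mult_mono trig_bounds) auto
    then have "\<bar>\<phi> (Y / 2)\<bar> \<le> sqrt Y * 2" "\<bar>\<phi> Y\<bar> \<le> sqrt Y * 2" using Y by auto
    moreover have "(Y - Y / 2) * M = sqrt Y + 13 * sqrt Y * (u / Y)"
    proof -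
      have "(v * v - v * v / 2) * (2 / v + 26 * u / (v * v * v)) = v + 13 * v * (u / (v * v))" if "v > 0" for v
        using that by (simp add: field_simps)
      from this[OF sY(1)] show ?thesis unfolding sY(2) M_def .
    qed
    moreover have "13 * sqrt Y * (1 + u / Y) = 13 * sqrt Y + 13 * sqrt Y * (u / Y)" by (simp add: algebra_simps)
    ultimately show "\<bar>\<phi> (Y / 2)\<bar> + \<bar>\<phi> Y\<bar> + (Y - Y / 2) * M \<le> 13 * sqrt Y * (1 + u / Y)"
      using sY by linarith
    show "E \<ge> 0" using E[of 0] by simp
  qed
  also have "(\<Sum>n\<in>{n. Y / 2 < real n \<and> real n \<le> Y}. c n * \<phi> (real n))
     = (\<Sum>n\<in>{n. Y / 2 < real n \<and> real n \<le> Y \<and> n mod 4 = e}. real_of_int (jkernel (int q) n) * (sqrt (real n) * trig e (u / real n)))"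
    unfolding c_def \<phi>_def using finite
    by (intro sum.mono_neutral_cong_right) auto
  finally show ?thesis by (simp add: \<phi>_def E_def)
qed

definition kernel_sum :: "real \<Rightarrow> real \<Rightarrow> real" where
  "kernel_sum X Y = (\<Sum>n\<in>odd_upto Y. \<Sum>m\<in>odd_upto X. real_of_int (jkernel (int m) n))"

lemma sum_square_ind:
  fixes h :: "nat \<Rightarrow> real"
  shows "(\<Sum>k=1..R ^ 2. square_ind k * h k) = (\<Sum>l=1..R. h (l ^ 2))"
proof -
  have "(\<Sum>k=1..R ^ 2. square_ind k * h k) = (\<Sum>k\<in>{k\<in>{1..R ^ 2}. \<exists>s. k = s ^ 2}. h k)"
    by (subst sum.inter_filter) (auto simp: square_ind_def intro!: sum.cong)
  also have "{k\<in>{1..R ^ 2}. \<exists>s. k = s ^ 2} = (\<lambda>l. l ^ 2) ` {1..R}"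
    by (auto simp: Suc_le_eq power2_nat_le_eq_le intro!: imageI)
  also have "(\<Sum>k\<in>(\<lambda>l. l ^ 2) ` {1..R}. h k) = (\<Sum>l=1..R. h (l ^ 2))"
    by (rule sum.reindex_cong[of "\<lambda>l. l ^ 2"]) (auto simp: inj_on_def)
  finally show ?thesis .
qed

text \<open>\<open>2 * k\<close> is a square exactly for \<open>k = 2 * i^2\<close>. The upper limit
  \<open>2 * R^2\<close> gives \<open>i\<close> the same range as the square roots have in
  \<open>sum_square_ind\<close>, so both sums can be combined.\<close>

lemma sum_square_ind_double:
  fixes h :: "nat \<Rightarrow> real"
  shows "(\<Sum>k=1..2 * R ^ 2. square_ind (2 * k) * h k) = (\<Sum>i=1..R. h (2 * i ^ 2))"
proof -
  have "(\<Sum>k=1..2 * R ^ 2. square_ind (2 * k) * h k) = (\<Sum>k\<in>{k\<in>{1..2 * R ^ 2}. \<exists>s. 2 * k = s ^ 2}. h k)"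
    by (subst sum.inter_filter) (auto simp: square_ind_def intro!: sum.cong)
  also have "{k\<in>{1..2 * R ^ 2}. \<exists>s. 2 * k = s ^ 2} = (\<lambda>i. 2 * i ^ 2) ` {1..R}"
  proof (intro subset_antisym subsetI)
    fix k assume k: "k \<in> {k\<in>{1..2 * R ^ 2}. \<exists>s. 2 * k = s ^ 2}"
    then obtain s where s: "2 * k = s ^ 2" by blast
    then have "even (s ^ 2)" by (metis dvd_triv_left)
    then have "even s" by simp
    then obtain i where i: "s = 2 * i" by auto
    have ki: "k = 2 * i ^ 2" using s by (simp add: i power_mult_distrib)
    then have "i ^ 2 \<le> R ^ 2" "i > 0" using k by (auto intro!: Nat.gr0I)
    then show "k \<in> (\<lambda>i. 2 * i ^ 2) ` {1..R}" using ki by (auto simp: power2_nat_le_eq_le)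
  next
    fix k assume "k \<in> (\<lambda>i. 2 * i ^ 2) ` {1..R}"
    then obtain i where i: "k = 2 * i ^ 2" "1 \<le> i" "i \<le> R" by auto
    have "2 * k = (2 * i) ^ 2" by (simp add: i power_mult_distrib)
    moreover have "k \<in> {1..2 * R ^ 2}" using i by (auto simp: power2_nat_le_eq_le)
    ultimately show "k \<in> {k\<in>{1..2 * R ^ 2}. \<exists>s. 2 * k = s ^ 2}" by blast
  qed
  also have "(\<Sum>k\<in>(\<lambda>i. 2 * i ^ 2) ` {1..R}. h k) = (\<Sum>i=1..R. h (2 * i ^ 2))"
    by (rule sum.reindex_cong[of "\<lambda>i. 2 * i ^ 2"]) (auto simp: inj_on_def)
  finally show ?thesis .
qed

lemma odd_squares_count:
  assumes t: "t \<ge> 0"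
  shows "\<bar>(\<Sum>n\<in>odd_upto t. square_ind n) - sqrt t / 2\<bar> \<le> 1"
proof -
  define M where "M = nat \<lfloor>sqrt t\<rfloor>"
  have "(\<Sum>n\<in>odd_upto t. square_ind n) = (\<Sum>n\<in>{n \<in> odd_upto t. \<exists>s. n = s ^ 2}. 1)"
    by (subst sum.inter_filter) (auto simp: square_ind_def intro!: sum.cong)
  also have "\<dots> = (\<Sum>i<(M + 1) div 2. 1)"
  proof (rule sum.reindex_bij_witness[symmetric, of _ "\<lambda>n. (nat \<lfloor>sqrt (real n)\<rfloor>) div 2" "\<lambda>i. (2 * i + 1) ^ 2"])
    fix i assume "i \<in> {..<(M + 1) div 2}"
    then have "2 * i + 1 \<le> M" by auto
    then have "real (2 * i + 1) \<le> sqrt t" unfolding M_def using t by (subst (asm) le_nat_floor_iff) auto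
    then have "real (2 * i + 1) ^ 2 \<le> t" using t by (metis of_nat_0_le_iff power_mono real_sqrt_pow2)
    then show "(2 * i + 1) ^ 2 \<in> {n \<in> odd_upto t. \<exists>s. n = s ^ 2}" by (auto simp: odd_upto_def)
    have "sqrt (real ((2 * i + 1) ^ 2)) = real (2 * i + 1)" by (simp only: of_nat_power real_sqrt_abs abs_of_nat)
    then show "nat \<lfloor>sqrt (real ((2 * i + 1) ^ 2))\<rfloor> div 2 = i" by (simp only: floor_of_nat nat_int)
  next
    fix n assume n: "n \<in> {n \<in> odd_upto t. \<exists>s. n = s ^ 2}"
    then obtain s where s: "n = s ^ 2" "odd n" "real n \<le> t" by (auto simp: odd_upto_def)
    then have os: "odd s" by simp
    have sq: "nat \<lfloor>sqrt (real n)\<rfloor> = s" by (simp add: s)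
    show "(2 * (nat \<lfloor>sqrt (real n)\<rfloor> div 2) + 1) ^ 2 = n" using os unfolding sq by (simp add: s)
    have "real s \<le> sqrt t" using s(3) by (intro real_le_rsqrt) (simp add: s)
    then have "s \<le> M" unfolding M_def using t by (subst le_nat_floor_iff) auto
    then show "nat \<lfloor>sqrt (real n)\<rfloor> div 2 \<in> {..<(M + 1) div 2}" using os unfolding sq by (auto elim!: oddE)
  qed auto
  finally have eq: "(\<Sum>n\<in>odd_upto t. square_ind n) = real ((M + 1) div 2)" by simp
  have "real M \<le> sqrt t" "sqrt t \<le> real M + 1" unfolding M_def using t by (simp_all add: of_nat_nat)
  moreover have "2 * ((M + 1) div 2) \<le> M + 1" "M \<le> 2 * ((M + 1) div 2)" by auto
  then have "real (2 * ((M + 1) div 2)) \<le> real (M + 1)" "real M \<le> real (2 * ((M + 1) div 2))"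
    by (simp_all only: of_nat_le_iff)
  ultimately show ?thesis unfolding eq by (simp add: abs_le_iff)
qed

lemma sum_col_err_le:
  assumes "Q > 0"
  shows "(\<Sum>q=1..Q. col_err q / real q) \<le> 344 * (1 + ln (real Q)) * sqrt (real Q)"
proof -
  define L where "L = 1 + ln (real Q)"
  have L: "L \<ge> 1" using assms by (simp add: L_def)
  have "(\<Sum>q=1..Q. col_err q / real q) \<le> (\<Sum>q=1..Q. 43 * L * (div_weight q / real q))"
  proof (rule sum_mono)
    fix q assume q: "q \<in> {1..Q}"
    have "43 * (1 + ln (real q)) * (div_weight q / real q) \<le> 43 * L * (div_weight q / real q)"
      using q div_weight_ge_1[of q] by (intro mult_right_mono mult_left_mono) (auto simp: L_def)
    then show "col_err q / real q \<le> 43 * L * (div_weight q / real q)"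
      by (simp only: col_err_def times_divide_eq_right)
  qed
  also have "\<dots> = 43 * L * (\<Sum>q=1..Q. div_weight q / real q)" by (simp only: sum_distrib_left)
  also have "\<dots> \<le> 43 * L * (8 * sqrt (real Q))"
    using L by (intro mult_left_mono sum_div_weight_le) auto
  finally show ?thesis by (simp add: L_def[symmetric])
qed

lemma col_err_nonneg: "q > 0 \<Longrightarrow> col_err q \<ge> 0"
  using div_weight_ge_1[of q] unfolding col_err_def by (intro mult_nonneg_nonneg add_nonneg_nonneg) auto

lemma polya_err_nonneg: "n > 0 \<Longrightarrow> polya_err K n \<ge> 0"
  unfolding polya_err_def by (intro sum_nonneg mult_nonneg_nonneg add_nonneg_nonneg divide_nonneg_nonneg) auto

definition osc_int :: "real \<Rightarrow> real \<Rightarrow> real" where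
  "osc_int Y u = integral {Y / 2..Y} (\<lambda>y. sqrt y * osc (2 * pi * u / y))"

text \<open>The classes 1 and 3 modulo 4 together produce \<open>1 - cos + sin\<close>, the
  integrand in the definition of \<open>C\<close>.\<close>

lemma osc_int_eq:
  assumes Y: "Y > 0"
  shows "integral {Y / 2..Y} (\<lambda>y. sqrt y * trig 1 (u / y)) + integral {Y / 2..Y} (\<lambda>y. sqrt y * trig 3 (u / y)) = osc_int Y u"
proof -
  have i: "(\<lambda>y. sqrt y * trig e (u / y)) integrable_on {Y / 2..Y}" if "e \<in> {1, 3}" for e :: nat
  proof -
    have "continuous_on {Y / 2..Y} (\<lambda>y. sqrt y * trig e (u / y))"
      using that Y unfolding trig_def by (auto intro!: continuous_intros)
    then show ?thesis by (rule integrable_continuous_interval)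
  qed
  have "integral {Y / 2..Y} (\<lambda>y. sqrt y * trig 1 (u / y)) + integral {Y / 2..Y} (\<lambda>y. sqrt y * trig 3 (u / y))
     = integral {Y / 2..Y} (\<lambda>y. sqrt y * trig 1 (u / y) + sqrt y * trig 3 (u / y))"
    using i[of 1] i[of 3] by (intro Henstock_Kurzweil_Integration.integral_add[symmetric]) auto
  also have "(\<lambda>y. sqrt y * trig 1 (u / y) + sqrt y * trig 3 (u / y)) = (\<lambda>y. sqrt y * osc (2 * pi * u / y))"
    by (rule ext) (simp add: trig_def osc_def algebra_simps)
  finally show ?thesis by (simp only: osc_int_def)
qed

lemma osc_int_bound:
  assumes Y: "Y > 0"
  shows "\<bar>osc_int Y u\<bar> \<le> 2 * Y * sqrt Y"
proof -
  have "norm (osc_int Y u) \<le> (3 * sqrt Y) * (Y - Y / 2)"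
    unfolding osc_int_def
  proof (rule integral_bound)
    have "continuous_on {Y / 2..Y} (\<lambda>y. sqrt y * (1 - cos (2 * pi * u / y) + sin (2 * pi * u / y)))"
      using Y by (auto intro!: continuous_intros)
    then show "continuous_on {Y / 2..Y} (\<lambda>y. sqrt y * osc (2 * pi * u / y))" by (simp only: osc_def)
    fix y assume y: "y \<in> {Y / 2..Y}"
    have "sqrt y * \<bar>osc (2 * pi * u / y)\<bar> \<le> sqrt Y * 3" using y Y osc_bounds(1) by (intro mult_mono) auto
    then show "norm (sqrt y * osc (2 * pi * u / y)) \<le> 3 * sqrt Y" using y Y by (simp add: abs_mult)
  qed (use Y in auto)
  also have "\<dots> \<le> 2 * Y * sqrt Y" using Y by simp
  finally show ?thesis by simp
qed

text \<open>The substitution \<open>y = X * t\<close> carries the part of the integral between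
  \<open>\<alpha> / 2\<close> and \<open>\<alpha> = Y / X\<close> to \<open>[Y/2, Y]\<close>, at the
  price of the factor \<open>X powr (3/2)\<close>. The terms of the series beyond \<open>R\<close>
  are bounded by the tail of the inverse squares.\<close>

lemma C_fun_block:
  assumes X: "X > 0" and Y: "Y > 0" and R: "R > 0"
  shows "\<bar>1 / 4 * (C_fun (Y / X) - C_fun (Y / 2 / X)) * X powr (3 / 2)
     - (X * (sqrt Y - sqrt (Y / 2)) / 4 + 1 / (8 * pi) * (\<Sum>l=1..R. osc_int Y (real l ^ 2 * X) / real l ^ 2))\<bar>
    \<le> Y * sqrt Y / real R"
proof -
  define a where "a = Y / X"
  have a: "a > 0" using X Y by (simp add: a_def)
  define f where "f t = sqrt t * osc_series osc (2 * pi / t)" for t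
  define F where "F y = sqrt y * osc_series osc (2 * pi * X / y)" for y
  have fc: "continuous_on {0..b} f" if "b \<ge> 0" for b
    unfolding f_def by (rule osc_series_integral(1)[where \<phi> = osc, OF osc_bounds(3) osc_bounds(1)]) (use that in auto)
  have Fc: "continuous_on {Y / 2..Y} F"
    unfolding F_def by (rule osc_series_integral(1)[where \<phi> = osc, OF osc_bounds(3) osc_bounds(1)]) (use Y in auto)
  have split: "integral {0..a} f = integral {0..a / 2} f + integral {a / 2..a} f"
    using a by (intro Henstock_Kurzweil_Integration.integral_combine[symmetric] integrable_continuous_interval fc) auto
  have Cdiff: "C_fun a - C_fun (a / 2) = sqrt a - sqrt (a / 2) + 1 / (2 * pi) * integral {a / 2..a} f"
    using a C_fun_eq_integral[of a] C_fun_eq_integral[of "a / 2"] split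
    by (simp add: f_def[abs_def] add_divide_distrib)
  have s: "X powr (3 / 2) = X * sqrt X"
    using X powr_add[of X 1 "1/2"] by (simp add: powr_half_sqrt)
  have sub: "X * sqrt X * integral {a / 2..a} f = integral {Y / 2..Y} F"
  proof -
    have "((\<lambda>t. X *\<^sub>R F (X * t)) has_integral integral {X * (a / 2)..X * a} F) {a / 2..a}"
      by (rule has_integral_substitution[where c = "Y / 2" and d = Y])
         (use a X Fc in \<open>auto simp: a_def field_simps intro!: derivative_eq_intros\<close>)
    moreover have "(\<lambda>t. X *\<^sub>R F (X * t)) = (\<lambda>t. X * sqrt X * f t)"
    proof
      fix t
      have "2 * pi * X / (X * t) = 2 * pi / t" using X by simp
      then show "X *\<^sub>R F (X * t) = X * sqrt X * f t" using X by (simp add: F_def f_def real_sqrt_mult)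
    qed
    moreover have "X * (a / 2) = Y / 2" "X * a = Y" using X by (simp_all add: a_def)
    ultimately have "((\<lambda>t. X * sqrt X * f t) has_integral integral {Y / 2..Y} F) {a / 2..a}" by (simp only:)
    then show ?thesis by (metis integral_mult_right integral_unique)
  qed
  have sums: "(\<lambda>k. 1 / real (Suc k) ^ 2 * osc_int Y (real (Suc k) ^ 2 * X)) sums integral {Y / 2..Y} F"
  proof -
    have "(\<lambda>k. 1 / real (Suc k) ^ 2 * integral {Y / 2..Y} (\<lambda>y. sqrt y * osc (2 * pi * X * real (Suc k) ^ 2 / y))) sums integral {Y / 2..Y} F"
      unfolding F_def by (rule osc_series_integral(2)[where \<phi> = osc, OF osc_bounds(3) osc_bounds(1)]) (use Y in auto)
    moreover have "integral {Y / 2..Y} (\<lambda>y. sqrt y * osc (2 * pi * X * real (Suc k) ^ 2 / y)) = osc_int Y (real (Suc k) ^ 2 * X)" for k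
      unfolding osc_int_def by (simp only: mult_ac)
    ultimately show ?thesis by (simp only:)
  qed
  define h where "h k = 1 / real (Suc k) ^ 2 * osc_int Y (real (Suc k) ^ 2 * X)" for k
  have hsum: "summable h" "suminf h = integral {Y / 2..Y} F" using sums by (simp_all add: sums_iff h_def[abs_def])
  have fin: "(\<Sum>l=1..R. osc_int Y (real l ^ 2 * X) / real l ^ 2) = (\<Sum>k<R. h k)"
    unfolding h_def by (rule sum.reindex_bij_witness[of _ Suc "\<lambda>d. d - 1"]) auto
  have "\<bar>integral {Y / 2..Y} F - (\<Sum>k<R. h k)\<bar> \<le> 2 * Y * sqrt Y * (1 / real R)"
  proof -
    have tl: "suminf h - (\<Sum>k<R. h k) = (\<Sum>k. h (k + R))"
      using suminf_split_initial_segment[OF hsum(1), of R] by simp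
    have bd: "norm (h (k + R)) \<le> 2 * Y * sqrt Y * (1 / real (Suc (k + R)) ^ 2)" for k
    proof -
      have "1 / real (Suc (k + R)) ^ 2 * \<bar>osc_int Y (real (Suc (k + R)) ^ 2 * X)\<bar> \<le> 1 / real (Suc (k + R)) ^ 2 * (2 * Y * sqrt Y)"
        by (intro mult_left_mono osc_int_bound Y) auto
      then show ?thesis by (simp add: h_def abs_mult mult.commute)
    qed
    have sm: "summable (\<lambda>k. 2 * Y * sqrt Y * (1 / real (Suc (k + R)) ^ 2))"
      using summable_ignore_initial_segment[OF inverse_squares_summable, of R] by (intro summable_mult) simp
    have "norm (\<Sum>k. h (k + R)) \<le> (\<Sum>k. 2 * Y * sqrt Y * (1 / real (Suc (k + R)) ^ 2))"
      by (rule norm_suminf_le[OF bd sm])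
    also have "\<dots> = 2 * Y * sqrt Y * (\<Sum>k. 1 / real (Suc (k + R)) ^ 2)"
      using summable_ignore_initial_segment[OF inverse_squares_summable, of R] by (intro suminf_mult) simp
    also have "\<dots> \<le> 2 * Y * sqrt Y * (1 / real R)"
      using Y R by (intro mult_left_mono inverse_squares_tail) auto
    finally show ?thesis using tl hsum(2) by simp
  qed
  then have "1 / (8 * pi) * \<bar>integral {Y / 2..Y} F - (\<Sum>k<R. h k)\<bar> \<le> 1 / (8 * pi) * (2 * Y * sqrt Y * (1 / real R))"
    by (intro mult_left_mono) auto
  also have "\<dots> \<le> 1 / 2 * (2 * Y * sqrt Y * (1 / real R))"
    using Y pi_ge_two by (intro mult_right_mono divide_left_mono) auto
  finally have tail: "1 / (8 * pi) * \<bar>integral {Y / 2..Y} F - (\<Sum>k<R. h k)\<bar> \<le> Y * sqrt Y / real R" by simp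
  have sq: "X * sqrt X * sqrt (b / X) = X * sqrt b" if "b \<ge> 0" for b
    using X that by (simp add: real_sqrt_divide)
  have "1 / 4 * (C_fun a - C_fun (a / 2)) * (X * sqrt X)
     = (X * sqrt X * sqrt a - X * sqrt X * sqrt (a / 2)) / 4 + 1 / (8 * pi) * (X * sqrt X * integral {a / 2..a} f)"
    unfolding Cdiff by (simp add: field_simps)
  also have "X * sqrt X * sqrt a = X * sqrt Y" unfolding a_def using Y by (intro sq) auto
  also have "X * sqrt X * sqrt (a / 2) = X * sqrt (Y / 2)" using sq[of "Y / 2"] Y by (simp add: a_def field_simps)
  also note sub
  finally have eq: "1 / 4 * (C_fun a - C_fun (a / 2)) * (X * sqrt X)
     - (X * (sqrt Y - sqrt (Y / 2)) / 4 + 1 / (8 * pi) * (\<Sum>k<R. h k))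
     = 1 / (8 * pi) * (integral {Y / 2..Y} F - (\<Sum>k<R. h k))"
    by (simp add: algebra_simps diff_divide_distrib)
  have "Y / 2 / X = a / 2" by (simp add: a_def)
  then show ?thesis using tail unfolding fin s a_def[symmetric] by (simp only: eq abs_mult) simp
qed

text \<open>Odd \<open>m\<close> are all \<open>m\<close> minus the even ones, so each row is
  expanded at \<open>X\<close> and at \<open>X / 2\<close>. After exchanging the sums, columns
  \<open>k\<close> occur in the first expansion and columns \<open>2 * k\<close> in the second;
  those whose index is a square give the main term, and all deviations from the column means go into
  the error.\<close>

theorem kernel_sum_block:
  assumes X: "X \<ge> 0" and Y: "Y \<ge> 1" and R: "R > 0"
  shows "\<bar>(kernel_sum X Y - kernel_sum X (Y / 2))
      - (X * (sqrt Y - sqrt (Y / 2)) / 4 + 1 / (8 * pi) * (\<Sum>l=1..R. osc_int Y (real l ^ 2 * X) / real l ^ 2))\<bar>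
    \<le> X + 30000 * (sqrt Y * (1 + real R ^ 2 * X / Y) * real R * (1 + ln (4 * real R ^ 2)))
     + 16 * Y * (1 + ln Y) + 6 * Y ^ 2 / real R ^ 2 * (1 + ln Y)"
proof -
  have Y0: "Y > 0" using Y by simp
  define B where "B = {n. Y / 2 < real n \<and> real n \<le> Y \<and> odd n}"
  define N where "N e = {n. Y / 2 < real n \<and> real n \<le> Y \<and> n mod 4 = e}" for e :: nat
  \<comment> \<open>With these two lengths the frequency \<open>u\<close> stays at most
    \<open>R^2 * X\<close> in both expansions, and the square columns are indexed by 1 to
    \<open>R\<close> in both.\<close>
  define K L where "K = R ^ 2" and "L = 2 * R ^ 2"
  have KL: "K > 0" "L > 0" using R by (simp_all add: K_def L_def)
  have finN: "finite (N e)" for e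
    by (rule finite_subset[of _ "{..nat \<lfloor>Y\<rfloor>}"]) (auto simp: N_def le_nat_floor)
  have BN: "B = N 1 \<union> N 3" unfolding B_def N_def by (auto; presburger)
  have finB: "finite B" unfolding BN using finN by simp
  have sumB: "(\<Sum>n\<in>B. g n) = (\<Sum>n\<in>N 1. g n) + (\<Sum>n\<in>N 3. g n)" for g :: "nat \<Rightarrow> real"
    unfolding BN by (rule sum.union_disjoint[OF finN finN]) (auto simp: N_def)
  have oddB: "odd n" "n > 0" if "n \<in> B" for n using that by (auto simp: B_def odd_pos)
  have upto: "odd_upto Y = odd_upto (Y / 2) \<union> B" "odd_upto (Y / 2) \<inter> B = {}"
    using Y0 by (auto simp: odd_upto_def B_def odd_pos Suc_le_eq)
  have sum_upto: "(\<Sum>n\<in>odd_upto Y. g n) = (\<Sum>n\<in>odd_upto (Y / 2). g n) + (\<Sum>n\<in>B. g n)" for g :: "nat \<Rightarrow> real"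
    unfolding upto(1) by (rule sum.union_disjoint[OF finite_odd_upto finB upto(2)])
  define J where "J n = real_of_int (Jacobi 2 n)" for n
  define A1 where "A1 n = sqrt (real n) / pi * (\<Sum>k=1..K. real_of_int (jkernel (int k) n) / real k * trig n (real k * X / real n))" for n
  define A2 where "A2 n = sqrt (real n) / pi * (\<Sum>k=1..L. real_of_int (jkernel (int k) n) / real k * trig n (real k * (X / 2) / real n))" for n
  have row: "\<bar>(\<Sum>m\<in>odd_upto X. real_of_int (jkernel (int m) n)) - (X / 2 * square_ind n + A1 n - J n * A2 n)\<bar>
      \<le> 2 * polya_err K n + 2 * polya_err L n" if n: "n \<in> B" for n
  proof -
    note o = oddB(1)[OF n]
    have e1: "\<bar>jkernel_sum n X - X * square_ind n - A1 n\<bar> \<le> 2 * polya_err K n"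
      unfolding A1_def by (rule polya_expansion[OF o X KL(1)])
    have e2: "\<bar>jkernel_sum n (X / 2) - X / 2 * square_ind n - A2 n\<bar> \<le> 2 * polya_err L n"
      unfolding A2_def by (rule polya_expansion[OF o _ KL(2)]) (use X in simp)
    have J1: "\<bar>J n\<bar> \<le> 1" using Jacobi_values[OF o, of 2] by (auto simp: J_def)
    \<comment> \<open>An odd square is 1 modulo 8, so \<open>(2 | n) = 1\<close> there and the even
      \<open>m\<close> remove exactly half of the mean.\<close>
    have Jsq: "J n * square_ind n = square_ind n"
    proof (cases "\<exists>s. n = s ^ 2")
      case True
      then obtain s where "n = s ^ 2" "odd s" using o by auto
      then have "n mod 8 = 1" using odd_square_mod_8 by simp
      then show ?thesis by (simp add: J_def Jacobi_2[OF o])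
    qed (simp add: square_ind_def)
    have "\<bar>J n\<bar> * \<bar>jkernel_sum n (X / 2) - X / 2 * square_ind n - A2 n\<bar> \<le> 1 * (2 * polya_err L n)"
      using J1 e2 by (intro mult_mono) auto
    then have "\<bar>J n * jkernel_sum n (X / 2) - X / 2 * (J n * square_ind n) - J n * A2 n\<bar> \<le> 2 * polya_err L n"
      unfolding abs_mult[symmetric] by (simp add: algebra_simps)
    then show ?thesis using e1 unfolding odd_row_sum[OF o X] J_def[symmetric] Jsq by (simp add: algebra_simps abs_le_iff)
  qed
  define U where "U q u e = (\<Sum>n\<in>N e. real_of_int (jkernel (int q) n) * (sqrt (real n) * trig e (u / real n)))" for q u e
  define I where "I u e = integral {Y / 2..Y} (\<lambda>y. sqrt y * trig e (u / y))" for u e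
  have trigN: "trig n t = trig e t" if "n \<in> N e" "e \<in> {1, 3}" for n e t
    using that by (auto simp: trig_def N_def)
  have A1sum: "(\<Sum>n\<in>N e. A1 n) = (\<Sum>k=1..K. 1 / (pi * real k) * U k (real k * X) e)" if e: "e \<in> {1, 3}" for e
  proof -
    have "(\<Sum>n\<in>N e. A1 n) = (\<Sum>n\<in>N e. \<Sum>k=1..K. 1 / (pi * real k) * (real_of_int (jkernel (int k) n) * (sqrt (real n) * trig e (real k * X / real n))))"
      unfolding A1_def sum_distrib_left by (intro sum.cong refl) (simp add: trigN[OF _ e])
    then show ?thesis unfolding U_def sum_distrib_left by (simp only: sum.swap[of _ "N e"])
  qed
  \<comment> \<open>The twist \<open>(2 | n)\<close> is absorbed into the kernel and doubles its
    first argument.\<close>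
  have A2sum: "(\<Sum>n\<in>N e. J n * A2 n) = (\<Sum>k=1..L. 1 / (pi * real k) * U (2 * k) (real k * X / 2) e)" if e: "e \<in> {1, 3}" for e
  proof -
    have "(\<Sum>n\<in>N e. J n * A2 n) = (\<Sum>n\<in>N e. \<Sum>k=1..L. 1 / (pi * real k) * (real_of_int (jkernel (int (2 * k)) n) * (sqrt (real n) * trig e (real k * X / 2 / real n))))"
      unfolding A2_def sum_distrib_left
    proof (intro sum.cong refl)
      fix n k assume n: "n \<in> N e"
      have "odd n" using n e unfolding N_def by (auto; presburger)
      then have "real_of_int (jkernel (int (2 * k)) n) = J n * real_of_int (jkernel (int k) n)"
        using jkernel_2_mult[of n "int k"] by (simp add: J_def)
      then show "J n * (sqrt (real n) / pi * (real_of_int (jkernel (int k) n) / real k * trig n (real k * (X / 2) / real n)))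
         = 1 / (pi * real k) * (real_of_int (jkernel (int (2 * k)) n) * (sqrt (real n) * trig e (real k * X / 2 / real n)))"
        by (simp add: trigN[OF n e])
    qed
    then show ?thesis unfolding U_def sum_distrib_left by (simp only: sum.swap[of _ "N e"])
  qed
  define W where "W = sqrt Y * (1 + real R ^ 2 * X / Y)"
  have W0: "W \<ge> 0" using X Y by (simp add: W_def)
  define l4 where "l4 = 1 + ln (4 * real R ^ 2)"
  have R1: "real R \<ge> 1" using R by simp
  have R2: "real R ^ 2 \<ge> 1" using R1 by simp
  have Ub: "\<bar>U q u e - square_ind q / 4 * I u e\<bar> \<le> col_err q * (13 * W)"
    if "q > 0" "e \<in> {1, 3}" "u \<ge> 0" "u \<le> real R ^ 2 * X" for q u e
  proof -
    have "\<bar>U q u e - square_ind q / 4 * I u e\<bar> \<le> col_err q * (13 * sqrt Y * (1 + u / Y))"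
      unfolding U_def I_def N_def by (rule column_abel[OF that(1,2) Y0 that(3)])
    also have "\<dots> \<le> col_err q * (13 * sqrt Y * (1 + real R ^ 2 * X / Y))"
      using Y0 that(4) col_err_nonneg[OF that(1)] by (intro mult_left_mono add_left_mono divide_right_mono) auto
    finally show ?thesis by (simp only: W_def mult.assoc)
  qed
  have S1: "\<bar>(\<Sum>k=1..K. 1 / (pi * real k) * U k (real k * X) e) - (\<Sum>k=1..K. 1 / (pi * real k) * (square_ind k / 4 * I (real k * X) e))\<bar>
     \<le> 2236 * (W * real R * l4)" if e: "e \<in> {1, 3}" for e
  proof -
    have "\<bar>(\<Sum>k=1..K. 1 / (pi * real k) * U k (real k * X) e) - (\<Sum>k=1..K. 1 / (pi * real k) * (square_ind k / 4 * I (real k * X) e))\<bar>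
       \<le> (\<Sum>k=1..K. \<bar>1 / (pi * real k) * (U k (real k * X) e - square_ind k / 4 * I (real k * X) e)\<bar>)"
      unfolding sum_subtractf[symmetric] right_diff_distrib[symmetric] by (rule sum_abs)
    also have "\<dots> \<le> (\<Sum>k=1..K. 1 / 2 * (13 * W) * (col_err k / real k))"
    proof (rule sum_mono)
      fix k assume k: "k \<in> {1..K}"
      have "real k \<le> real R ^ 2" using k by (simp add: K_def flip: of_nat_power)
      then have ub: "real k * X \<le> real R ^ 2 * X" using X by (intro mult_right_mono)
      have "1 / (pi * real k) * \<bar>U k (real k * X) e - square_ind k / 4 * I (real k * X) e\<bar> \<le> 1 / (2 * real k) * (col_err k * (13 * W))"
        using k e X ub pi_ge_two by (intro mult_mono Ub divide_left_mono mult_right_mono) (auto simp: K_def)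
      then show "\<bar>1 / (pi * real k) * (U k (real k * X) e - square_ind k / 4 * I (real k * X) e)\<bar> \<le> 1 / 2 * (13 * W) * (col_err k / real k)"
        by (simp add: abs_mult mult_ac)
    qed
    also have "\<dots> = 1 / 2 * (13 * W) * (\<Sum>k=1..K. col_err k / real k)" by (simp only: sum_distrib_left)
    also have "\<dots> \<le> 1 / 2 * (13 * W) * (344 * l4 * real R)"
    proof (intro mult_left_mono)
      have "(\<Sum>k=1..K. col_err k / real k) \<le> 344 * (1 + ln (real K)) * sqrt (real K)" by (rule sum_col_err_le[OF KL(1)])
      also have "sqrt (real K) = real R" by (simp add: K_def)
      also have "344 * (1 + ln (real K)) * real R \<le> 344 * l4 * real R"
      proof (intro mult_right_mono mult_left_mono)
        have "ln (real K) \<le> ln (4 * real R ^ 2)" using R1 by (simp add: K_def)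
        then show "1 + ln (real K) \<le> l4" by (simp add: l4_def)
      qed auto
      finally show "(\<Sum>k=1..K. col_err k / real k) \<le> 344 * l4 * real R" .
    qed (use W0 in auto)
    also have "\<dots> = 2236 * (W * real R * l4)" by simp
    finally show ?thesis .
  qed
  have S2: "\<bar>(\<Sum>k=1..L. 1 / (pi * real k) * U (2 * k) (real k * X / 2) e) - (\<Sum>k=1..L. 1 / (pi * real k) * (square_ind (2 * k) / 4 * I (real k * X / 2) e))\<bar>
     \<le> 8944 * (W * real R * l4)" if e: "e \<in> {1, 3}" for e
  proof -
    have "\<bar>(\<Sum>k=1..L. 1 / (pi * real k) * U (2 * k) (real k * X / 2) e) - (\<Sum>k=1..L. 1 / (pi * real k) * (square_ind (2 * k) / 4 * I (real k * X / 2) e))\<bar>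
       \<le> (\<Sum>k=1..L. \<bar>1 / (pi * real k) * (U (2 * k) (real k * X / 2) e - square_ind (2 * k) / 4 * I (real k * X / 2) e)\<bar>)"
      unfolding sum_subtractf[symmetric] right_diff_distrib[symmetric] by (rule sum_abs)
    also have "\<dots> \<le> (\<Sum>k=1..L. 13 * W * (col_err (2 * k) / real (2 * k)))"
    proof (rule sum_mono)
      fix k assume k: "k \<in> {1..L}"
      have "real k \<le> real (2 * R ^ 2)" using k by (simp only: L_def atLeastAtMost_iff of_nat_le_iff)
      then have "real k * X \<le> 2 * real R ^ 2 * X" using X by (intro mult_right_mono) simp_all
      then have ub: "real k * X / 2 \<le> real R ^ 2 * X" by simp
      have "\<bar>U (2 * k) (real k * X / 2) e - square_ind (2 * k) / 4 * I (real k * X / 2) e\<bar> \<le> col_err (2 * k) * (13 * W)"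
        using k e X ub by (intro Ub) auto
      then have "1 / (pi * real k) * \<bar>U (2 * k) (real k * X / 2) e - square_ind (2 * k) / 4 * I (real k * X / 2) e\<bar> \<le> 1 / (2 * real k) * (col_err (2 * k) * (13 * W))"
        using k pi_ge_two by (intro mult_mono divide_left_mono mult_right_mono) auto
      then show "\<bar>1 / (pi * real k) * (U (2 * k) (real k * X / 2) e - square_ind (2 * k) / 4 * I (real k * X / 2) e)\<bar> \<le> 13 * W * (col_err (2 * k) / real (2 * k))"
        by (simp add: abs_mult mult_ac)
    qed
    also have "\<dots> = 13 * W * (\<Sum>k=1..L. col_err (2 * k) / real (2 * k))" by (simp only: sum_distrib_left)
    also have "\<dots> \<le> 13 * W * (344 * l4 * (2 * real R))"
    proof (intro mult_left_mono)
      have "(\<Sum>k=1..L. col_err (2 * k) / real (2 * k)) = (\<Sum>q\<in>(\<lambda>k. 2 * k) ` {1..L}. col_err q / real q)"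
        by (rule sum.reindex_cong[symmetric, of "\<lambda>k. 2 * k"]) (auto simp: inj_on_def)
      also have "\<dots> \<le> (\<Sum>q=1..4 * R ^ 2. col_err q / real q)"
        by (intro sum_mono2 divide_nonneg_nonneg col_err_nonneg) (auto simp: L_def)
      also have "\<dots> \<le> 344 * (1 + ln (real (4 * R ^ 2))) * sqrt (real (4 * R ^ 2))"
        by (rule sum_col_err_le) (use R in simp)
      also have "\<dots> = 344 * l4 * (2 * real R)" by (simp add: l4_def real_sqrt_mult)
      finally show "(\<Sum>k=1..L. col_err (2 * k) / real (2 * k)) \<le> 344 * l4 * (2 * real R)" .
    qed (use W0 in auto)
    also have "\<dots> = 8944 * (W * real R * l4)" by simp
    finally show ?thesis .
  qed
  have II: "I u 1 + I u 3 = osc_int Y u" for u unfolding I_def by (rule osc_int_eq[OF Y0])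
  have M1: "(\<Sum>k=1..K. 1 / (pi * real k) * (square_ind k / 4 * I (real k * X) 1)) + (\<Sum>k=1..K. 1 / (pi * real k) * (square_ind k / 4 * I (real k * X) 3))
     = 1 / (4 * pi) * (\<Sum>l=1..R. osc_int Y (real l ^ 2 * X) / real l ^ 2)"
  proof -
    have "(\<Sum>k=1..K. 1 / (pi * real k) * (square_ind k / 4 * I (real k * X) 1)) + (\<Sum>k=1..K. 1 / (pi * real k) * (square_ind k / 4 * I (real k * X) 3))
       = (\<Sum>k=1..R ^ 2. square_ind k * (1 / (4 * pi) * (osc_int Y (real k * X) / real k)))"
      unfolding sum.distrib[symmetric] K_def
      by (intro sum.cong refl) (simp add: II[symmetric] field_simps)
    also have "\<dots> = (\<Sum>l=1..R. 1 / (4 * pi) * (osc_int Y (real (l ^ 2) * X) / real (l ^ 2)))" by (rule sum_square_ind)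
    also have "\<dots> = 1 / (4 * pi) * (\<Sum>l=1..R. osc_int Y (real l ^ 2 * X) / real l ^ 2)"
      by (simp only: of_nat_power sum_distrib_left)
    finally show ?thesis .
  qed
  have M2: "(\<Sum>k=1..L. 1 / (pi * real k) * (square_ind (2 * k) / 4 * I (real k * X / 2) 1)) + (\<Sum>k=1..L. 1 / (pi * real k) * (square_ind (2 * k) / 4 * I (real k * X / 2) 3))
     = 1 / (8 * pi) * (\<Sum>l=1..R. osc_int Y (real l ^ 2 * X) / real l ^ 2)"
  proof -
    have "(\<Sum>k=1..L. 1 / (pi * real k) * (square_ind (2 * k) / 4 * I (real k * X / 2) 1)) + (\<Sum>k=1..L. 1 / (pi * real k) * (square_ind (2 * k) / 4 * I (real k * X / 2) 3))
       = (\<Sum>k=1..2 * R ^ 2. square_ind (2 * k) * (1 / (4 * pi) * (osc_int Y (real k * X / 2) / real k)))"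
      unfolding sum.distrib[symmetric] L_def
      by (intro sum.cong refl) (simp add: II[symmetric] field_simps)
    also have "\<dots> = (\<Sum>l=1..R. 1 / (4 * pi) * (osc_int Y (real (2 * l ^ 2) * X / 2) / real (2 * l ^ 2)))" by (rule sum_square_ind_double)
    also have "\<dots> = (\<Sum>l=1..R. 1 / (8 * pi) * (osc_int Y (real l ^ 2 * X) / real l ^ 2))"
      by (intro sum.cong refl) simp
    also have "\<dots> = 1 / (8 * pi) * (\<Sum>l=1..R. osc_int Y (real l ^ 2 * X) / real l ^ 2)"
      by (simp only: sum_distrib_left)
    finally show ?thesis .
  qed
  define S where "S = (\<Sum>l=1..R. osc_int Y (real l ^ 2 * X) / real l ^ 2)"
  \<comment> \<open>The first expansion yields \<open>S / (4 * pi)\<close>, the second removes half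
    of it; the difference is the \<open>S / (8 * pi)\<close> that \<open>C_fun_block\<close>
    predicts.\<close>
  have half: "1 / (4 * pi) * S = 1 / (8 * pi) * S + 1 / (8 * pi) * S" by (simp add: field_simps)
  have d1: "kernel_sum X Y - kernel_sum X (Y / 2) = (\<Sum>n\<in>B. \<Sum>m\<in>odd_upto X. real_of_int (jkernel (int m) n))"
    unfolding kernel_sum_def sum_upto by simp
  have d2: "\<bar>(\<Sum>n\<in>B. \<Sum>m\<in>odd_upto X. real_of_int (jkernel (int m) n)) - (\<Sum>n\<in>B. X / 2 * square_ind n + A1 n - J n * A2 n)\<bar>
      \<le> (\<Sum>n\<in>B. 2 * polya_err K n + 2 * polya_err L n)"
    unfolding sum_subtractf[symmetric] by (rule order.trans[OF sum_abs]) (intro sum_mono row)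
  have d3: "(\<Sum>n\<in>B. X / 2 * square_ind n + A1 n - J n * A2 n)
     = X / 2 * (\<Sum>n\<in>B. square_ind n) + ((\<Sum>n\<in>N 1. A1 n) + (\<Sum>n\<in>N 3. A1 n)) - ((\<Sum>n\<in>N 1. J n * A2 n) + (\<Sum>n\<in>N 3. J n * A2 n))"
    unfolding sum_subtractf sum.distrib sumB[of A1] sumB[of "\<lambda>n. J n * A2 n"] by (simp only: sum_distrib_left)
  have d4: "\<bar>X / 2 * (\<Sum>n\<in>B. square_ind n) - X * (sqrt Y - sqrt (Y / 2)) / 4\<bar> \<le> X"
  proof -
    have "\<bar>(\<Sum>n\<in>B. square_ind n) - (sqrt Y - sqrt (Y / 2)) / 2\<bar> \<le> 2"
    proof -
      have c1: "\<bar>(\<Sum>n\<in>odd_upto Y. square_ind n) - sqrt Y / 2\<bar> \<le> 1"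
        by (rule odd_squares_count) (use Y0 in auto)
      have c2: "\<bar>(\<Sum>n\<in>odd_upto (Y / 2). square_ind n) - sqrt (Y / 2) / 2\<bar> \<le> 1"
        by (rule odd_squares_count) (use Y0 in auto)
      have "\<bar>b - (u - v) / 2\<bar> \<le> 2" if "a = a' + b" "\<bar>a - u / 2\<bar> \<le> 1" "\<bar>a' - v / 2\<bar> \<le> 1" for a a' b u v :: real
        using that by (simp add: abs_le_iff field_simps)
      from this[OF sum_upto[of square_ind] c1 c2] show ?thesis .
    qed
    then have "X / 2 * \<bar>(\<Sum>n\<in>B. square_ind n) - (sqrt Y - sqrt (Y / 2)) / 2\<bar> \<le> X / 2 * 2"
      using X by (intro mult_left_mono) auto
    moreover have "X / 2 * (\<Sum>n\<in>B. square_ind n) - X * (sqrt Y - sqrt (Y / 2)) / 4 = X / 2 * ((\<Sum>n\<in>B. square_ind n) - (sqrt Y - sqrt (Y / 2)) / 2)"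
      by (simp add: field_simps)
    ultimately show ?thesis using X by (simp only: abs_mult)
  qed
  have d5: "(\<Sum>n\<in>B. 2 * polya_err K n + 2 * polya_err L n) \<le> 16 * Y * (1 + ln Y) + 6 * Y ^ 2 / real R ^ 2 * (1 + ln Y)"
  proof -
    define M where "M = nat \<lfloor>Y\<rfloor>"
    have M: "real M \<le> Y" "M > 0" using Y unfolding M_def by (simp_all add: of_nat_nat)
    have lnM: "1 + ln (real M) \<le> 1 + ln Y" "0 \<le> 1 + ln (real M)" using M by simp_all
    have pe: "(\<Sum>n\<in>B. polya_err k n) \<le> 4 * Y * (1 + ln Y) + 2 * Y ^ 2 / real k * (1 + ln Y)" if k: "k > 0" for k
    proof -
      have "(\<Sum>n\<in>B. polya_err k n) \<le> (\<Sum>n=1..M. polya_err k n)"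
        by (intro sum_mono2 polya_err_nonneg) (use Y in \<open>auto simp: B_def M_def le_nat_floor_iff Suc_le_eq odd_pos\<close>)
      also have "\<dots> \<le> 4 * real M * (1 + ln (real M)) + 2 * real M ^ 2 / real k * (1 + ln (real M))"
        by (rule sum_polya_err_le[OF M(2) k])
      also have "\<dots> \<le> 4 * Y * (1 + ln Y) + 2 * Y ^ 2 / real k * (1 + ln Y)"
        using M lnM Y by (intro add_mono mult_mono mult_left_mono divide_right_mono power_mono) auto
      finally show ?thesis .
    qed
    have "(\<Sum>n\<in>B. 2 * polya_err K n + 2 * polya_err L n) = 2 * (\<Sum>n\<in>B. polya_err K n) + 2 * (\<Sum>n\<in>B. polya_err L n)"
      by (simp only: sum.distrib sum_distrib_left)
    also have "\<dots> \<le> 2 * (4 * Y * (1 + ln Y) + 2 * Y ^ 2 / real K * (1 + ln Y)) + 2 * (4 * Y * (1 + ln Y) + 2 * Y ^ 2 / real L * (1 + ln Y))"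
      by (intro add_mono mult_left_mono pe KL) auto
    also have "\<dots> = 16 * Y * (1 + ln Y) + 6 * (Y ^ 2 / real R ^ 2 * (1 + ln Y))"
      using R by (simp add: K_def L_def field_simps)
    finally show ?thesis by simp
  qed
  have e13: "(1::nat) \<in> {1, 3}" "(3::nat) \<in> {1, 3}" by auto
  have aux: "\<bar>D - (m + h)\<bar> \<le> x + p + (2 * w1 + 2 * w2)"
    if "\<bar>D - E\<bar> \<le> P" "P \<le> p" "E = q + (a1 + a3) - (b1 + b3)" "\<bar>q - m\<bar> \<le> x"
      "\<bar>a1 - c1\<bar> \<le> w1" "\<bar>a3 - c3\<bar> \<le> w1" "\<bar>b1 - f1\<bar> \<le> w2" "\<bar>b3 - f3\<bar> \<le> w2"
      "c1 + c3 = h2" "f1 + f3 = h" "h2 = h + h" for D E P p q a1 a3 b1 b3 m x c1 c3 w1 w2 f1 f3 h h2 :: real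
  proof -
    note u = that(1,4-8)[THEN abs_le_D1] and l = that(1,4-8)[THEN abs_le_D2]
    show ?thesis by (rule abs_leI) (use u l that(2,3,9-11) in linarith)+
  qed
  have "\<bar>(kernel_sum X Y - kernel_sum X (Y / 2)) - (X * (sqrt Y - sqrt (Y / 2)) / 4 + 1 / (8 * pi) * S)\<bar>
     \<le> X + (16 * Y * (1 + ln Y) + 6 * Y ^ 2 / real R ^ 2 * (1 + ln Y))
        + (2 * (2236 * (W * real R * l4)) + 2 * (8944 * (W * real R * l4)))"
    unfolding d1 S_def
    by (rule aux[OF d2 d5 d3[unfolded A1sum[OF e13(1)] A1sum[OF e13(2)] A2sum[OF e13(1)] A2sum[OF e13(2)]] d4
          S1[OF e13(1)] S1[OF e13(2)] S2[OF e13(1)] S2[OF e13(2)] M1 M2 half[unfolded S_def]])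
  moreover have "0 \<le> W * real R * l4" using W0 R2 by (intro mult_nonneg_nonneg) (auto simp: l4_def)
  ultimately show ?thesis unfolding S_def W_def[symmetric] l4_def[symmetric] by linarith
qed

section \<open>Balancing the errors and summing the dyadic blocks\<close>

definition err_T :: "real \<Rightarrow> real \<Rightarrow> real" where
  "err_T X Y = X * Y powr (7 / 16) + Y * X powr (7 / 16)"

lemma err_T_nonneg: "X \<ge> 0 \<Longrightarrow> Y \<ge> 0 \<Longrightarrow> err_T X Y \<ge> 0"
  by (simp add: err_T_def)

definition kernel_dev :: "real \<Rightarrow> real \<Rightarrow> real" where
  "kernel_dev X Y = kernel_sum X Y - 1 / 4 * C_fun (Y / X) * X powr (3 / 2)"

lemma powr_three_halves: "X > 0 \<Longrightarrow> X powr (3 / 2) = X * sqrt X" for X :: real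
  using powr_add[of X 1 "1/2"] by (simp add: powr_half_sqrt)

text \<open>The smaller variable is then below 1, where \<open>sqrt Z \<le> Z powr (7/16)\<close>.
  The growth of \<open>C\<close> at 0 or at infinity, according to which variable is smaller, gives
  the matching half of \<open>err_T\<close>.\<close>

lemma main_term_small:
  assumes X: "X > 0" and Y: "Y > 0" and small: "X < 1 \<or> Y < 1"
  shows "\<bar>C_fun (Y / X) * X powr (3 / 2)\<bar> \<le> 11 * err_T X Y"
proof -
  define a where "a = Y / X"
  have a: "a > 0" using X Y by (simp add: a_def)
  have C: "\<bar>C_fun a\<bar> \<le> sqrt a + 10 * a" by (rule C_fun_bound) (use a in simp)
  have s: "sqrt Z \<le> Z powr (7 / 16)" if "0 < Z" "Z < 1" for Z :: real
    using that powr_mono'[of "7/16" "1/2" Z] by (simp add: powr_half_sqrt)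
  show ?thesis
  proof (cases "X \<le> Y")
    case True
    then have a1: "a \<ge> 1" and X1: "X < 1" using X small by (auto simp: a_def)
    have "sqrt a * 1 \<le> sqrt a * sqrt a" using a1 by (intro mult_left_mono) auto
    then have "\<bar>C_fun a\<bar> \<le> 11 * a" using C a by simp
    then have "\<bar>C_fun a\<bar> * (X * sqrt X) \<le> 11 * a * (X * sqrt X)" using X by (intro mult_right_mono) auto
    also have "\<dots> = 11 * (Y * sqrt X)" using X by (simp add: a_def)
    also have "\<dots> \<le> 11 * (Y * X powr (7 / 16))" using s[OF X X1] Y by simp
    also have "\<dots> \<le> 11 * err_T X Y" using X by (simp add: err_T_def)
    finally show ?thesis using X by (simp add: a_def abs_mult powr_three_halves)
  next
    case False
    then have a1: "a \<le> 1" and Y1: "Y < 1" using X small by (auto simp: a_def)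
    have "sqrt a * sqrt a \<le> sqrt a * 1" using a1 a by (intro mult_left_mono) auto
    then have "\<bar>C_fun a\<bar> \<le> 11 * sqrt a" using C a by simp
    then have "\<bar>C_fun a\<bar> * (X * sqrt X) \<le> 11 * sqrt a * (X * sqrt X)" using X by (intro mult_right_mono) auto
    also have "\<dots> = 11 * (X * sqrt Y)" using X by (simp add: a_def real_sqrt_divide)
    also have "\<dots> \<le> 11 * (X * Y powr (7 / 16))" using s[OF Y Y1] X by simp
    also have "\<dots> \<le> 11 * err_T X Y" using Y by (simp add: err_T_def)
    finally show ?thesis using X by (simp add: a_def abs_mult powr_three_halves)
  qed
qed

lemma kernel_dev_small:
  assumes X: "X > 0" and Y: "Y > 0" and small: "X < 1 \<or> Y < 1"
  shows "\<bar>kernel_dev X Y\<bar> \<le> 11 * err_T X Y"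
proof -
  have "odd_upto X = {} \<or> odd_upto Y = {}"
    using small by (auto simp: odd_upto_def Suc_le_eq)
  then have "kernel_sum X Y = 0" by (auto simp: kernel_sum_def)
  then have "\<bar>kernel_dev X Y\<bar> = 1 / 4 * \<bar>C_fun (Y / X) * X powr (3 / 2)\<bar>" by (simp add: kernel_dev_def abs_mult)
  also have "\<dots> \<le> 1 * \<bar>C_fun (Y / X) * X powr (3 / 2)\<bar>" by (intro mult_right_mono) auto
  finally show ?thesis using main_term_small[OF assms] by simp
qed

text \<open>
  With \<open>R\<close> the integer next to \<open>Y / \<surd>T\<close>, the truncation errors and the contribution of the non-square columns
  are both \<open>O(T)\<close>. All quantities are powers of \<open>x = X powr (1/32)\<close> and \<open>y = Y powr (1/32)\<close>.
\<close>

lemma choose_R: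
  assumes X: "X \<ge> 1" and Y: "Y \<ge> 1"
  defines "T \<equiv> err_T X Y"
  obtains R :: nat where "R > 0" "real R \<le> Y + 1" "Y * sqrt Y / real R \<le> T" "Y ^ 2 / real R ^ 2 \<le> T"
    "sqrt Y * (1 + real R ^ 2 * X / Y) * real R \<le> 10 * T" "X \<le> T" "Y \<le> T"
proof -
  define x y where "x = X powr (1 / 32)" and "y = Y powr (1 / 32)"
  have x1: "x \<ge> 1" "y \<ge> 1" using X Y by (simp_all add: x_def y_def ge_one_powr_ge_zero)
  have pw: "Z powr (real n / 32) = (Z powr (1 / 32)) ^ n" if "Z \<ge> 1" for Z n
    using that by (simp add: powr_powr flip: powr_realpow)
  have Xx: "X = x ^ 32" and Yy: "Y = y ^ 32" using pw[OF X, of 32] pw[OF Y, of 32] X Y by (simp_all add: x_def y_def)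
  have X7: "X powr (7 / 16) = x ^ 14" "Y powr (7 / 16) = y ^ 14" using pw[OF X, of 14] pw[OF Y, of 14] by (simp_all add: x_def y_def)
  have T_eq: "T = x ^ 32 * y ^ 14 + y ^ 32 * x ^ 14" by (simp add: T_def err_T_def X7 Xx[symmetric] Yy[symmetric])
  have sY: "sqrt Y = y ^ 16" using x1 by (intro real_sqrt_unique) (simp_all add: Yy)
  have p1: "x ^ n \<ge> 1" "y ^ n \<ge> 1" for n using x1 by (simp_all add: one_le_power)
  have p0: "x ^ n > 0" "y ^ n > 0" for n using x1 by simp_all
  have T1: "x ^ 32 * y ^ 14 \<le> T" "y ^ 32 * x ^ 14 \<le> T" using p0 by (simp_all add: T_eq less_imp_le)
  have XT: "X \<le> T"
  proof -
    have "x ^ 32 * 1 \<le> x ^ 32 * y ^ 14" using p1 p0 by (intro mult_left_mono) (auto simp: less_imp_le)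
    then show ?thesis using T1 Xx by simp
  qed
  have YT: "Y \<le> T"
  proof -
    have "y ^ 32 * 1 \<le> y ^ 32 * x ^ 14" using p1 p0 by (intro mult_left_mono) (auto simp: less_imp_le)
    then show ?thesis using T1 Yy by simp
  qed
  have T0: "T \<ge> 1" using YT Y by simp
  have sT: "sqrt T \<ge> 1" "sqrt T * sqrt T = T" using T0 by simp_all
  \<comment> \<open>With this choice \<open>Y^2 / q^2\<close> is exactly \<open>T\<close>. The
    column error has room: for \<open>X = Y\<close> a balanced choice would even give the exponent
    \<open>7/5\<close> in place of \<open>23/16\<close>, apart from logarithms.\<close>
  define q where "q = Y / sqrt T"
  have q0: "q > 0" using Y sT by (simp add: q_def)
  define R where "R = nat \<lceil>q\<rceil>"
  have Rq: "real R \<ge> q" "real R \<le> q + 1" using q0 unfolding R_def by (simp_all add: of_nat_nat)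
  have R0: "real R > 0" using Rq q0 by linarith
  have qY: "q \<le> Y" using sT Y unfolding q_def by (simp add: divide_le_eq mult_left_mono)
  have c1: "Y * sqrt Y / real R \<le> T"
  proof -
    have "Y * sqrt Y / real R \<le> Y * sqrt Y / q" using Rq q0 R0 Y by (intro divide_left_mono) auto
    also have "\<dots> = sqrt Y * sqrt T" using Y sT by (simp add: q_def)
    also have "\<dots> \<le> sqrt T * sqrt T" using YT sT by (intro mult_right_mono) auto
    finally show ?thesis using sT by simp
  qed
  have qq: "q ^ 2 = Y ^ 2 / T" using T0 by (simp add: q_def power_divide)
  then have q_sq: "q ^ 2 = y ^ 32 * y ^ 32 / T" by (simp only: Yy power2_eq_square)
  have c2: "Y ^ 2 / real R ^ 2 \<le> T"
  proof -
    have "q ^ 2 \<le> real R ^ 2" using Rq q0 by (intro power_mono) auto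
    then have "Y ^ 2 / real R ^ 2 \<le> Y ^ 2 / q ^ 2" using q0 R0 by (intro divide_left_mono) auto
    also have "\<dots> = T" using qq Y T0 by simp
    finally show ?thesis .
  qed
  have RR: "real R ^ 2 \<le> 2 + 2 * q ^ 2"
  proof -
    have "real R ^ 2 \<le> (q + 1) ^ 2" using Rq R0 by (intro power_mono) auto
    also have "\<dots> \<le> 2 + 2 * q ^ 2" using sum_squares_bound[of q 1] by (simp add: power2_eq_square algebra_simps)
    finally show ?thesis .
  qed
  \<comment> \<open>The case distinction selects the larger of the two terms of \<open>T\<close>,
    and that term alone bounds \<open>q\<close> from above.\<close>
  have c3: "sqrt Y * (1 + real R ^ 2 * X / Y) * real R \<le> 10 * T"
  proof (cases "x \<le> y")
    case True
    have "q ^ 2 \<le> y ^ 32 * y ^ 32 / (y ^ 32 * x ^ 14)"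
      unfolding q_sq using T1(2) T0 x1 by (intro divide_left_mono mult_pos_pos) auto
    also have "\<dots> = y ^ 32 / x ^ 14" by (rule nonzero_mult_divide_mult_cancel_left) (use x1 in simp)
    finally have q2: "q ^ 2 \<le> y ^ 32 / x ^ 14" .
    also have "y ^ 32 / x ^ 14 = (y ^ 16 / x ^ 7) ^ 2" by (simp add: power_divide flip: power_mult)
    finally have q1: "q \<le> y ^ 16 / x ^ 7" by (rule power2_le_imp_le) (use x1 in simp)
    have "x ^ 32 = x ^ 18 * x ^ 14" by (simp flip: power_add)
    moreover have "(b / a) * (c * a / b) = c" if "a \<noteq> 0" "b \<noteq> 0" for a b c :: real
      using that by (simp add: field_simps)
    moreover have "x ^ 14 \<noteq> 0" "y ^ 32 \<noteq> 0" using x1 by simp_all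
    ultimately have ab: "(y ^ 32 / x ^ 14) * (x ^ 32 / y ^ 32) = x ^ 18" by (simp only:)
    have "real R ^ 2 * (x ^ 32 / y ^ 32) \<le> (2 + 2 * (y ^ 32 / x ^ 14)) * (x ^ 32 / y ^ 32)"
      using RR q2 x1 by (intro mult_right_mono) auto
    also have "\<dots> = 2 * (x ^ 32 / y ^ 32) + 2 * x ^ 18"
      by (simp only: distrib_right mult.assoc ab)
    also have "x ^ 32 / y ^ 32 \<le> 1" using True x1 by (simp add: power_mono)
    finally have "1 + real R ^ 2 * (x ^ 32 / y ^ 32) \<le> 5 * x ^ 18" using p1[of 18] by simp
    then have "y ^ 16 * (1 + real R ^ 2 * (x ^ 32 / y ^ 32)) * real R \<le> y ^ 16 * (5 * x ^ 18) * (y ^ 16 / x ^ 7 + 1)"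
      using p0 q1 Rq x1 by (intro mult_mono mult_left_mono mult_nonneg_nonneg add_nonneg_nonneg) (auto simp: less_imp_le)
    also have "\<dots> = 5 * (y ^ 32 * x ^ 11) + 5 * (y ^ 16 * x ^ 18)"
    proof -
      have "y ^ 16 * (5 * x ^ 18) * (y ^ 16 / x ^ 7) = 5 * ((y ^ 16 * y ^ 16) * (x ^ 18 / x ^ 7))" by simp
      also have "x ^ 18 / x ^ 7 = x ^ 11" using x1 by (subst power_diff[symmetric]) auto
      also have "y ^ 16 * y ^ 16 = y ^ 32" by (simp flip: power_add)
      finally show ?thesis by (simp add: distrib_left)
    qed
    also have "y ^ 32 * x ^ 11 \<le> y ^ 32 * x ^ 14" using x1 p0 by (intro mult_left_mono power_increasing) (auto simp: less_imp_le)
    also have "y ^ 16 * x ^ 18 = (y ^ 16 * x ^ 4) * x ^ 14" by (simp flip: power_add mult.assoc)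
    also have "(y ^ 16 * x ^ 4) * x ^ 14 \<le> (y ^ 16 * y ^ 16) * x ^ 14"
    proof (intro mult_right_mono mult_left_mono)
      have "x ^ 4 \<le> y ^ 4" using True x1 by (intro power_mono) auto
      also have "\<dots> \<le> y ^ 16" using x1 by (intro power_increasing) auto
      finally show "x ^ 4 \<le> y ^ 16" .
    qed (use p0 in \<open>auto simp: less_imp_le\<close>)
    also have "y ^ 16 * y ^ 16 = y ^ 32" by (simp flip: power_add)
    finally show ?thesis using T1(2) unfolding sY unfolding Xx Yy by (simp add: mult_ac)
  next
    case False
    have yx: "y ^ n \<le> x ^ n" for n using False x1 by (intro power_mono) auto
    have "q ^ 2 \<le> y ^ 32 * y ^ 32 / (x ^ 32 * y ^ 14)"
      unfolding q_sq using T1(1) T0 x1 by (intro divide_left_mono mult_pos_pos) auto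
    also have "y ^ 32 * y ^ 32 = y ^ 50 * y ^ 14" by (simp flip: power_add)
    also have "y ^ 50 * y ^ 14 / (x ^ 32 * y ^ 14) = y ^ 50 / x ^ 32"
      by (rule nonzero_mult_divide_mult_cancel_right) (use x1 in simp)
    finally have q2: "q ^ 2 \<le> y ^ 50 / x ^ 32" .
    have y50: "y ^ 50 = y ^ 18 * y ^ 32" by (simp flip: power_add)
    have "y ^ 50 / x ^ 32 \<le> y ^ 50 / y ^ 32" using x1 yx by (intro divide_left_mono mult_pos_pos) auto
    also have "\<dots> = y ^ 18" unfolding y50 by (rule nonzero_mult_div_cancel_right) (use x1 in simp)
    also have "\<dots> = (y ^ 9) ^ 2" by (simp flip: power_mult)
    finally have "q ^ 2 \<le> (y ^ 9) ^ 2" using q2 by linarith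
    then have q1: "q \<le> y ^ 9" by (rule power2_le_imp_le) (use x1 in simp)
    have R9: "real R \<le> 2 * y ^ 9" using Rq q1 p1[of 9] by linarith
    have "(c * b / a) * (a / b) = c" if "a \<noteq> 0" "b \<noteq> 0" for a b c :: real
      using that by (simp add: field_simps)
    moreover have "x ^ 32 \<noteq> 0" "y ^ 32 \<noteq> 0" using x1 by simp_all
    ultimately have ab: "(y ^ 50 / x ^ 32) * (x ^ 32 / y ^ 32) = y ^ 18" unfolding y50 by blast
    have "real R ^ 2 * (x ^ 32 / y ^ 32) \<le> (2 + 2 * (y ^ 50 / x ^ 32)) * (x ^ 32 / y ^ 32)"
      using RR q2 x1 by (intro mult_right_mono) auto
    also have "\<dots> = 2 * (x ^ 32 / y ^ 32) + 2 * y ^ 18"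
      by (simp only: distrib_right mult.assoc ab)
    finally have f: "y ^ 16 * (1 + real R ^ 2 * (x ^ 32 / y ^ 32)) * real R \<le> y ^ 16 * (1 + (2 * (x ^ 32 / y ^ 32) + 2 * y ^ 18)) * (2 * y ^ 9)"
      using p0 R9 R0 by (intro mult_mono mult_left_mono mult_nonneg_nonneg add_nonneg_nonneg) (auto simp: less_imp_le)
    have a1: "y ^ 25 \<le> x ^ 32 * y ^ 14"
    proof -
      have "y ^ 25 \<le> y ^ 32" using x1 by (intro power_increasing) auto
      also have "\<dots> \<le> x ^ 32 * 1" using yx by simp
      also have "\<dots> \<le> x ^ 32 * y ^ 14" using p0 p1 by (intro mult_left_mono) (auto simp: less_imp_le)
      finally show ?thesis .
    qed
    have a2: "y ^ 25 * (x ^ 32 / y ^ 32) \<le> x ^ 32 * y ^ 14"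
    proof -
      have "y ^ 25 * (x ^ 32 / y ^ 32) = x ^ 32 * (y ^ 25 / y ^ 32)" by simp
      also have "\<dots> \<le> x ^ 32 * 1" using x1 p0 by (intro mult_left_mono) (auto simp: less_imp_le power_increasing)
      also have "\<dots> \<le> x ^ 32 * y ^ 14" using p0 p1 by (intro mult_left_mono) (auto simp: less_imp_le)
      finally show ?thesis .
    qed
    have a3: "y ^ 43 \<le> x ^ 32 * y ^ 14"
    proof -
      have "y ^ 43 = y ^ 32 * y ^ 11" by (simp flip: power_add)
      also have "\<dots> \<le> x ^ 32 * y ^ 14" using yx x1 p0 by (intro mult_mono power_increasing) (auto simp: less_imp_le)
      finally show ?thesis .
    qed
    note f
    also have "y ^ 16 * (1 + (2 * (x ^ 32 / y ^ 32) + 2 * y ^ 18)) * (2 * y ^ 9) = 2 * y ^ 25 + 4 * (y ^ 25 * (x ^ 32 / y ^ 32)) + 4 * y ^ 43"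
      by (simp add: algebra_simps flip: power_add)
    also have "\<dots> \<le> 2 * (x ^ 32 * y ^ 14) + 4 * (x ^ 32 * y ^ 14) + 4 * (x ^ 32 * y ^ 14)"
      by (intro add_mono mult_left_mono a1 a2 a3) auto
    also have "\<dots> = 10 * (x ^ 32 * y ^ 14)" by simp
    finally show ?thesis using T1(1) unfolding sY unfolding Xx Yy by simp
  qed
  show ?thesis
    by (rule that[of R]) (use R0 Rq qY c1 c2 c3 XT YT in auto)
qed

text \<open>
  The shift by 2 keeps the factor monotone and at least 1 for all nonnegative arguments, also for
  the small ones that occur in the inductions.
\<close>

definition log_factor :: "real \<Rightarrow> real \<Rightarrow> real" where
  "log_factor X Y = ln (X + 2) + ln (Y + 2)"

lemma ln_2_plus: "x \<ge> 0 \<Longrightarrow> ln (x + 2) \<ge> 1 / 2" for x :: real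
proof -
  assume x: "x \<ge> 0"
  have "1 / 2 \<le> ln (2 :: real)" using ln2_ge_two_thirds by simp
  also have "\<dots> \<le> ln (x + 2)" using x by simp
  finally show ?thesis .
qed

lemma log_factor_mono: "0 \<le> X \<Longrightarrow> X \<le> X' \<Longrightarrow> 0 \<le> Y \<Longrightarrow> Y \<le> Y' \<Longrightarrow> log_factor X Y \<le> log_factor X' Y'"
  by (simp add: log_factor_def add_mono)

lemma log_factor_ge_1: "X \<ge> 0 \<Longrightarrow> Y \<ge> 0 \<Longrightarrow> log_factor X Y \<ge> 1"
  using ln_2_plus[of X] ln_2_plus[of Y] by (simp add: log_factor_def)

theorem kernel_dev_block:
  assumes X: "X \<ge> 1" and Y: "Y \<ge> 1"
  shows "\<bar>kernel_dev X Y - kernel_dev X (Y / 2)\<bar> \<le> 3000000 * (err_T X Y * log_factor X Y)"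
proof -
  define T where "T = err_T X Y"
  define L where "L = log_factor X Y"
  have L1: "L \<ge> 1" using X Y by (simp add: L_def log_factor_ge_1)
  obtain R :: nat where R: "R > 0" "real R \<le> Y + 1" "Y * sqrt Y / real R \<le> T" "Y ^ 2 / real R ^ 2 \<le> T"
    "sqrt Y * (1 + real R ^ 2 * X / Y) * real R \<le> 10 * T" "X \<le> T" "Y \<le> T"
    using choose_R[OF X Y] unfolding T_def by blast
  have T0: "T \<ge> 1" using R X by simp
  have lnY: "ln Y \<le> L" "1 + ln Y \<ge> 0"
  proof -
    have "ln Y \<le> ln (Y + 2)" using Y by simp
    then show "ln Y \<le> L" using ln_2_plus[of X] X by (simp add: L_def log_factor_def)
    show "1 + ln Y \<ge> 0" using Y by simp
  qed
  \<comment> \<open>The number of columns is of order \<open>R^2\<close>, and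
    \<open>R \<le> Y + 1\<close> keeps its logarithm within the logarithmic factor.\<close>
  have l4: "1 + ln (4 * real R ^ 2) \<le> 5 * L" "1 + ln (4 * real R ^ 2) \<ge> 0"
  proof -
    have R1: "real R \<ge> 1" using R(1) by simp
    have "ln (4 * real R ^ 2) = ln 4 + 2 * ln (real R)" using R(1) by (simp add: ln_mult ln_realpow)
    moreover have "ln (real R) \<le> ln (Y + 2)" using R R1 by simp
    moreover have "ln (Y + 2) \<le> L" using ln_2_plus[of X] X by (simp add: L_def log_factor_def)
    moreover have "ln (4 :: real) \<le> 2"
    proof -
      have "ln (4 :: real) = 2 * ln 2" using ln_realpow[of 2 2] by simp
      then show ?thesis using ln_2_less_1 by simp
    qed
    ultimately show "1 + ln (4 * real R ^ 2) \<le> 5 * L" using L1 by simp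
    show "1 + ln (4 * real R ^ 2) \<ge> 0"
    proof -
      have "1 * 1 \<le> 4 * real R ^ 2" using R1 by (intro mult_mono) auto
      then have "ln (4 * real R ^ 2) \<ge> 0" by simp
      then show ?thesis by simp
    qed
  qed
  define S where "S = (\<Sum>l=1..R. osc_int Y (real l ^ 2 * X) / real l ^ 2)"
  define m where "m = X * (sqrt Y - sqrt (Y / 2)) / 4 + 1 / (8 * pi) * S"
  define W where "W = sqrt Y * (1 + real R ^ 2 * X / Y) * real R"
  have W0: "W \<ge> 0" using X Y by (simp add: W_def)
  have b1: "\<bar>(kernel_sum X Y - kernel_sum X (Y / 2)) - m\<bar>
    \<le> X + 30000 * (W * (1 + ln (4 * real R ^ 2))) + 16 * Y * (1 + ln Y) + 6 * Y ^ 2 / real R ^ 2 * (1 + ln Y)"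
    unfolding m_def S_def W_def by (rule kernel_sum_block) (use X Y R in auto)
  have b2: "\<bar>1 / 4 * (C_fun (Y / X) - C_fun (Y / 2 / X)) * X powr (3 / 2) - m\<bar> \<le> Y * sqrt Y / real R"
    unfolding m_def S_def by (rule C_fun_block) (use X Y R in auto)
  have e1: "W * (1 + ln (4 * real R ^ 2)) \<le> 10 * T * (5 * L)"
    using R(5) l4 W0 T0 unfolding W_def[symmetric] by (intro mult_mono) auto
  have e2: "Y * (1 + ln Y) \<le> T * (2 * L)" using R lnY L1 T0 by (intro mult_mono) auto
  have scale: "c * a * b \<le> 2 * c * (T * L)" if "a * b \<le> T * (2 * L)" "c \<ge> 0" for a b c
    using mult_left_mono[OF that] by (simp add: mult_ac)
  have e3: "Y ^ 2 / real R ^ 2 * (1 + ln Y) \<le> T * (2 * L)" using R lnY L1 T0 by (intro mult_mono) auto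
  have e4: "T * 1 \<le> T * L" using L1 T0 by (intro mult_left_mono) auto
  have eq: "kernel_dev X Y - kernel_dev X (Y / 2) = (kernel_sum X Y - kernel_sum X (Y / 2)) - 1 / 4 * (C_fun (Y / X) - C_fun (Y / 2 / X)) * X powr (3 / 2)"
    by (simp add: kernel_dev_def algebra_simps)
  have aux: "\<bar>k - c\<bar> \<le> 3000000 * tl"
    if "\<bar>k - m\<bar> \<le> x + 30000 * w + y + z" "\<bar>c - m\<bar> \<le> v" "x \<le> T" "w \<le> 50 * tl" "y \<le> 32 * tl" "z \<le> 12 * tl" "v \<le> T" "T \<le> tl" "0 \<le> T"
    for k c m x w y z v tl :: real
    using that by linarith
  have "\<bar>(kernel_sum X Y - kernel_sum X (Y / 2)) - 1 / 4 * (C_fun (Y / X) - C_fun (Y / 2 / X)) * X powr (3 / 2)\<bar> \<le> 3000000 * (T * L)"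
  proof (rule aux[OF b1 b2 R(6) _ _ _ R(3)])
    show "W * (1 + ln (4 * real R ^ 2)) \<le> 50 * (T * L)" using e1 by simp
    show "16 * Y * (1 + ln Y) \<le> 32 * (T * L)" using scale[OF e2, of 16] by simp
    show "6 * Y ^ 2 / real R ^ 2 * (1 + ln Y) \<le> 12 * (T * L)" using scale[OF e3, of 6] by simp
  qed (use e4 T0 in auto)
  then show ?thesis by (simp only: eq T_def L_def)
qed

text \<open>The ratio makes the sum over blocks geometric. The first term shrinks by
  \<open>2 powr (-7/16) \<le> 3/4\<close>, that is \<open>2^25 \<le> 3^16\<close>; the second is
  halved.\<close>

lemma err_T_half:
  assumes "X > 0" "Y > 0"
  shows "err_T X (Y / 2) \<le> 3 / 4 * err_T X Y"
proof -
  have p: "(1 / 2) powr (7 / 16) \<le> (3 / 4 :: real)"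
  proof (rule power_le_imp_le_base[of _ 15])
    have "((1 / 2 :: real) powr (7 / 16)) ^ 16 = (1 / 2) powr 7"
      by (subst powr_realpow[symmetric]) (simp_all add: powr_powr)
    also have "\<dots> = (1 / 2) ^ 7" by (subst powr_realpow[symmetric]) auto
    also have "\<dots> \<le> (3 / 4) ^ 16" by (simp add: power_divide)
    finally show "((1 / 2 :: real) powr (7 / 16)) ^ Suc 15 \<le> (3 / 4) ^ Suc 15" by simp
  qed simp
  have "(Y / 2) powr (7 / 16) = Y powr (7 / 16) * (1 / 2) powr (7 / 16)"
    using assms powr_mult[of Y "1/2" "7/16"] by simp
  also have "\<dots> \<le> Y powr (7 / 16) * (3 / 4)" using p by (intro mult_left_mono) auto
  finally have "X * (Y / 2) powr (7 / 16) \<le> X * (Y powr (7 / 16) * (3 / 4))" using assms by (intro mult_left_mono) auto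
  moreover have "Y / 2 * X powr (7 / 16) \<le> 3 / 4 * (Y * X powr (7 / 16))" using assms by simp
  ultimately show ?thesis unfolding err_T_def by (simp add: algebra_simps)
qed

text \<open>Induction on the dyadic size of \<open>Y\<close>, down to \<open>Y < 1\<close>. The
  constant is that of a geometric series with ratio \<open>3/4\<close>: four times the constant of
  one block, so that \<open>3000000 + 3/4 * 12000000 = 12000000\<close>.\<close>

theorem kernel_dev_bound:
  assumes "X > 0" "Y > 0"
  shows "\<bar>kernel_dev X Y\<bar> \<le> 12000000 * (err_T X Y * log_factor X Y)"
proof -
  have small: "\<bar>kernel_dev X Y\<bar> \<le> 12000000 * (err_T X Y * log_factor X Y)" if "X > 0" "Y > 0" "X < 1 \<or> Y < 1" for X Y
  proof -
    have "err_T X Y * 1 \<le> err_T X Y * log_factor X Y"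
      using that log_factor_ge_1[of X Y] err_T_nonneg[of X Y] by (intro mult_left_mono) auto
    moreover have "0 \<le> err_T X Y" using that err_T_nonneg[of X Y] by simp
    ultimately show ?thesis using kernel_dev_small[OF that] by linarith
  qed
  have "\<bar>kernel_dev X Y\<bar> \<le> 12000000 * (err_T X Y * log_factor X Y)" if "X \<ge> 1" "Y > 0" "Y < 2 ^ n" for n Y
    using that(2,3)
  proof (induction n arbitrary: Y)
    case 0
    then show ?case using small that(1) by simp
  next
    case (Suc n)
    show ?case
    proof (cases "Y < 1")
      case False
      then have b: "\<bar>kernel_dev X Y - kernel_dev X (Y / 2)\<bar> \<le> 3000000 * (err_T X Y * log_factor X Y)"
        using that(1) by (intro kernel_dev_block) auto
      have IH: "\<bar>kernel_dev X (Y / 2)\<bar> \<le> 12000000 * (err_T X (Y / 2) * log_factor X (Y / 2))"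
        using Suc by (intro Suc.IH) auto
      have "err_T X (Y / 2) * log_factor X (Y / 2) \<le> (3 / 4 * err_T X Y) * log_factor X Y"
        using that(1) Suc.prems(1) err_T_half[of X Y] log_factor_mono[of X X "Y / 2" Y] log_factor_ge_1[of X "Y / 2"] err_T_nonneg[of X Y]
        by (intro mult_mono) auto
      then have "12000000 * (err_T X (Y / 2) * log_factor X (Y / 2)) \<le> 9000000 * (err_T X Y * log_factor X Y)" by simp
      then show ?thesis using b IH by linarith
    qed (use small that(1) Suc.prems in auto)
  qed
  moreover obtain n where "Y < 2 ^ n" using real_arch_pow[of 2 Y] by auto
  ultimately show ?thesis using small[OF assms] assms by (cases "X < 1") auto
qed

section \<open>From the kernel sum to the sum of Jacobi symbols\<close>

lemma odd_square_divisor_reindex: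
  assumes X: "X > 0" and d: "odd d"
  shows "{m \<in> odd_upto X. d ^ 2 dvd m} = (\<lambda>m. d ^ 2 * m) ` odd_upto (X / real d ^ 2)"
proof (intro subset_antisym subsetI)
  have d0: "d > 0" using d by (simp add: odd_pos)
  {
    fix m assume m: "m \<in> {m \<in> odd_upto X. d ^ 2 dvd m}"
    then obtain q where q: "m = d ^ 2 * q" by auto
    have "q \<in> odd_upto (X / real d ^ 2)" using m d0 q by (auto simp: odd_upto_def field_simps Suc_le_eq odd_pos)
    then show "m \<in> (\<lambda>m. d ^ 2 * m) ` odd_upto (X / real d ^ 2)" using q by blast
  }
  fix m assume "m \<in> (\<lambda>m. d ^ 2 * m) ` odd_upto (X / real d ^ 2)"
  then obtain q where q: "m = d ^ 2 * q" "q \<in> odd_upto (X / real d ^ 2)" by blast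
  then show "m \<in> {m \<in> odd_upto X. d ^ 2 dvd m}"
    using d d0 by (auto simp: odd_upto_def field_simps Suc_le_eq)
qed

text \<open>Multiples of \<open>d^2\<close> up to \<open>X\<close> and \<open>Y\<close> are
  parametrised by numbers up to \<open>X / d^2\<close> and \<open>Y / d^2\<close>. Odd arguments
  admit only odd \<open>d\<close>, and \<open>X < N\<close> ensures that all of them are
  reached.\<close>

lemma kernel_sum_eq_jacobi_sums:
  assumes X: "X > 0" and Y: "Y > 0" and N: "X < real N"
  shows "kernel_sum X Y = (\<Sum>i<N. real (2 * i + 1) * jacobi_sum (X / real (2 * i + 1) ^ 2) (Y / real (2 * i + 1) ^ 2))"
proof -
  define d where "d i = 2 * i + 1" for i :: nat
  have od: "odd (d i)" "d i > 0" for i by (simp_all add: d_def)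
  define t where "t m n i = (if d i ^ 2 dvd m \<and> d i ^ 2 dvd n then real (d i) * real_of_int (Jacobi (int (m div d i ^ 2)) (n div d i ^ 2)) else 0)" for m n i
  have jk: "real_of_int (jkernel (int m) n) = (\<Sum>i<N. t m n i)" if m: "m \<in> odd_upto X" and n: "n \<in> odd_upto Y" for m n
  proof -
    have mn: "odd m" "odd n" "m > 0" "n > 0" "real m < real N" using m n N by (auto simp: odd_upto_def odd_pos)
    have "{e. e ^ 2 dvd n \<and> int e ^ 2 dvd int m} = d ` {i \<in> {..<N}. d i ^ 2 dvd m \<and> d i ^ 2 dvd n}"
    proof (intro subset_antisym subsetI)
      fix e assume "e \<in> {e. e ^ 2 dvd n \<and> int e ^ 2 dvd int m}"
      then have e: "e ^ 2 dvd n" "e ^ 2 dvd m" by (simp_all flip: of_nat_power)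
      have oe: "odd e" using square_dvd_quotient[OF e(1) mn(2)] by simp
      then obtain i where i: "e = d i" by (auto simp: d_def elim!: oddE)
      have "e ^ 2 \<le> m" using e(2) mn by (intro dvd_imp_le)
      moreover have "e \<le> e ^ 2" by (rule self_le_power) (use oe in \<open>simp_all add: Suc_le_eq odd_pos\<close>)
      ultimately have "i < N" using mn(5) i by (simp add: d_def)
      then show "e \<in> d ` {i \<in> {..<N}. d i ^ 2 dvd m \<and> d i ^ 2 dvd n}" using e i by auto
    qed (auto simp flip: of_nat_power)
    then have "jkernel (int m) n = (\<Sum>e\<in>d ` {i \<in> {..<N}. d i ^ 2 dvd m \<and> d i ^ 2 dvd n}. int e * Jacobi (int m div int e ^ 2) (n div e ^ 2))"
      unfolding jkernel_def by (simp only:)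
    also have "\<dots> = (\<Sum>i\<in>{i \<in> {..<N}. d i ^ 2 dvd m \<and> d i ^ 2 dvd n}. int (d i) * Jacobi (int m div int (d i) ^ 2) (n div d i ^ 2))"
      by (rule sum.reindex_cong[of d]) (auto simp: inj_on_def d_def)
    finally have "real_of_int (jkernel (int m) n) = (\<Sum>i\<in>{i \<in> {..<N}. d i ^ 2 dvd m \<and> d i ^ 2 dvd n}. real (d i) * real_of_int (Jacobi (int (m div d i ^ 2)) (n div d i ^ 2)))"
      by (simp add: zdiv_int)
    also have "\<dots> = (\<Sum>i<N. t m n i)" unfolding t_def by (rule sum.inter_filter) simp
    finally show ?thesis .
  qed
  have "kernel_sum X Y = (\<Sum>n\<in>odd_upto Y. \<Sum>m\<in>odd_upto X. \<Sum>i<N. t m n i)"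
    unfolding kernel_sum_def by (intro sum.cong refl jk)
  also have "\<dots> = (\<Sum>n\<in>odd_upto Y. \<Sum>i<N. \<Sum>m\<in>odd_upto X. t m n i)"
    by (intro sum.cong refl sum.swap)
  also have "\<dots> = (\<Sum>i<N. \<Sum>n\<in>odd_upto Y. \<Sum>m\<in>odd_upto X. t m n i)" by (rule sum.swap)
  also have "\<dots> = (\<Sum>i<N. real (d i) * jacobi_sum (X / real (d i) ^ 2) (Y / real (d i) ^ 2))"
  proof (rule sum.cong[OF refl])
    fix i
    define e where "e = d i"
    have e: "odd e" "e > 0" using od by (simp_all add: e_def)
    define g where "g m n = real e * real_of_int (Jacobi (int (m div e ^ 2)) (n div e ^ 2))" for m n
    have inj: "inj_on (\<lambda>m. e ^ 2 * m) A" for A using e by (auto simp: inj_on_def)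
    have "(\<Sum>n\<in>odd_upto Y. \<Sum>m\<in>odd_upto X. t m n i) = (\<Sum>n\<in>odd_upto Y. if e ^ 2 dvd n then \<Sum>m\<in>odd_upto X. if e ^ 2 dvd m then g m n else 0 else 0)"
      by (rule sum.cong[OF refl]) (auto simp: t_def e_def g_def intro!: sum.cong)
    also have "\<dots> = (\<Sum>n\<in>{n \<in> odd_upto Y. e ^ 2 dvd n}. \<Sum>m\<in>{m \<in> odd_upto X. e ^ 2 dvd m}. g m n)"
      by (simp only: sum.inter_filter[OF finite_odd_upto])
    also have "\<dots> = (\<Sum>n\<in>odd_upto (Y / real e ^ 2). \<Sum>m\<in>odd_upto (X / real e ^ 2). g (e ^ 2 * m) (e ^ 2 * n))"
      unfolding odd_square_divisor_reindex[OF X e(1)] odd_square_divisor_reindex[OF Y e(1)] sum.reindex[OF inj] o_def ..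
    also have "\<dots> = (\<Sum>n\<in>odd_upto (Y / real e ^ 2). \<Sum>m\<in>odd_upto (X / real e ^ 2). real e * real_of_int (Jacobi (int m) n))"
      using e by (simp add: g_def)
    also have "\<dots> = (\<Sum>m\<in>odd_upto (X / real e ^ 2). \<Sum>n\<in>odd_upto (Y / real e ^ 2). real e * real_of_int (Jacobi (int m) n))"
      by (rule sum.swap)
    also have "\<dots> = real e * jacobi_sum (X / real e ^ 2) (Y / real e ^ 2)"
      by (simp add: jacobi_sum_def sum_distrib_left)
    finally show "(\<Sum>n\<in>odd_upto Y. \<Sum>m\<in>odd_upto X. t m n i) = real (d i) * jacobi_sum (X / real (d i) ^ 2) (Y / real (d i) ^ 2)"
      by (simp only: e_def)
  qed
  finally show ?thesis by (simp only: d_def)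
qed

lemma odd_upto_empty: "X < 1 \<Longrightarrow> odd_upto X = {}"
  by (auto simp: odd_upto_def)

lemma jacobi_sum_small: "X < 1 \<Longrightarrow> jacobi_sum X Y = 0"
  by (simp add: jacobi_sum_def odd_upto_empty)

definition jacobi_dev :: "real \<Rightarrow> real \<Rightarrow> real" where
  "jacobi_dev X Y = jacobi_sum X Y - 2 / pi ^ 2 * C_fun (Y / X) * X powr (3 / 2)"

text \<open>The terms of the series of inverse squares are grouped in pairs, and the even ones
  amount to a quarter of the whole. This constant turns \<open>2 / pi^2\<close> into
  \<open>1/4\<close>.\<close>

lemma inverse_odd_squares_sums: "(\<lambda>i. 1 / real (2 * i + 1) ^ 2) sums (pi ^ 2 / 8)"
proof -
  define f where "f n = 1 / real (Suc n) ^ 2" for n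
  have f: "f sums (pi ^ 2 / 6)" using inverse_squares_sums by (simp add: f_def[abs_def] add.commute)
  have "(\<lambda>n. \<Sum>i\<in>{n * 2..<n * 2 + 2}. f i) sums (pi ^ 2 / 6)" by (rule sums_group[OF f]) simp
  moreover have "(\<Sum>i\<in>{n * 2..<n * 2 + 2}. f i) = 1 / real (2 * n + 1) ^ 2 + 1 / 4 * f n" for n
  proof -
    have "{n * 2..<n * 2 + 2} = {2 * n, 2 * n + 1}" by auto
    then have "(\<Sum>i\<in>{n * 2..<n * 2 + 2}. f i) = f (2 * n) + f (2 * n + 1)" by simp
    moreover have "f (2 * n) = 1 / real (2 * n + 1) ^ 2" by (simp add: f_def add.commute)
    moreover have "real (Suc (2 * n + 1)) = 2 * real (Suc n)" by simp
    then have "f (2 * n + 1) = 1 / 4 * f n" unfolding f_def by (simp only: power_mult_distrib) simp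
    ultimately show ?thesis by simp
  qed
  ultimately have "(\<lambda>n. 1 / real (2 * n + 1) ^ 2 + 1 / 4 * f n) sums (pi ^ 2 / 6)" by simp
  from sums_diff[OF this sums_mult[OF f, of "1/4"]] show ?thesis by simp
qed

text \<open>The main term is homogeneous of degree \<open>3/2\<close> in \<open>X\<close> and
  \<open>Y\<close>, so its copy for \<open>d\<close> carries \<open>d * d^(-3) = d^(-2)\<close>. The
  Jacobi sums vanish for large \<open>d\<close> but the main terms do not, hence an infinite
  series.\<close>

lemma kernel_dev_sums:
  assumes X: "X > 0" and Y: "Y > 0"
  shows "(\<lambda>i. real (2 * i + 1) * jacobi_dev (X / real (2 * i + 1) ^ 2) (Y / real (2 * i + 1) ^ 2)) sums kernel_dev X Y"
proof -
  obtain N where N: "X < real N" using reals_Archimedean2 by blast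
  define J where "J i = real (2 * i + 1) * jacobi_sum (X / real (2 * i + 1) ^ 2) (Y / real (2 * i + 1) ^ 2)" for i
  have "J i = 0" if "i \<notin> {..<N}" for i
  proof -
    have "X < real (2 * i + 1)" using N that by simp
    also have "\<dots> \<le> real (2 * i + 1) ^ 2" by (rule self_le_power) auto
    finally have "X / real (2 * i + 1) ^ 2 < 1" by simp
    then show ?thesis by (simp add: J_def jacobi_sum_small)
  qed
  then have "J sums (\<Sum>i<N. J i)" by (intro sums_finite) auto
  also have "(\<Sum>i<N. J i) = kernel_sum X Y"
    unfolding J_def by (rule kernel_sum_eq_jacobi_sums[OF X Y N, symmetric])
  finally have 1: "J sums kernel_sum X Y" .
  define M where "M = 2 / pi ^ 2 * C_fun (Y / X) * X powr (3 / 2)"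
  have "(\<lambda>i. M * (1 / real (2 * i + 1) ^ 2)) sums (M * (pi ^ 2 / 8))"
    by (intro sums_mult inverse_odd_squares_sums)
  also have "M * (pi ^ 2 / 8) = 1 / 4 * C_fun (Y / X) * X powr (3 / 2)" by (simp add: M_def)
  finally have 2: "(\<lambda>i. M * (1 / real (2 * i + 1) ^ 2)) sums (1 / 4 * C_fun (Y / X) * X powr (3 / 2))" .
  have "J i - M * (1 / real (2 * i + 1) ^ 2) = real (2 * i + 1) * jacobi_dev (X / real (2 * i + 1) ^ 2) (Y / real (2 * i + 1) ^ 2)" for i
  proof -
    define e where "e = real (2 * i + 1)"
    have e: "e > 0" by (simp add: e_def)
    have "(X / e ^ 2) powr (3 / 2) = X * sqrt X / e ^ 3"
    proof -
      have "(X / e ^ 2) powr (3 / 2) = X / e ^ 2 * sqrt (X / e ^ 2)" using X e by (intro powr_three_halves) simp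
      also have "sqrt (X / e ^ 2) = sqrt X / e" using e by (simp add: real_sqrt_divide)
      finally show ?thesis by (simp add: power2_eq_square power3_eq_cube)
    qed
    moreover have "Y / e ^ 2 / (X / e ^ 2) = Y / X" using e by simp
    ultimately have "jacobi_dev (X / e ^ 2) (Y / e ^ 2) = jacobi_sum (X / e ^ 2) (Y / e ^ 2) - M / e ^ 3"
      using X by (simp add: jacobi_dev_def M_def powr_three_halves)
    then have "e * jacobi_dev (X / e ^ 2) (Y / e ^ 2) = e * jacobi_sum (X / e ^ 2) (Y / e ^ 2) - M * (1 / e ^ 2)"
      using e by (simp add: right_diff_distrib power2_eq_square power3_eq_cube)
    then show ?thesis by (simp add: J_def e_def)
  qed
  then show ?thesis using sums_diff[OF 1 2] by (simp only: kernel_dev_def)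
qed

text \<open>The true exponent of \<open>e\<close> is \<open>1 - 2 - 7/8 = -15/8\<close>. It is
  weakened to \<open>-3/2\<close>, for which the sum over odd \<open>e\<close> can be compared with
  a telescoping one.\<close>

lemma err_T_scale:
  assumes X: "X > 0" and Y: "Y > 0" and e: "e \<ge> 1"
  shows "e * err_T (X / e ^ 2) (Y / e ^ 2) \<le> err_T X Y * (1 / (e * sqrt e))"
proof -
  define w where "w = e powr (7 / 8)"
  have w: "w \<ge> sqrt e" using e powr_mono[of "1/2" "7/8" e] by (simp add: w_def powr_half_sqrt)
  have w0: "w > 0" using e by (simp add: w_def)
  have p: "(Z / e ^ 2) powr (7 / 16) = Z powr (7 / 16) / w" if "Z > 0" for Z
  proof -
    have "(e ^ 2) powr (7 / 16) = (e powr 2) powr (7 / 16)" using e by (simp add: powr_numeral)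
    also have "\<dots> = w" by (simp add: powr_powr w_def)
    finally show ?thesis using that e by (simp add: powr_divide)
  qed
  have "e * err_T (X / e ^ 2) (Y / e ^ 2) = err_T X Y * (1 / (e * w))"
    unfolding err_T_def p[OF X] p[OF Y] using e w0 by (simp add: field_simps power2_eq_square)
  also have "\<dots> \<le> err_T X Y * (1 / (e * sqrt e))"
    using w e X Y w0 err_T_nonneg[of X Y] by (intro mult_left_mono divide_left_mono mult_pos_pos) auto
  finally show ?thesis .
qed

text \<open>Each term is at most \<open>1 / sqrt (e - 1) - 1 / sqrt (e + 1)\<close>. Starting at
  \<open>e = 3\<close> the sum telescopes to less than \<open>1 / sqrt 2\<close>; what counts is
  that the bound is below 1.\<close>

lemma sum_odd_powers_tail:
  "(\<Sum>i<n. 1 / (real (2 * Suc i + 1) * sqrt (real (2 * Suc i + 1)))) \<le> 3 / 4"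
proof -
  have "(\<Sum>i<n. 1 / (real (2 * Suc i + 1) * sqrt (real (2 * Suc i + 1)))) \<le> 1 / sqrt 2 - 1 / sqrt (2 * real n + 2)"
  proof (induction n)
    case (Suc n)
    define e where "e = real (2 * Suc n + 1)"
    define a b s where "a = sqrt (e - 1)" and "b = sqrt (e + 1)" and "s = sqrt e"
    have e: "e \<ge> 3" by (simp add: e_def)
    have abs: "a > 0" "b > 0" "s > 0" "a * a = e - 1" "b * b = e + 1" "s * s = e" using e by (simp_all add: a_def b_def s_def)
    have ab: "a * b \<le> e"
    proof -
      have "a * b = sqrt ((e - 1) * (e + 1))" by (simp add: a_def b_def real_sqrt_mult)
      also have "\<dots> \<le> sqrt (e * e)" by (intro real_sqrt_le_mono) (simp add: algebra_simps)
      finally show ?thesis using e by simp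
    qed
    have "(a + b) ^ 2 \<le> (2 * s) ^ 2" using ab abs by (simp add: power2_eq_square algebra_simps)
    then have abs2: "a + b \<le> 2 * s" by (rule power2_le_imp_le) (use abs in simp)
    have "(b - a) * (a + b) = 2" using abs by (simp add: algebra_simps)
    then have "b - a = 2 / (a + b)" using abs by (simp add: field_simps)
    also have "\<dots> \<ge> 2 / (2 * s)" using abs abs2 by (intro divide_left_mono) auto
    finally have ba: "b - a \<ge> 1 / s" by simp
    have "1 / (e * s) = (1 / s) / e" by simp
    also have "\<dots> \<le> (b - a) / (a * b)"
    proof (rule frac_le)
      show "0 \<le> b - a" by (simp add: a_def b_def)
    qed (use ba ab abs in auto)
    also have "\<dots> = 1 / a - 1 / b" using abs by (simp add: field_simps)
    finally have "1 / (e * s) \<le> 1 / a - 1 / b" .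
    moreover have "a = sqrt (2 * real n + 2)" "b = sqrt (2 * real (Suc n) + 2)" by (simp_all add: a_def b_def e_def add_ac)
    ultimately have "1 / (e * s) \<le> 1 / sqrt (2 * real n + 2) - 1 / sqrt (2 * real (Suc n) + 2)" by (simp only:)
    then show ?case using Suc.IH unfolding sum.lessThan_Suc e_def[symmetric] s_def[symmetric] by linarith
  qed simp
  also have "\<dots> \<le> 1 / sqrt 2" by simp
  also have "\<dots> \<le> 3 / 4"
  proof -
    have "4 / 3 \<le> sqrt (2 :: real)" by (intro real_le_rsqrt) (simp add: power2_eq_square)
    then show ?thesis by (simp add: field_simps)
  qed
  finally show ?thesis .
qed

text \<open>In the series for \<open>kernel_dev\<close> the term \<open>d = 1\<close> is the wanted
  deviation, and the others are controlled by induction, since dividing by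
  \<open>d^2 \<ge> 9\<close> lowers the dyadic size. The constant \<open>4 * B\<close> closes the
  argument because \<open>B + 3/4 * (4 * B) = 4 * B\<close>.\<close>

theorem jacobi_dev_bound:
  assumes X: "X > 0" and Y: "Y > 0"
  shows "\<bar>jacobi_dev X Y\<bar> \<le> 48000000 * (err_T X Y * log_factor X Y)"
proof -
  define L where "L = log_factor X Y"
  have L1: "L \<ge> 1" using X Y by (simp add: L_def log_factor_ge_1)
  define B :: real where "B = 12000000"
  \<comment> \<open>The logarithmic factor is frozen at the outer \<open>X\<close> and
    \<open>Y\<close>, so that it is the same in every step of the induction.\<close>
  have "\<bar>jacobi_dev x y\<bar> \<le> 4 * B * (err_T x y * L)" if "0 < x" "x \<le> X" "0 < y" "y \<le> Y" "x < 2 ^ n" for n x y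
    using that
  proof (induction n arbitrary: x y)
    case 0
    have "\<bar>jacobi_dev x y\<bar> = 2 / pi ^ 2 * \<bar>C_fun (y / x) * x powr (3 / 2)\<bar>"
      using 0 by (simp add: jacobi_dev_def jacobi_sum_small abs_mult)
    also have "\<dots> \<le> 1 * \<bar>C_fun (y / x) * x powr (3 / 2)\<bar>"
    proof (intro mult_right_mono)
      have "2 * 2 \<le> pi * pi" using pi_ge_two by (intro mult_mono) auto
      then show "2 / pi ^ 2 \<le> 1" by (simp add: power2_eq_square)
    qed auto
    also have "\<dots> \<le> 11 * err_T x y" using main_term_small[of x y] 0 by simp
    also have "\<dots> \<le> 4 * B * (err_T x y * 1)" using err_T_nonneg[of x y] 0 by (simp add: B_def)
    also have "\<dots> \<le> 4 * B * (err_T x y * L)" using L1 err_T_nonneg[of x y] 0 by (intro mult_left_mono) (auto simp: B_def)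
    finally show ?case .
  next
    case (Suc n)
    define T where "T = err_T x y"
    have T0: "T \<ge> 0" using Suc err_T_nonneg[of x y] by (simp add: T_def)
    define v where "v i = real (2 * i + 1) * jacobi_dev (x / real (2 * i + 1) ^ 2) (y / real (2 * i + 1) ^ 2)" for i
    have sums: "v sums kernel_dev x y" unfolding v_def by (rule kernel_dev_sums) (use Suc in auto)
    have vb: "\<bar>v (Suc i)\<bar> \<le> 4 * B * L * T * (1 / (real (2 * Suc i + 1) * sqrt (real (2 * Suc i + 1))))" for i
    proof -
      define e where "e = real (2 * Suc i + 1)"
      have e: "e \<ge> 3" by (simp add: e_def)
      have "e ^ 2 \<ge> 3 ^ 2" using e by (intro power_mono) auto
      then have e2: "e ^ 2 \<ge> 9" by simp
      have le: "z / e ^ 2 \<le> z / 9" if "z > 0" for z using e2 that by (intro divide_left_mono) auto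
      have "\<bar>jacobi_dev (x / e ^ 2) (y / e ^ 2)\<bar> \<le> 4 * B * (err_T (x / e ^ 2) (y / e ^ 2) * L)"
      proof (rule Suc.IH)
        show "x / e ^ 2 \<le> X" "y / e ^ 2 \<le> Y" using le[of x] le[of y] Suc.prems by linarith+
        show "x / e ^ 2 < 2 ^ n" using le[of x] Suc.prems by simp
      qed (use Suc.prems e in auto)
      then have "e * \<bar>jacobi_dev (x / e ^ 2) (y / e ^ 2)\<bar> \<le> e * (4 * B * (err_T (x / e ^ 2) (y / e ^ 2) * L))"
        using e by (intro mult_left_mono) auto
      also have "\<dots> = 4 * B * L * (e * err_T (x / e ^ 2) (y / e ^ 2))" by simp
      also have "\<dots> \<le> 4 * B * L * (T * (1 / (e * sqrt e)))"
        unfolding T_def using Suc.prems e L1 by (intro mult_left_mono err_T_scale) (auto simp: B_def)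
      finally have f: "e * \<bar>jacobi_dev (x / e ^ 2) (y / e ^ 2)\<bar> \<le> 4 * B * L * (T * (1 / (e * sqrt e)))" .
      have "v (Suc i) = e * jacobi_dev (x / e ^ 2) (y / e ^ 2)" by (simp only: v_def e_def)
      then show ?thesis using f e unfolding e_def[symmetric] by (simp add: abs_mult)
    qed
    define w where "w i = 4 * B * L * T * (1 / (real (2 * Suc i + 1) * sqrt (real (2 * Suc i + 1))))" for i
    have wn: "(\<Sum>i<m. w i) \<le> 4 * B * L * T * (3 / 4)" for m
      unfolding w_def sum_distrib_left[symmetric] using L1 T0
      by (intro mult_left_mono sum_odd_powers_tail) (auto simp: B_def)
    have tail: "\<bar>(\<Sum>i<m. v (Suc i))\<bar> \<le> 4 * B * L * T * (3 / 4)" for m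
    proof -
      have "\<bar>(\<Sum>i<m. v (Suc i))\<bar> \<le> (\<Sum>i<m. w i)"
        by (rule order.trans[OF sum_abs]) (intro sum_mono, use vb in \<open>simp add: w_def\<close>)
      then show ?thesis using wn[of m] by linarith
    qed
    have "(\<lambda>n. v (Suc n)) sums (kernel_dev x y - v 0)"
      by (subst sums_Suc_iff) (use sums in simp)
    then have "(\<lambda>m. \<Sum>i<m. v (Suc i)) \<longlonglongrightarrow> kernel_dev x y - v 0" by (simp only: sums_def)
    then have "(\<lambda>m. \<bar>\<Sum>i<m. v (Suc i)\<bar>) \<longlonglongrightarrow> \<bar>kernel_dev x y - v 0\<bar>" by (rule tendsto_rabs)
    then have "\<bar>kernel_dev x y - v 0\<bar> \<le> 4 * B * L * T * (3 / 4)"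
      by (rule LIMSEQ_le_const2) (use tail in blast)
    moreover have "v 0 = jacobi_dev x y" by (simp add: v_def)
    moreover have "\<bar>kernel_dev x y\<bar> \<le> B * (L * T)"
    proof -
      have "\<bar>kernel_dev x y\<bar> \<le> B * (T * log_factor x y)" unfolding B_def T_def by (rule kernel_dev_bound) (use Suc in auto)
      also have "\<dots> \<le> B * (T * L)"
        unfolding L_def using Suc.prems T0 by (intro mult_left_mono log_factor_mono) (auto simp: B_def)
      finally show ?thesis by (simp add: mult_ac)
    qed
    ultimately have "\<bar>jacobi_dev x y\<bar> \<le> B * (L * T) + 4 * B * L * T * (3 / 4)" by linarith
    then show ?case by (simp add: T_def mult_ac)
  qed
  moreover obtain n where "X < 2 ^ n" using real_arch_pow[of 2 X] by auto
  ultimately have "\<bar>jacobi_dev X Y\<bar> \<le> 4 * B * (err_T X Y * L)" using X Y by blast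
  then show ?thesis by (simp add: B_def L_def)
qed

lemma log_factor_le:
  assumes "X \<ge> 2" "Y \<ge> 2"
  shows "log_factor X Y \<le> 2 * ln (X * Y)"
proof -
  have "ln (Z + 2) \<le> 2 * ln Z" if "Z \<ge> 2" for Z :: real
  proof -
    have "2 * Z \<le> Z * Z" using that by (intro mult_right_mono) auto
    then have "Z + 2 \<le> Z * Z" using that by linarith
    then have "ln (Z + 2) \<le> ln (Z * Z)" using that by simp
    then show ?thesis using that by (simp add: ln_mult)
  qed
  from this[of X] this[of Y] show ?thesis using assms by (simp add: log_factor_def ln_mult)
qed

theorem jacobi_sum_asymptotic:
  "\<exists>K X\<^sub>0 :: real. X\<^sub>0 \<ge> 1 \<and> (\<forall>X\<ge>X\<^sub>0. \<forall>Y\<ge>X\<^sub>0.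
      \<bar>jacobi_sum X Y - 2 / pi ^ 2 * C_fun (Y / X) * X powr (3 / 2)\<bar>
        \<le> K * ((X * Y powr (7 / 16) + Y * X powr (7 / 16)) * ln (X * Y)))"
proof (rule exI[of _ 96000000], rule exI[of _ 2], intro conjI allI impI)
  fix X Y :: real assume XY: "X \<ge> 2" "Y \<ge> 2"
  have "\<bar>jacobi_dev X Y\<bar> \<le> 48000000 * (err_T X Y * log_factor X Y)" by (rule jacobi_dev_bound) (use XY in auto)
  also have "\<dots> \<le> 48000000 * (err_T X Y * (2 * ln (X * Y)))"
    using XY err_T_nonneg[of X Y] by (intro mult_left_mono log_factor_le) auto
  finally show "\<bar>jacobi_sum X Y - 2 / pi ^ 2 * C_fun (Y / X) * X powr (3 / 2)\<bar>
        \<le> 96000000 * ((X * Y powr (7 / 16) + Y * X powr (7 / 16)) * ln (X * Y))"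
    by (simp add: jacobi_dev_def err_T_def)
qed simp

section \<open>The theta function\<close>

text \<open>The Fourier transform of the Gaussian, read off from the characteristic function of the
  standard normal distribution by scaling with \<open>c = sqrt (2 * pi * a)\<close>. The integrand
  is even, so half of the line gives half of the value.\<close>

lemma gaussian_cos_integral:
  fixes a :: real
  assumes a: "a > 0"
  shows "(\<lambda>N. integral {0..real N} (\<lambda>x. exp (- pi * a * x ^ 2) * cos (2 * pi * real k * x))) \<longlonglongrightarrow> exp (- pi * real k ^ 2 / a) / (2 * sqrt a)"
proof -
  define f where "f x = exp (- pi * a * x ^ 2) * cos (2 * pi * real k * x)" for x
  define t where "t = 2 * pi * real k / sqrt (2 * pi * a)"
  define c where "c = sqrt (2 * pi * a)"
  have c: "c > 0" "c * c = 2 * pi * a" using a by (simp_all add: c_def)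
  define g where "g x = std_normal_density x * cos (t * x)" for x
  have int_exp: "integrable lborel (\<lambda>x. std_normal_density x *\<^sub>R iexp (t * x))"
  proof (rule Bochner_Integration.integrable_bound)
    show "integrable lborel std_normal_density"
      using integrable_std_normal_moment[of 0] by simp
  qed auto
  have "(LBINT x. std_normal_density x *\<^sub>R iexp (t * x)) = char std_normal_distribution t"
    unfolding char_def by (rule integral_density[symmetric]) auto
  also have "\<dots> = of_real (exp (- (t ^ 2) / 2))" by (simp add: char_std_normal_distribution)
  finally have "Re (LBINT x. std_normal_density x *\<^sub>R iexp (t * x)) = exp (- (t ^ 2) / 2)" by simp
  moreover have Re_g: "(\<lambda>x. Re (std_normal_density x *\<^sub>R iexp (t * x))) = g"
    by (simp add: fun_eq_iff g_def Re_exp)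
  ultimately have g_int: "(LBINT x. g x) = exp (- (t ^ 2) / 2)" using integral_Re[OF int_exp] by simp
  have g_integrable: "integrable lborel g" using integrable_Re[OF int_exp] unfolding Re_g .
  have gf: "c * g (c * x) = sqrt a * f x" for x
  proof -
    have 1: "(c * x) ^ 2 / 2 = pi * a * x ^ 2" using c by (simp add: power2_eq_square)
    have 2: "t * (c * x) = 2 * pi * real k * x" using c by (simp add: t_def c_def[symmetric])
    have "c / sqrt (2 * pi) = sqrt a" using a by (simp add: c_def real_sqrt_mult)
    moreover have "c * g (c * x) = (c / sqrt (2 * pi)) * (exp (- ((c * x) ^ 2 / 2)) * cos (t * (c * x)))"
      by (simp add: g_def std_normal_density_def)
    ultimately show ?thesis unfolding 1 2 f_def by simp
  qed
  have "integrable lborel (\<lambda>x. g (0 + c * x))"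
    by (rule lborel_integrable_real_affine[OF g_integrable]) (use c in simp)
  then have "integrable lborel (\<lambda>x. c * g (c * x))" by simp
  then have "integrable lborel (\<lambda>x. sqrt a * f x)" unfolding gf .
  then have f_integrable: "integrable lborel f" using a by simp
  have "(LBINT x. g x) = \<bar>c\<bar> *\<^sub>R (LBINT x. g (0 + c * x))"
    by (rule lborel_integral_real_affine) (use c in simp)
  also have "\<dots> = (LBINT x. c * g (c * x))" using c by simp
  also have "\<dots> = sqrt a * (LBINT x. f x)" unfolding gf by simp
  finally have "(LBINT x. f x) = exp (- (t ^ 2) / 2) / sqrt a" using g_int a by simp
  moreover have "t ^ 2 / 2 = pi * real k ^ 2 / a" using a by (simp add: t_def power_divide power_mult_distrib power2_eq_square)
  ultimately have I: "(LBINT x. f x) = exp (- pi * real k ^ 2 / a) / sqrt a" by simp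
  have hi: "(f has_integral (LBINT x. f x)) UNIV" by (rule has_integral_integral_lborel[OF f_integrable])
  have half: "integral {- real N..real N} f = 2 * integral {0..real N} f" for N
  proof -
    have fi: "f integrable_on {u..v}" for u v
      unfolding f_def by (intro integrable_continuous_interval continuous_intros)
    have "(\<lambda>x. f (- x)) = f" by (simp add: f_def fun_eq_iff)
    then have "integral {- real N..0} f = integral {0..real N} f"
      using Henstock_Kurzweil_Integration.integral_reflect_real[of "real N" 0 f] by simp
    then show ?thesis
      using Henstock_Kurzweil_Integration.integral_combine[of "- real N" 0 "real N" f] fi by simp
  qed
  have "(\<lambda>N. integral {- real N..real N} f) \<longlonglongrightarrow> (LBINT x. f x)"
  proof (rule LIMSEQ_I)
    fix r :: real assume r: "r > 0"
    then obtain B where B: "B > 0" "\<And>u v. ball 0 B \<subseteq> cbox u v \<Longrightarrow>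
        \<exists>z. ((\<lambda>x. if x \<in> UNIV then f x else 0) has_integral z) (cbox u v) \<and> norm (z - (LBINT x. f x)) < r"
      using hi unfolding has_integral'[of f] by blast
    obtain N0 :: nat where N0: "B < real N0" using reals_Archimedean2 by blast
    have "norm (integral {- real N..real N} f - (LBINT x. f x)) < r" if "N \<ge> N0" for N
    proof -
      have "ball 0 B \<subseteq> cbox (- real N) (real N)" using N0 that by (auto simp: dist_real_def)
      from B(2)[OF this] show ?thesis by (auto dest: integral_unique)
    qed
    then show "\<exists>no. \<forall>n\<ge>no. norm (integral {- real n..real n} f - (LBINT x. f x)) < r" by blast
  qed
  then have "(\<lambda>N. integral {0..real N} f) \<longlonglongrightarrow> (LBINT x. f x) / 2"
    unfolding half by (auto dest: tendsto_mult_left[where c = "1/2"])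
  then show ?thesis using I a by (simp add: f_def[abs_def] mult.commute)
qed

text \<open>
  Agrees with \<open>saw_err\<close> on \<open>[0, 1)\<close> but has no jump at \<open>1\<close>.
\<close>

definition smooth_saw :: "nat \<Rightarrow> real \<Rightarrow> real" where
  "smooth_saw K x = x - 1 / 2 + (\<Sum>k=1..K. sin (2 * pi * (real k * x)) / (pi * real k))"

lemma smooth_saw_bounds:
  assumes x: "0 \<le> x" "x < 1"
  shows "\<bar>smooth_saw K x\<bar> \<le> 2"
    and "K > 0 \<Longrightarrow> 0 < d \<Longrightarrow> d \<le> x \<Longrightarrow> x \<le> 1 - d \<Longrightarrow> \<bar>smooth_saw K x\<bar> \<le> 1 / (real K * d)"
proof -
  have fr: "frac x = x" using x by (simp add: frac_eq)
  have eq: "smooth_saw K x = saw_err K x" by (simp add: smooth_saw_def saw_err_def fr)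
  show "\<bar>smooth_saw K x\<bar> \<le> 2" unfolding eq by (rule saw_err_bounded)
  assume K: "K > 0" and d: "0 < d" "d \<le> x" "x \<le> 1 - d"
  have "\<bar>smooth_saw K x\<bar> \<le> 1 / (2 * real K * x) + 1 / (2 * real K * (1 - x))"
    unfolding eq using saw_err_decay[OF K, of x] d by (simp add: fr)
  also have "\<dots> \<le> 1 / (2 * real K * d) + 1 / (2 * real K * d)"
    using K d by (intro add_mono divide_left_mono mult_left_mono mult_pos_pos) auto
  also have "\<dots> = 1 / (real K * d)" by simp
  finally show "\<bar>smooth_saw K x\<bar> \<le> 1 / (real K * d)" .
qed

lemma smooth_saw_bound_1: "\<bar>smooth_saw K 1\<bar> \<le> 2"
proof -
  have "sin (2 * pi * (real k * 1)) = 0" for k using sin_int_2pin[of "int k"] by simp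
  then have "smooth_saw K 1 = 1 / 2" unfolding smooth_saw_def by (simp only:) simp
  then show ?thesis by simp
qed

text \<open>Integration by parts against the truncated sawtooth, which runs from \<open>-1/2\<close>
  to \<open>1/2\<close> and has the truncated cosine series as derivative. The remainder uses the
  bound 2 within \<open>\<delta>\<close> of the two end points, hence \<open>4 * \<delta>\<close>,
  and the decay bound in between.\<close>

lemma unit_interval_euler_maclaurin:
  fixes f f' :: "real \<Rightarrow> real"
  assumes d: "\<And>x. (f has_real_derivative f' x) (at x)" and f'c: "continuous_on UNIV f'"
    and M: "\<And>x. real j \<le> x \<Longrightarrow> x \<le> real j + 1 \<Longrightarrow> \<bar>f' x\<bar> \<le> M"
    and K: "K > 0" and \<delta>: "0 < \<delta>" "\<delta> \<le> 1 / 2"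
  shows "\<bar>(f (real j) + f (real j + 1)) / 2 - integral {real j..real j + 1} (\<lambda>x. f x * (1 + 2 * (\<Sum>k=1..K. cos (2 * pi * real k * x))))\<bar>
     \<le> M * (4 * \<delta> + 1 / (real K * \<delta>))"
proof -
  define s where "s x = smooth_saw K (x - real j)" for x
  define s' where "s' x = 1 + 2 * (\<Sum>k=1..K. cos (2 * pi * real k * x))" for x
  have per: "sin (2 * pi * (real k * (x - real j))) = sin (2 * pi * (real k * x))" for k x
  proof -
    have "2 * pi * (real k * (x - real j)) = 2 * pi * (real k * x) - 2 * pi * of_int (int (k * j))"
      by (simp add: algebra_simps)
    then show ?thesis by (simp only: sin_diff sin_int_2pin cos_int_2pin mult_1_right mult_zero_right diff_zero)
  qed
  have s_eq: "s x = x - real j - 1 / 2 + (\<Sum>k=1..K. sin (2 * pi * (real k * x)) / (pi * real k))" for x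
    by (simp add: s_def smooth_saw_def per)
  have ds: "(s has_real_derivative s' x) (at x)" for x
    unfolding s_eq[abs_def] s'_def sum_distrib_left
    by (auto intro!: derivative_eq_intros sum.cong simp: field_simps)
  have sc: "continuous_on A s" for A
    unfolding s_eq[abs_def] by (intro continuous_intros) auto
  have fc: "continuous_on A f" for A
    by (intro continuous_at_imp_continuous_on ballI DERIV_isCont[OF d])
  have f'c': "continuous_on A f'" for A by (rule continuous_on_subset[OF f'c]) simp
  have s'c: "continuous_on A s'" for A unfolding s'_def by (intro continuous_intros)
  have "((\<lambda>x. f' x * s x + f x * s' x) has_integral (f (real j + 1) * s (real j + 1) - f (real j) * s (real j))) {real j..real j + 1}"
  proof (rule fundamental_theorem_of_calculus)
    fix x assume "x \<in> {real j..real j + 1}"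
    have "((\<lambda>x. f x * s x) has_real_derivative f' x * s x + s' x * f x) (at x)"
      by (rule DERIV_mult[OF d ds])
    then show "((\<lambda>x. f x * s x) has_vector_derivative f' x * s x + f x * s' x) (at x within {real j..real j + 1})"
      by (simp add: has_real_derivative_iff_has_vector_derivative[symmetric] has_field_derivative_at_within mult.commute)
  qed simp
  moreover have "s (real j) = - 1 / 2" by (simp add: s_def smooth_saw_def)
  moreover have "s (real j + 1) = 1 / 2"
  proof -
    have "sin (2 * pi * (real k * 1)) = 0" for k using sin_int_2pin[of "int k"] by simp
    then show ?thesis unfolding s_def smooth_saw_def by simp
  qed
  moreover have "f (real j + 1) * (1 / 2) - f (real j) * (- 1 / 2) = (f (real j) + f (real j + 1)) / 2" by simp
  ultimately have I1: "((\<lambda>x. f' x * s x + f x * s' x) has_integral (f (real j) + f (real j + 1)) / 2) {real j..real j + 1}"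
    by (simp only:)
  have I2: "((\<lambda>x. f x * s' x) has_integral integral {real j..real j + 1} (\<lambda>x. f x * s' x)) {real j..real j + 1}"
    by (intro integrable_integral integrable_continuous_interval continuous_intros fc s'c)
  have I3: "integral {real j..real j + 1} (\<lambda>x. f' x * s x)
     = (f (real j) + f (real j + 1)) / 2 - integral {real j..real j + 1} (\<lambda>x. f x * s' x)"
    using has_integral_diff[OF I1 I2] by (simp add: integral_unique)
  have M0: "M \<ge> 0" using M[of "real j"] by linarith
  define h where "h x = f' x * s x" for x
  have hc: "continuous_on A h" for A unfolding h_def by (intro continuous_intros sc f'c')
  have hi: "h integrable_on {u..v}" for u v by (rule integrable_continuous_interval[OF hc])
  have hb: "norm (h x) \<le> M * b" if "real j \<le> x" "x \<le> real j + 1" "\<bar>s x\<bar> \<le> b" for x b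
    unfolding h_def norm_mult by (rule mult_mono) (use M[OF that(1,2)] that(3) M0 in auto)
  have sb: "\<bar>s x\<bar> \<le> 2" if "real j \<le> x" "x \<le> real j + 1" for x
    using smooth_saw_bounds(1)[of "x - real j" K] smooth_saw_bound_1[of K] that unfolding s_def by (cases "x = real j + 1") auto
  define u v where "u = real j + \<delta>" and "v = real j + 1 - \<delta>"
  have uv: "real j \<le> u" "u \<le> v" "v \<le> real j + 1" using \<delta> by (simp_all add: u_def v_def)
  have "integral {real j..real j + 1} h = integral {real j..u} h + integral {u..real j + 1} h"
    by (rule Henstock_Kurzweil_Integration.integral_combine[symmetric]) (use uv hi in auto)
  also have "integral {u..real j + 1} h = integral {u..v} h + integral {v..real j + 1} h"
    by (rule Henstock_Kurzweil_Integration.integral_combine[symmetric]) (use uv hi in auto)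
  finally have split: "integral {real j..real j + 1} h = integral {real j..u} h + (integral {u..v} h + integral {v..real j + 1} h)" .
  have b1: "norm (integral {real j..u} h) \<le> (M * 2) * (u - real j)"
    by (rule integral_bound[OF uv(1) hc]) (use hb sb uv in auto)
  have b3: "norm (integral {v..real j + 1} h) \<le> (M * 2) * (real j + 1 - v)"
    by (rule integral_bound[OF uv(3) hc]) (use hb sb uv in auto)
  have b2: "norm (integral {u..v} h) \<le> (M * (1 / (real K * \<delta>))) * (v - u)"
  proof (rule integral_bound[OF uv(2) hc])
    fix x assume x: "x \<in> {u..v}"
    have "\<bar>s x\<bar> \<le> 1 / (real K * \<delta>)"
      unfolding s_def by (rule smooth_saw_bounds(2)[OF _ _ K \<delta>(1)]) (use x \<delta> in \<open>auto simp: u_def v_def\<close>)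
    then show "norm (h x) \<le> M * (1 / (real K * \<delta>))" using x uv by (intro hb) auto
  qed
  have b2': "(M * (1 / (real K * \<delta>))) * (v - u) \<le> (M * (1 / (real K * \<delta>))) * 1"
    using M0 K \<delta> uv by (intro mult_left_mono) (auto simp: u_def v_def)
  have e1: "u - real j = \<delta>" "real j + 1 - v = \<delta>" by (simp_all add: u_def v_def)
  have "\<bar>integral {real j..real j + 1} h\<bar> \<le> M * 2 * \<delta> + (M * (1 / (real K * \<delta>)) + M * 2 * \<delta>)"
    unfolding split using b1 b2 b2' b3 unfolding e1 real_norm_def
    by (intro order.trans[OF abs_triangle_ineq] add_mono) auto
  also have "\<dots> = M * (4 * \<delta> + 1 / (real K * \<delta>))" by (simp add: algebra_simps)
  finally show ?thesis using I3 unfolding h_def[abs_def] s'_def by simp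
qed

section \<open>The functional equation on the positive reals\<close>

definition theta_tail :: "real \<Rightarrow> real" where
  "theta_tail u = (\<Sum>k. exp (- (real (Suc k) ^ 2 * u)))"

lemma theta_tail_summable:
  assumes "u > 0"
  shows "summable (\<lambda>k. exp (- (real (Suc k) ^ 2 * u)))"
proof (rule summable_comparison_test_bigo)
  show "summable (\<lambda>k. norm (1 / real (Suc k) ^ 2))" using inverse_squares_summable by simp
  show "(\<lambda>k. exp (- (real (Suc k) ^ 2 * u))) \<in> O(\<lambda>k. 1 / real (Suc k) ^ 2)" using assms by real_asymp
qed

lemma gaussian_derivative_bound_summable:
  assumes "a > 0"
  shows "summable (\<lambda>j. 2 * pi * a * (real j + 1) * exp (- pi * a * real j ^ 2))"
proof (rule summable_comparison_test_bigo)
  show "summable (\<lambda>k. norm (1 / real (Suc k) ^ 2))" using inverse_squares_summable by simp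
  show "(\<lambda>j. 2 * pi * a * (real j + 1) * exp (- pi * a * real j ^ 2)) \<in> O(\<lambda>k. 1 / real (Suc k) ^ 2)"
    using assms by real_asymp
qed

text \<open>Poisson summation for the Gaussian with all sums finite until the end. The formula on
  unit intervals is added up, \<open>N\<close> tends to infinity for fixed \<open>K\<close>, and
  then \<open>K\<close> does. With \<open>\<delta> = 1 / sqrt K\<close> both parts of
  \<open>4 * \<delta> + 1 / (K * \<delta>)\<close> tend to 0.\<close>

theorem theta_functional_equation:
  assumes a: "a > 0"
  shows "1 + 2 * theta_tail (pi * a) = (1 + 2 * theta_tail (pi / a)) / sqrt a"
proof -
  define f where "f x = exp (- pi * a * x ^ 2)" for x
  define f' where "f' x = - 2 * pi * a * x * exp (- pi * a * x ^ 2)" for x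
  have df: "(f has_real_derivative f' x) (at x)" for x
    unfolding f_def f'_def by (auto intro!: derivative_eq_intros)
  have f'c: "continuous_on UNIV f'" unfolding f'_def by (intro continuous_intros)
  define M where "M j = 2 * pi * a * (real j + 1) * exp (- pi * a * real j ^ 2)" for j :: nat
  have M: "\<bar>f' x\<bar> \<le> M j" if "real j \<le> x" "x \<le> real j + 1" for x j
  proof -
    have x0: "x \<ge> 0" using that by linarith
    have "real j ^ 2 \<le> x ^ 2" using that by (intro power_mono) auto
    then have "exp (- pi * a * x ^ 2) \<le> exp (- pi * a * real j ^ 2)" using a by simp
    then have "2 * pi * a * x * exp (- pi * a * x ^ 2) \<le> 2 * pi * a * (real j + 1) * exp (- pi * a * real j ^ 2)"
      using that a x0 by (intro mult_mono mult_left_mono) auto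
    then show ?thesis using x0 a by (simp add: f'_def M_def abs_mult)
  qed
  have M0: "M j \<ge> 0" for j using a by (simp add: M_def)
  have Ms: "summable M" unfolding M_def by (rule gaussian_derivative_bound_summable[OF a])
  define A where "A = suminf M"
  have A: "(\<Sum>j<N. M j) \<le> A" for N unfolding A_def by (rule sum_le_suminf[OF Ms]) (use M0 in auto)
  define c where "c K x = 1 + 2 * (\<Sum>k=1..K. cos (2 * pi * real k * x))" for K :: nat and x
  have cc: "continuous_on S (\<lambda>x. f x * c K x)" for S K
    unfolding f_def c_def by (intro continuous_intros)
  define G where "G k = exp (- pi * real k ^ 2 / a) / (2 * sqrt a)" for k :: nat
  define S where "S N = (\<Sum>j<N. f (real (Suc j)))" for N
  have sumf: "(\<Sum>j<N. (f (real j) + f (real j + 1)) / 2) = 1 / 2 + S N - f (real N) / 2" for N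
    by (induction N) (simp_all add: S_def f_def add.commute field_simps)
  have bound: "\<bar>(1 / 2 + S N - f (real N) / 2) - integral {0..real N} (\<lambda>x. f x * c K x)\<bar> \<le> A * (4 * \<delta> + 1 / (real K * \<delta>))"
    if K: "K > 0" and \<delta>: "0 < \<delta>" "\<delta> \<le> 1 / 2" for N K \<delta>
  proof -
    have int: "integral {0..real N} (\<lambda>x. f x * c K x) = (\<Sum>j<N. integral {real j..real j + 1} (\<lambda>x. f x * c K x))"
    proof (induction N)
      case (Suc N)
      have "integral {0..real (Suc N)} (\<lambda>x. f x * c K x) = integral {0..real N} (\<lambda>x. f x * c K x) + integral {real N..real (Suc N)} (\<lambda>x. f x * c K x)"
        by (rule Henstock_Kurzweil_Integration.integral_combine[symmetric]) (auto intro: integrable_continuous_interval cc)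
      then show ?case using Suc by (simp add: add.commute)
    qed simp
    have "\<bar>(\<Sum>j<N. (f (real j) + f (real j + 1)) / 2) - (\<Sum>j<N. integral {real j..real j + 1} (\<lambda>x. f x * c K x))\<bar>
      \<le> (\<Sum>j<N. M j * (4 * \<delta> + 1 / (real K * \<delta>)))"
      unfolding sum_subtractf[symmetric]
    proof (rule order.trans[OF sum_abs], rule sum_mono)
      fix j
      show "\<bar>(f (real j) + f (real j + 1)) / 2 - integral {real j..real j + 1} (\<lambda>x. f x * c K x)\<bar> \<le> M j * (4 * \<delta> + 1 / (real K * \<delta>))"
        unfolding c_def by (rule unit_interval_euler_maclaurin[OF df f'c M K \<delta>])
    qed
    also have "\<dots> = (\<Sum>j<N. M j) * (4 * \<delta> + 1 / (real K * \<delta>))" by (simp only: sum_distrib_right)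
    also have "\<dots> \<le> A * (4 * \<delta> + 1 / (real K * \<delta>))" using A K \<delta> by (intro mult_right_mono) auto
    finally show ?thesis unfolding sumf int .
  qed
  have S_lim: "S \<longlonglongrightarrow> theta_tail (pi * a)"
  proof -
    have "(\<lambda>k. exp (- (real (Suc k) ^ 2 * (pi * a)))) sums theta_tail (pi * a)"
      unfolding theta_tail_def using a by (intro summable_sums theta_tail_summable) simp
    then show ?thesis unfolding sums_def S_def f_def by (simp add: mult_ac)
  qed
  have fN: "(\<lambda>N. f (real N)) \<longlonglongrightarrow> 0" unfolding f_def using a by real_asymp
  have int_lim: "(\<lambda>N. integral {0..real N} (\<lambda>x. f x * c K x)) \<longlonglongrightarrow> G 0 + 2 * (\<Sum>k=1..K. G k)" for K
  proof -
    have "integral {0..real N} (\<lambda>x. f x * c K x)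
       = integral {0..real N} (\<lambda>x. f x * cos (2 * pi * real 0 * x)) + 2 * (\<Sum>k=1..K. integral {0..real N} (\<lambda>x. f x * cos (2 * pi * real k * x)))" for N
    proof -
      have i: "((\<lambda>x. f x * cos (2 * pi * real k * x)) has_integral integral {0..real N} (\<lambda>x. f x * cos (2 * pi * real k * x))) {0..real N}" for k
        unfolding f_def by (intro integrable_integral integrable_continuous_interval continuous_intros)
      have "((\<lambda>x. f x * cos (2 * pi * real 0 * x) + 2 * (\<Sum>k=1..K. f x * cos (2 * pi * real k * x))) has_integral
          (integral {0..real N} (\<lambda>x. f x * cos (2 * pi * real 0 * x)) + 2 * (\<Sum>k=1..K. integral {0..real N} (\<lambda>x. f x * cos (2 * pi * real k * x))))) {0..real N}"
        by (intro has_integral_add has_integral_mult_right has_integral_sum i) simp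
      moreover have "(\<lambda>x. f x * cos (2 * pi * real 0 * x) + 2 * (\<Sum>k=1..K. f x * cos (2 * pi * real k * x))) = (\<lambda>x. f x * c K x)"
        by (simp add: fun_eq_iff c_def sum_distrib_left algebra_simps)
      ultimately show ?thesis by (simp add: integral_unique)
    qed
    moreover have "(\<lambda>N. integral {0..real N} (\<lambda>x. f x * cos (2 * pi * real k * x))) \<longlonglongrightarrow> G k" for k
      unfolding f_def G_def by (rule gaussian_cos_integral[OF a])
    ultimately show ?thesis by (simp only:) (intro tendsto_intros)
  qed
  have fin: "\<bar>(1 / 2 + theta_tail (pi * a)) - (G 0 + 2 * (\<Sum>k=1..K. G k))\<bar> \<le> A * (4 * \<delta> + 1 / (real K * \<delta>))"
    if K: "K > 0" and \<delta>: "0 < \<delta>" "\<delta> \<le> 1 / 2" for K \<delta>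
  proof (rule LIMSEQ_le_const2)
    have "(\<lambda>N. \<bar>(1 / 2 + S N - f (real N) / 2) - integral {0..real N} (\<lambda>x. f x * c K x)\<bar>)
       \<longlonglongrightarrow> \<bar>(1 / 2 + theta_tail (pi * a) - 0 / 2) - (G 0 + 2 * (\<Sum>k=1..K. G k))\<bar>"
      by (intro tendsto_intros S_lim fN int_lim) simp
    then show "(\<lambda>N. \<bar>(1 / 2 + S N - f (real N) / 2) - integral {0..real N} (\<lambda>x. f x * c K x)\<bar>)
       \<longlonglongrightarrow> \<bar>(1 / 2 + theta_tail (pi * a)) - (G 0 + 2 * (\<Sum>k=1..K. G k))\<bar>" by simp
    show "\<exists>N. \<forall>n\<ge>N. \<bar>(1 / 2 + S n - f (real n) / 2) - integral {0..real n} (\<lambda>x. f x * c K x)\<bar> \<le> A * (4 * \<delta> + 1 / (real K * \<delta>))"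
      using bound[OF K \<delta>] by blast
  qed
  have G_lim: "(\<lambda>K. \<Sum>k=1..K. G k) \<longlonglongrightarrow> theta_tail (pi / a) / (2 * sqrt a)"
  proof -
    have "(\<lambda>k. exp (- (real (Suc k) ^ 2 * (pi / a)))) sums theta_tail (pi / a)"
      unfolding theta_tail_def using a by (intro summable_sums theta_tail_summable) simp
    from sums_divide[OF this, of "2 * sqrt a"] have "(\<lambda>k. G (Suc k)) sums (theta_tail (pi / a) / (2 * sqrt a))"
      by (simp add: G_def mult.commute)
    moreover have "(\<Sum>k<K. G (Suc k)) = (\<Sum>k=1..K. G k)" for K
      by (rule sum.reindex_bij_witness[of _ "\<lambda>d. d - 1" Suc]) auto
    ultimately show ?thesis by (simp add: sums_def)
  qed
  have "(\<lambda>K. \<bar>(1 / 2 + theta_tail (pi * a)) - (G 0 + 2 * (\<Sum>k=1..K. G k))\<bar>) \<longlonglongrightarrow> 0"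
  proof (rule tendsto_sandwich[of "\<lambda>_. 0" _ _ "\<lambda>K. A * (4 * (1 / sqrt (real K)) + 1 / (real K * (1 / sqrt (real K))))"])
    show "\<forall>\<^sub>F K in sequentially. \<bar>(1 / 2 + theta_tail (pi * a)) - (G 0 + 2 * (\<Sum>k=1..K. G k))\<bar>
        \<le> A * (4 * (1 / sqrt (real K)) + 1 / (real K * (1 / sqrt (real K))))"
      using eventually_ge_at_top[of 4]
    proof eventually_elim
      case (elim K)
      have "sqrt (real K) \<ge> 2" using elim by (intro real_le_rsqrt) simp
      then show ?case using elim by (intro fin) (auto simp: divide_simps)
    qed
    show "(\<lambda>K. A * (4 * (1 / sqrt (real K)) + 1 / (real K * (1 / sqrt (real K))))) \<longlonglongrightarrow> 0" by real_asymp
  qed auto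
  moreover have "(\<lambda>K. \<bar>(1 / 2 + theta_tail (pi * a)) - (G 0 + 2 * (\<Sum>k=1..K. G k))\<bar>)
     \<longlonglongrightarrow> \<bar>(1 / 2 + theta_tail (pi * a)) - (G 0 + 2 * (theta_tail (pi / a) / (2 * sqrt a)))\<bar>"
    by (intro tendsto_intros G_lim)
  ultimately have "\<bar>(1 / 2 + theta_tail (pi * a)) - (G 0 + 2 * (theta_tail (pi / a) / (2 * sqrt a)))\<bar> = 0"
    by (rule LIMSEQ_unique[symmetric])
  then show ?thesis using a by (simp add: G_def field_simps)
qed

section \<open>The theta function in the right half plane\<close>

definition complex_theta :: "complex \<Rightarrow> complex" where
  "complex_theta z = (\<Sum>k. exp (- (of_real (real (Suc k) ^ 2) * z)))"

text \<open>An antiderivative of \<open>- complex_theta\<close>. The weights \<open>1 / k^2\<close>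
  make it continuous up to the imaginary axis, where the series of \<open>complex_theta\<close>
  itself diverges; this is why the functional equation is integrated before passing to the
  boundary.\<close>

definition theta_primitive :: "complex \<Rightarrow> complex" where
  "theta_primitive z = (\<Sum>k. exp (- (of_real (real (Suc k) ^ 2) * z)) / of_real (real (Suc k) ^ 2))"

lemma norm_theta_term: "norm (exp (- (of_real r * z :: complex))) = exp (- (r * Re z))"
  by (simp add: norm_exp_eq_Re)

lemma norm_theta_primitive_term:
  assumes "Re z \<ge> 0"
  shows "norm (exp (- (of_real (real (Suc k) ^ 2) * z)) / of_real (real (Suc k) ^ 2)) \<le> 1 / real (Suc k) ^ 2"
proof -
  have "norm (exp (- (of_real (real (Suc k) ^ 2) * z))) \<le> 1" unfolding norm_theta_term using assms by simp
  moreover have "norm (of_real (real (Suc k) ^ 2) :: complex) = real (Suc k) ^ 2"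
    by (simp only: norm_of_real) simp
  ultimately show ?thesis unfolding norm_divide by (simp only:) (intro divide_right_mono, auto)
qed

lemma theta_primitive_summable:
  assumes "Re z \<ge> 0"
  shows "summable (\<lambda>k. exp (- (of_real (real (Suc k) ^ 2) * z)) / of_real (real (Suc k) ^ 2))"
  by (rule summable_comparison_test'[OF inverse_squares_summable norm_theta_primitive_term[OF assms]])

lemma theta_primitive_continuous: "continuous_on {z. Re z \<ge> 0} theta_primitive"
proof (rule uniform_limit_theorem)
  show "uniform_limit {z. Re z \<ge> 0} (\<lambda>n z. \<Sum>k<n. exp (- (of_real (real (Suc k) ^ 2) * z)) / of_real (real (Suc k) ^ 2)) theta_primitive sequentially"
    unfolding theta_primitive_def
    by (rule Weierstrass_m_test[OF norm_theta_primitive_term inverse_squares_summable]) simp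
  show "\<forall>\<^sub>F n in sequentially. continuous_on {z. Re z \<ge> 0} (\<lambda>z. \<Sum>k<n. exp (- (of_real (real (Suc k) ^ 2) * z)) / of_real (real (Suc k) ^ 2))"
    by (intro always_eventually allI continuous_intros) (auto simp del: of_nat_Suc)
qed auto

lemma theta_primitive_bound:
  assumes "Re z \<ge> 0"
  shows "norm (theta_primitive z) \<le> 2"
proof -
  have s: "summable (\<lambda>k. norm (exp (- (of_real (real (Suc k) ^ 2) * z)) / of_real (real (Suc k) ^ 2)))"
    by (rule summable_comparison_test'[OF inverse_squares_summable]) (use norm_theta_primitive_term[OF assms] in simp)
  have "norm (theta_primitive z) \<le> (\<Sum>k. norm (exp (- (of_real (real (Suc k) ^ 2) * z)) / of_real (real (Suc k) ^ 2)))"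
    unfolding theta_primitive_def by (rule summable_norm[OF s])
  also have "\<dots> \<le> (\<Sum>k. 1 / real (Suc k) ^ 2)"
    by (rule suminf_le[OF norm_theta_primitive_term[OF assms] s inverse_squares_summable])
  finally show ?thesis using inverse_squares_suminf_le by linarith
qed

lemma theta_primitive_deriv:
  assumes "Re z > 0"
  shows "(theta_primitive has_field_derivative - complex_theta z) (at z)"
proof -
  \<comment> \<open>On this smaller half plane the derivatives are dominated by the theta series at
    \<open>Re z / 2\<close>, which gives the uniform convergence needed for differentiation term by
    term.\<close>
  define S where "S = {w. Re w > Re z / 2}"
  have S: "open S" "convex S" "z \<in> S"
    unfolding S_def using assms by (auto simp only: open_halfspace_Re_gt convex_halfspace_Re_gt)
  have "((\<lambda>z. \<Sum>k. exp (- (of_real (real (Suc k) ^ 2) * z)) / of_real (real (Suc k) ^ 2)) has_field_derivative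
      (\<Sum>k. - exp (- (of_real (real (Suc k) ^ 2) * z)))) (at z)"
  proof (rule has_field_derivative_series'(2)[OF S(2) _ _ S(3)])
    fix k w
    show "((\<lambda>z. exp (- (of_real (real (Suc k) ^ 2) * z)) / of_real (real (Suc k) ^ 2)) has_field_derivative
        - exp (- (of_real (real (Suc k) ^ 2) * w))) (at w within S)"
    proof -
      have "of_real (real (Suc k) ^ 2) \<noteq> (0 :: complex)" by (simp only: of_real_eq_0_iff) simp
      then show ?thesis by (auto intro!: derivative_eq_intros simp del: of_real_power of_nat_Suc)
    qed
  next
    show "uniformly_convergent_on S (\<lambda>n w. \<Sum>k<n. - exp (- (of_real (real (Suc k) ^ 2) * w)))"
    proof (rule Weierstrass_m_test')
      fix k w assume "w \<in> S"
      then have "real (Suc k) ^ 2 * (Re z / 2) \<le> real (Suc k) ^ 2 * Re w"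
        unfolding S_def by (intro mult_left_mono) auto
      then show "norm (- exp (- (of_real (real (Suc k) ^ 2) * w))) \<le> exp (- (real (Suc k) ^ 2 * (Re z / 2)))"
        unfolding norm_minus_cancel norm_theta_term by simp
    qed (use assms in \<open>intro theta_tail_summable, simp\<close>)
  next
    show "summable (\<lambda>k. exp (- (of_real (real (Suc k) ^ 2) * z)) / of_real (real (Suc k) ^ 2))"
      by (rule theta_primitive_summable) (use assms in simp)
    show "z \<in> interior S" using S by (simp add: interior_open)
  qed
  moreover have "summable (\<lambda>k. exp (- (of_real (real (Suc k) ^ 2) * z)))"
    by (rule summable_comparison_test'[OF theta_tail_summable[OF assms]]) (simp only: norm_theta_term order_refl)
  ultimately show ?thesis unfolding theta_primitive_def[abs_def] complex_theta_def by (simp only: suminf_minus)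
qed

text \<open>Up to sign it is the derivative of a holomorphic function.\<close>

lemma complex_theta_holomorphic: "complex_theta holomorphic_on {z. Re z > 0}"
proof -
  have "(\<lambda>z. - deriv theta_primitive z) holomorphic_on {z. Re z > 0}"
    by (intro holomorphic_intros holomorphic_deriv) 
      (auto simp: open_halfspace_Re_gt holomorphic_on_open intro: theta_primitive_deriv)
  moreover have "- deriv theta_primitive z = complex_theta z" if "z \<in> {z. Re z > 0}" for z
    using DERIV_imp_deriv[OF theta_primitive_deriv] that by simp
  ultimately show ?thesis using holomorphic_cong[OF refl] by (metis (no_types, lifting))
qed

lemma complex_theta_of_real:
  assumes "u > 0"
  shows "complex_theta (of_real u) = of_real (theta_tail u)"
proof -
  have "(\<lambda>k. complex_of_real (exp (- (real (Suc k) ^ 2 * u)))) sums of_real (theta_tail u)"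
    unfolding theta_tail_def by (intro sums_of_real summable_sums theta_tail_summable assms)
  then show ?thesis unfolding complex_theta_def by (simp add: sums_iff exp_of_real[symmetric])
qed

text \<open>Identity theorem along the positive reals. The half plane is mapped into itself by
  inversion, and the principal square root is holomorphic on it.\<close>

theorem complex_theta_functional_equation:
  assumes "Re z > 0"
  shows "(1 + 2 * complex_theta (of_real pi * z)) * csqrt z = 1 + 2 * complex_theta (of_real pi / z)"
proof -
  define S where "S = {z. Re z > 0}"
  have S: "open S" "connected S" by (simp_all add: S_def open_halfspace_Re_gt convex_connected convex_halfspace_Re_gt)
  have np: "w \<notin> \<real>\<^sub>\<le>\<^sub>0" if "w \<in> S" for w using that by (auto simp: S_def complex_nonpos_Reals_iff)
  have z0: "w \<noteq> 0" if "w \<in> S" for w using that by (auto simp: S_def)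
  have p1: "of_real pi * w \<in> S" if "w \<in> S" for w using that by (simp add: S_def)
  have p2: "of_real pi / w \<in> S" if "w \<in> S" for w
    using that by (auto simp: S_def Re_divide sum_power2_gt_zero_iff intro!: divide_pos_pos)
  have h: "(\<lambda>w. complex_theta (f w)) holomorphic_on S" if "f holomorphic_on S" "\<And>w. w \<in> S \<Longrightarrow> f w \<in> S" for f
    using holomorphic_on_compose_gen[OF that(1) complex_theta_holomorphic] that(2) by (auto simp: o_def S_def)
  have hol: "(\<lambda>w. (1 + 2 * complex_theta (of_real pi * w)) * csqrt w - (1 + 2 * complex_theta (of_real pi / w))) holomorphic_on S"
    using np p1 p2 z0 by (intro holomorphic_intros h) auto
  have "(1 + 2 * complex_theta (of_real pi * z)) * csqrt z - (1 + 2 * complex_theta (of_real pi / z)) = 0"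
  proof (rule analytic_continuation[OF hol S, of "of_real ` {0<..}" 1])
    show "complex_of_real ` {0<..} \<subseteq> S" by (auto simp: S_def)
    show "(1 :: complex) islimpt of_real ` {0<..}"
      using islimpt_isCont_image[of 1 "{0<..}" complex_of_real]
      by (auto simp: islimpt_greaterThanLessThan1 interior_limit_point interior_open eventually_at_filter)
    fix w assume "w \<in> complex_of_real ` {0<..}"
    then obtain a where a: "a > 0" "w = of_real a" by auto
    have "complex_theta (of_real pi * w) = of_real (theta_tail (pi * a))"
      using complex_theta_of_real[of "pi * a"] a by simp
    moreover have "complex_theta (of_real pi / w) = of_real (theta_tail (pi / a))"
      using complex_theta_of_real[of "pi / a"] a by simp
    moreover have "csqrt w = of_real (sqrt a)" using a by simp
    moreover have "(1 + 2 * theta_tail (pi * a)) * sqrt a = 1 + 2 * theta_tail (pi / a)"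
      using theta_functional_equation[OF a(1)] a by (simp add: field_simps)
    then have "complex_of_real ((1 + 2 * theta_tail (pi * a)) * sqrt a) = of_real (1 + 2 * theta_tail (pi / a))" by simp
    ultimately show "(1 + 2 * complex_theta (of_real pi * w)) * csqrt w - (1 + 2 * complex_theta (of_real pi / w)) = 0"
      by simp
  qed (use assms in \<open>auto simp: S_def\<close>)
  then show ?thesis by simp
qed

section \<open>The alternate expression\<close>

text \<open>
  The junk value at \<open>y = 0\<close> is killed by the factor \<open>sqrt y\<close>.
\<close>

definition ray_term :: "complex \<Rightarrow> real \<Rightarrow> complex" where
  "ray_term w y = of_real (sqrt y) * theta_primitive (of_real pi / (of_real y * w))"

lemma Re_ray:
  assumes "Re w \<ge> 0" "y \<ge> 0"
  shows "Re (of_real pi / (of_real y * w)) \<ge> 0"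
proof -
  have "of_real pi / (of_real y * w) = of_real (pi / y) * (1 / w)" by simp
  moreover have "Re (of_real (pi / y) * (1 / w)) = pi / y * Re (1 / w)"
    by (simp only: times_complex.sel Re_complex_of_real Im_complex_of_real mult_zero_left diff_zero)
  moreover have "Re (1 / w) \<ge> 0" using assms by (simp add: Re_divide)
  ultimately show ?thesis using assms by (simp only: zero_le_mult_iff) simp
qed

lemma norm_ray_term:
  assumes "Re w \<ge> 0" "y \<ge> 0"
  shows "norm (ray_term w y) \<le> 2 * sqrt y"
proof -
  have "sqrt y * norm (theta_primitive (of_real pi / (of_real y * w))) \<le> sqrt y * 2"
    using assms by (intro mult_left_mono theta_primitive_bound Re_ray) auto
  then show ?thesis using assms by (simp add: ray_term_def norm_mult)
qed

lemma ray_term_continuous: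
  assumes w: "Re w \<ge> 0" "w \<noteq> 0"
  shows "continuous_on {0..} (ray_term w)"
  unfolding continuous_on_eq_continuous_within
proof
  fix y :: real assume y: "y \<in> {0..}"
  show "continuous (at y within {0..}) (ray_term w)"
  proof (cases "y = 0")
    case True
    have "(ray_term w \<longlongrightarrow> 0) (at 0 within {0..})"
    proof (rule Lim_null_comparison)
      show "\<forall>\<^sub>F y in at 0 within {0..}. norm (ray_term w y) \<le> 2 * sqrt y"
        using norm_ray_term[OF w(1)] by (auto simp: eventually_at_filter)
      have "((\<lambda>y. 2 * sqrt y) \<longlongrightarrow> 2 * sqrt 0) (at 0 within {0..})" by (intro tendsto_intros)
      then show "((\<lambda>y. 2 * sqrt y) \<longlongrightarrow> 0) (at 0 within {0..})" by simp
    qed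
    then show ?thesis using True by (simp add: continuous_within ray_term_def)
  next
    case False
    have "continuous_on {0<..} (ray_term w)"
      unfolding ray_term_def
      by (intro continuous_intros continuous_on_compose2[OF theta_primitive_continuous])
        (use w Re_ray in auto)
    then have "isCont (ray_term w) y" using False y by (auto simp: continuous_on_eq_continuous_at)
    then show ?thesis by (rule continuous_at_imp_continuous_at_within)
  qed
qed

lemma ray_term_integrable:
  assumes "Re w \<ge> 0" "w \<noteq> 0"
  shows "ray_term w integrable_on {0..t}"
  by (rule integrable_continuous_interval, rule continuous_on_subset[OF ray_term_continuous[OF assms]]) auto

lemma ray_integral_deriv:
  assumes "Re w \<ge> 0" "w \<noteq> 0" "t > 0"
  shows "((\<lambda>t. integral {0..t} (ray_term w)) has_vector_derivative ray_term w t) (at t)"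
proof -
  have "((\<lambda>t. integral {0..t} (ray_term w)) has_vector_derivative ray_term w t) (at t within {0..t + 1})"
    by (rule integral_has_vector_derivative[OF continuous_on_subset[OF ray_term_continuous[OF assms(1,2)]]])
       (use assms in auto)
  then show ?thesis using assms by (simp add: at_within_Icc_at)
qed

text \<open>The functional equation integrated over the ray from 0 to \<open>t * w\<close>. The dual
  theta term is \<open>t powr (3/2)\<close> times a derivative of \<open>theta_primitive\<close> at
  \<open>pi / (t * w)\<close>, up to constants; integrating it by parts produces the boundary term
  \<open>of_real t * ray_term w t\<close> and the factor \<open>3/2\<close> before the remaining
  integral.\<close>

lemma theta_primitive_ray_identity:
  assumes w: "Re w > 0" and t: "t > 0"
  shows "theta_primitive 0 - theta_primitive (of_real (pi * t) * w)
    = - of_real (pi * t) * w / 2 + of_real (pi * sqrt t) * csqrt w + w * csqrt w * (of_real t * ray_term w t)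
      - 3 / 2 * (w * csqrt w) * integral {0..t} (ray_term w)"
proof -
  \<comment> \<open>Both sides are compared without carrying out the integrations: the difference
    has derivative 0 for \<open>t > 0\<close>, and it tends to 0 as \<open>t\<close> does.\<close>
  define D where "D t = theta_primitive 0 - theta_primitive (of_real (pi * t) * w)
    - (- of_real (pi * t) * w / 2 + of_real (pi * sqrt t) * csqrt w + w * csqrt w * (of_real t * ray_term w t)
      - 3 / 2 * (w * csqrt w) * integral {0..t} (ray_term w))" for t
  have w0: "w \<noteq> 0" "Re w \<ge> 0" using w by auto
  have dD: "(D has_vector_derivative 0) (at t)" if t: "t > 0" for t
  proof -
    define q where "q = csqrt w"
    have q: "q \<noteq> 0" "q * q = w" using w0 by (simp_all add: q_def power2_eq_square[symmetric])
    define r where "r = complex_of_real (sqrt t)"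
    have r: "r \<noteq> 0" "r * r = of_real t" using t by (simp_all add: r_def of_real_mult[symmetric] del: of_real_mult)
    have Re2: "Re (of_real pi / (of_real t * w)) > 0"
    proof -
      have "of_real pi / (of_real t * w) = of_real (pi / t) * (1 / w)" by simp
      moreover have "Re (of_real (pi / t) * (1 / w)) = pi / t * Re (1 / w)"
        by (simp only: times_complex.sel Re_complex_of_real Im_complex_of_real mult_zero_left diff_zero)
      moreover have "Re (1 / w) > 0" using w by (auto simp: Re_divide sum_power2_gt_zero_iff intro!: divide_pos_pos)
      ultimately show ?thesis using t by (simp only: zero_less_mult_iff) simp
    qed
    define \<Theta>1 \<Theta>2 \<E> where "\<Theta>1 = complex_theta (of_real (pi * t) * w)"
      and "\<Theta>2 = complex_theta (of_real pi / (of_real t * w))"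
      and "\<E> = theta_primitive (of_real pi / (of_real t * w))"
    have d1: "((\<lambda>t. theta_primitive (of_real (pi * t) * w)) has_vector_derivative (of_real pi * w) * - \<Theta>1) (at t)"
    proof -
      have "((\<lambda>t. of_real (pi * t) * w) has_vector_derivative of_real pi * w) (at t)"
        by (auto intro!: derivative_eq_intros)
      from field_vector_diff_chain_at[OF this, of theta_primitive "- \<Theta>1"] show ?thesis
        using theta_primitive_deriv[of "of_real (pi * t) * w"] w t by (simp add: o_def \<Theta>1_def)
    qed
    have d2: "((\<lambda>t. theta_primitive (of_real pi / (of_real t * w))) has_vector_derivative - (of_real pi / (of_real t ^ 2 * w)) * - \<Theta>2) (at t)"
    proof -
      have "((\<lambda>z. of_real pi / (z * w)) has_field_derivative - (of_real pi / (of_real t ^ 2 * w))) (at (of_real t))"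
        using t w0 by (auto intro!: derivative_eq_intros simp: divide_simps power2_eq_square)
      then have "((\<lambda>t. of_real pi / (of_real t * w)) has_vector_derivative - (of_real pi / (of_real t ^ 2 * w))) (at t)"
        by (rule has_vector_derivative_real_field)
      from field_vector_diff_chain_at[OF this, of theta_primitive "- \<Theta>2"] show ?thesis
        using theta_primitive_deriv[OF Re2] by (simp add: o_def \<Theta>2_def)
    qed
    have d3: "((\<lambda>t. complex_of_real (sqrt t)) has_vector_derivative 1 / (2 * r)) (at t)"
    proof -
      have "((\<lambda>t. complex_of_real (sqrt t)) has_vector_derivative of_real (inverse (sqrt t) / 2)) (at t)"
        by (rule has_vector_derivative_of_real[OF DERIV_real_sqrt[OF t]])
      then show ?thesis by (simp add: r_def field_simps)
    qed
    have d4: "((\<lambda>t. of_real t * ray_term w t) has_vector_derivative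
        of_real t * (r * (- (of_real pi / (of_real t ^ 2 * w)) * - \<Theta>2) + 1 / (2 * r) * \<E>) + 1 * ray_term w t) (at t)"
    proof -
      have "((\<lambda>t. complex_of_real t) has_vector_derivative 1) (at t)"
        using has_vector_derivative_of_real[OF DERIV_ident] by simp
      from has_vector_derivative_mult[OF this has_vector_derivative_mult[OF d3 d2]]
      show ?thesis unfolding ray_term_def r_def \<E>_def .
    qed
    have "(D has_vector_derivative (0 - (of_real pi * w) * - \<Theta>1
       - ((- of_real pi * w / 2 + of_real pi * (1 / (2 * r)) * q)
         + w * q * (of_real t * (r * (- (of_real pi / (of_real t ^ 2 * w)) * - \<Theta>2) + 1 / (2 * r) * \<E>) + 1 * ray_term w t)
         - 3 / 2 * (w * q) * ray_term w t))) (at t)"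
    proof -
      have e1: "((\<lambda>t. - of_real (pi * t) * w / 2) has_vector_derivative - of_real pi * w / 2) (at t)"
        by (auto intro!: derivative_eq_intros)
      have e2: "((\<lambda>t. of_real (pi * sqrt t) * csqrt w) has_vector_derivative of_real pi * (1 / (2 * r)) * q) (at t)"
        unfolding q_def of_real_mult
        by (intro has_vector_derivative_mult_left has_vector_derivative_mult_right d3)
      show ?thesis unfolding D_def[abs_def] q_def
        by (intro has_vector_derivative_diff has_vector_derivative_add has_vector_derivative_const
            d1 e1 e2[unfolded q_def] has_vector_derivative_mult_right d4 ray_integral_deriv w0 t)
    qed
    also have "ray_term w t = r * \<E>" by (simp add: ray_term_def r_def \<E>_def)
    also have "(0 - (of_real pi * w) * - \<Theta>1
       - ((- of_real pi * w / 2 + of_real pi * (1 / (2 * r)) * q)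
         + w * q * (of_real t * (r * (- (of_real pi / (of_real t ^ 2 * w)) * - \<Theta>2) + 1 / (2 * r) * \<E>) + 1 * (r * \<E>))
         - 3 / 2 * (w * q) * (r * \<E>))) = 0"
    proof -
      have "(1 + 2 * \<Theta>1) * csqrt (of_real t * w) = 1 + 2 * \<Theta>2"
        using complex_theta_functional_equation[of "of_real t * w"] w t
        by (simp add: \<Theta>1_def \<Theta>2_def mult.assoc)
      moreover have "csqrt (of_real t * w) = r * q"
        
      proof (rule csqrt_unique)
        show "(r * q)\<^sup>2 = of_real t * w" unfolding power2_eq_square r(2)[symmetric] q(2)[symmetric] by (simp add: mult_ac)
        show "0 < Re (r * q) \<or> Re (r * q) = 0 \<and> 0 \<le> Im (r * q)"
          using csqrt_principal[of w] t by (auto simp: r_def q_def)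
      qed
      ultimately have f: "\<Theta>2 = ((1 + 2 * \<Theta>1) * (r * q) - 1) / 2" by (simp add: field_simps)
      show ?thesis unfolding f r(2)[symmetric] q(2)[symmetric] using r(1) q(1) by (simp add: field_simps power2_eq_square)
    qed
    finally show ?thesis .
  qed
  obtain c where c: "\<And>x. x \<in> {0<..} \<Longrightarrow> D x = c"
    by (rule has_vector_derivative_zero_constant[of "{0<..} :: real set" D])
       (auto intro: has_vector_derivative_at_within dD)
  have "(D \<longlongrightarrow> 0) (at_right 0)"
  proof -
    have rt: "(ray_term w \<longlongrightarrow> 0) (at_right 0)"
    proof -
      have "(ray_term w \<longlongrightarrow> ray_term w 0) (at 0 within {0..})"
        using ray_term_continuous[OF w0(2,1)] by (auto simp: continuous_on_def)
      then have "(ray_term w \<longlongrightarrow> ray_term w 0) (at_right 0)" by (rule tendsto_within_subset) auto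
      then show ?thesis by (simp add: ray_term_def)
    qed
    have ri: "((\<lambda>t. integral {0..t} (ray_term w)) \<longlongrightarrow> 0) (at_right 0)"
    proof -
      have "continuous_on {0..1} (\<lambda>t. integral {0..t} (ray_term w))"
        by (rule indefinite_integral_continuous_1) (rule ray_term_integrable[OF w0(2,1)])
      then have "((\<lambda>t. integral {0..t} (ray_term w)) \<longlongrightarrow> integral {0..0} (ray_term w)) (at 0 within {0..1})"
        unfolding continuous_on_def by (rule bspec) simp
      then show ?thesis by (simp add: at_within_Icc_at_right)
    qed
    have tp: "((\<lambda>t. theta_primitive (of_real (pi * t) * w)) \<longlongrightarrow> theta_primitive 0) (at_right 0)"
    proof -
      have "continuous_on {0..} (\<lambda>t. theta_primitive (of_real (pi * t) * w))"
        by (rule continuous_on_compose2[OF theta_primitive_continuous]) (use w in \<open>auto intro!: continuous_intros\<close>)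
      then have "((\<lambda>t. theta_primitive (of_real (pi * t) * w)) \<longlongrightarrow> theta_primitive (of_real (pi * 0) * w)) (at 0 within {0..})"
        unfolding continuous_on_def by (rule bspec) simp
      then have "((\<lambda>t. theta_primitive (of_real (pi * t) * w)) \<longlongrightarrow> theta_primitive (of_real (pi * 0) * w)) (at_right 0)"
        by (rule tendsto_within_subset) auto
      then show ?thesis by simp
    qed
    have "(D \<longlongrightarrow> theta_primitive 0 - theta_primitive 0
      - (- of_real (pi * 0) * w / 2 + of_real (pi * sqrt 0) * csqrt w + w * csqrt w * (of_real 0 * 0) - 3 / 2 * (w * csqrt w) * 0)) (at_right 0)"
      unfolding D_def by (intro tendsto_intros tp rt ri) auto
    then show ?thesis by simp
  qed
  moreover have "(D \<longlongrightarrow> c) (at_right 0)"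
    by (rule tendsto_eventually) (use c in \<open>auto simp: eventually_at_filter\<close>)
  ultimately have "c = 0" using tendsto_unique trivial_limit_at_right_real by blast
  then have "D t = 0" using c t by simp
  then show ?thesis by (simp add: D_def)
qed

text \<open>On the positive imaginary axis the terms are exponentials of \<open>- i * x\<close>, and
  real plus imaginary part of \<open>1 - exp (- i * x)\<close> is \<open>1 - cos x + sin x\<close>.
  This is how the combination in \<open>osc\<close> arises.\<close>

lemma theta_primitive_imaginary:
  "Im (theta_primitive (- \<i> * of_real x)) = osc_series sin x"
  "Re (theta_primitive 0 - theta_primitive (\<i> * of_real x)) + Im (theta_primitive 0 - theta_primitive (\<i> * of_real x)) = osc_series osc x"
proof -
  have expo: "exp (- (of_real r * (\<i> * of_real x))) / of_real r = Complex (cos (x * r) / r) (- (sin (x * r) / r))" for r x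
    by (rule complex_eqI) (simp_all add: Re_exp Im_exp Re_divide_of_real Im_divide_of_real mult.commute)
  have s: "(\<lambda>k. Complex (cos (x * real (Suc k) ^ 2) / real (Suc k) ^ 2) (- (sin (x * real (Suc k) ^ 2) / real (Suc k) ^ 2))) sums theta_primitive (\<i> * of_real x)" for x
  proof -
    have "Re (\<i> * of_real x) \<ge> 0" by simp
    from theta_primitive_summable[OF this, THEN summable_sums] show ?thesis
      unfolding theta_primitive_def expo .
  qed
  have ims: "(\<lambda>k. - (sin (x * real (Suc k) ^ 2) / real (Suc k) ^ 2)) sums Im (theta_primitive (\<i> * of_real x))" for x
    using bounded_linear.sums[OF bounded_linear_Im s[of x]] by simp
  have res: "(\<lambda>k. cos (x * real (Suc k) ^ 2) / real (Suc k) ^ 2) sums Re (theta_primitive (\<i> * of_real x))" for x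
    using bounded_linear.sums[OF bounded_linear_Re s[of x]] by simp
  have "(\<lambda>k. 1 / real (Suc k) ^ 2 * sin (x * real (Suc k) ^ 2)) sums Im (theta_primitive (\<i> * of_real (- x)))"
    using ims[of "- x"] by simp
  then show "Im (theta_primitive (- \<i> * of_real x)) = osc_series sin x"
    unfolding osc_series_def by (simp add: sums_iff)
  have "(\<lambda>k. (cos (0 * real (Suc k) ^ 2) / real (Suc k) ^ 2 - cos (x * real (Suc k) ^ 2) / real (Suc k) ^ 2)
      + (- (sin (0 * real (Suc k) ^ 2) / real (Suc k) ^ 2) - - (sin (x * real (Suc k) ^ 2) / real (Suc k) ^ 2)))
     sums ((Re (theta_primitive (\<i> * of_real 0)) - Re (theta_primitive (\<i> * of_real x)))
      + (Im (theta_primitive (\<i> * of_real 0)) - Im (theta_primitive (\<i> * of_real x))))"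
    by (intro sums_add sums_diff res ims)
  moreover have "(cos (0 * real (Suc k) ^ 2) / real (Suc k) ^ 2 - cos (x * real (Suc k) ^ 2) / real (Suc k) ^ 2)
      + (- (sin (0 * real (Suc k) ^ 2) / real (Suc k) ^ 2) - - (sin (x * real (Suc k) ^ 2) / real (Suc k) ^ 2))
     = 1 / real (Suc k) ^ 2 * osc (x * real (Suc k) ^ 2)" for k
    by (simp only: osc_def mult_zero_left cos_zero sin_zero) (simp add: diff_divide_distrib add_divide_distrib del: of_nat_Suc)
  ultimately show "Re (theta_primitive 0 - theta_primitive (\<i> * of_real x)) + Im (theta_primitive 0 - theta_primitive (\<i> * of_real x)) = osc_series osc x"
    unfolding osc_series_def by (simp only: sums_iff) simp
qed

text \<open>The ray \<open>2 * i\<close> matches the two arguments \<open>2 * pi * t\<close> and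
  \<open>pi / (2 * t)\<close> of the formulas for \<open>C\<close>, and its principal square root is
  \<open>1 + i\<close>. It is approached from the right half plane; the integrals converge by
  domination with \<open>2 * sqrt y\<close>.\<close>

lemma theta_primitive_ray_identity_boundary:
  assumes t: "t > 0"
  shows "theta_primitive 0 - theta_primitive (of_real (pi * t) * (2 * \<i>))
    = - of_real (pi * t) * (2 * \<i>) / 2 + of_real (pi * sqrt t) * (1 + \<i>) + 2 * \<i> * (1 + \<i>) * (of_real t * ray_term (2 * \<i>) t)
      - 3 / 2 * (2 * \<i> * (1 + \<i>)) * integral {0..t} (ray_term (2 * \<i>))"
proof -
  define w where "w n = 2 * \<i> + complex_of_real (inverse (real (Suc n)))" for n
  have wpos: "Re (w n) > 0" for n by (simp add: w_def)
  have wnz: "w n \<noteq> 0" for n using wpos[of n] by auto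
  have "w \<longlonglongrightarrow> 2 * \<i> + complex_of_real 0"
    unfolding w_def by (intro tendsto_intros LIMSEQ_inverse_real_of_nat)
  then have wlim: "w \<longlonglongrightarrow> 2 * \<i>" by simp
  have tp: "(\<lambda>n. theta_primitive (f n)) \<longlonglongrightarrow> theta_primitive l"
    if "f \<longlonglongrightarrow> l" "\<And>n. Re (f n) \<ge> 0" "Re l \<ge> 0" for f l
    using continuous_on_tendsto_compose[OF theta_primitive_continuous that(1)] that by simp
  have rt: "(\<lambda>n. ray_term (w n) y) \<longlonglongrightarrow> ray_term (2 * \<i>) y" if y: "y \<ge> 0" for y
  proof (cases "y = 0")
    case False
    have "(\<lambda>n. of_real pi / (of_real y * w n)) \<longlonglongrightarrow> of_real pi / (of_real y * (2 * \<i>))"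
      by (intro tendsto_intros wlim) (use False in auto)
    then show ?thesis unfolding ray_term_def
      by (intro tendsto_mult_left tp Re_ray) (use y wpos less_imp_le in auto)
  qed (simp add: ray_term_def)
  have ri: "(\<lambda>n. integral {0..t} (ray_term (w n))) \<longlonglongrightarrow> integral {0..t} (ray_term (2 * \<i>))"
  proof (rule dominated_convergence(2))
    show "ray_term (w n) integrable_on {0..t}" for n
      using ray_term_integrable wpos wnz less_imp_le by blast
    show "(\<lambda>y. 2 * sqrt y) integrable_on {0..t}" by (intro integrable_continuous_interval continuous_intros)
    show "norm (ray_term (w n) y) \<le> 2 * sqrt y" if "y \<in> {0..t}" for n y
      using norm_ray_term[of "w n" y] wpos[of n] that by simp
    show "(\<lambda>n. ray_term (w n) y) \<longlonglongrightarrow> ray_term (2 * \<i>) y" if "y \<in> {0..t}" for y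
      using rt that by simp
  qed
  have c2i: "csqrt (2 * \<i>) = 1 + \<i>"
    by (rule csqrt_unique) (simp_all add: power2_eq_square algebra_simps)
  have cl: "(\<lambda>n. csqrt (w n)) \<longlonglongrightarrow> 1 + \<i>"
  proof -
    have "isCont csqrt (2 * \<i>)" by (rule continuous_at_csqrt) (simp add: complex_nonpos_Reals_iff)
    then show ?thesis using isCont_tendsto_compose[OF _ wlim] c2i by fastforce
  qed
  have tl: "(\<lambda>n. theta_primitive (of_real (pi * t) * w n)) \<longlonglongrightarrow> theta_primitive (of_real (pi * t) * (2 * \<i>))"
    by (rule tp) (intro tendsto_intros wlim, use t less_imp_le[OF wpos] in auto)
  have "(\<lambda>n. theta_primitive 0 - theta_primitive (of_real (pi * t) * w n)) \<longlonglongrightarrow> theta_primitive 0 - theta_primitive (of_real (pi * t) * (2 * \<i>))"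
    by (intro tendsto_intros tl)
  moreover have "(\<lambda>n. theta_primitive 0 - theta_primitive (of_real (pi * t) * w n)) \<longlonglongrightarrow>
      - of_real (pi * t) * (2 * \<i>) / 2 + of_real (pi * sqrt t) * (1 + \<i>) + 2 * \<i> * (1 + \<i>) * (of_real t * ray_term (2 * \<i>) t)
      - 3 / 2 * (2 * \<i> * (1 + \<i>)) * integral {0..t} (ray_term (2 * \<i>))"
    unfolding theta_primitive_ray_identity[OF wpos t]
    by (intro tendsto_intros wlim cl rt ri) (use t in auto)
  ultimately show ?thesis by (rule LIMSEQ_unique)
qed

text \<open>The factor \<open>2 * i * (1 + i)\<close> is \<open>-2 + 2 * i\<close>. For a product of
  it with \<open>a + b * i\<close>, real plus imaginary part is \<open>-4 * b\<close>: the cosine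
  part drops out and only the sine series remains, with coefficients \<open>-4\<close> and
  \<open>3/2 * 4 = 6\<close>.\<close>

theorem osc_series_reciprocity:
  assumes t: "t > 0"
  shows "osc_series osc (2 * pi * t) = - pi * t + 2 * pi * sqrt t - 4 * t * sqrt t * osc_series sin (pi / 2 / t)
    + 6 * integral {0..t} (\<lambda>y. sqrt y * osc_series sin (pi / 2 / y))"
proof -
  have im: "Im (ray_term (2 * \<i>) y) = sqrt y * osc_series sin (pi / 2 / y)" for y
  proof -
    have "of_real pi / (of_real y * (2 * \<i>)) = - \<i> * of_real (pi / 2 / y)" by (cases "y = 0") (simp_all add: divide_simps)
    then show ?thesis unfolding ray_term_def using theta_primitive_imaginary(1)[of "pi / 2 / y"] by simp
  qed
  define R I where "R = Re (integral {0..t} (ray_term (2 * \<i>)))" and "I = Im (integral {0..t} (ray_term (2 * \<i>)))"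
  have int: "integral {0..t} (ray_term (2 * \<i>)) = Complex R I" by (simp add: R_def I_def)
  have I: "I = integral {0..t} (\<lambda>y. sqrt y * osc_series sin (pi / 2 / y))"
    unfolding I_def im[symmetric]
    using integral_linear[OF ray_term_integrable bounded_linear_Im, of "2 * \<i>" t] by (simp add: o_def)
  have rt: "ray_term (2 * \<i>) t = Complex (Re (ray_term (2 * \<i>) t)) (sqrt t * osc_series sin (pi / 2 / t))"
    by (rule complex_eqI) (simp_all only: complex.sel im)
  have "of_real (pi * t) * (2 * \<i>) = \<i> * of_real (2 * pi * t)" by simp
  note eq = theta_primitive_ray_identity_boundary[OF t, unfolded this]
  have "osc_series osc (2 * pi * t) = Re (theta_primitive 0 - theta_primitive (\<i> * of_real (2 * pi * t)))
      + Im (theta_primitive 0 - theta_primitive (\<i> * of_real (2 * pi * t)))"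
    by (rule theta_primitive_imaginary(2)[symmetric])
  also have "\<dots> = - pi * t + 2 * pi * sqrt t - 4 * t * (sqrt t * osc_series sin (pi / 2 / t)) + 6 * I"
    unfolding eq int by (subst (1 2) rt) (simp add: algebra_simps)
  finally show ?thesis unfolding I by simp
qed

lemma sin_series_integral_bound:
  assumes "t \<ge> 0"
  shows "\<bar>integral {0..t} (\<lambda>y. sqrt y * osc_series sin (pi / 2 / y))\<bar> \<le> 4 * sqrt (pi / 2) * t"
proof -
  have bd: "\<bar>sqrt y * osc_series sin (pi / 2 / y)\<bar> \<le> 4 * sqrt (pi / 2)" if y: "y \<ge> 0" for y
  proof (cases "y = 0")
    case False
    have "\<bar>osc_series sin (pi / 2 / y)\<bar> \<le> (2 * 1 + 2 * 1) * sqrt (pi / 2 / y)"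
      using y False by (intro osc_series_bound) (auto intro: order.trans[OF abs_sin_x_le_abs_x])
    then have "\<bar>sqrt y\<bar> * \<bar>osc_series sin (pi / 2 / y)\<bar> \<le> \<bar>sqrt y\<bar> * ((2 * 1 + 2 * 1) * sqrt (pi / 2 / y))"
      by (intro mult_left_mono) auto
    also have "\<dots> = 4 * (sqrt y * sqrt (pi / 2 / y))" using y by simp
    also have "sqrt y * sqrt (pi / 2 / y) = sqrt (y * (pi / 2 / y))" by (rule real_sqrt_mult[symmetric])
    also have "y * (pi / 2 / y) = pi / 2" using False by simp
    finally show ?thesis by (simp add: abs_mult)
  qed simp
  have "norm (integral {0..t} (\<lambda>y. sqrt y * osc_series sin (pi / 2 / y))) \<le> 4 * sqrt (pi / 2) * (t - 0)"
  proof (rule integral_bound[OF assms])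
    show "continuous_on {0..t} (\<lambda>y. sqrt y * osc_series sin (pi / 2 / y))"
      by (rule osc_series_integral(1)[where \<phi> = sin and B = 1]) (use assms in \<open>auto intro: continuous_intros\<close>)
  qed (use bd in auto)
  then show ?thesis by simp
qed

lemma osc_integral_deriv:
  assumes c: "continuous_on UNIV \<phi>" and B: "\<And>x. \<bar>\<phi> x\<bar> \<le> B" and t: "t > 0"
  shows "((\<lambda>t. integral {0..t} (\<lambda>y. sqrt y * osc_series \<phi> (w / y))) has_real_derivative sqrt t * osc_series \<phi> (w / t)) (at t)"
proof -
  have "((\<lambda>t. integral {0..t} (\<lambda>y. sqrt y * osc_series \<phi> (w / y))) has_real_derivative sqrt t * osc_series \<phi> (w / t)) (at t within {0..t + 1})"
    by (rule integral_has_real_derivative[OF osc_series_integral(1)[where \<phi> = \<phi>, OF c B]]) (use t in auto)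
  then show ?thesis using t by (simp add: at_within_Icc_at)
qed

theorem C_fun_alternate:
  assumes \<alpha>: "\<alpha> > 0"
  shows "C_fun \<alpha> = \<alpha> + \<alpha> * sqrt \<alpha> * (2 / pi) * integral {0..1 / \<alpha>} (\<lambda>y. sqrt y * osc_series sin (pi / 2 / y))"
proof -
  define G where "G t = integral {0..t} (\<lambda>y. sqrt y * osc_series osc (2 * pi / y))" for t
  define J where "J t = integral {0..t} (\<lambda>y. sqrt y * osc_series sin (pi / 2 / y))" for t
  define D where "D a = sqrt a + 1 / (2 * pi) * G a - (a + a * sqrt a * (2 / pi) * J (1 / a))" for a
  have dG: "(G has_real_derivative sqrt t * osc_series osc (2 * pi / t)) (at t)" if "t > 0" for t
    unfolding G_def[abs_def] by (rule osc_integral_deriv[OF osc_bounds(3,1) that])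
  have dJ: "(J has_real_derivative sqrt t * osc_series sin (pi / 2 / t)) (at t)" if "t > 0" for t
    unfolding J_def[abs_def] by (rule osc_integral_deriv[OF _ _ that, of _ 1]) (auto intro: continuous_intros)
  have dD: "(D has_real_derivative 0) (at a)" if a: "a > 0" for a
  proof -
    define r where "r = sqrt a"
    have r: "r > 0" "a = r * r" using a by (simp_all add: r_def)
    define S where "S = osc_series sin (pi / 2 * a)"
    have "((\<lambda>a. J (1 / a)) has_real_derivative (sqrt (1 / a) * osc_series sin (pi / 2 / (1 / a))) * (- 1 / (a * a))) (at a)"
      by (rule DERIV_chain2[OF dJ]) (use a in \<open>auto intro!: derivative_eq_intros simp: field_simps power2_eq_square\<close>)
    then have dJ': "((\<lambda>a. J (1 / a)) has_real_derivative (1 / r * S) * (- 1 / (a * a))) (at a)"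
      by (simp add: real_sqrt_divide r_def S_def)
    have "(D has_real_derivative (1 / (2 * r) + 1 / (2 * pi) * (r * osc_series osc (2 * pi / a))
        - (1 + ((1 * r + a * (1 / (2 * r))) * (2 / pi) * J (1 / a) + a * r * (2 / pi) * ((1 / r * S) * (- 1 / (a * a))))))) (at a)"
    proof -
      have ds: "(sqrt has_real_derivative 1 / (2 * r)) (at a)"
        using DERIV_real_sqrt[OF a] by (simp add: r_def field_simps)
      have "((\<lambda>a. a * sqrt a * (2 / pi) * J (1 / a)) has_real_derivative
          (1 * sqrt a + 1 / (2 * r) * a) * (2 / pi) * J (1 / a) + ((1 / r * S) * (- 1 / (a * a))) * (a * sqrt a * (2 / pi))) (at a)"
        by (rule DERIV_mult[OF DERIV_cmult_right[OF DERIV_mult[OF DERIV_ident ds]] dJ'])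
      then have "(D has_real_derivative (1 / (2 * r) + 1 / (2 * pi) * (sqrt a * osc_series osc (2 * pi / a))
        - (1 + ((1 * sqrt a + 1 / (2 * r) * a) * (2 / pi) * J (1 / a) + ((1 / r * S) * (- 1 / (a * a))) * (a * sqrt a * (2 / pi)))))) (at a)"
        unfolding D_def[abs_def] by (intro DERIV_diff DERIV_add DERIV_ident DERIV_cmult ds dG a)
      then show ?thesis unfolding r_def[symmetric] by (simp only: mult_ac)
    qed
    \<comment> \<open>Reciprocity at \<open>t = 1 / a\<close> exchanges the series of the first
      formula for the ingredients of the second.\<close>
    also have "osc_series osc (2 * pi / a) = - pi / a + 2 * pi * (1 / r) - 4 / a * (1 / r) * S + 6 * J (1 / a)"
      using osc_series_reciprocity[of "1 / a"] a by (simp add: J_def S_def r_def real_sqrt_divide)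
    also have "1 / (2 * r) + 1 / (2 * pi) * (r * (- pi / a + 2 * pi * (1 / r) - 4 / a * (1 / r) * S + 6 * J (1 / a)))
        - (1 + ((1 * r + a * (1 / (2 * r))) * (2 / pi) * J (1 / a) + a * r * (2 / pi) * ((1 / r * S) * (- 1 / (a * a))))) = 0"
      unfolding r(2) using r(1) by (simp add: field_simps)
    finally show ?thesis .
  qed
  obtain c where c: "\<And>x. x \<in> {0<..} \<Longrightarrow> D x = c"
    by (rule has_vector_derivative_zero_constant[of "{0<..} :: real set" D])
       (auto simp: has_real_derivative_iff_has_vector_derivative[symmetric] intro: has_field_derivative_at_within dD)
  have CG: "sqrt a + 1 / (2 * pi) * G a = C_fun a" if "a > 0" for a
    using C_fun_eq_integral[of a] that by (simp add: G_def)
  have "(D \<longlongrightarrow> 0) (at_right 0)"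
  proof (rule Lim_null_comparison)
    have "norm (D a) \<le> sqrt a + 10 * a + (a + 4 * sqrt (pi / 2) * (2 / pi) * sqrt a)" if a: "a > 0" for a
    proof -
      \<comment> \<open>As \<open>a\<close> tends to 0 the upper limit \<open>1 / a\<close> grows,
        but the integral grows at most linearly with it, so the prefactor leaves
        \<open>sqrt a\<close>.\<close>
      have "\<bar>a * sqrt a * (2 / pi)\<bar> * \<bar>J (1 / a)\<bar> \<le> \<bar>a * sqrt a * (2 / pi)\<bar> * (4 * sqrt (pi / 2) * (1 / a))"
        unfolding J_def by (intro mult_left_mono sin_series_integral_bound) (use a in auto)
      also have "\<dots> = 4 * sqrt (pi / 2) * (2 / pi) * sqrt a" using a by (simp add: abs_mult)
      finally have 1: "\<bar>a * sqrt a * (2 / pi) * J (1 / a)\<bar> \<le> 4 * sqrt (pi / 2) * (2 / pi) * sqrt a"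
        unfolding abs_mult .
      have 2: "\<bar>C_fun a\<bar> \<le> sqrt a + 10 * a" by (rule C_fun_bound) (use a in simp)
      have aux: "\<bar>x - (y + z)\<bar> \<le> p + (y + q)" if "\<bar>x\<bar> \<le> p" "\<bar>z\<bar> \<le> q" "y > 0" for x y z p q :: real
        using that by linarith
      show ?thesis unfolding D_def CG[OF a] real_norm_def by (rule aux[OF 2 1 a])
    qed
    then show "\<forall>\<^sub>F a in at_right 0. norm (D a) \<le> sqrt a + 10 * a + (a + 4 * sqrt (pi / 2) * (2 / pi) * sqrt a)"
      by (simp add: eventually_at_filter)
    have "((\<lambda>a. sqrt a + 10 * a + (a + 4 * sqrt (pi / 2) * (2 / pi) * sqrt a)) \<longlongrightarrow> sqrt 0 + 10 * 0 + (0 + 4 * sqrt (pi / 2) * (2 / pi) * sqrt 0)) (at_right 0)"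
      by (intro tendsto_intros)
    then show "((\<lambda>a. sqrt a + 10 * a + (a + 4 * sqrt (pi / 2) * (2 / pi) * sqrt a)) \<longlongrightarrow> 0) (at_right 0)" by simp
  qed
  moreover have "(D \<longlongrightarrow> c) (at_right 0)"
    by (rule tendsto_eventually) (use c in \<open>auto simp: eventually_at_filter\<close>)
  ultimately have "c = 0" using tendsto_unique trivial_limit_at_right_real by blast
  then have "D \<alpha> = 0" using c \<alpha> by simp
  then show ?thesis unfolding D_def CG[OF \<alpha>] J_def by simp
qed

theorem theorem1:
  shows "(\<exists>K X\<^sub>0 :: real. X\<^sub>0 \<ge> 1 \<and> (\<forall>X\<ge>X\<^sub>0. \<forall>Y\<ge>X\<^sub>0.
            \<bar>jacobi_sum X Y - 2 / pi ^ 2 * C_fun (Y / X) * X powr (3 / 2)\<bar>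
              \<le> K * ((X * Y powr (7 / 16) + Y * X powr (7 / 16)) * ln (X * Y))))
       \<and> (\<forall>\<alpha>::real. \<alpha> > 0 \<longrightarrow>
            C_fun \<alpha> = \<alpha> + \<alpha> powr (3 / 2) * (2 / pi) *
              (\<Sum>k. 1 / real (Suc k) ^ 2 *
                 integral {0..1 / \<alpha>} (\<lambda>y. sqrt y * sin (pi * real (Suc k) ^ 2 / (2 * y)))))"
proof (intro conjI allI impI jacobi_sum_asymptotic)
  fix \<alpha> :: real assume \<alpha>: "\<alpha> > 0"
  have "\<alpha> powr (3 / 2) = \<alpha> powr (1 + 1 / 2)" by simp
  also have "\<dots> = \<alpha> * sqrt \<alpha>" unfolding powr_add using \<alpha> by (simp add: powr_half_sqrt)
  finally have p: "\<alpha> powr (3 / 2) = \<alpha> * sqrt \<alpha>" .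
  have arg: "pi / 2 * real (Suc k) ^ 2 / y = pi * real (Suc k) ^ 2 / (2 * y)" for k y by simp
  have "(\<Sum>k. 1 / real (Suc k) ^ 2 * integral {0..1 / \<alpha>} (\<lambda>y. sqrt y * sin (pi * real (Suc k) ^ 2 / (2 * y))))
     = integral {0..1 / \<alpha>} (\<lambda>y. sqrt y * osc_series sin (pi / 2 / y))"
    unfolding arg[symmetric]
    by (rule sums_unique[symmetric, OF osc_series_integral(2)[where \<phi> = sin and B = 1]])
       (use \<alpha> in \<open>auto intro: continuous_intros\<close>)
  then show "C_fun \<alpha> = \<alpha> + \<alpha> powr (3 / 2) * (2 / pi) *
      (\<Sum>k. 1 / real (Suc k) ^ 2 * integral {0..1 / \<alpha>} (\<lambda>y. sqrt y * sin (pi * real (Suc k) ^ 2 / (2 * y))))"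
    unfolding p using C_fun_alternate[OF \<alpha>] by simp
qed

end
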